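(* In the setting described in the context, there exists an admissible constant $\xi'\in(0,\xi]$ such that, defining for $f\in C(\Omega)$ and $x\in K$ $$\mathcal Mf(x)=\sup_{0<\delta\le\xi'}\frac1{\mathrm{Vol}(B_{(X,d)}(x,\delta))}\int_{B_{(X,d)}(x,\delta)}|f(y)|\,dy,$$ we have for every $1<p\le\infty$ and every $f\in C(\Omega)\cap L^p(\Omega)$ $$\|\mathcal Mf\|_{L^p(K)}\le C_p\|f\|_{L^p(\Omega)},$$ where $C_p$ is an admissible constant that may also depend on $p$.
   Context: Setting: $\Omega\subseteq\mathbb R^n$ open; $X_1,\dots,X_q$ are $C^1$ vector fields on $\Omega$ with single-parameter formal degrees $d_1,\dots,d_q\in(0,\infty)$; $K\Subset\Omega$ compact; $\xi>0$ is such that $(X,d)$ satisfies $\mathcal C(x,\xi)$ for every $x\in K$. Assume that for every $0<\delta\le\xi$ and $x\in K$, on $B_{(X,d)}(x,\delta)$, $[\delta^{d_i}X_i,\delta^{d_j}X_j]=\sum_kc^{k,\delta,x}_{i,j}\delta^{d_k}X_k$, that $\sup_{x\in K}\|X_j\|_{C^2(B_{(X,d)}(x,\xi))}<\infty$, and that $\sup_{\delta,x}\sum_{|\alpha|\le2}\|(\delta^dX)^\alpha c^{k,\delta,x}_{i,j}\|_{C^0(B_{(X,d)}(x,\delta))}<\infty$ (derivatives continuous). Here $\delta^dX$ is the list $\delta^{d_1}X_1,\dots,\delta^{d_q}X_q$, $(\delta^dX)^\alpha$ products of these; $B_{(X,d)}(x_0,\delta)$ is the set of $\gamma(1)$ over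 paths $\gamma:[0,1]\to\Omega$, $\gamma(t)=x_0+\int_0^t\sum_ja_j\delta^{d_j}X_j(\gamma)$, $a\in L^\infty$, $\|(\sum|a_j|^2)^{1/2}\|_\infty<1$; $\mathcal C(x_0,\delta)$ means all such paths exist. $\mathrm{Vol}$ and $dy$ refer to the induced Lebesgue measure on the leaf through $x$ of the distribution spanned by the $X_j$. Admissible constants depend only on upper and positive lower bounds for the $d_j$, upper bounds for $n,q$, and upper bounds for the two suprema above.
   Formalization: The constant ξ' is bounded below by a positive quantity depending on the admissible data and also on ξ; since ξ' ≤ ξ for arbitrarily small ξ, it cannot depend on the admissible data alone. C_p does not depend on ξ. *)

theory Defs
  imports "HOL-Analysis.Analysis"
begin

definition C1_on :: "(real^'n \<Rightarrow> real^'n) \<Rightarrow> (real^'n) set \<Rightarrow> bool" where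
  "C1_on V U \<longleftrightarrow> (\<exists>D :: (real^'n) \<Rightarrow> ((real^'n) \<Rightarrow>\<^sub>L (real^'n)).
      (\<forall>y\<in>U. (V has_derivative blinfun_apply (D y)) (at y)) \<and> continuous_on U D)"

definition sX :: "(nat \<Rightarrow> real^'n \<Rightarrow> real^'n) \<Rightarrow> (nat \<Rightarrow> real) \<Rightarrow> real \<Rightarrow> nat \<Rightarrow> real^'n \<Rightarrow> real^'n" where
  "sX X d \<delta> j = (\<lambda>y. (\<delta> powr d j) *\<^sub>R X j y)"

definition lie_bracket :: "(real^'n \<Rightarrow> real^'n) \<Rightarrow> (real^'n \<Rightarrow> real^'n) \<Rightarrow> real^'n \<Rightarrow> real^'n" where
  "lie_bracket V W y = frechet_derivative W (at y) (V y) - frechet_derivative V (at y) (W y)"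

definition pd :: "(real^'n \<Rightarrow> 'b::real_normed_vector) \<Rightarrow> 'n \<Rightarrow> real^'n \<Rightarrow> 'b" where
  "pd F i y = frechet_derivative F (at y) (axis i 1)"

definition C2_ok :: "(real^'n) set \<Rightarrow> (real^'n \<Rightarrow> real^'n) \<Rightarrow> bool" where
  "C2_ok U F \<longleftrightarrow> (\<forall>y\<in>U. F differentiable (at y) \<and> (\<forall>i. pd F i differentiable (at y)))"

definition C2_norm :: "(real^'n) set \<Rightarrow> (real^'n \<Rightarrow> real^'n) \<Rightarrow> ennreal" where
  "C2_norm U F =
     (SUP y\<in>U. ennreal (norm (F y)))
   + (\<Sum>i\<in>UNIV. SUP y\<in>U. ennreal (norm (pd F i y)))
   + (\<Sum>i\<in>UNIV. \<Sum>l\<in>UNIV. SUP y\<in>U. ennreal (norm (pd (pd F i) l y)))"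

text \<open>Derivative of a function g along a vector field V at y, computed along an integral
  curve of V through y staying in U (so it makes sense for functions only defined on U).\<close>
definition has_vf_deriv :: "(real^'n \<Rightarrow> real^'n) \<Rightarrow> (real^'n \<Rightarrow> real) \<Rightarrow> (real^'n) set \<Rightarrow> real^'n \<Rightarrow> real \<Rightarrow> bool" where
  "has_vf_deriv V g U y D \<longleftrightarrow> (\<exists>\<epsilon>>0. \<exists>\<gamma>. \<gamma> 0 = y \<and>
      (\<forall>t\<in>{-\<epsilon><..<\<epsilon>}. \<gamma> t \<in> U \<and> (\<gamma> has_vector_derivative V (\<gamma> t)) (at t)) \<and>
      ((g \<circ> \<gamma>) has_real_derivative D) (at 0))"

text \<open>The derivatives (Y)^alpha c, |alpha| \<le> 2, exist on U, are continuous on U, and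
  the sum over |alpha| \<le> 2 of their sup norms over U is at most A.
  Here g alpha represents (Y)^alpha c, with g (a # alpha) = Y_a (g alpha).\<close>
definition vf_deriv_bound :: "nat \<Rightarrow> (nat \<Rightarrow> real^'n \<Rightarrow> real^'n) \<Rightarrow> (real^'n) set \<Rightarrow> (real^'n \<Rightarrow> real) \<Rightarrow> ennreal \<Rightarrow> bool" where
  "vf_deriv_bound q Y U c A \<longleftrightarrow> (\<exists>g :: nat list \<Rightarrow> real^'n \<Rightarrow> real.
      (\<forall>y\<in>U. g [] y = c y) \<and>
      (\<forall>\<alpha> a. length \<alpha> \<le> 1 \<longrightarrow> set \<alpha> \<subseteq> {..<q} \<longrightarrow> a < q \<longrightarrow>
           (\<forall>y\<in>U. has_vf_deriv (Y a) (g \<alpha>) U y (g (a # \<alpha>) y))) \<and>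
      (\<forall>\<alpha>. length \<alpha> \<le> 2 \<longrightarrow> set \<alpha> \<subseteq> {..<q} \<longrightarrow> continuous_on U (g \<alpha>)) \<and>
      (\<Sum>\<alpha>\<in>{\<alpha>. length \<alpha> \<le> 2 \<and> set \<alpha> \<subseteq> {..<q}}. SUP y\<in>U. ennreal \<bar>g \<alpha> y\<bar>) \<le> A)"

definition ctrl_admissible :: "nat \<Rightarrow> (nat \<Rightarrow> real \<Rightarrow> real) \<Rightarrow> bool" where
  "ctrl_admissible q a \<longleftrightarrow> (\<forall>j<q. a j \<in> borel_measurable (restrict_space lborel {0..1})) \<and>
     (\<exists>r<1. AE s in lborel. s \<in> {0..1} \<longrightarrow> sqrt (\<Sum>j<q. (a j s)\<^sup>2) \<le> r)"

definition ctrl_path :: "(real^'n) set \<Rightarrow> (nat \<Rightarrow> real^'n \<Rightarrow> real^'n) \<Rightarrow> (nat \<Rightarrow> real) \<Rightarrow> nat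
     \<Rightarrow> real^'n \<Rightarrow> real \<Rightarrow> (nat \<Rightarrow> real \<Rightarrow> real) \<Rightarrow> (real \<Rightarrow> real^'n) \<Rightarrow> bool" where
  "ctrl_path \<Omega> X d q x0 \<delta> a \<gamma> \<longleftrightarrow> (\<forall>t\<in>{0..1}. \<gamma> t \<in> \<Omega> \<and>
      ((\<lambda>s. \<Sum>j<q. a j s *\<^sub>R sX X d \<delta> j (\<gamma> s)) has_integral (\<gamma> t - x0)) {0..t})"

definition CC_ball :: "(real^'n) set \<Rightarrow> (nat \<Rightarrow> real^'n \<Rightarrow> real^'n) \<Rightarrow> (nat \<Rightarrow> real) \<Rightarrow> nat
     \<Rightarrow> real^'n \<Rightarrow> real \<Rightarrow> (real^'n) set" where
  "CC_ball \<Omega> X d q x0 \<delta> = {\<gamma> 1 | \<gamma> a. ctrl_admissible q a \<and> ctrl_path \<Omega> X d q x0 \<delta> a \<gamma>}"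

definition cond_C :: "(real^'n) set \<Rightarrow> (nat \<Rightarrow> real^'n \<Rightarrow> real^'n) \<Rightarrow> (nat \<Rightarrow> real) \<Rightarrow> nat
     \<Rightarrow> real^'n \<Rightarrow> real \<Rightarrow> bool" where
  "cond_C \<Omega> X d q x0 \<delta> \<longleftrightarrow> (\<forall>a. ctrl_admissible q a \<longrightarrow> (\<exists>\<gamma>. ctrl_path \<Omega> X d q x0 \<delta> a \<gamma>))"

section \<open>Induced Lebesgue measure on leaves (k-dimensional Hausdorff measure)\<close>

definition haus_outer :: "nat \<Rightarrow> 'a::metric_space set \<Rightarrow> ennreal" where
  "haus_outer k A = (SUP \<epsilon>\<in>{0<..}. INF C\<in>{C :: nat \<Rightarrow> 'a set.
        A \<subseteq> (\<Union>i. C i) \<and> (\<forall>i. bounded (C i) \<and> diameter (C i) \<le> \<epsilon>)}.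
      (\<Sum>i. (if C i = {} then 0 else ennreal (unit_ball_vol (real k) * (diameter (C i) / 2) ^ k))))"

definition hausdorff_measure :: "nat \<Rightarrow> 'a::metric_space measure" where
  "hausdorff_measure k = measure_of UNIV (sets borel) (haus_outer k)"

definition leaf_dim :: "(nat \<Rightarrow> real^'n \<Rightarrow> real^'n) \<Rightarrow> nat \<Rightarrow> real^'n \<Rightarrow> nat" where
  "leaf_dim X q x = dim {X j x | j. j < q}"

definition leaf_measure :: "(nat \<Rightarrow> real^'n \<Rightarrow> real^'n) \<Rightarrow> nat \<Rightarrow> real^'n \<Rightarrow> (real^'n) measure" where
  "leaf_measure X q x = hausdorff_measure (leaf_dim X q x)"

definition maximal_fn :: "(real^'n) set \<Rightarrow> (nat \<Rightarrow> real^'n \<Rightarrow> real^'n) \<Rightarrow> (nat \<Rightarrow> real) \<Rightarrow> nat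
     \<Rightarrow> real \<Rightarrow> (real^'n \<Rightarrow> real) \<Rightarrow> real^'n \<Rightarrow> ennreal" where
  "maximal_fn \<Omega> X d q \<xi>' f x = (SUP \<delta>\<in>{0<..\<xi>'}.
      (\<integral>\<^sup>+ y\<in>CC_ball \<Omega> X d q x \<delta>. ennreal \<bar>f y\<bar> \<partial>leaf_measure X q x)
        / emeasure (leaf_measure X q x) (CC_ball \<Omega> X d q x \<delta>))"

definition enn_powr :: "ennreal \<Rightarrow> real \<Rightarrow> ennreal" where
  "enn_powr x r = (if x = \<infinity> then \<infinity> else ennreal (enn2real x powr r))"

text \<open>Upper (outer) integral, so that no measurability of the integrand is presupposed;
  it agrees with the usual integral on measurable functions.\<close>
definition upper_nn_integral :: "'a measure \<Rightarrow> ('a \<Rightarrow> ennreal) \<Rightarrow> ennreal" where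
  "upper_nn_integral M g = (INF h\<in>{h \<in> borel_measurable M. \<forall>x\<in>space M. g x \<le> h x}. nn_integral M h)"

definition Lp_norm :: "'a measure \<Rightarrow> ennreal \<Rightarrow> ('a \<Rightarrow> ennreal) \<Rightarrow> ennreal" where
  "Lp_norm M p g = (if p = \<infinity> then Inf {c. AE x in M. g x \<le> c}
      else enn_powr (upper_nn_integral M (\<lambda>x. enn_powr (g x) (enn2real p))) (1 / enn2real p))"

end

theory Submission
 imports Defs
begin

text \<open>Around a point \<open>x\<close> of \<open>K\<close> choose, among the rescaled fields \<open>\<delta>\<^sup>d X\<close>, a maximal independent subfamily at \<open>x\<close>
 for which the determinant is largest, and compose the flows of its members to get a parametrisation \<open>FF\<close> of the leaf.
 Transporting the fields along flows satisfies a linear equation with coefficients \<open>c\<close>, so on a ball of admissible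
 radius \<open>FF\<close> is injective, its derivative is comparable to the one at the origin, and \<open>FF\<close> maps a ball of admissible size into
 \<open>B(x,dl)\<close> and a comparable ball onto a superset of it. Comparing Hausdorff measures of images of small cubes
 with those of one fixed linear image shows that averages over \<open>B(x,dl)\<close> are bounded by averages of \<open>f \<circ> FF\<close> over a
 coordinate box, which iterated one-parameter maximal functions along the flows of single fields dominate. Each of these is bounded on
 \<open>L\<^sup>p\<close> by transference of the Hardy-Littlewood theorem, as the flows distort Lebesgue measure by bounded factors only.\<close>

text \<open>Chart, frame and leaf dimension vary with the point and the radius, no measurable
  selection of them is made, and the frame degenerates near points where the dimension drops. Two
  devices answer this. Norms are compared relative to the frame at the centre: transport along flows
  distorts them by a factor of at most 2, however close to dependent the frame vectors are.
  Quantities that do degenerate (coercivity of \<open>ZZ x\<close>, tube radii, moduli of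
  continuity) only fix the size of small cubes or time steps, and the measure of a small cube
  cancels in the quotient that defines an average. Secondly, each average is dominated by one of
  finitely many iterated maximal functions, indexed by lists of at most n field indices; the sum
  over all lists is a Borel majorant of the p-th power. The ball of radius \<open>dl\<close> is
  studied with the fields rescaled at the larger radius dl/\<eta>: with \<eta> small the ball fits
  into the chart, and since \<eta> is fixed, a cube of fixed size in the chart fits into the
  ball.\<close>

section \<open>Hausdorff outer measure and Caratheodory's criterion\<close>

definition haus_weight :: "nat => 'a::metric_space set => ennreal" where
 "haus_weight k C = (if C = {} then 0 else ennreal (unit_ball_vol (real k)*(diameter C/2) ^ k))"

definition haus_covers :: "real => 'a::metric_space set => (nat => 'a set) set" where
 "haus_covers ep A = {C. A \<subseteq> (\<Union>i. C i) & (ALL i. bounded (C i) & diameter (C i) <= ep)}"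

definition haus_pre :: "nat => real => 'a::metric_space set => ennreal" where
 "haus_pre k ep A = (INF C\<in>haus_covers ep A. \<Sum>i. haus_weight k (C i))"

lemma haus_outer_eq: "haus_outer k A = (SUP ep\<in>{0<..}. haus_pre k ep A)"
 unfolding haus_outer_def haus_pre_def haus_covers_def haus_weight_def by simp

lemma haus_pre_le_outer: "0 < ep ==> haus_pre k ep A <= haus_outer k A"
 unfolding haus_outer_eq by (rule SUP_upper) simp

lemma haus_outer_leI: "(!!ep. 0 < ep ==> haus_pre k ep A <= c) ==> haus_outer k A <= c"
 unfolding haus_outer_eq by (rule SUP_least) simp

lemma haus_pre_leI: "C : haus_covers ep A ==> haus_pre k ep A <= (\<Sum>i. haus_weight k (C i))"
 unfolding haus_pre_def by (rule INF_lower)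

lemma haus_pre_mono: "A \<subseteq> B ==> haus_pre k ep A <= haus_pre k ep B"
 unfolding haus_pre_def haus_covers_def by (rule INF_superset_mono) auto

lemma haus_pre_antimono: "ep <= ep' ==> haus_pre k ep' A <= haus_pre k ep A"
 unfolding haus_pre_def haus_covers_def by (rule INF_superset_mono) (auto intro: order_trans)

lemma haus_outer_mono: "A \<subseteq> B ==> haus_outer k A <= haus_outer k B"
 unfolding haus_outer_eq by (rule SUP_mono) (use haus_pre_mono in blast)

lemma haus_outer_empty [simp]: "haus_outer k {} = 0"
proof -
 have "haus_pre k ep ({}::'a set) <= 0" if "0 < ep" for ep
  using haus_pre_leI[of "%_. {}" ep "{}::'a set" k] that by (auto simp: haus_covers_def haus_weight_def)
 then have "haus_outer k ({}::'a set) <= 0" by (intro haus_outer_leI)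
 then show ?thesis by simp
qed

text \<open>Nearly optimal covers with errors e/2^(i+1) are merged through
  \<open>prod_decode\<close>. The mesh \<open>ep\<close> stays fixed, so the supremum over
  \<open>ep\<close> never has to be exchanged with the sum.\<close>

lemma haus_pre_UN_le: "haus_pre k ep (\<Union>i. A i) <= (\<Sum>i. haus_pre k ep (A i :: 'a::metric_space set))"
proof (rule ennreal_le_epsilon)
 fix e :: real assume e: "0 < e" and fin: "(\<Sum>i. haus_pre k ep (A i)) < top"
 have "EX C. C : haus_covers ep (A i) & (\<Sum>j. haus_weight k (C j)) <= haus_pre k ep (A i) + ennreal (e*(1/2) ^ Suc i)" for i
 proof -
  have "haus_pre k ep (A i) < top" using ennreal_suminf_lessD[OF fin] by simp
  then have "haus_pre k ep (A i) < haus_pre k ep (A i) + ennreal (e*(1/2) ^ Suc i)"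
   using e by (cases "haus_pre k ep (A i)") (simp_all add: ennreal_plus[symmetric] ennreal_less_iff del: ennreal_plus)
  then show ?thesis
   unfolding haus_pre_def[of k ep "A i"] INF_less_iff using less_imp_le by blast
 qed
 then have "EX C. ALL i. C i : haus_covers ep (A i) & (\<Sum>j. haus_weight k (C i j)) <= haus_pre k ep (A i) + ennreal (e*(1/2) ^ Suc i)"
  by (intro choice allI)
 then obtain C where C: "!!i. C i : haus_covers ep (A i)"
  and S: "!!i. (\<Sum>j. haus_weight k (C i j)) <= haus_pre k ep (A i) + ennreal (e*(1/2) ^ Suc i)" by blast
 define D where "D n = C (fst (prod_decode n)) (snd (prod_decode n))" for n
 have "D : haus_covers ep (\<Union>i. A i)"
 proof -
  have "(\<Union>i. A i) \<subseteq> (\<Union>n. D n)"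
  proof
   fix x assume "x : (\<Union>i. A i)"
   then obtain i where "x : A i" by blast
   then obtain j where "x : C i j" using C[of i] unfolding haus_covers_def by blast
   then have "x : D (prod_encode (i, j))" by (simp add: D_def)
   then show "x : (\<Union>n. D n)" by blast
  qed
  moreover have "bounded (D n) & diameter (D n) <= ep" for n
   using C[of "fst (prod_decode n)"] unfolding haus_covers_def D_def by blast
  ultimately show ?thesis unfolding haus_covers_def by blast
 qed
 then have "haus_pre k ep (\<Union>i. A i) <= (\<Sum>n. haus_weight k (D n))" by (rule haus_pre_leI)
 also have "... = (\<Sum>n. (%z. haus_weight k (C (fst z) (snd z))) (prod_decode n))"
  by (simp only: D_def)
 also have "... = (\<Sum>i. \<Sum>j. haus_weight k (C i j))"
  by (rule suminf_ennreal_2dimen) simp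
 also have "... <= (\<Sum>i. haus_pre k ep (A i) + ennreal (e*(1/2) ^ Suc i))"
  by (rule suminf_le[OF S]) (rule summableI)+
 also have "... = (\<Sum>i. haus_pre k ep (A i)) + (\<Sum>i. ennreal (e*(1/2) ^ Suc i))"
  by (rule suminf_add[symmetric]) (rule summableI)+
 also have "(\<Sum>i. ennreal (e*(1/2) ^ Suc i)) = ennreal e"
 proof -
  have "(%i. e*(1/2) ^ Suc i) sums (e*1)" by (rule sums_mult[OF power_half_series])
  then have "(%i. e*(1/2) ^ Suc i) sums e" unfolding mult_1_right .
  moreover have "0 <= e*(1/2) ^ Suc i" for i using e by (intro mult_nonneg_nonneg) auto
  ultimately show ?thesis by (intro suminf_ennreal_eq)
 qed
 finally show "haus_pre k ep (\<Union>i. A i) <= (\<Sum>i. haus_pre k ep (A i)) + ennreal e" .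
qed

lemma haus_outer_UN_le: "haus_outer k (\<Union>i. A i) <= (\<Sum>i. haus_outer k (A i :: 'a::metric_space set))"
proof (rule haus_outer_leI)
 fix ep :: real assume "0 < ep"
 have "haus_pre k ep (\<Union>i. A i) <= (\<Sum>i. haus_pre k ep (A i))" by (rule haus_pre_UN_le)
 also have "... <= (\<Sum>i. haus_outer k (A i))" by (intro suminf_le haus_pre_le_outer \<open>0 < ep\<close>) auto
 finally show "haus_pre k ep (\<Union>i. A i) <= (\<Sum>i. haus_outer k (A i))" .
qed

lemma haus_outer_Un_le: "haus_outer k (A \<union> B) <= haus_outer k A + haus_outer k (B::'a::metric_space set)"
proof -
 have "haus_outer k (\<Union>i. binaryset A B i) <= (\<Sum>i. haus_outer k (binaryset A B i))" by (rule haus_outer_UN_le)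
 moreover have "(\<Sum>i. haus_outer k (binaryset A B i)) = haus_outer k A + haus_outer k B"
  by (rule suminf_binaryset_eq) simp
 ultimately show ?thesis by (simp add: UN_binaryset_eq)
qed

text \<open>A set of diameter less than \<open>e\<close> cannot meet both \<open>A\<close> and
  \<open>B\<close>. Every fine cover of the union therefore splits into a cover of \<open>A\<close>
  and a cover of \<open>B\<close>; members of the wrong kind are replaced by \<open>{}\<close>,
  whose weight is 0.\<close>

lemma haus_outer_separated:
 fixes A B :: "'a::metric_space set"
 assumes e: "0 < e" and sep: "!!x y. x : A ==> y : B ==> e <= dist x y"
 shows "haus_outer k A + haus_outer k B <= haus_outer k (A \<union> B)"
proof -
 have pre: "haus_pre k ep A + haus_pre k ep B <= haus_outer k (A \<union> B)" if "0 < ep" "ep < e" for ep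
 proof -
  have "haus_pre k ep A + haus_pre k ep B <= (\<Sum>i. haus_weight k (C i))" if C: "C : haus_covers ep (A \<union> B)" for C
  proof -
   let ?R = "%S i. if C i \<inter> S = {} then {} else C i"
   have R: "?R S : haus_covers ep S" if S: "S \<subseteq> A \<union> B" for S
   proof -
    have "S \<subseteq> (\<Union>i. ?R S i)"
    proof
     fix x assume "x : S"
     then obtain i where "x : C i" using C S unfolding haus_covers_def by blast
     then have "x : ?R S i" using \<open>x : S\<close> by auto
     then show "x : (\<Union>i. ?R S i)" by blast
    qed
    then show ?thesis using C \<open>0 < ep\<close> by (auto simp: haus_covers_def)
   qed
   have A: "haus_pre k ep A <= (\<Sum>i. haus_weight k (?R A i))"
    by (intro haus_pre_leI R) auto
   have B: "haus_pre k ep B <= (\<Sum>i. haus_weight k (?R B i))"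
    by (intro haus_pre_leI R) auto
   have one: "C i \<inter> A = {} \<or> C i \<inter> B = {}" for i
   proof (rule ccontr)
    assume "~ ?thesis"
    then obtain x y where "x : C i" "x : A" "y : C i" "y : B" by auto
    moreover from this C have "dist x y <= ep"
     using diameter_bounded_bound[of "C i" x y] by (auto simp: haus_covers_def intro: order_trans)
    ultimately show False using sep[of x y] \<open>ep < e\<close> by auto
   qed
   have "haus_pre k ep A + haus_pre k ep B <= (\<Sum>i. haus_weight k (?R A i)) + (\<Sum>i. haus_weight k (?R B i))"
    by (rule add_mono[OF A B])
   also have "... = (\<Sum>i. haus_weight k (?R A i) + haus_weight k (?R B i))" by (rule suminf_add) auto
   also have "... <= (\<Sum>i. haus_weight k (C i))"
   proof (intro suminf_le)
    fix i show "haus_weight k (?R A i) + haus_weight k (?R B i) <= haus_weight k (C i)"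
     using one[of i] by (auto simp: haus_weight_def)
   qed auto
   finally show ?thesis .
  qed
  then have "haus_pre k ep A + haus_pre k ep B <= haus_pre k ep (A \<union> B)"
   unfolding haus_pre_def[of k ep "A \<union> B"] by (rule INF_greatest)
  also have "... <= haus_outer k (A \<union> B)" using that by (intro haus_pre_le_outer)
  finally show ?thesis .
 qed
 have "haus_pre k ep1 A + haus_pre k ep2 B <= haus_outer k (A \<union> B)" if "0 < ep1" "0 < ep2" for ep1 ep2
 proof -
  \<comment> \<open>The two suprema over meshes are taken independently, hence two meshes; a common
    finer one below \<open>e\<close> dominates both.\<close>
  let ?m = "min (min ep1 ep2) (e/2)"
  have "haus_pre k ep1 A + haus_pre k ep2 B <= haus_pre k ?m A + haus_pre k ?m B"
   by (intro add_mono haus_pre_antimono) auto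
  also have "... <= haus_outer k (A \<union> B)" using that e by (intro pre) auto
  finally show ?thesis .
 qed
 then have *: "haus_pre k ep1 A + haus_outer k B <= haus_outer k (A \<union> B)" if "0 < ep1" for ep1
  unfolding haus_outer_eq[of k B] using that by (subst ennreal_SUP_add_right) (auto intro!: SUP_least)
 show ?thesis
  unfolding haus_outer_eq[of k A] using *
  by (subst ennreal_SUP_add_left[symmetric]) (auto intro!: SUP_least)
qed

text \<open>The separation may depend on the pair \<open>i\<close>, \<open>j\<close>; in the
  induction the minimum over the finitely many earlier rings serves.\<close>

lemma haus_outer_finite_sum_rings:
 fixes R :: "nat => 'a::metric_space set"
 assumes sep: "!!i j. i < j ==> j <= n ==> EX e>0. ALL x:R i. ALL y:R j. e <= dist x y"
 shows "(\<Sum>i\<le>n. haus_outer k (R i)) <= haus_outer k (\<Union>i\<le>n. R i)"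
 using sep
proof (induction n)
 case 0
 then show ?case by simp
next
 case (Suc n)
 have IH: "(\<Sum>i\<le>n. haus_outer k (R i)) <= haus_outer k (\<Union>i\<le>n. R i)" by (rule Suc.IH) (use Suc.prems in auto)
 have "ALL i. EX e. i <= n --> 0 < e & (ALL x:R i. ALL y:R (Suc n). e <= dist x y)"
  using Suc.prems[of _ "Suc n"] by (simp add: less_Suc_eq_le)
 from choice[OF this] obtain e where e: "!!i. i <= n ==> 0 < e i & (ALL x:R i. ALL y:R (Suc n). e i <= dist x y)" by auto
 define m where "m = Min (e ` {..n})"
 have m: "0 < m" "!!i. i <= n ==> m <= e i" using e by (auto simp: m_def)
 have "(\<Sum>i\<le>Suc n. haus_outer k (R i)) <= haus_outer k (\<Union>i\<le>n. R i) + haus_outer k (R (Suc n))"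
  using IH by (simp add: add_mono)
 also have "... <= haus_outer k ((\<Union>i\<le>n. R i) \<union> R (Suc n))"
 proof (rule haus_outer_separated[OF m(1)])
  fix x y assume "x : (\<Union>i\<le>n. R i)" "y : R (Suc n)"
  then obtain i where "i <= n" "x : R i" "y : R (Suc n)" by auto
  then show "m <= dist x y" using e[of i] m(2)[of i] by fastforce
 qed
 also have "(\<Union>i\<le>n. R i) \<union> R (Suc n) = (\<Union>i\<le>Suc n. R i)" by (auto simp: atMost_Suc)
 finally show ?case .
qed

lemma suminf_ennreal_tail_small:
 fixes f :: "nat => ennreal"
 assumes "(\<Sum>i. f i) < top" and e: "0 < (e::real)"
 shows "EX n. (\<Sum>i. f (i + n)) <= ennreal e"
proof -
 have fi: "f i < top" for i using assms(1) by (metis ennreal_suminf_lessD top.not_eq_extremum)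
 define g where "g i = enn2real (f i)" for i
 have f: "f i = ennreal (g i)" for i using fi[of i] by (simp add: g_def)
 have g0: "0 <= g i" for i by (simp add: g_def)
 have sg: "summable g" using assms(1) g0 unfolding f
  by (intro summable_suminf_not_top) auto
 have "(%n. \<Sum>i. g (i + n)) \<longlonglongrightarrow> 0" by (rule suminf_exist_split2[OF sg])
 then obtain n where "norm ((\<Sum>i. g (i + n)) - 0) < e" using e by (meson LIMSEQ_D order_refl)
 then have "(\<Sum>i. f (i + n)) = ennreal (\<Sum>i. g (i + n))" "(\<Sum>i. g (i + n)) <= e"
  unfolding f using sg g0 by (auto intro!: suminf_ennreal2 simp: summable_iff_shift)
 then show ?thesis by (metis ennreal_leI)
qed

text \<open>Caratheodory's argument. \<open>A n\<close> is at distance at least 1/(n+1) from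
  \<open>F\<close>, so it is additive together with \<open>X \<inter> F\<close>, and what it misses
  of \<open>X - F\<close> is exhausted by the rings \<open>R\<close> from \<open>n\<close> on. Rings
  whose indices differ by at least two lie at positive distance, so the ring measures form a
  convergent series and the tail is small.\<close>

lemma haus_outer_closed_split:
 fixes F X :: "'a::metric_space set"
 assumes F: "closed F"
 shows "haus_outer k (X \<inter> F) + haus_outer k (X - F) <= haus_outer k X"
proof (cases "haus_outer k X = top \<or> F = {}")
 case True
 then show ?thesis by auto
next
 case False
 define A where "A n = {x\<in>X. 1/real (Suc n) <= infdist x F}" for n
 define R where "R n = A (Suc n) - A n" for n
 have Amono: "A m \<subseteq> A n" if "m <= n" for m n
 proof -
  have "1/real (Suc n) <= 1/real (Suc m)" using that by (intro divide_left_mono) auto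
  then show ?thesis by (auto simp: A_def simp del: of_nat_Suc)
 qed
 have sepA: "1/real (Suc n) <= dist x y" if "x : A n" "y : F" for x y n
  using that infdist_le[of y F x] by (auto simp: A_def)
 have XF: "X - F = A n \<union> (\<Union>i. R (i + n))" for n
 proof (intro equalityI subsetI)
  fix x assume x: "x : X - F"
  then have "0 < infdist x F" using F False in_closed_iff_infdist_zero[of F x] infdist_nonneg[of x F] by auto
  then obtain m where "1/real (Suc m) <= infdist x F" using nat_approx_posE by (metis less_imp_le)
  then have m: "x : A m" using x by (auto simp: A_def)
  define l where "l = (LEAST m. x : A m)"
  have l: "x : A l" "!!j. j < l ==> x \<notin> A j" unfolding l_def using m by (auto intro: LeastI dest: not_less_Least)
  show "x : A n \<union> (\<Union>i. R (i + n))"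
  proof (cases "l <= n")
   case True then show ?thesis using Amono l by auto
  next
   case False
   then have "x : R ((l - Suc n) + n)" using l by (auto simp: R_def Suc_diff_le)
   then show ?thesis by blast
  qed
 next
  fix x assume x: "x : A n \<union> (\<Union>i. R (i + n))"
  have "x : X & x \<notin> F" if "x : A m" for m
   using that False by (auto simp: A_def)
  then show "x : X - F" using x by (auto simp: R_def)
 qed
 have sepR: "EX e>0. ALL x:R i. ALL y:R j. e <= dist x y" if "Suc i < j" for i j
 proof (intro exI conjI ballI)
  have "1/real (Suc j) < 1/real (Suc (Suc i))" using that by (intro divide_strict_left_mono) auto
  then show "0 < 1/real (Suc (Suc i)) - 1/real (Suc j)" by simp
  fix x y assume "x : R i" "y : R j"
  then have x: "1/real (Suc (Suc i)) <= infdist x F" and y: "infdist y F < 1/real (Suc j)"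
   by (auto simp: R_def A_def)
  have "infdist x F <= infdist y F + dist x y" by (rule infdist_triangle)
  then show "1/real (Suc (Suc i)) - 1/real (Suc j) <= dist x y" using x y by linarith
 qed
 \<comment> \<open>Rings of one parity (\<open>c\<close> is 0 or 1) are pairwise separated;
   neighbouring rings need not be.\<close>
 have ev: "(\<Sum>i. haus_outer k (R (2*i + c))) <= haus_outer k X" for c
 proof (rule suminf_le_const)
  fix n
  have "(\<Sum>i<n. haus_outer k (R (2*i + c))) <= (\<Sum>i\<le>n. haus_outer k (R (2*i + c)))"
   by (intro sum_mono2) auto
  also have "... <= haus_outer k (\<Union>i\<le>n. R (2*i + c))"
   by (rule haus_outer_finite_sum_rings, rule sepR) auto
  also have "... <= haus_outer k X" by (intro haus_outer_mono) (auto simp: R_def A_def)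
  finally show "(\<Sum>i<n. haus_outer k (R (2*i + c))) <= haus_outer k X" .
 qed simp
 have pair: "(\<Sum>i. haus_outer k (R i)) = (\<Sum>i. haus_outer k (R (2*i)) + haus_outer k (R (2*i + 1)))"
 proof -
  have "(%n. \<Sum>i<n*2. haus_outer k (R i)) \<longlonglongrightarrow> (\<Sum>i. haus_outer k (R i))"
   by (rule LIMSEQ_subseq_LIMSEQ[OF summable_LIMSEQ, unfolded comp_def]) (auto simp: strict_mono_def)
  moreover have "(\<Sum>i<n*2. haus_outer k (R i)) = (\<Sum>i<n. haus_outer k (R (2*i)) + haus_outer k (R (2*i + 1)))" for n
   by (induction n) (auto simp: algebra_simps)
  ultimately have "(%n. \<Sum>i<n. haus_outer k (R (2*i)) + haus_outer k (R (2*i + 1))) \<longlonglongrightarrow> (\<Sum>i. haus_outer k (R i))" by simp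
  moreover have "(%n. \<Sum>i<n. haus_outer k (R (2*i)) + haus_outer k (R (2*i + 1))) \<longlonglongrightarrow>
    (\<Sum>i. haus_outer k (R (2*i)) + haus_outer k (R (2*i + 1)))" by (rule summable_LIMSEQ) auto
  ultimately show ?thesis by (rule LIMSEQ_unique)
 qed
 have "(\<Sum>i. haus_outer k (R i)) = (\<Sum>i. haus_outer k (R (2*i))) + (\<Sum>i. haus_outer k (R (2*i + 1)))"
  unfolding pair by (rule suminf_add[symmetric]) auto
 also have "... <= haus_outer k X + haus_outer k X" using ev[of 0] ev[of 1] by (intro add_mono) auto
 also have "... < top" using False by (simp add: top.not_eq_extremum)
 finally have fin: "(\<Sum>i. haus_outer k (R i)) < top" .
 show ?thesis
 proof (rule ennreal_le_epsilon)
  fix e :: real assume "0 < e"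
  from suminf_ennreal_tail_small[OF fin this] obtain n where n: "(\<Sum>i. haus_outer k (R (i + n))) <= ennreal e" by auto
  have "haus_outer k (X - F) <= haus_outer k (A n) + haus_outer k (\<Union>i. R (i + n))"
   by (subst XF[of n]) (rule haus_outer_Un_le)
  also have "... <= haus_outer k (A n) + ennreal e"
   by (intro add_left_mono order_trans[OF haus_outer_UN_le n])
  finally have "haus_outer k (X \<inter> F) + haus_outer k (X - F) <= (haus_outer k (A n) + haus_outer k (X \<inter> F)) + ennreal e"
   by (metis add.assoc add.commute add_right_mono)
  also have "haus_outer k (A n) + haus_outer k (X \<inter> F) <= haus_outer k (A n \<union> (X \<inter> F))"
   by (rule haus_outer_separated[of "1/real (Suc n)"]) (use sepA in auto)
  also have "haus_outer k (A n \<union> (X \<inter> F)) <= haus_outer k X" by (intro haus_outer_mono) (auto simp: A_def)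
  finally show "haus_outer k (X \<inter> F) + haus_outer k (X - F) <= haus_outer k X + ennreal e"
   by (simp add: add_right_mono)
 qed
qed

text \<open>\<open>measure_of\<close> returns the given function only if that function is a measure
  on the sigma-algebra. Closed sets split every set additively, so they, and hence all Borel sets,
  belong to the Caratheodory system of \<open>haus_outer k\<close>.\<close>

lemma emeasure_hausdorff_measure:
 fixes A :: "'a::metric_space set"
 assumes A: "A : sets borel"
 shows "emeasure (hausdorff_measure k) A = haus_outer k A"
proof -
 let ?L = "lambda_system UNIV (Pow UNIV) (haus_outer k :: 'a set => ennreal)"
 interpret P: sigma_algebra "UNIV :: 'a set" "Pow UNIV" by (rule sigma_algebra_Pow)
 have "outer_measure_space (Pow UNIV) (haus_outer k :: 'a set => ennreal)"
  unfolding outer_measure_space_def positive_def increasing_def countably_subadditive_def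
  by (auto intro: haus_outer_mono haus_outer_UN_le)
 from P.caratheodory_lemma[OF this] have ms: "measure_space UNIV ?L (haus_outer k)" .
 then interpret L: sigma_algebra "UNIV :: 'a set" ?L by (simp add: measure_space_def)
 have "F : ?L" if "closed F" for F
 proof -
  have "haus_outer k (F \<inter> X) + haus_outer k ((UNIV - F) \<inter> X) = haus_outer k X" for X
  proof (rule antisym)
   show "haus_outer k (F \<inter> X) + haus_outer k ((UNIV - F) \<inter> X) <= haus_outer k X"
    using haus_outer_closed_split[OF that, of k X] by (simp add: Int_commute Diff_eq)
   have "X = (F \<inter> X) \<union> ((UNIV - F) \<inter> X)" by auto
   then show "haus_outer k X <= haus_outer k (F \<inter> X) + haus_outer k ((UNIV - F) \<inter> X)"
    by (metis haus_outer_Un_le)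
  qed
  then show ?thesis by (simp add: lambda_system_def)
 qed
 then have "sigma_sets UNIV (Collect closed) \<subseteq> ?L" by (intro L.sigma_sets_subset) auto
 then have "sets borel \<subseteq> ?L" by (simp add: borel_eq_closed)
 then have m: "measure_space UNIV (sets borel) (haus_outer k :: 'a set => ennreal)"
  by (intro measure_down[OF ms]) (auto simp: sets.sigma_algebra_axioms[of borel, simplified])
 show ?thesis unfolding hausdorff_measure_def
  by (rule emeasure_measure_of_sigma) (use m A in \<open>auto simp: measure_space_def\<close>)
qed

lemma sets_hausdorff_measure [simp, measurable_cong]: "sets (hausdorff_measure k) = sets borel"
 and space_hausdorff_measure [simp]: "space (hausdorff_measure k) = UNIV"
 unfolding hausdorff_measure_def
 using sets.sigma_sets_eq[of borel] by (auto simp: space_measure_of_conv)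

section \<open>Powers and distribution functions of extended nonnegative reals\<close>

lemma enn_powr_mono: "0 < p ==> x <= y ==> enn_powr x p <= enn_powr y p"
 unfolding enn_powr_def
 by (auto simp: top_unique intro!: ennreal_leI powr_mono2 enn2real_mono) (auto simp: top.not_eq_extremum)

lemma enn_powr_ennreal: "0 <= x ==> enn_powr (ennreal x) p = ennreal (x powr p)"
 by (simp add: enn_powr_def)

lemma enn_powr_top [simp]: "enn_powr top p = top"
 by (simp add: enn_powr_def)

lemma enn_powr_cmult: "0 < c ==> enn_powr (ennreal c*x) p = ennreal (c powr p)*enn_powr x p"
 by (cases x) (auto simp: enn_powr_ennreal ennreal_mult[symmetric] powr_mult ennreal_mult_top)

lemma enn_powr_inverse: "0 < p ==> enn_powr (enn_powr x p) (1/p) = x"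
 by (cases x) (auto simp: enn_powr_ennreal powr_powr)

lemma enn_powr_measurable [measurable]:
 assumes [measurable]: "f : borel_measurable M"
 shows "(%x. enn_powr (f x) p) : borel_measurable M"
 unfolding enn_powr_def by measurable

lemma nn_integral_powr_Icc:
 assumes "-1 < a" "0 <= c"
 shows "(\<integral>\<^sup>+l. ennreal (l powr a)*indicator {0..c} l \<partial>lborel) = ennreal (c powr (a + 1)/(a + 1))"
proof -
 have "((%x. x powr a) has_integral (c powr (a + 1)/(a + 1))) {0..c}"
  using assms by (intro has_integral_powr_from_0) auto
 then have "((%x. if x : {0..c} then x powr a else 0) has_integral (c powr (a + 1)/(a + 1))) UNIV"
  by (simp only: has_integral_restrict_UNIV)
 moreover have "(%x. if x : {0..c} then x powr a else 0) = (%x. x powr a*indicator {0..c} x)"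
  by (auto simp: fun_eq_iff)
 ultimately have "((%x. x powr a*indicator {0..c} x) has_integral (c powr (a + 1)/(a + 1))) UNIV"
  by simp
 then have "integral\<^sup>N lborel (%x. ennreal (x powr a*indicator {0..c} x)) = ennreal (c powr (a + 1)/(a + 1))"
  by (intro nn_integral_has_integral_lborel) auto
 moreover have "ennreal (x powr a*indicator {0..c} x) = ennreal (x powr a)*indicator {0..c} x" for x
  by (simp split: split_indicator)
 ultimately show ?thesis by simp
qed

lemma ennreal_eq_topI:
 assumes "!!x. 0 <= x ==> ennreal x <= y" shows "y = top"
proof (cases y)
 case (real r)
 then show ?thesis using assms[of "r + 1"] by simp
qed

lemma enn_powr_layer_cake:
 assumes p: "0 < p"
 shows "(\<integral>\<^sup>+l. ennreal (p * l powr (p - 1))*indicator {l. 0 <= l & ennreal l <= h} l \<partial>lborel) = enn_powr h p"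
proof -
 have *: "(\<integral>\<^sup>+l. ennreal (p * l powr (p - 1))*indicator {0..c} l \<partial>lborel) = ennreal (c powr p)" if "0 <= c" for c
 proof -
  have "(\<integral>\<^sup>+l. ennreal (p * l powr (p - 1))*indicator {0..c} l \<partial>lborel)
    = (\<integral>\<^sup>+l. ennreal p * (ennreal (l powr (p - 1))*indicator {0..c} l) \<partial>lborel)"
   using p by (simp add: ennreal_mult mult.assoc)
  also have "... = ennreal p * ennreal (c powr p/p)"
   using nn_integral_powr_Icc[of "p - 1" c] p that by (subst nn_integral_cmult) auto
  also have "... = ennreal (c powr p)" using p by (simp add: ennreal_mult[symmetric])
  finally show ?thesis .
 qed
 show ?thesis
 proof (cases h)
  case (real r)
  then have "{l. 0 <= l & ennreal l <= h} = {0..r}" by auto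
  then show ?thesis using *[of r] real by (simp add: enn_powr_ennreal)
 next
  case top
  have "ennreal x <= (\<integral>\<^sup>+l. ennreal (p * l powr (p - 1))*indicator {l. 0 <= l & ennreal l <= h} l \<partial>lborel)" if "0 <= x" for x
  proof -
   have "ennreal x = ennreal ((x powr (1/p)) powr p)" using p that by (simp add: powr_powr)
   also have "... = (\<integral>\<^sup>+l. ennreal (p * l powr (p - 1))*indicator {0..x powr (1/p)} l \<partial>lborel)"
    by (rule *[symmetric]) simp
   also have "... <= (\<integral>\<^sup>+l. ennreal (p * l powr (p - 1))*indicator {l. 0 <= l & ennreal l <= h} l \<partial>lborel)"
    using top by (intro nn_integral_mono) (auto split: split_indicator)
   finally show ?thesis .
  qed
  then have "(\<integral>\<^sup>+l. ennreal (p * l powr (p - 1))*indicator {l. 0 <= l & ennreal l <= h} l \<partial>lborel) = top"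
   by (rule ennreal_eq_topI)
  then show ?thesis using top by simp
 qed
qed

section \<open>The Hardy-Littlewood maximal theorem on the line\<close>

text \<open>The radii are the successive halves of \<open>r0\<close>: the supremum is countable,
  hence measurable, while every radius up to \<open>r0\<close> is within a factor 2 of one of
  them.\<close>

definition hl_max :: "real => (real => ennreal) => real => ennreal" where
 "hl_max r0 g s = (SUP m::nat. (\<integral>\<^sup>+t. g (s + t)*indicator {-(r0/2^m)..r0/2^m} t \<partial>lborel)/ennreal (2*(r0/2^m)))"

lemma hl_max_shift:
 assumes [measurable]: "g : borel_measurable borel"
 shows "(\<integral>\<^sup>+t. g (s + t)*indicator {-r..r} t \<partial>lborel) = (\<integral>\<^sup>+t. g t*indicator (cball s r) t \<partial>lborel)"
proof -
 have "(\<integral>\<^sup>+t. g t*indicator (cball s r) t \<partial>lborel) = (\<integral>\<^sup>+t. g t*indicator (cball s r) t \<partial>distr lborel borel ((+) s))"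
  by (simp add: lborel_distr_plus)
 also have "... = (\<integral>\<^sup>+t. g (s + t)*indicator (cball s r) (s + t) \<partial>lborel)"
  by (subst nn_integral_distr) (auto intro!: borel_measurable_times_ennreal borel_measurable_indicator)
 also have "... = (\<integral>\<^sup>+t. g (s + t)*indicator {-r..r} t \<partial>lborel)"
  by (intro nn_integral_cong) (auto simp: dist_real_def split: split_indicator)
 finally show ?thesis by simp
qed

lemma hl_max_measurable [measurable]:
 assumes [measurable]: "g : borel_measurable borel"
 shows "hl_max r0 g : borel_measurable borel"
 unfolding hl_max_def by measurable

text \<open>Countable subadditivity for an index set that may be finite; written over
  \<open>count_space\<close> to match \<open>emeasure_UN_countable\<close>, which later sums
  disjoint pieces over the same index set.\<close>

lemma emeasure_UN_countable_le:
 assumes "!!i. i : I ==> X i : sets M" and "countable I"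
 shows "emeasure M (\<Union>i\<in>I. X i) <= (\<integral>\<^sup>+i. emeasure M (X i) \<partial>count_space I)"
proof -
 have "emeasure M (\<Union>i\<in>I. X i) = (\<integral>\<^sup>+x. indicator (\<Union>i\<in>I. X i) x \<partial>M)"
  using assms by (intro nn_integral_indicator[symmetric] sets.countable_UN') auto
 also have "... <= (\<integral>\<^sup>+x. (\<integral>\<^sup>+i. indicator (X i) x \<partial>count_space I) \<partial>M)"
 proof (rule nn_integral_mono)
  fix x
  show "indicator (\<Union>i\<in>I. X i) x <= (\<integral>\<^sup>+i. indicator (X i) x \<partial>count_space I)"
  proof (cases "x : (\<Union>i\<in>I. X i)")
   case True
   then obtain i where i: "i : I" "x : X i" by auto
   have "(indicator (X i) x :: ennreal) <= (\<integral>\<^sup>+i. indicator (X i) x \<partial>count_space I)"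
    by (rule nn_integral_ge_point[OF i(1)])
   then show ?thesis using True i by simp
  qed simp
 qed
 also have "... = (\<integral>\<^sup>+i. (\<integral>\<^sup>+x. indicator (X i) x \<partial>M) \<partial>count_space I)"
  using assms by (intro nn_integral_count_space_nn_integral) auto
 also have "... = (\<integral>\<^sup>+i. emeasure M (X i) \<partial>count_space I)"
  using assms by (intro nn_integral_cong) simp
 finally show ?thesis .
qed

text \<open>Vitali covering: the selected balls are disjoint and their fivefold enlargements cover
  the level set. A selected ball of radius r carries mass at least 2*l*r, its enlargement has length
  10*r, whence the factor 5/l.\<close>

lemma hl_max_weak:
 assumes [measurable]: "g : borel_measurable borel" and r0: "0 < r0" and l: "0 < (l::real)"
 shows "emeasure lborel {s. ennreal l < hl_max r0 g s} <= ennreal (5/l)*(\<integral>\<^sup>+t. g t \<partial>lborel)"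
proof -
 let ?E = "{s. ennreal l < hl_max r0 g s}"
 have "EX r. 0 < r & r <= r0 & ennreal (l*(2*r)) <= (\<integral>\<^sup>+t. g t*indicator (cball s r) t \<partial>lborel)" if "s : ?E" for s
 proof -
  from that obtain m where m: "ennreal l < (\<integral>\<^sup>+t. g (s + t)*indicator {-(r0/2^m)..r0/2^m} t \<partial>lborel)/ennreal (2*(r0/2^m))"
   unfolding hl_max_def by (auto simp: less_SUP_iff)
  let ?r = "r0/2^m"
  have "ennreal l*ennreal (2*?r) <= (\<integral>\<^sup>+t. g (s + t)*indicator {-?r..?r} t \<partial>lborel)"
  proof (rule ccontr)
   assume "~ ?thesis"
   then have "(\<integral>\<^sup>+t. g (s + t)*indicator {-?r..?r} t \<partial>lborel)/ennreal (2*?r) <= ennreal l*ennreal (2*?r)/ennreal (2*?r)"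
    by (intro divide_right_mono_ennreal) simp
   also have "... = ennreal l" using r0 by (intro mult_divide_eq_ennreal) auto
   finally show False using m by simp
  qed
  moreover have "?r <= r0" using r0 by (simp add: field_simps)
  ultimately show ?thesis using r0 l by (intro exI[of _ ?r]) (simp add: hl_max_shift ennreal_mult[symmetric])
 qed
 then have "EX r. ALL s:?E. 0 < r s & r s <= r0 & ennreal (l*(2*r s)) <= (\<integral>\<^sup>+t. g t*indicator (cball s (r s)) t \<partial>lborel)"
  by (intro bchoice ballI)
 then obtain r where r: "!!s. s : ?E ==> 0 < r s & r s <= r0"
  and rg: "!!s. s : ?E ==> ennreal (l*(2*r s)) <= (\<integral>\<^sup>+t. g t*indicator (cball s (r s)) t \<partial>lborel)" by blast
 have "s : cball s (r s)" if "s : ?E" for s using r[OF that] by simp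
 then have sub: "?E \<subseteq> (\<Union>s\<in>?E. cball s (r s))" by blast
 obtain C where C: "countable C" "C \<subseteq> ?E"
   "pairwise (%i j. disjnt (cball i (r i)) (cball j (r j))) C"
   "?E \<subseteq> (\<Union>i\<in>C. cball i (5*r i))" by (rule Vitali_covering_lemma_cballs[OF sub r])
 have "emeasure lborel ?E <= emeasure lborel (\<Union>i\<in>C. cball i (5*r i))"
  using C by (intro emeasure_mono) auto
 also have "... <= (\<integral>\<^sup>+i. emeasure lborel (cball i (5*r i)) \<partial>count_space C)"
  using C by (intro emeasure_UN_countable_le) auto
 also have "... <= (\<integral>\<^sup>+i. ennreal (5/l)*(\<integral>\<^sup>+t. g t*indicator (cball i (r i)) t \<partial>lborel) \<partial>count_space C)"
 proof (intro nn_integral_mono)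
  fix i assume "i : space (count_space C)"
  then have i: "i : ?E" using C by auto
  have "emeasure lborel (cball i (5*r i)) = ennreal (10*r i)"
   using r[OF i] by (simp add: cball_eq_atLeastAtMost)
  also have "... = ennreal (5/l)*ennreal (l*(2*r i))" using l r[OF i] by (simp add: ennreal_mult[symmetric])
  also have "... <= ennreal (5/l)*(\<integral>\<^sup>+t. g t*indicator (cball i (r i)) t \<partial>lborel)"
   by (intro mult_left_mono rg i) auto
  finally show "emeasure lborel (cball i (5*r i)) <= ennreal (5/l)*(\<integral>\<^sup>+t. g t*indicator (cball i (r i)) t \<partial>lborel)" .
 qed
 also have "... = ennreal (5/l)*(\<integral>\<^sup>+i. (\<integral>\<^sup>+t. g t*indicator (cball i (r i)) t \<partial>lborel) \<partial>count_space C)"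
  by (rule nn_integral_cmult) auto
 also have "(\<integral>\<^sup>+i. (\<integral>\<^sup>+t. g t*indicator (cball i (r i)) t \<partial>lborel) \<partial>count_space C)
   = (\<integral>\<^sup>+i. emeasure (density lborel g) (cball i (r i)) \<partial>count_space C)"
  by (intro nn_integral_cong) (simp add: emeasure_density)
 also have "... = emeasure (density lborel g) (\<Union>i\<in>C. cball i (r i))"
 proof (rule emeasure_UN_countable[symmetric])
  show "disjoint_family_on (%i. cball i (r i)) C"
   using C(3) by (auto simp: disjoint_family_on_def pairwise_def disjnt_def)
 qed (use C in auto)
 also have "... <= emeasure (density lborel g) (space (density lborel g))" by (rule emeasure_space)
 also have "... = (\<integral>\<^sup>+t. g t \<partial>lborel)" by (simp add: emeasure_density)
 finally show ?thesis by (simp add: mult_left_mono)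
qed

text \<open>The part of \<open>g\<close> below the level \<open>l\<close> adds at most
  \<open>l\<close> to each average.\<close>

lemma hl_max_trunc:
 assumes [measurable]: "g : borel_measurable borel" and r0: "0 < r0" and l: "0 < (l::real)"
 shows "hl_max r0 g s <= hl_max r0 (%t. g t*indicator {t. ennreal l <= g t} t) s + ennreal l"
 unfolding hl_max_def[of _ g]
proof (rule SUP_least)
 fix m :: nat
 let ?r = "r0/2^m" and ?g = "%t. g t*indicator {t. ennreal l <= g t} t"
 have r: "0 < ?r" using r0 by simp
 have "(\<integral>\<^sup>+t. g (s + t)*indicator {-?r..?r} t \<partial>lborel)
   <= (\<integral>\<^sup>+t. ?g (s + t)*indicator {-?r..?r} t + ennreal l*indicator {-?r..?r} t \<partial>lborel)"
  by (intro nn_integral_mono) (auto split: split_indicator)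
 also have "... = (\<integral>\<^sup>+t. ?g (s + t)*indicator {-?r..?r} t \<partial>lborel) + (\<integral>\<^sup>+t. ennreal l*indicator {-?r..?r} t \<partial>lborel)"
  by (intro nn_integral_add) auto
 also have "(\<integral>\<^sup>+t. ennreal l*indicator {-?r..?r} t \<partial>lborel) = ennreal l*ennreal (2*?r)"
  using r by (subst nn_integral_cmult_indicator) auto
 finally have "(\<integral>\<^sup>+t. g (s + t)*indicator {-?r..?r} t \<partial>lborel)/ennreal (2*?r)
   <= ((\<integral>\<^sup>+t. ?g (s + t)*indicator {-?r..?r} t \<partial>lborel) + ennreal l*ennreal (2*?r))/ennreal (2*?r)"
  by (rule divide_right_mono_ennreal)
 also have "... = (\<integral>\<^sup>+t. ?g (s + t)*indicator {-?r..?r} t \<partial>lborel)/ennreal (2*?r) + ennreal l"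
 proof -
  have "ennreal l*ennreal (2*?r)/ennreal (2*?r) = ennreal l" using r by (intro mult_divide_eq_ennreal) auto
  then show ?thesis by (simp only: add_divide_distrib_ennreal)
 qed
 also have "... <= hl_max r0 ?g s + ennreal l"
  unfolding hl_max_def by (intro add_right_mono SUP_upper) auto
 finally show "(\<integral>\<^sup>+t. g (s + t)*indicator {-?r..?r} t \<partial>lborel)/ennreal (2*?r) <= hl_max r0 ?g s + ennreal l" .
qed

text \<open>Truncation at l/4 leaves at least 3*l/4 for the maximal function of the large part. This
  is strictly above l/2, the level at which \<open>hl_max_weak\<close>, stated for strict
  inequality, is applied.\<close>

lemma hl_max_weak_trunc:
 assumes g [measurable]: "g : borel_measurable borel" and r0: "0 < r0" and l: "0 < (l::real)"
 shows "emeasure lborel {s. ennreal l <= hl_max r0 g s}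
  <= ennreal (10/l)*(\<integral>\<^sup>+t. g t*indicator {t. ennreal (l/4) <= g t} t \<partial>lborel)"
proof -
 let ?g = "%t. g t*indicator {t. ennreal (l/4) <= g t} t"
 have "{s. ennreal l <= hl_max r0 g s} \<subseteq> {s. ennreal (l/2) < hl_max r0 ?g s}"
 proof safe
  fix s assume "ennreal l <= hl_max r0 g s"
  also have "... <= hl_max r0 ?g s + ennreal (l/4)" using l r0 by (intro hl_max_trunc) auto
  finally have *: "ennreal l <= hl_max r0 ?g s + ennreal (l/4)" .
  show "ennreal (l/2) < hl_max r0 ?g s"
  proof (rule ccontr)
   assume "~ ?thesis"
   then have "hl_max r0 ?g s + ennreal (l/4) <= ennreal (l/2) + ennreal (l/4)" by (intro add_right_mono) simp
   also have "... = ennreal (3*l/4)" using l by (simp add: ennreal_plus[symmetric] del: ennreal_plus)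
   also have "... < ennreal l" using l by (simp add: ennreal_less_iff)
   finally show False using*by simp
  qed
 qed
 then have "emeasure lborel {s. ennreal l <= hl_max r0 g s} <= emeasure lborel {s. ennreal (l/2) < hl_max r0 ?g s}"
  by (intro emeasure_mono) measurable
 also have "... <= ennreal (5/(l/2))*(\<integral>\<^sup>+t. ?g t \<partial>lborel)"
  using l r0 by (intro hl_max_weak) auto
 finally show ?thesis by simp
qed

text \<open>The interchange is used twice: with \<open>v l = l\<close> for the levels of the maximal
  function, and with \<open>v l = l/4\<close> for those of \<open>g\<close>.\<close>

lemma fubini_level:
 fixes v :: "real => real" and w :: "real => ennreal" and h :: "real => ennreal"
 assumes [measurable]: "w : borel_measurable borel" "h : borel_measurable borel" "k : borel_measurable borel" "v : borel_measurable borel"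
 shows "(\<integral>\<^sup>+s. (\<integral>\<^sup>+l. k s*(w l*indicator {l. 0 <= l & ennreal (v l) <= h s} l) \<partial>lborel) \<partial>lborel)
  = (\<integral>\<^sup>+l. (\<integral>\<^sup>+s. k s*(w l*indicator {l. 0 <= l & ennreal (v l) <= h s} l) \<partial>lborel) \<partial>lborel)"
proof -
 have [measurable]: "Measurable.pred (borel \<Otimes>\<^sub>M borel) (%z. 0 <= snd z & ennreal (v (snd z)) <= h (fst z))"
  by measurable
 have "(%z. k (fst z)*(w (snd z)*indicator {l. 0 <= l & ennreal (v l) <= h (fst z)} (snd z)))
   = (%z. if 0 <= snd z & ennreal (v (snd z)) <= h (fst z) then k (fst z)*w (snd z) else 0)"
  by (auto simp: fun_eq_iff)
 moreover have "(%z. if 0 <= snd z & ennreal (v (snd z)) <= h (fst z) then k (fst z)*w (snd z) else 0) : borel_measurable (borel \<Otimes>\<^sub>M borel)"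
  by measurable
 ultimately have "case_prod (%s l. k s*(w l*indicator {l. 0 <= l & ennreal (v l) <= h s} l)) : borel_measurable (lborel \<Otimes>\<^sub>M lborel)"
  by (simp add: case_prod_beta' cong: measurable_cong_sets)
 then show ?thesis by (rule lborel_pair.Fubini'[symmetric])
qed

text \<open>Marcinkiewicz interpolation. The truncated weak bound is integrated against p*l^(p-1);
  after the interchange the inner integral of 10*p*l^(p-2) over [0, 4*g(s)] equals
  10*p*(4*g(s))^(p-1)/(p-1), which is where p > 1 enters and where the constant comes from.\<close>

lemma hl_max_strong:
 assumes g [measurable]: "g : borel_measurable borel" and r0: "0 < r0" and p: "1 < p"
 shows "(\<integral>\<^sup>+s. enn_powr (hl_max r0 g s) p \<partial>lborel)
   <= ennreal (10 * p * 4 powr (p - 1)/(p - 1))*(\<integral>\<^sup>+s. enn_powr (g s) p \<partial>lborel)"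
proof -
 let ?w = "%l. ennreal (p * l powr (p - 1))"
 have "(\<integral>\<^sup>+s. enn_powr (hl_max r0 g s) p \<partial>lborel)
  = (\<integral>\<^sup>+s. (\<integral>\<^sup>+l. ?w l*indicator {l. 0 <= l & ennreal l <= hl_max r0 g s} l \<partial>lborel) \<partial>lborel)"
  using p by (simp add: enn_powr_layer_cake)
 also have "... = (\<integral>\<^sup>+l. (\<integral>\<^sup>+s. ?w l*indicator {l. 0 <= l & ennreal l <= hl_max r0 g s} l \<partial>lborel) \<partial>lborel)"
  proof -
  have m: "?w : borel_measurable borel" "(%_::real. 1::ennreal) : borel_measurable borel" "(%l::real. l) : borel_measurable borel"
   by measurable
  show ?thesis using fubini_level[OF m(1) hl_max_measurable[OF g, of r0] m(2,3)] by (simp only: mult_1)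
 qed
 also have "... <= (\<integral>\<^sup>+l. (\<integral>\<^sup>+s. g s*(ennreal (10 * p)*(ennreal (l powr (p - 2))*indicator {l. 0 <= l & ennreal (l/4) <= g s} l)) \<partial>lborel) \<partial>lborel)"
 proof (rule nn_integral_mono)
  fix l :: real
  show "(\<integral>\<^sup>+s. ?w l*indicator {l. 0 <= l & ennreal l <= hl_max r0 g s} l \<partial>lborel)
    <= (\<integral>\<^sup>+s. g s*(ennreal (10 * p)*(ennreal (l powr (p - 2))*indicator {l. 0 <= l & ennreal (l/4) <= g s} l)) \<partial>lborel)"
  proof (cases "0 < l")
   case False
   then have "(\<integral>\<^sup>+s. ?w l*indicator {l. 0 <= l & ennreal l <= hl_max r0 g s} l \<partial>lborel) = (\<integral>\<^sup>+s. 0 \<partial>(lborel::real measure))"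
    using p by (intro nn_integral_cong) (cases "l = 0", auto)
   then show ?thesis by simp
  next
   case True
   have "(\<integral>\<^sup>+s. ?w l*indicator {l. 0 <= l & ennreal l <= hl_max r0 g s} l \<partial>lborel)
     = (\<integral>\<^sup>+s. ?w l*indicator {s. ennreal l <= hl_max r0 g s} s \<partial>lborel)"
    using True by (intro nn_integral_cong) (auto split: split_indicator)
   also have "... = ?w l*emeasure lborel {s. ennreal l <= hl_max r0 g s}"
    by (rule nn_integral_cmult_indicator) measurable
   also have "... <= ?w l*(ennreal (10/l)*(\<integral>\<^sup>+t. g t*indicator {t. ennreal (l/4) <= g t} t \<partial>lborel))"
    by (intro mult_left_mono hl_max_weak_trunc g r0 True) simp
   also have "... = ennreal (10 * p)*ennreal (l powr (p - 2))*(\<integral>\<^sup>+t. g t*indicator {t. ennreal (l/4) <= g t} t \<partial>lborel)"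
   proof -
    have "p * l powr (p - 1)*(10/l) = 10 * p * l powr (p - 2)"
     using True by (simp add: powr_diff power2_eq_square field_simps)
    then show ?thesis using True p by (simp add: mult.assoc[symmetric] ennreal_mult[symmetric])
   qed
   also have "... = (\<integral>\<^sup>+t. (ennreal (10 * p)*ennreal (l powr (p - 2)))*(g t*indicator {t. ennreal (l/4) <= g t} t) \<partial>lborel)"
    by (rule nn_integral_cmult[symmetric]) measurable
   also have "... = (\<integral>\<^sup>+s. g s*(ennreal (10 * p)*(ennreal (l powr (p - 2))*indicator {l. 0 <= l & ennreal (l/4) <= g s} l)) \<partial>lborel)"
    using True by (intro nn_integral_cong) (auto split: split_indicator simp: mult_ac)
   finally show ?thesis .
  qed
 qed
 also have "... = (\<integral>\<^sup>+s. (\<integral>\<^sup>+l. g s*(ennreal (10 * p)*(ennreal (l powr (p - 2))*indicator {l. 0 <= l & ennreal (l/4) <= g s} l)) \<partial>lborel) \<partial>lborel)"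
  proof -
  have m: "(%l. ennreal (10 * p)*ennreal (l powr (p - 2))) : borel_measurable borel" "(%l::real. l/4) : borel_measurable borel"
   by measurable
  show ?thesis using fubini_level[OF m(1) g g m(2), symmetric] by (simp only: mult.assoc)
 qed
 also have "... <= (\<integral>\<^sup>+s. ennreal (10 * p * 4 powr (p - 1)/(p - 1))*enn_powr (g s) p \<partial>lborel)"
 proof (rule nn_integral_mono)
  fix s
  show "(\<integral>\<^sup>+l. g s*(ennreal (10 * p)*(ennreal (l powr (p - 2))*indicator {l. 0 <= l & ennreal (l/4) <= g s} l)) \<partial>lborel)
   <= ennreal (10 * p * 4 powr (p - 1)/(p - 1))*enn_powr (g s) p"
  proof (cases "g s")
   case top
   then show ?thesis using p by (simp add: ennreal_mult_top)
  next
   case (real r)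
   then have S: "{l. 0 <= l & ennreal (l/4) <= g s} = {0..4*r}" by auto
   have "(\<integral>\<^sup>+l. g s*(ennreal (10 * p)*(ennreal (l powr (p - 2))*indicator {0..4*r} l)) \<partial>lborel)
     = g s*(ennreal (10 * p)*(\<integral>\<^sup>+l. ennreal (l powr (p - 2))*indicator {0..4*r} l \<partial>lborel))"
    by (simp add: nn_integral_cmult)
   also have "... = ennreal r*(ennreal (10 * p)*ennreal ((4*r) powr (p - 1)/(p - 1)))"
    using real p nn_integral_powr_Icc[of "p - 2" "4*r"] by (simp add: diff_add_eq)
   also have "... = ennreal (10 * p * 4 powr (p - 1)/(p - 1)*r powr p)"
   proof -
    have "r*(10 * p * ((4*r) powr (p - 1)/(p - 1))) = 10 * p * 4 powr (p - 1)/(p - 1)*r powr p"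
     using real p by (cases "r = 0") (simp_all add: powr_mult powr_diff field_simps)
    then show ?thesis using real p by (simp add: ennreal_mult[symmetric])
   qed
   also have "... = ennreal (10 * p * 4 powr (p - 1)/(p - 1))*enn_powr (g s) p"
    using real p by (subst ennreal_mult) (simp_all add: enn_powr_ennreal)
   finally show ?thesis unfolding S by simp
  qed
 qed
 also have "... = ennreal (10 * p * 4 powr (p - 1)/(p - 1))*(\<integral>\<^sup>+s. enn_powr (g s) p \<partial>lborel)"
  by (rule nn_integral_cmult) measurable
 finally show ?thesis .
qed

section \<open>Gronwall estimates for integral curves\<close>

text \<open>The function exp(-L*s)*(a + L*integral of e up to s) has nonpositive derivative. The
  integral form suits curves driven by measurable controls, which need not be
  differentiable.\<close>

lemma gronwall_integral:
 fixes e :: "real => real"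
 assumes cont: "continuous_on {0..T} e" and L: "0 <= L"
  and le: "!!t. t : {0..T} ==> e t <= a + L*integral {0..t} e" and t: "t : {0..T}"
 shows "e t <= a*exp (L*t)"
proof -
 define G where "G s = exp (- (L * s))*(a + L*integral {0..s} e)" for s
 have d: "(G has_real_derivative (- L*exp (- (L * s))*(a + L*integral {0..s} e) + exp (- (L * s))*(L*e s))) (at s within {0..T})"
  if "s : {0..T}" for s
  unfolding G_def
  by (rule derivative_eq_intros integral_has_real_derivative[OF cont that] refl | simp)+
 have "G t <= G 0"
 proof (rule DERIV_nonpos_imp_decreasing_open[where f=G and a=0 and b=t])
  show "0 <= t" using t by simp
  show "EX y. DERIV G s :> y & y <= 0" if "0 < s" "s < t" for s
  proof (intro exI conjI)
   have s: "s : {0..T}" using that t by auto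
   have "at s within {0..T} = at s" using that t by (intro at_within_interior) auto
   then show "DERIV G s :> - L*exp (- (L * s))*(a + L*integral {0..s} e) + exp (- (L * s))*(L*e s)"
    using d[OF s] by simp
   have "exp (- (L * s))*L*(e s - (a + L*integral {0..s} e)) <= 0"
    using le[OF s] L by (intro mult_nonneg_nonpos) auto
   then show "- L*exp (- (L * s))*(a + L*integral {0..s} e) + exp (- (L * s))*(L*e s) <= 0"
    by (simp add: algebra_simps)
  qed
  have "continuous_on {0..T} G"
   using d by (intro DERIV_continuous_on) auto
  then show "continuous_on {0..t} G" by (rule continuous_on_subset) (use t in auto)
 qed
 then have "exp (- (L*t))*(a + L*integral {0..t} e) <= a" by (simp add: G_def)
 then have "exp (L*t)*(exp (- (L*t))*(a + L*integral {0..t} e)) <= exp (L*t)*a"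
  by (intro mult_left_mono) auto
 then have "a + L*integral {0..t} e <= a*exp (L*t)"
  by (simp add: mult.assoc[symmetric] exp_add[symmetric] mult.commute)
 then show ?thesis using le[OF t] by linarith
qed

text \<open>Since \<open>T <= 1\<close>, the perturbation \<open>b\<close> of the velocities
  accumulates to at most \<open>b\<close> and can be added to the initial distance before Gronwall
  is applied.\<close>

lemma integral_curves_close_bounded:
 fixes ga1 ga2 g1 g2 :: "real => 'a::euclidean_space"
 assumes I1: "!!t. t : {0..T} ==> (g1 has_integral (ga1 t - ga1 0)) {0..t}"
  and I2: "!!t. t : {0..T} ==> (g2 has_integral (ga2 t - ga2 0)) {0..t}"
  and lip: "!!s. s : {0..T} ==> norm (g1 s - g2 s) <= L*norm (ga1 s - ga2 s) + b"
  and L: "0 <= L" and b: "0 <= b" and T: "T <= 1" and t: "t : {0..T}"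
 shows "norm (ga1 t - ga2 t) <= (norm (ga1 0 - ga2 0) + b)*exp (L*t)"
proof -
 let ?e = "%s. norm (ga1 s - ga2 s)"
 have T0: "T : {0..T}" using t by auto
 have c: "continuous_on {0..T} ga" if I: "!!t. t : {0..T} ==> (g has_integral (ga t - ga 0)) {0..t}" for ga g :: "real => 'a"
 proof -
  have "continuous_on {0..T} (%x. integral {0..x} g)"
   using I[OF T0] by (intro indefinite_integral_continuous_1) (auto simp: integrable_on_def)
  then have "continuous_on {0..T} (%x. ga 0 + integral {0..x} g)" by (intro continuous_intros)
  then show ?thesis
   by (rule continuous_on_eq) (use I in \<open>force dest!: integral_unique\<close>)
 qed
 have ce: "continuous_on {0..T} ?e" using c[OF I1] c[OF I2] by (intro continuous_intros)
 show ?thesis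
 proof (rule gronwall_integral[OF ce L _ t])
  fix s assume s: "s : {0..T}"
  have ie: "?e integrable_on {0..s}"
   by (rule integrable_continuous_real, rule continuous_on_subset[OF ce]) (use s in auto)
  have "((%x. g1 x - g2 x) has_integral ((ga1 s - ga1 0) - (ga2 s - ga2 0))) {0..s}"
   by (intro has_integral_diff I1 I2 s)
  moreover have "norm (integral {0..s} (%x. g1 x - g2 x)) <= integral {0..s} (%x. L*?e x + b)"
  proof (rule integral_norm_bound_integral)
   show "(%x. g1 x - g2 x) integrable_on {0..s}" using calculation by (auto simp: integrable_on_def)
   show "(%x. L*?e x + b) integrable_on {0..s}"
    using integrable_cmul[OF ie, of L] by (intro integrable_add) auto
  qed (use lip s in auto)
  ultimately have "norm ((ga1 s - ga1 0) - (ga2 s - ga2 0)) <= integral {0..s} (%x. L*?e x + b)"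
   by (simp add: integral_unique)
  also have "... = L*integral {0..s} ?e + b * s"
   using ie s integrable_cmul[OF ie, of L] by (subst integral_add) auto
  also have "... <= L*integral {0..s} ?e + b" using s T b by (simp add: mult_left_le)
  finally have "norm ((ga1 s - ga1 0) - (ga2 s - ga2 0)) <= L*integral {0..s} ?e + b" .
  moreover have "norm (ga1 s - ga2 s) <= norm (ga1 0 - ga2 0) + norm ((ga1 s - ga1 0) - (ga2 s - ga2 0))"
   using norm_triangle_ineq[of "ga1 0 - ga2 0" "(ga1 s - ga1 0) - (ga2 s - ga2 0)"] by (simp add: algebra_simps)
  ultimately show "?e s <= norm (ga1 0 - ga2 0) + b + L*integral {0..s} ?e" by linarith
 qed
qed

lemma integral_curve_continuous:
 fixes ga g :: "real => 'a::euclidean_space"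
 assumes I: "!!t. t : {0..1} ==> (g has_integral (ga t - z)) {0..t}"
 shows "continuous_on {0..1} ga" and "ga 0 = z"
proof -
 have "continuous_on {0..1} (%x. integral {0..x} g)"
  using I[of 1] by (intro indefinite_integral_continuous_1) (auto simp: integrable_on_def)
 then have "continuous_on {0..1} (%x. z + integral {0..x} g)" by (intro continuous_intros)
 then show "continuous_on {0..1} ga"
  by (rule continuous_on_eq) (use I in \<open>force dest!: integral_unique\<close>)
 have "(g has_integral (ga 0 - z)) {0}" using I[of 0] by simp
 from has_integral_unique[OF this has_integral_refl(2)] show "ga 0 = z" by simp
qed

text \<open>The Lipschitz bound is only needed while the curves are \<open>r\<close>-close; a first-exit-time
  argument shows that they never get further apart.\<close>

lemma integral_curves_close:
 fixes ga1 ga2 g1 g2 :: "real => 'a::euclidean_space"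
 assumes I1: "!!t. t : {0..1} ==> (g1 has_integral (ga1 t - ga1 0)) {0..t}"
  and I2: "!!t. t : {0..1} ==> (g2 has_integral (ga2 t - ga2 0)) {0..t}"
  and lip: "!!s. s : {0..1} ==> norm (ga1 s - ga2 s) <= r ==> norm (g1 s - g2 s) <= L*norm (ga1 s - ga2 s) + b"
  and L: "0 <= L" and b: "0 <= b" and small: "(norm (ga1 0 - ga2 0) + b)*exp L < r" and t: "t : {0..1}"
 shows "norm (ga1 t - ga2 t) <= (norm (ga1 0 - ga2 0) + b)*exp (L*t)"
proof -
 let ?e = "%s. norm (ga1 s - ga2 s)" and ?a = "norm (ga1 0 - ga2 0) + b"
 have ce: "continuous_on {0..1} ?e"
  using integral_curve_continuous(1)[of g1 ga1, OF I1] integral_curve_continuous(1)[of g2 ga2, OF I2]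
  by (intro continuous_intros)
 have main: "?e s <= ?a*exp (L * s)" if "0 <= T" "T <= 1" "!!s. s : {0..T} ==> ?e s <= r" "s : {0..T}" for T s
  using that by (intro integral_curves_close_bounded[of T g1 ga1 g2 ga2 L b s] I1 I2 lip L b) auto
 have a0: "0 <= ?a" using b by simp
 have ltr: "?a*exp (L * s) < r" if "s : {0..1}" for s
 proof -
  have "?a*exp (L * s) <= ?a*exp L" using that L a0 by (intro mult_left_mono) (auto simp: mult_left_le)
  then show ?thesis using small by linarith
 qed
 have e0: "?e 0 < r" using ltr[of 0] b by simp
 have "?e s ~= r" if "s : {0..1}" for s
 proof
  assume er: "?e s = r"
  \<comment> \<open>\<open>Z\<close> collects the times at which the distance is exactly
    \<open>r\<close>. Up to the least of them, \<open>T\<close>, the bounded version applies, and it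
    says that the distance at \<open>T\<close> is below \<open>r\<close>.\<close>
  define Z where "Z = {s : {0..1}. ?e s = r}"
  have "closed Z" unfolding Z_def
   using continuous_closed_preimage[OF ce, of "{r}"] by (auto simp: vimage_def Int_def)
  moreover have "bounded Z" by (rule bounded_subset[of "{0..1}"]) (auto simp: Z_def)
  ultimately have "compact Z" by (simp add: compact_eq_bounded_closed)
  moreover have "Z ~= {}" using er that by (auto simp: Z_def)
  ultimately obtain T where T: "T : Z" "!!u. u : Z ==> T <= u" using compact_attains_inf by metis
  have T01: "T : {0..1}" "?e T = r" using T by (auto simp: Z_def)
  have "?e u <= r" if u: "u : {0..T}" for u
  proof (rule ccontr)
   assume "~ ?e u <= r"
   then have "EX v>=0. v <= u & ?e v = r"
    using e0 u T01 by (intro IVT') (auto intro: continuous_on_subset[OF ce])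
   then obtain v where "0 <= v" "v <= u" "?e v = r" by auto
   then have "v : Z" using u T01 by (auto simp: Z_def)
   then have "u = T" using T(2) \<open>v <= u\<close> u by force
   then show False using \<open>~ ?e u <= r\<close> T01 by simp
  qed
  then have "?e T <= ?a*exp (L*T)" using T01 by (intro main[of T]) auto
  then show False using ltr[of T] T01 by simp
 qed
 then have "?e s <= r" if "s : {0..1}" for s
 proof -
  have "EX v>=0. v <= s & ?e v = r" if "~ ?e s <= r"
   using e0 that \<open>s : {0..1}\<close> by (intro IVT') (auto intro: continuous_on_subset[OF ce])
  then show ?thesis using \<open>!!s. s : {0..1} ==> ?e s ~= r\<close> that by force
 qed
 then show ?thesis using t by (intro main[of 1]) auto
qed

text \<open>Comparison of \<open>v\<close> with the zero curve.\<close>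

lemma gronwall_derivative:
 fixes v v' :: "real => 'a::euclidean_space"
 assumes d: "!!t. t : {0..1} ==> (v has_vector_derivative v' t) (at t within {0..1})"
  and le: "!!t. t : {0..1} ==> norm (v' t) <= L*norm (v t) + b" and L: "0 <= L" and b: "0 <= b" and t: "t : {0..1}"
 shows "norm (v t) <= (norm (v 0) + b)*exp (L*t)"
proof -
 have "(v' has_integral (v t - v 0)) {0..t}" if "t : {0..1}" for t
  using that by (intro fundamental_theorem_of_calculus has_vector_derivative_within_subset[OF d]) auto
 then show ?thesis
  using integral_curves_close_bounded[of 1 v' v "%_. 0" "%_. 0" L b t] le L b t by auto
qed

section \<open>C1 fields near a compact set\<close>

lemma C1_on_derivative:
 assumes "C1_on V Om" "y : Om"
 shows "(V has_derivative frechet_derivative V (at y)) (at y)"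
 using assms unfolding C1_on_def using frechet_derivative_works differentiable_def by blast

text \<open>Uniform continuity of the derivative on a compact neighbourhood of \<open>C\<close>
  makes the first-order Taylor remainder small uniformly in the base point. Only the base point has
  to lie in \<open>C\<close>; the other point is free in a ball around it.\<close>

lemma C1_tube:
 fixes V :: "real^'n => real^'n"
 assumes Om: "open Om" and C: "compact C" "C \<subseteq> Om" and V: "C1_on V Om" and e: "0 < e"
 shows "EX r>0. ALL y:C. ALL y'. norm (y' - y) <= r --> y' : Om &
   norm (V y' - V y - frechet_derivative V (at y) (y' - y)) <= e*norm (y' - y)"
proof -
 obtain D :: "real^'n => (real^'n) \<Rightarrow>\<^sub>L (real^'n)" where D: "!!y. y : Om ==> (V has_derivative blinfun_apply (D y)) (at y)" and cD: "continuous_on Om D"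
  using V unfolding C1_on_def by blast
 have fD: "frechet_derivative V (at y) = blinfun_apply (D y)" if "y : Om" for y
  using frechet_derivative_at[OF D[OF that]] by simp
 obtain r0 where r0: "0 < r0" "(\<Union>x\<in>C. cball x r0) \<subseteq> Om"
  using compact_subset_open_imp_cball_epsilon_subset[OF C(1) Om C(2)] by blast
 have "compact (\<Union>x\<in>C. cball x r0)" by (rule compact_minkowski_sum_cball[OF C(1)])
 then have "uniformly_continuous_on (\<Union>x\<in>C. cball x r0) D"
  by (intro compact_uniformly_continuous continuous_on_subset[OF cD r0(2)])
 then obtain d where d: "0 < d" "!!x x'. x : (\<Union>x\<in>C. cball x r0) ==> x' : (\<Union>x\<in>C. cball x r0) ==> dist x' x < d ==> dist (D x') (D x) < e"
  unfolding uniformly_continuous_on_def using e by metis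
 define r where "r = min r0 (d/2)"
 have r: "0 < r" "r <= r0" "r < d" using r0 d by (auto simp: r_def)
 have "y' : Om & norm (V y' - V y - frechet_derivative V (at y) (y' - y)) <= e*norm (y' - y)"
  if y: "y : C" "norm (y' - y) <= r" for y y'
 proof -
  have sub: "cball y r \<subseteq> (\<Union>x\<in>C. cball x r0)" using y r by force
  have y': "y' : cball y r" using y by (simp add: dist_norm norm_minus_commute)
  have "norm (V y' - V y - blinfun_apply (D y) (y' - y)) <= norm (y' - y)*e"
  proof (rule differentiable_bound_linearization[where S="cball y r" and f'="%x. blinfun_apply (D x)"])
   show "y + t *\<^sub>R (y' - y) : cball y r" if "t : {0..1}" for t
   proof -
    have "norm (t *\<^sub>R (y' - y)) <= 1*r" using that y r unfolding norm_scaleR by (intro mult_mono) auto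
    then show ?thesis by (simp add: dist_norm)
   qed
   show "(V has_derivative blinfun_apply (D x)) (at x within cball y r)" if "x : cball y r" for x
    using D sub r0 that has_derivative_at_withinI by blast
   show "onorm (blinfun_apply (D x) - blinfun_apply (D y)) <= e" if "x : cball y r" for x
   proof -
    have "y : cball y r" using r by simp
    then have "dist (D x) (D y) < e"
     using subsetD[OF sub that] subsetD[OF sub, of y] that r by (intro d(2)) (auto simp: dist_commute)
    moreover have "blinfun_apply (D x) - blinfun_apply (D y) = blinfun_apply (D x - D y)"
     by (auto simp: fun_eq_iff blinfun.diff_left)
    ultimately show ?thesis by (simp add: dist_norm norm_blinfun.rep_eq)
   qed
   show "y : cball y r" using r by simp
  qed
  moreover have "y' : Om" using y' sub r0(2) by blast
  ultimately show ?thesis using fD[of y] C y by (auto simp: mult.commute)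
 qed
 then show ?thesis using r(1) by blast
qed

lemma C1_family_tube:
 fixes Y :: "nat => real^'n => real^'n"
 assumes Om: "open Om" and C: "compact C" "C \<subseteq> Om" and Y: "!!j. j < q ==> C1_on (Y j) Om" and e: "0 < e"
 obtains r where "0 < r" "!!y y'. y : C ==> norm (y' - y) <= r ==> y' : Om"
  "!!j y y'. j < q ==> y : C ==> norm (y' - y) <= r ==>
   norm (Y j y' - Y j y - frechet_derivative (Y j) (at y) (y' - y)) <= e*norm (y' - y)"
proof -
 obtain r0 where r0: "0 < r0" "(\<Union>x\<in>C. cball x r0) \<subseteq> Om"
  using compact_subset_open_imp_cball_epsilon_subset[OF C(1) Om C(2)] by blast
 have "ALL j. EX r. j < q --> 0 < r & (ALL y:C. ALL y'. norm (y' - y) <= r -->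
   norm (Y j y' - Y j y - frechet_derivative (Y j) (at y) (y' - y)) <= e*norm (y' - y))"
  using C1_tube[OF Om C Y e] by meson
 from choice[OF this] obtain s where s: "!!j. j < q ==> 0 < s j"
  "!!j y y'. j < q ==> y : C ==> norm (y' - y) <= s j ==>
   norm (Y j y' - Y j y - frechet_derivative (Y j) (at y) (y' - y)) <= e*norm (y' - y)" by auto
 \<comment> \<open>\<open>r0\<close> belongs to the set so that the minimum exists and points stay
   in \<open>Om\<close> also for \<open>q = 0\<close>.\<close>
 define r where "r = Min (insert r0 (s ` {..<q}))"
 have r: "0 < r" "r <= r0" "!!j. j < q ==> r <= s j" using s r0 by (auto simp: r_def)
 show ?thesis
 proof (rule that[of r])
  show "y' : Om" if "y : C" "norm (y' - y) <= r" for y y'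
  proof -
   have "y' : cball y r0" using that r by (simp add: dist_norm norm_minus_commute)
   then show ?thesis using that r0(2) by blast
  qed
  show "norm (Y j y' - Y j y - frechet_derivative (Y j) (at y) (y' - y)) <= e*norm (y' - y)"
   if "j < q" "y : C" "norm (y' - y) <= r" for j y y'
   using s(2)[OF that(1,2)] r(3)[OF that(1)] that(3) by simp
 qed (rule r(1))
qed

section \<open>Linear differential equations by Picard iteration\<close>

text \<open>Projection of the time axis to [0,1]: it extends the Picard integral to all real times,
  as a bounded continuous function on the whole space is required.\<close>

definition clip01 :: "real => real" where "clip01 s = max 0 (min 1 s)"

lemma clip01: "clip01 s : {0..1}" "s : {0..1} ==> clip01 s = s" "continuous_on S clip01"
 unfolding clip01_def[abs_def] by (auto intro!: continuous_intros)

definition hat :: "real => real" where "hat y = max 0 (1 - \<bar>y\<bar>)"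

lemma hat: "0 <= hat y" "hat y <= 1" "hat (real l - real l') = (if l = l' then 1 else 0)" "continuous_on S hat"
proof -
 show "hat (real l - real l') = (if l = l' then 1 else 0)"
 proof (cases "l = l'")
  case False
  then have "1 <= \<bar>int l - int l'\<bar>" by linarith
  then have "1 <= \<bar>real l - real l'\<bar>" by linarith
  then show ?thesis using False by (simp add: hat_def)
 qed (simp add: hat_def)
 show "continuous_on S hat" unfolding hat_def[abs_def] by (intro continuous_intros)
qed (auto simp: hat_def)

text \<open>The index \<open>l\<close> is encoded as a real argument through the hat function, so that the Picard
  operator acts on one complete space of bounded continuous functions whatever \<open>q\<close> is.\<close>

lemma linear_ode_exists:
 fixes C :: "nat => nat => real => real" and f ta0 :: "nat => real"
 assumes cC: "!!l m. l < q ==> m < q ==> continuous_on {0..1} (C l m)"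
  and bC: "!!l s. l < q ==> s : {0..1} ==> (\<Sum>m<q. \<bar>C l m s\<bar>) <= c0" and c0: "0 <= c0" "real q*c0 <= 1/2"
  and T: "!!l. l < q ==> \<bar>ta0 l\<bar> <= T" and F: "!!l. l < q ==> \<bar>f l\<bar> <= F" and TF: "0 <= T" "0 <= F"
 obtains ta :: "nat => real => real" where "!!l. l < q ==> ta l 0 = ta0 l"
  "!!l s. l < q ==> s : {0..1} ==> (ta l has_real_derivative (f l - (\<Sum>m<q. C l m s*ta m s))) (at s within {0..1})"
  "!!l s. l < q ==> s : {0..1} ==> \<bar>ta l s - ta0 l - s*f l\<bar> <= 2*(real q*c0)*(T + F)"
proof -
 define G where "G ph l r = f l - (\<Sum>m<q. C l m r*apply_bcontfun ph (real m, r))" for ph :: "(real \<times> real) \<Rightarrow>\<^sub>C real" and l r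
 \<comment> \<open>At \<open>fst z = real l\<close> the hat functions select the single component
   \<open>l\<close>; between integers they interpolate.\<close>
 define P where "P ph z = (\<Sum>l<q. hat (fst z - real l)*(ta0 l + integral {0..clip01 (snd z)} (G ph l)))" for ph :: "(real \<times> real) \<Rightarrow>\<^sub>C real" and z
 have cap: "continuous_on {0..1} (%r. apply_bcontfun ph (real m, r))" for ph :: "(real \<times> real) \<Rightarrow>\<^sub>C real" and m
  by (rule continuous_on_compose2[OF continuous_on_apply_bcontfun[of UNIV ph]]) (auto intro!: continuous_intros)
 have cG: "continuous_on {0..1} (G ph l)" if "l < q" for ph l
  unfolding G_def using that by (intro continuous_intros cC cap) auto
 have iG: "G ph l integrable_on {0..clip01 s}" if "l < q" for ph l s
  by (intro integrable_continuous_real continuous_on_subset[OF cG[OF that]]) (use clip01(1)[of s] in auto)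
 have sumb: "\<bar>\<Sum>m<q. C l m r*g m\<bar> <= c0*N" if "l < q" "r : {0..1}" "!!m. \<bar>g m\<bar> <= N" for l r g N
 proof -
  have N0: "0 <= N" using that(3)[of 0] by linarith
  have "\<bar>\<Sum>m<q. C l m r*g m\<bar> <= (\<Sum>m<q. \<bar>C l m r*g m\<bar>)" by (rule sum_abs)
  also have "... <= (\<Sum>m<q. \<bar>C l m r\<bar>*N)" using that(3) by (intro sum_mono) (simp add: abs_mult mult_left_mono)
  also have "... = (\<Sum>m<q. \<bar>C l m r\<bar>)*N" by (simp add: sum_distrib_right)
  also have "... <= c0*N" using bC[OF that(1,2)] N0 by (intro mult_right_mono)
  finally show ?thesis .
 qed
 have intb: "\<bar>integral {0..clip01 s} h\<bar> <= K" if "continuous_on {0..1} h" "!!r. r : {0..1} ==> \<bar>h r\<bar> <= K" for h :: "real => real" and s K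
 proof -
  have K0: "0 <= K" using that(2)[of 0] by simp
  have "norm (integral {0..clip01 s} h) <= K*(clip01 s - 0)"
  proof (rule integral_bound)
   show "continuous_on {0..clip01 s} h" by (rule continuous_on_subset[OF that(1)]) (use clip01(1)[of s] in auto)
  qed (use that(2) clip01(1)[of s] in auto)
  also have "... <= K" using clip01(1)[of s] K0 by (simp add: mult_left_le)
  finally show ?thesis by simp
 qed
 have apb: "\<bar>apply_bcontfun ph z\<bar> <= norm ph" for ph :: "(real \<times> real) \<Rightarrow>\<^sub>C real" and z
  using norm_bounded[of ph z] by simp
 have Gb: "\<bar>G ph l r\<bar> <= F + c0*norm ph" if "l < q" "r : {0..1}" for ph l r
  using F[OF that(1)] sumb[OF that, of "%m. apply_bcontfun ph (real m, r)" "norm ph"] apb unfolding G_def by fastforce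
 have hsum: "\<bar>\<Sum>l<q. hat (x - real l)*g l\<bar> <= real q*N" if "!!l. l < q ==> \<bar>g l\<bar> <= N" for x g N
 proof -
  have "\<bar>\<Sum>l<q. hat (x - real l)*g l\<bar> <= (\<Sum>l<q. \<bar>hat (x - real l)*g l\<bar>)" by (rule sum_abs)
  also have "... <= (\<Sum>l<q. N)"
  proof (rule sum_mono)
   fix l assume "l : {..<q}"
   then have "\<bar>g l\<bar> <= N" using that by simp
   moreover have "hat (x - real l) * \<bar>g l\<bar> <= 1 * \<bar>g l\<bar>" by (intro mult_right_mono hat) auto
   ultimately show "\<bar>hat (x - real l)*g l\<bar> <= N" using hat(1)[of "x - real l"] by (simp add: abs_mult)
  qed
  finally show ?thesis by simp
 qed
 have Pb: "\<bar>P ph z\<bar> <= real q*(T + (F + c0*norm ph))" for ph z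
  unfolding P_def
 proof (rule hsum)
  fix l assume l: "l < q"
  have "\<bar>integral {0..clip01 (snd z)} (G ph l)\<bar> <= F + c0*norm ph"
   by (intro intb cG Gb l)
  then show "\<bar>ta0 l + integral {0..clip01 (snd z)} (G ph l)\<bar> <= T + (F + c0*norm ph)" using T[OF l] by linarith
 qed
 have PB: "P ph : bcontfun" for ph
  unfolding bcontfun_def
 proof (intro CollectI conjI)
  have cI: "continuous_on UNIV (%z::real \<times> real. integral {0..clip01 (snd z)} (G ph l))" if "l < q" for l
  proof (rule continuous_on_compose2[of "{0..1}" "%x. integral {0..x} (G ph l)"])
   show "continuous_on {0..1} (%x. integral {0..x} (G ph l))"
    by (intro indefinite_integral_continuous_1 integrable_continuous_real cG that)
   show "continuous_on UNIV (%z::real \<times> real. clip01 (snd z))"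
    by (rule continuous_on_compose2[OF clip01(3)]) (auto intro!: continuous_intros)
  qed (use clip01(1) in auto)
  have cH: "continuous_on UNIV (%z::real \<times> real. hat (fst z - real l))" for l
   by (rule continuous_on_compose2[OF hat(4)]) (auto intro!: continuous_intros)
  show "continuous_on UNIV (P ph)"
   unfolding P_def[abs_def] by (intro continuous_on_sum continuous_on_mult continuous_on_add continuous_on_const cI cH) auto
  show "bounded (range (P ph))" using Pb by (auto simp: bounded_iff intro!: exI[of _ "real q*(T + (F + c0*norm ph))"])
 qed
 define TT where "TT ph = Bcontfun (P ph)" for ph
 have apT: "apply_bcontfun (TT ph) = P ph" for ph unfolding TT_def by (rule Bcontfun_inverse[OF PB])
 have "EX! ph. TT ph = ph"
 proof (rule banach_fix_type[where c="1/2"])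
  show "0 <= (1/2::real)" "(1/2::real) < 1" by auto
  show "ALL x y. dist (TT x) (TT y) <= (1/2)*dist x y"
  proof (intro allI dist_bound)
   fix x y z
   have "P x z - P y z = (\<Sum>l<q. hat (fst z - real l)*integral {0..clip01 (snd z)} (%r. G x l r - G y l r))"
    unfolding P_def sum_subtractf[symmetric] right_diff_distrib[symmetric]
    using iG by (intro sum.cong refl) (simp add: integral_diff)
   moreover have "\<bar>(\<Sum>l<q. hat (fst z - real l)*integral {0..clip01 (snd z)} (%r. G x l r - G y l r))\<bar> <= real q*(c0*dist x y)"
   proof (intro hsum intb)
    fix l assume l: "l < q"
    show "continuous_on {0..1} (%r. G x l r - G y l r)" by (intro continuous_intros cG l)
    fix r :: real assume r: "r : {0..1}"
    have "G x l r - G y l r = - (\<Sum>m<q. C l m r*(apply_bcontfun x (real m, r) - apply_bcontfun y (real m, r)))"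
     by (simp add: G_def right_diff_distrib sum_subtractf)
    then show "\<bar>G x l r - G y l r\<bar> <= c0*dist x y"
     using sumb[OF l r, of "%m. apply_bcontfun x (real m, r) - apply_bcontfun y (real m, r)" "dist x y"]
      dist_bounded[of x _ y] by (simp add: dist_real_def)
   qed
   ultimately have "\<bar>P x z - P y z\<bar> <= (real q*c0)*dist x y" by (simp add: mult.assoc)
   also have "... <= (1/2)*dist x y" using c0 by (intro mult_right_mono) auto
   finally show "dist (apply_bcontfun (TT x) z) (apply_bcontfun (TT y) z) <= (1/2)*dist x y"
    by (simp add: apT dist_real_def)
  qed
 qed
 then obtain ph where ph: "TT ph = ph" by blast
 define ta where "ta l s = apply_bcontfun ph (real l, s)" for l s
 have taP: "ta l s = P ph (real l, s)" for l s unfolding ta_def using apT[of ph] ph by simp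
 \<comment> \<open>Because \<open>real q*c0 <= 1/2\<close>, the norm of the fixed point is at most
   q*(T + F) plus half of itself.\<close>
 have nb: "norm ph <= 2*(real q*(T + F))"
 proof -
  have "norm ph <= real q*(T + (F + c0*norm ph))"
   using Pb[of ph] apT[of ph] ph by (intro norm_bound) auto
  moreover have "(real q*c0)*norm ph <= (1/2)*norm ph" using c0 by (intro mult_right_mono) auto
  ultimately show ?thesis by (simp add: algebra_simps)
 qed
 have eq: "ta l s = ta0 l + integral {0..s} (G ph l)" if "l < q" "s : {0..1}" for l s
 proof -
  have "ta l s = (\<Sum>l'<q. hat (real l - real l')*(ta0 l' + integral {0..s} (G ph l')))"
   using that by (simp add: taP P_def clip01(2))
  also have "... = (\<Sum>l'<q. if l = l' then ta0 l' + integral {0..s} (G ph l') else 0)"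
   by (intro sum.cong refl) (simp add: hat(3))
  finally show ?thesis using that by simp
 qed
 show ?thesis
 proof (rule that[of ta])
  show "ta l 0 = ta0 l" if "l < q" for l using eq[OF that, of 0] by simp
  fix l s assume ls: "l < q" "s : {0..1::real}"
  have "((%s. ta0 l + integral {0..s} (G ph l)) has_real_derivative (0 + G ph l s)) (at s within {0..1})"
   by (intro DERIV_add DERIV_const integral_has_real_derivative cG ls)
  then have "(ta l has_real_derivative (0 + G ph l s)) (at s within {0..1})"
   by (rule has_field_derivative_transform_within[where d=1]) (use eq ls in auto)
  then show "(ta l has_real_derivative (f l - (\<Sum>m<q. C l m s*ta m s))) (at s within {0..1})"
   by (simp add: G_def ta_def)
  have cS: "continuous_on {0..1} (%r. G ph l r - f l)" by (intro continuous_intros cG ls)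
  have "integral {0..s} (%r. G ph l r - f l) = integral {0..s} (G ph l) - s*f l"
   using iG[OF ls(1), of ph s] ls clip01(2)[of s] by (subst integral_diff) auto
  then have "ta l s - ta0 l - s*f l = integral {0..clip01 s} (%r. G ph l r - f l)"
   using eq[OF ls] ls by (simp add: clip01(2))
  also have "\<bar>...\<bar> <= c0*norm ph"
  proof (rule intb[OF cS])
   fix r :: real assume "r : {0..1}"
   then show "\<bar>G ph l r - f l\<bar> <= c0*norm ph"
    using sumb[OF ls(1), of r "%m. apply_bcontfun ph (real m, r)" "norm ph"] apb by (simp add: G_def)
  qed
  also have "... <= c0*(2*(real q*(T + F)))" using nb c0 by (intro mult_left_mono) auto
  finally show "\<bar>ta l s - ta0 l - s*f l\<bar> <= 2*(real q*c0)*(T + F)" by (simp add: mult_ac)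
 qed
qed

section \<open>Derivative and Lipschitz bounds for families of fields\<close>

lemma C1_derivative_bounded:
 fixes V :: "real^'n => real^'n"
 assumes C: "compact C" "C \<subseteq> Om" and V: "C1_on V Om"
 shows "EX A>=0. ALL y:C. ALL v. norm (frechet_derivative V (at y) v) <= A*norm v"
proof -
 obtain D :: "real^'n => (real^'n) \<Rightarrow>\<^sub>L (real^'n)" where D: "!!y. y : Om ==> (V has_derivative blinfun_apply (D y)) (at y)" and cD: "continuous_on Om D"
  using V unfolding C1_on_def by blast
 have fD: "frechet_derivative V (at y) = blinfun_apply (D y)" if "y : Om" for y
  using frechet_derivative_at[OF D[OF that]] by simp
 have "bounded (D ` C)" using C by (intro compact_imp_bounded compact_continuous_image continuous_on_subset[OF cD])
 then obtain A where A: "!!y. y : C ==> norm (D y) <= A" by (auto simp: bounded_iff)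
 have "norm (frechet_derivative V (at y) v) <= max 0 A*norm v" if "y : C" for y v
 proof -
  have "norm (blinfun_apply (D y) v) <= norm (D y)*norm v" by (rule norm_blinfun)
  also have "... <= max 0 A*norm v" using A[OF that] by (intro mult_right_mono) auto
  finally show ?thesis using fD[of y] that C by auto
 qed
 then show ?thesis by (intro exI[of _ "max 0 A"]) auto
qed

lemma C1_on_continuous: "C1_on V Om ==> continuous_on Om V"
 unfolding C1_on_def using has_derivative_continuous continuous_at_imp_continuous_on by blast

text \<open>The Taylor remainder with \<open>e = 1\<close> is added to the derivative at the base
  point. The constant \<open>A + 1\<close> thus retains a given, possibly admissible, bound
  \<open>A\<close>; only the radius \<open>r\<close> escapes quantitative control.\<close>

lemma C1_family_lipschitz_tube:
 fixes Y :: "nat => real^'n => real^'n"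
 assumes Om: "open Om" and C: "compact C" "C \<subseteq> Om" and Y: "!!j. j < q ==> C1_on (Y j) Om"
  and A: "!!j y v. j < q ==> y : C ==> norm (frechet_derivative (Y j) (at y) v) <= A*norm v"
 obtains r where "0 < r" "!!y y'. y : C ==> norm (y' - y) <= r ==> y' : Om"
  "!!j y y'. j < q ==> y : C ==> norm (y' - y) <= r ==> norm (Y j y' - Y j y) <= (A + 1)*norm (y' - y)"
proof -
 obtain r where r: "0 < r" "!!y y'. y : C ==> norm (y' - y) <= r ==> y' : Om"
  "!!j y y'. j < q ==> y : C ==> norm (y' - y) <= r ==>
   norm (Y j y' - Y j y - frechet_derivative (Y j) (at y) (y' - y)) <= 1*norm (y' - y)"
  by (rule C1_family_tube[where e=1 and q=q and Y=Y, OF Om C Y]) auto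
 show ?thesis
 proof (rule that[OF r(1,2)])
  fix j y y' assume "j < q" "y : C" "norm (y' - y) <= r"
  then have "norm (Y j y' - Y j y - frechet_derivative (Y j) (at y) (y' - y)) <= norm (y' - y)"
   "norm (frechet_derivative (Y j) (at y) (y' - y)) <= A*norm (y' - y)" using r(3) A by auto
  then show "norm (Y j y' - Y j y) <= (A + 1)*norm (y' - y)"
   using norm_triangle_sub[of "Y j y' - Y j y" "frechet_derivative (Y j) (at y) (y' - y)"] by (simp add: algebra_simps)
 qed
qed

lemma C1_family_derivative_bounded:
 fixes Y :: "nat => real^'n => real^'n"
 assumes C: "compact C" "C \<subseteq> Om" and Y: "!!j. j < q ==> C1_on (Y j) Om"
 obtains A where "0 <= A" "!!j y v. j < q ==> y : C ==> norm (frechet_derivative (Y j) (at y) v) <= A*norm v"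
proof -
 have "ALL j. EX A. j < q --> 0 <= A & (ALL y:C. ALL v. norm (frechet_derivative (Y j) (at y) v) <= A*norm v)"
  using C1_derivative_bounded[OF C Y] by meson
 from choice[OF this] obtain s where s: "!!j. j < q ==> 0 <= s j"
  "!!j y v. j < q ==> y : C ==> norm (frechet_derivative (Y j) (at y) v) <= s j*norm v" by auto
 show ?thesis
 proof (rule that[of "\<Sum>j<q. s j"])
  show "0 <= (\<Sum>j<q. s j)" using s by (intro sum_nonneg) auto
  fix j y and v :: "real^'n" assume j: "j < q" "y : C"
  have "s j <= (\<Sum>j<q. s j)" using s j by (intro member_le_sum) auto
  then have "s j*norm v <= (\<Sum>j<q. s j)*norm v" by (intro mult_right_mono) auto
  then show "norm (frechet_derivative (Y j) (at y) v) <= (\<Sum>j<q. s j)*norm v" using s(2)[OF j, of v] by linarith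
 qed
qed

section \<open>Controls, reachable sets and flows\<close>

definition lc :: "nat => (nat => real^'n => real^'n) => (nat => real) => real^'n => real^'n" where
 "lc q Y w y = (\<Sum>j<q. w j *\<^sub>R Y j y)"

definition l1 :: "nat => (nat => real) => real" where "l1 q w = (\<Sum>j<q. \<bar>w j\<bar>)"

definition l2 :: "nat => (nat => real) => real" where "l2 q w = sqrt (\<Sum>j<q. (w j)\<^sup>2)"

definition solves :: "(real^'n) set => (real^'n => real^'n) => (real => real^'n) => bool" where
 "solves Om W ga \<longleftrightarrow> (ALL t:{0..1}. ga t : Om & (ga has_vector_derivative W (ga t)) (at t within {0..1}))"

text \<open>The time-one map of the field \<open>W\<close>. \<open>SOME\<close> makes it total;
  where a solution on [0,1] exists, uniqueness (\<open>flow_eq\<close>) identifies its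
  value.\<close>

definition flow :: "(real^'n) set => (real^'n => real^'n) => real^'n => real^'n" where
 "flow Om W y = (SOME z. EX ga. solves Om W ga & ga 0 = y & ga 1 = z)"

text \<open>Unlike \<open>ctrl_admissible\<close>, the control is Borel on the whole line and its
  bound holds everywhere rather than almost everywhere, which eases rescaling and concatenation.
  \<open>CC_ball_eq\<close> recovers the balls as unions of \<open>reach\<close> over
  \<open>L < 1\<close>.\<close>

definition is_ctrl :: "nat => real => (nat => real => real) => bool" where
 "is_ctrl q L a \<longleftrightarrow> (ALL j<q. a j : borel_measurable borel) & (ALL s. l2 q (%j. a j s) <= L)"

definition cpath :: "(real^'n) set => (nat => real^'n => real^'n) => nat => real^'n => (nat => real => real) => (real => real^'n) => bool" where
 "cpath Om Y q x a ga \<longleftrightarrow> (ALL t:{0..1}. ga t : Om & ((%s. lc q Y (%j. a j s) (ga s)) has_integral (ga t - x)) {0..t})"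

definition reach :: "(real^'n) set => (nat => real^'n => real^'n) => nat => real^'n => real => (real^'n) set" where
 "reach Om Y q x L = {ga 1 | ga a. is_ctrl q L a & cpath Om Y q x a ga}"

lemma l2_nonneg: "0 <= l2 q w" by (simp add: l2_def sum_nonneg)
lemma l2_le_l1: "l2 q w <= l1 q w"
 unfolding l2_def l1_def using L2_set_le_sum_abs[of w "{..<q}"] by (simp add: L2_set_def)
lemma l2_component: "j < q ==> \<bar>w j\<bar> <= l2 q w"
 unfolding l2_def using member_le_L2_set[of "{..<q}" j "%j. \<bar>w j\<bar>"] by (simp add: L2_set_def)
lemma l1_nonneg: "0 <= l1 q w" by (simp add: l1_def sum_nonneg)
lemma l2_scale: "l2 q (%j. c*w j) = \<bar>c\<bar>*l2 q w"
 by (simp add: l2_def power_mult_distrib sum_distrib_left[symmetric] real_sqrt_mult)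

lemma l1_le: "(!!j. j < q ==> \<bar>w j\<bar> <= c) ==> l1 q w <= real q*c"
 unfolding l1_def using sum_bounded_above[of "{..<q}" "%j. \<bar>w j\<bar>" c] by simp

lemma lc_scale: "lc q Y (%j. c*w j) y = c *\<^sub>R lc q Y w y"
 by (simp add: lc_def scaleR_sum_right)
lemma lc_diff: "lc q Y w y - lc q Y w' y = lc q Y (%j. w j - w' j) y"
 by (simp add: lc_def scaleR_left_diff_distrib sum_subtractf)
lemma lc_add: "lc q Y w y + lc q Y w' y = lc q Y (%j. w j + w' j) y"
 by (simp add: lc_def scaleR_left_distrib sum.distrib)
lemma lc_norm_le: "(!!j. j < q ==> norm (Y j y) <= M) ==> norm (lc q Y w y) <= l1 q w*M"
proof -
 assume M: "!!j. j < q ==> norm (Y j y) <= M"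
 have "norm (lc q Y w y) <= (\<Sum>j<q. norm (w j *\<^sub>R Y j y))" unfolding lc_def by (rule norm_sum)
 also have "... <= (\<Sum>j<q. \<bar>w j\<bar>*M)" using M by (intro sum_mono) (simp add: mult_left_mono)
 finally show ?thesis by (simp add: l1_def sum_distrib_right)
qed
lemma lc_lipschitz: "(!!j. j < q ==> norm (Y j y - Y j y') <= L) ==> norm (lc q Y w y - lc q Y w y') <= l1 q w*L"
proof -
 assume L: "!!j. j < q ==> norm (Y j y - Y j y') <= L"
 have "lc q Y w y - lc q Y w y' = lc q (%j y. Y j y - Y j y') w y" by (simp add: lc_def scaleR_diff_right sum_subtractf)
 then show ?thesis using lc_norm_le[of q "%j y. Y j y - Y j y'" y L w] L by simp
qed

lemma reach_mono: "L <= L' ==> reach Om Y q x L \<subseteq> reach Om Y q x L'"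
proof -
 assume "L <= L'"
 then have "is_ctrl q L' a" if "is_ctrl q L a" for a
  using that order_trans[OF _ \<open>L <= L'\<close>] unfolding is_ctrl_def by simp
 then show ?thesis unfolding reach_def by blast
qed

lemma is_ctrl_nonneg: "is_ctrl q L a ==> 0 <= L"
proof -
 assume "is_ctrl q L a"
 then have "l2 q (%j. a j 0) <= L" by (simp add: is_ctrl_def)
 then show ?thesis using l2_nonneg[of q "%j. a j 0"] by linarith
qed

lemma cpath_cong:
 assumes "!!j s. j < q ==> s : {0..1} ==> a j s = b j s" "cpath Om Y q x a ga"
 shows "cpath Om Y q x b ga"
 unfolding cpath_def
proof (intro ballI conjI)
 fix t :: real assume t: "t : {0..1}"
 then show "ga t : Om" using assms(2) by (auto simp: cpath_def)
 have "((%s. lc q Y (%j. a j s) (ga s)) has_integral (ga t - x)) {0..t}" using assms(2) t by (auto simp: cpath_def)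
 then show "((%s. lc q Y (%j. b j s) (ga s)) has_integral (ga t - x)) {0..t}"
  by (rule has_integral_eq[rotated]) (use assms(1) t in \<open>auto simp: lc_def intro!: sum.cong\<close>)
qed

lemma has_integral_rescale:
 fixes f :: "real => 'a::real_normed_vector"
 assumes "(f has_integral i) {m*a + c..m*b + c}" "0 < m"
 shows "((%s. m *\<^sub>R f (m * s + c)) has_integral i) {a..b}"
proof -
 have "((%s. f (m *\<^sub>R s + c)) has_integral (i /\<^sub>R m ^ DIM(real))) (cbox (((m*a + c) - c) /\<^sub>R m) (((m*b + c) - c) /\<^sub>R m))"
  using assms by (intro has_integral_affinity') auto
 then have "((%s. f (m * s + c)) has_integral (i /\<^sub>R m)) {a..b}" using assms by (simp add: mult.assoc[symmetric])
 from has_integral_cmul[OF this, of m] show ?thesis using assms by simp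
qed

lemma has_integral_subinterval:
 fixes f :: "real => 'a::euclidean_space"
 assumes I: "!!t. t : {0..1} ==> (f has_integral (ga t - z)) {0..t}" and "0 <= u" "u <= v" "v <= 1"
 shows "(f has_integral (ga v - ga u)) {u..v}"
proof -
 have "f integrable_on {0..1}" using I[of 1] by (auto simp: integrable_on_def)
 then have i: "f integrable_on {0..v}" "f integrable_on {u..v}"
  using assms by (auto intro: integrable_on_subinterval)
 have "integral {0..u} f + integral {u..v} f = integral {0..v} f"
  using assms i by (intro Henstock_Kurzweil_Integration.integral_combine) auto
 moreover have "integral {0..u} f = ga u - z" "integral {0..v} f = ga v - z"
  using assms by (auto intro!: integral_unique)
 ultimately have "integral {u..v} f = ga v - ga u" by (simp add: algebra_simps)
 then show ?thesis using i(2) by (simp add: has_integral_iff)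
qed

lemma cpath_rescale:
 assumes p: "cpath Om Y q x a ga" and m: "0 <= m" "m <= 1"
 shows "cpath Om Y q x (%j s. m*a j (m * s)) (%s. ga (m * s))"
proof (cases "m = 0")
 case True
 have "ga 0 = x" "ga 0 : Om" using p integral_curve_continuous(2)[of "%s. lc q Y (%j. a j s) (ga s)" ga x] by (auto simp: cpath_def)
 then show ?thesis using True by (auto simp: cpath_def lc_def)
next
 case False
 then have m0: "0 < m" using m by simp
 show ?thesis unfolding cpath_def
 proof (intro ballI conjI)
  fix t :: real assume t: "t : {0..1}"
  then have mt: "m*t : {0..1}" using m by (auto simp: mult_le_one)
  then show "ga (m*t) : Om" using p by (auto simp: cpath_def)
  have "((%s. lc q Y (%j. a j s) (ga s)) has_integral (ga (m*t) - x)) {m*0 + 0..m*t + 0}"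
   using p mt by (auto simp: cpath_def)
  from has_integral_rescale[OF this m0]
  show "((%s. lc q Y (%j. m*a j (m * s)) (ga (m * s))) has_integral (ga (m*t) - x)) {0..t}"
   by (simp add: lc_scale)
 qed
qed

lemma is_ctrl_rescale:
 assumes "is_ctrl q L a" "0 <= m" "m <= 1" "0 <= L"
 shows "is_ctrl q L (%j s. m*a j (m * s))"
 unfolding is_ctrl_def
proof (intro conjI allI impI)
 fix j assume "j < q"
 then have [measurable]: "a j : borel_measurable borel" using assms by (auto simp: is_ctrl_def)
 show "(%s. m*a j (m * s)) : borel_measurable borel" by measurable
next
 fix s
 have "l2 q (%j. a j (m * s)) <= L" using assms by (auto simp: is_ctrl_def)
 then have "m*l2 q (%j. a j (m * s)) <= 1*L" using assms by (intro mult_mono) (auto simp: l2_nonneg)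
 then show "l2 q (%j. m*a j (m * s)) <= L" using assms by (simp add: l2_scale)
qed

text \<open>Slowing the control down by the factor \<open>t\<close> moves the point of time
  \<open>t\<close> to time 1 and does not increase the bound \<open>L\<close>.\<close>

lemma cpath_in_reach:
 assumes "cpath Om Y q x a ga" "is_ctrl q L a" "t : {0..1}"
 shows "ga t : reach Om Y q x L"
proof -
 have "0 <= L" using assms(2) by (rule is_ctrl_nonneg)
 then have "is_ctrl q L (%j s. t*a j (t * s))" "cpath Om Y q x (%j s. t*a j (t * s)) (%s. ga (t * s))"
  using assms by (auto intro!: is_ctrl_rescale cpath_rescale)
 then show ?thesis unfolding reach_def by (auto intro!: exI[of _ "%s. ga (t * s)"])
qed

locale cfields =
 fixes Om :: "(real^'n) set" and Y :: "nat => real^'n => real^'n" and q :: nat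
 assumes open_Om: "open Om" and C1: "!!j. j < q ==> C1_on (Y j) Om"
begin

text \<open>In a tube around the compact trajectory \<open>ga\<close> the fields are Lipschitz, so
  Gronwall applies with zero initial distance and zero perturbation.\<close>

lemma cpath_unique:
 assumes p: "cpath Om Y q x a ga" "cpath Om Y q x a ga'" and a: "is_ctrl q L a" and t: "t : {0..1}"
 shows "ga t = ga' t"
proof -
 have I: "((%s. lc q Y (%j. a j s) (ga s)) has_integral (ga t - x)) {0..t}" "((%s. lc q Y (%j. a j s) (ga' s)) has_integral (ga' t - x)) {0..t}" if "t : {0..1}" for t
  using p that by (auto simp: cpath_def)
 have 0: "ga 0 = x" "ga' 0 = x" using integral_curve_continuous(2)[OF I(1)] integral_curve_continuous(2)[OF I(2)] by auto
 have "continuous_on {0..1} ga" by (rule integral_curve_continuous(1)[OF I(1)])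
 then have C: "compact (ga ` {0..1})" "ga ` {0..1} \<subseteq> Om" using p(1) by (auto simp: cpath_def intro: compact_continuous_image)
 obtain A where A: "0 <= A" "!!j y v. j < q ==> y : ga ` {0..1} ==> norm (frechet_derivative (Y j) (at y) v) <= A*norm v"
  by (rule C1_family_derivative_bounded[where Y=Y and q=q, OF C C1]) auto
 obtain r where r: "0 < r" "!!y y'. y : ga ` {0..1} ==> norm (y' - y) <= r ==> y' : Om"
  "!!j y y'. j < q ==> y : ga ` {0..1} ==> norm (y' - y) <= r ==> norm (Y j y' - Y j y) <= (A + 1)*norm (y' - y)"
  by (rule C1_family_lipschitz_tube[where Y=Y and q=q and A=A, OF open_Om C C1 A(2)]) auto
 have L0: "0 <= L" using a by (rule is_ctrl_nonneg)
 have "norm (ga t - ga' t) <= (norm (ga 0 - ga' 0) + 0)*exp (real q*L*(A + 1)*t)"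
 proof (rule integral_curves_close[where r = r])
  fix s :: real assume s: "s : {0..1}" "norm (ga s - ga' s) <= r"
  have "norm (lc q Y (%j. a j s) (ga s) - lc q Y (%j. a j s) (ga' s)) <= l1 q (%j. a j s)*((A + 1)*norm (ga s - ga' s))"
   using r(3)[of _ "ga s" "ga' s"] s by (intro lc_lipschitz) (auto simp: norm_minus_commute)
  also have "l1 q (%j. a j s) <= real q*L"
  proof (rule l1_le)
   fix j assume "j < q"
   then have "\<bar>a j s\<bar> <= l2 q (%j. a j s)" by (rule l2_component)
   also have "... <= L" using a by (auto simp: is_ctrl_def)
   finally show "\<bar>a j s\<bar> <= L" .
  qed
  then have "l1 q (%j. a j s)*((A + 1)*norm (ga s - ga' s)) <= (real q*L)*((A + 1)*norm (ga s - ga' s))"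
   using A by (intro mult_right_mono) auto
  finally show "norm (lc q Y (%j. a j s) (ga s) - lc q Y (%j. a j s) (ga' s)) <= real q*L*(A + 1)*norm (ga s - ga' s) + 0"
   by (simp add: mult.assoc)
 qed (use I 0 r(1) A(1) t L0 in auto)
 then show ?thesis using 0 by simp
qed

lemma solves_integral:
 assumes "solves Om W ga" "t : {0..1}"
 shows "((%s. W (ga s)) has_integral (ga t - ga 0)) {0..t}"
proof (rule fundamental_theorem_of_calculus)
 show "0 <= t" using assms by simp
 fix s assume s: "s : {0..t}"
 then have "(ga has_vector_derivative W (ga s)) (at s within {0..1})" using assms by (simp add: solves_def)
 then show "(ga has_vector_derivative W (ga s)) (at s within {0..t})"
  by (rule has_vector_derivative_within_subset) (use assms in auto)
qed

lemma solves_continuous: "solves Om W ga ==> continuous_on {0..1} ga"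
 unfolding solves_def by (auto intro!: continuous_on_vector_derivative)

lemma solves_compact: "solves Om W ga ==> compact (ga ` {0..1}) & ga ` {0..1} \<subseteq> Om"
 using solves_continuous by (auto simp: solves_def intro: compact_continuous_image)

lemma family_bounded:
 assumes C: "compact C" "C \<subseteq> Om"
 obtains M where "0 <= M" "!!j y. j < q ==> y : C ==> norm (Y j y) <= M"
proof -
 have "EX M. j < q --> (ALL y:C. norm (Y j y) <= M)" for j
 proof (cases "j < q")
  case True
  have "bounded (Y j ` C)"
   by (intro compact_imp_bounded compact_continuous_image continuous_on_subset[OF C1_on_continuous[OF C1[OF True]]] C)
  then show ?thesis by (auto simp: bounded_iff)
 qed auto
 then have "EX M. ALL j. j < q --> (ALL y:C. norm (Y j y) <= M j)" by (intro choice allI)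
 then obtain M where M: "!!j y. j < q ==> y : C ==> norm (Y j y) <= M j" by blast
 show ?thesis
 proof (rule that[of "\<Sum>j<q. \<bar>M j\<bar>"])
  fix j y assume j: "j < q" "y : C"
  have "\<bar>M j\<bar> <= (\<Sum>j<q. \<bar>M j\<bar>)" using j by (intro member_le_sum) auto
  then show "norm (Y j y) <= (\<Sum>j<q. \<bar>M j\<bar>)" using M[OF j] by linarith
 qed (simp add: sum_nonneg)
qed

text \<open>Only the threshold \<open>r\<close> depends on the compact set \<open>C\<close>; the
  factor exp (A + 1) is governed by \<open>A\<close>. Smallness of the right-hand side keeps
  \<open>ga2\<close> in the tube around \<open>ga1\<close> where the fields are Lipschitz.\<close>

lemma flow_compare:
 assumes C: "compact C" "C \<subseteq> Om" and A0: "0 <= A"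
  and A: "!!j y v. j < q ==> y : C ==> norm (frechet_derivative (Y j) (at y) v) <= A*norm v"
  and M: "!!j y. j < q ==> y : C ==> norm (Y j y) <= M" and M0: "0 <= M"
 obtains r where "0 < r" "!!w1 w2 ga1 ga2 t. solves Om (lc q Y w1) ga1 ==> solves Om (lc q Y w2) ga2 ==> ga1 ` {0..1} \<subseteq> C ==>
   l1 q w2 <= 1 ==> (norm (ga1 0 - ga2 0) + l1 q (%j. w1 j - w2 j)*M)*exp (A + 1) < r ==> t : {0..1} ==>
   norm (ga1 t - ga2 t) <= (norm (ga1 0 - ga2 0) + l1 q (%j. w1 j - w2 j)*M)*exp (A + 1)"
proof -
 obtain r where r: "0 < r" "!!y y'. y : C ==> norm (y' - y) <= r ==> y' : Om"
  "!!j y y'. j < q ==> y : C ==> norm (y' - y) <= r ==> norm (Y j y' - Y j y) <= (A + 1)*norm (y' - y)"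
  by (rule C1_family_lipschitz_tube[where Y=Y and q=q and A=A, OF open_Om C C1 A]) auto
 show ?thesis
 proof (rule that[OF r(1)])
  fix w1 w2 ga1 ga2 and t :: real
  assume s1: "solves Om (lc q Y w1) ga1" and s2: "solves Om (lc q Y w2) ga2" and sub: "ga1 ` {0..1} \<subseteq> C"
   and w2: "l1 q w2 <= 1" and sm: "(norm (ga1 0 - ga2 0) + l1 q (%j. w1 j - w2 j)*M)*exp (A + 1) < r" and t: "t : {0..1}"
  let ?b = "l1 q (%j. w1 j - w2 j)*M"
  have b0: "0 <= ?b" using M0 l1_nonneg[of q] by simp
  have "norm (ga1 t - ga2 t) <= (norm (ga1 0 - ga2 0) + ?b)*exp ((A + 1)*t)"
  proof (rule integral_curves_close[where r = r])
   fix s :: real assume s: "s : {0..1}" "norm (ga1 s - ga2 s) <= r"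
   have sC: "ga1 s : C" using s sub by auto
   have 1: "norm (lc q Y w2 (ga1 s) - lc q Y w2 (ga2 s)) <= l1 q w2*((A + 1)*norm (ga1 s - ga2 s))"
    using r(3)[of _ "ga1 s" "ga2 s"] s sC by (intro lc_lipschitz) (auto simp: norm_minus_commute)
   have 2: "l1 q w2*((A + 1)*norm (ga1 s - ga2 s)) <= 1*((A + 1)*norm (ga1 s - ga2 s))"
    using w2 A0 by (intro mult_right_mono) auto
   have 3: "norm (lc q Y w1 (ga1 s) - lc q Y w2 (ga1 s)) <= ?b"
    unfolding lc_diff using M sC by (intro lc_norm_le) auto
   have "norm (lc q Y w1 (ga1 s) - lc q Y w2 (ga2 s)) <= norm (lc q Y w1 (ga1 s) - lc q Y w2 (ga1 s)) + norm (lc q Y w2 (ga1 s) - lc q Y w2 (ga2 s))"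
    using norm_triangle_ineq[of "lc q Y w1 (ga1 s) - lc q Y w2 (ga1 s)" "lc q Y w2 (ga1 s) - lc q Y w2 (ga2 s)"] by simp
   then show "norm (lc q Y w1 (ga1 s) - lc q Y w2 (ga2 s)) <= (A + 1)*norm (ga1 s - ga2 s) + ?b"
    using 1 2 3 by linarith
  qed (use solves_integral[OF s1] solves_integral[OF s2] A0 b0 sm t in auto)
  also have "... <= (norm (ga1 0 - ga2 0) + ?b)*exp (A + 1)"
   using t A0 b0 by (intro mult_left_mono) (auto simp: mult_left_le)
  finally show "norm (ga1 t - ga2 t) <= (norm (ga1 0 - ga2 0) + ?b)*exp (A + 1)" .
 qed
qed

lemma solves_lc_cpath:
 assumes "solves Om (lc q Y w) ga" shows "cpath Om Y q (ga 0) (%j s. w j) ga"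
 using assms solves_integral[OF assms] by (auto simp: cpath_def solves_def)

lemma solves_unique:
 assumes "solves Om (lc q Y w) ga" "solves Om (lc q Y w) ga'" "ga 0 = ga' 0" "t : {0..1}"
 shows "ga t = ga' t"
proof -
 have "is_ctrl q (l2 q w) (%j s. w j)" by (auto simp: is_ctrl_def)
 moreover have "cpath Om Y q (ga 0) (%j s. w j) ga'" using solves_lc_cpath[OF assms(2)] assms(3) by simp
 ultimately show ?thesis by (intro cpath_unique[OF solves_lc_cpath[OF assms(1)] _ _ assms(4)])
qed

lemma flow_eq:
 assumes "solves Om (lc q Y w) ga" shows "flow Om (lc q Y w) (ga 0) = ga 1"
 unfolding flow_def
proof (rule some_equality)
 show "EX ga'. solves Om (lc q Y w) ga' & ga' 0 = ga 0 & ga' 1 = ga 1" using assms by blast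
 show "z = ga 1" if "EX ga'. solves Om (lc q Y w) ga' & ga' 0 = ga 0 & ga' 1 = z" for z
 proof -
  from that obtain ga' where g: "solves Om (lc q Y w) ga'" "ga 0 = ga' 0" "ga' 1 = z" by auto
  then show ?thesis using solves_unique[OF assms g(1,2), of 1] by simp
 qed
qed

text \<open>Running from time \<open>a\<close> to time \<open>b\<close> multiplies the field by
  \<open>b - a\<close>. The case \<open>b < a\<close> is allowed and gives the backward
  flow.\<close>

lemma solves_affine:
 assumes s: "solves Om (lc q Y w) ga" and ab: "a : {0..1}" "b : {0..1}"
 shows "solves Om (lc q Y (%j. (b - a)*w j)) (%t. ga (a + (b - a)*t))"
 unfolding solves_def
proof (intro ballI conjI)
 fix t :: real assume t: "t : {0..1}"
 have in01: "a + (b - a)*t : {0..1}" if "t : {0..1}" for t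
 proof -
  have "a + (b - a)*t = (1 - t)*a + t*b" by (simp add: algebra_simps)
  moreover have "0 <= (1 - t)*a" "0 <= t*b" using ab that by (auto intro!: mult_nonneg_nonneg)
  moreover have "(1 - t)*a <= 1 - t" using mult_left_mono[of a 1 "1 - t"] ab that by simp
  moreover have "t*b <= t" using mult_left_mono[of b 1 t] ab that by simp
  ultimately have "0 <= a + (b - a)*t" "a + (b - a)*t <= 1" by linarith+
  then show ?thesis by simp
 qed
 then show "ga (a + (b - a)*t) : Om" using s t by (auto simp: solves_def)
 have "((ga \<circ> (%t. a + (b - a)*t)) has_vector_derivative (b - a) *\<^sub>R lc q Y w (ga (a + (b - a)*t))) (at t within {0..1})"
 proof (rule vector_diff_chain_within)
  show "((%t. a + (b - a)*t) has_vector_derivative (b - a)) (at t within {0..1})"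
   by (auto intro!: derivative_eq_intros simp: has_real_derivative_iff_has_vector_derivative[symmetric])
  have "(ga has_vector_derivative lc q Y w (ga (a + (b - a)*t))) (at (a + (b - a)*t) within {0..1})"
   using s in01[OF t] by (auto simp: solves_def)
  then show "(ga has_vector_derivative lc q Y w (ga (a + (b - a)*t))) (at (a + (b - a)*t) within (%t. a + (b - a)*t) ` {0..1})"
   by (rule has_vector_derivative_within_subset) (use in01 in auto)
 qed
 then show "((%t. ga (a + (b - a)*t)) has_vector_derivative lc q Y (%j. (b - a)*w j) (ga (a + (b - a)*t))) (at t within {0..1})"
  by (simp add: comp_def lc_scale)
qed

lemma flow_between:
 assumes "solves Om (lc q Y w) ga" "a : {0..1}" "b : {0..1}"
 shows "flow Om (lc q Y (%j. (b - a)*w j)) (ga a) = ga b"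
 using flow_eq[OF solves_affine[OF assms]] by simp

end

locale cbase = cfields +
 fixes x :: "real^'n"
 assumes ex_path: "!!a L. L < 1 ==> is_ctrl q L a ==> EX ga. cpath Om Y q x a ga"
begin

abbreviation "RR \<equiv> reach Om Y q x"

lemma RR_sub: "RR L \<subseteq> Om" unfolding reach_def cpath_def by auto

lemma base_in_RR: "0 <= L ==> x : RR L"
proof -
 assume "0 <= L"
 have c: "is_ctrl q 0 (%j s. 0)" by (auto simp: is_ctrl_def l2_def)
 obtain ga where p: "cpath Om Y q x (%j s. 0) ga" using ex_path[OF _ c] by auto
 then have "ga 0 = x" using integral_curve_continuous(2)[of "%s. lc q Y (%j. 0) (ga s)" ga x] by (auto simp: cpath_def)
 then have "x : RR 0" using cpath_in_reach[OF p c, of 0] by simp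
 then show ?thesis by (rule subsetD[OF reach_mono[OF \<open>0 <= L\<close>]])
qed

text \<open>Existence of flow lines is drawn from the control hypothesis: the control that leads to
  \<open>y\<close> is followed by the constant control \<open>w\<close>, both sped up so as to fit
  together into [0,1]. This also keeps the flow line inside the slightly larger reachable set
  \<open>RR L'\<close>.\<close>

lemma extend_flow:
 assumes y: "y : RR L" and L: "0 <= L" "L + l2 q w < L'" "L' < 1"
 obtains ga where "solves Om (lc q Y w) ga" "ga 0 = y" "!!t. t : {0..1} ==> ga t : RR L'"
proof -
 obtain ga a where a: "is_ctrl q L a" and p: "cpath Om Y q x a ga" and y1: "ga 1 = y" using y by (auto simp: reach_def)
 \<comment> \<open>Chosen so that \<open>th*L'\<close> is the midpoint of \<open>L\<close> and
   \<open>L' - l2 q w\<close>; then both sped-up pieces obey the bound \<open>L'\<close>.\<close>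
 define th where "th = (L + L' - l2 q w)/(2*L')"
 have w0: "0 <= l2 q w" by (rule l2_nonneg)
 have L'0: "0 < L'" using L w0 by linarith
 have th: "0 < th" "th < 1" using L w0 L'0 by (auto simp: th_def field_simps)
 have "th*L' = (L + L' - l2 q w)/2" using L'0 by (simp add: th_def)
 then have th1: "L <= th*L'" and th2: "l2 q w <= (1 - th)*L'" using L w0 by (auto simp: left_diff_distrib)
 define b where "b j s = (if s <= th then (1/th)*a j (s/th) else (1/(1-th))*w j)" for j s
 have bc: "is_ctrl q L' b" unfolding is_ctrl_def
 proof (intro conjI allI impI)
  fix j assume "j < q"
  then have [measurable]: "a j : borel_measurable borel" using a by (auto simp: is_ctrl_def)
  show "b j : borel_measurable borel" unfolding b_def[abs_def] by measurable
 next
  fix s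
  show "l2 q (%j. b j s) <= L'"
  proof (cases "s <= th")
   case True
   have "l2 q (%j. a j (s/th)) <= L" using a by (auto simp: is_ctrl_def)
   then have "(1/th)*l2 q (%j. a j (s/th)) <= L'" using th1 th by (simp add: field_simps)
   moreover have "l2 q (%j. (1/th)*a j (s/th)) = (1/th)*l2 q (%j. a j (s/th))" using th by (subst l2_scale) auto
   ultimately show ?thesis using True by (simp add: b_def)
  next
   case False
   have "(1/(1-th))*l2 q w <= L'" using th2 th by (simp add: field_simps)
   moreover have "l2 q (%j. (1/(1-th))*w j) = (1/(1-th))*l2 q w" using th by (subst l2_scale) auto
   ultimately show ?thesis using False by (simp add: b_def)
  qed
 qed
 obtain \<Gamma> where \<Gamma>: "cpath Om Y q x b \<Gamma>" using ex_path[OF L(3) bc] by auto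
 have "cpath Om Y q x (%j s. th*b j (th * s)) (%s. \<Gamma> (th * s))" using \<Gamma> th by (intro cpath_rescale) auto
 then have "cpath Om Y q x a (%s. \<Gamma> (th * s))"
  by (rule cpath_cong[rotated]) (use th in \<open>auto simp: b_def mult_left_le\<close>)
 \<comment> \<open>Uniqueness shows that the concatenated path is at \<open>y\<close> at time
   \<open>th\<close>, whichever path the hypothesis supplies.\<close>
 from cpath_unique[OF p this a, of 1] have Gth: "\<Gamma> th = y" using y1 by simp
 define gan where "gan t = \<Gamma> (th + (1 - th)*t)" for t
 have in01: "th + (1 - th)*t : {0..1}" "th <= th + (1 - th)*t" if "t : {0..1}" for t
 proof -
  have "0 <= (1 - th)*t" using that th by (intro mult_nonneg_nonneg) auto
  moreover have "(1 - th)*t <= 1 - th" using mult_left_mono[of t 1 "1 - th"] that th by simp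
  ultimately have "0 <= th + (1 - th)*t" "th + (1 - th)*t <= 1" "th <= th + (1 - th)*t"
   using th by linarith+
  then show "th + (1 - th)*t : {0..1}" "th <= th + (1 - th)*t" by auto
 qed
 have \<Gamma>I: "((%s. lc q Y (%j. b j s) (\<Gamma> s)) has_integral (\<Gamma> t - x)) {0..t}" if "t : {0..1}" for t
  using \<Gamma> that by (auto simp: cpath_def)
 have int: "((%s. lc q Y w (gan s)) has_integral (gan t - y)) {0..t}" if t: "t : {0..1}" for t
 proof -
  have "((%s. lc q Y (%j. b j s) (\<Gamma> s)) has_integral (\<Gamma> (th + (1 - th)*t) - \<Gamma> th)) {th..th + (1 - th)*t}"
   by (rule has_integral_subinterval[OF \<Gamma>I]) (use th in01[OF t] in auto)
  then have "((%s. lc q Y (%j. (1/(1-th))*w j) (\<Gamma> s)) has_integral (gan t - y)) {th..th + (1 - th)*t}"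
   unfolding gan_def Gth by (rule has_integral_spike_finite[of "{th}", rotated 2]) (auto simp: b_def)
  then have "((%s. lc q Y (%j. (1/(1-th))*w j) (\<Gamma> s)) has_integral (gan t - y)) {(1-th)*0 + th..(1-th)*t + th}"
   by (simp add: add.commute)
  from has_integral_rescale[OF this] show ?thesis using th unfolding lc_scale by (simp add: gan_def add.commute)
 qed
 have ganOm: "gan t : Om" if "t : {0..1}" for t using \<Gamma> in01[OF that] by (auto simp: gan_def cpath_def)
 have cn: "continuous_on {0..1} gan" and n0: "gan 0 = y" using integral_curve_continuous[OF int] by auto
 have cY: "continuous_on Om (Y j)" if "j < q" for j using C1[OF that] by (rule C1_on_continuous)
 \<comment> \<open>Under the constant control the integrand is continuous, so the integral equation
   upgrades to a differential equation.\<close>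
 have cW: "continuous_on {0..1} (%s. lc q Y w (gan s))" unfolding lc_def
  by (intro continuous_intros continuous_on_compose2[OF cY cn]) (use ganOm in auto)
 have "solves Om (lc q Y w) gan" unfolding solves_def
 proof (intro ballI conjI ganOm)
  fix t :: real assume t: "t : {0..1}"
  have "((%u. y + integral {0..u} (%s. lc q Y w (gan s))) has_vector_derivative (0 + lc q Y w (gan t))) (at t within {0..1})"
   by (intro has_vector_derivative_add has_vector_derivative_const integral_has_vector_derivative cW t)
  then show "(gan has_vector_derivative lc q Y w (gan t)) (at t within {0..1})"
   unfolding add_0
  proof (rule has_vector_derivative_transform[rotated 2])
   show "gan s = y + integral {0..s} (%s. lc q Y w (gan s))" if "s : {0..1}" for s
    using integral_unique[OF int[OF that]] by simp
  qed (rule t)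
 qed
 moreover have "gan t : RR L'" if "t : {0..1}" for t
  using cpath_in_reach[OF \<Gamma> bc in01(1)[OF that]] by (simp add: gan_def)
 ultimately show ?thesis using n0 that by blast
qed

end

section \<open>Transport of the fields along flows\<close>

locale cgeom = cbase Om Y q x for Om :: "(real^'n) set" and Y q x +
 fixes A :: real and Q :: nat and c :: "nat => nat => nat => real^'n => real"
 assumes A1: "1 <= A" and qQ: "q <= Q" and Q1: "1 <= Q"
  and DY_bound: "!!L j y v. L < 1 ==> y : RR L ==> j < q ==> norm (frechet_derivative (Y j) (at y) v) <= A*norm v"
  and bracket: "!!L i j y. L < 1 ==> y : RR L ==> i < q ==> j < q ==> lie_bracket (Y i) (Y j) y = (\<Sum>k<q. c i j k y *\<^sub>R Y k y)"
  and c_bound: "!!L i j k y. L < 1 ==> y : RR L ==> i < q ==> j < q ==> k < q ==> \<bar>c i j k y\<bar> <= A"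
  and c_cont: "!!L i j k. L < 1 ==> i < q ==> j < q ==> k < q ==> continuous_on (RR L) (c i j k)"
begin

definition DW :: "(nat => real) => real^'n => real^'n => real^'n" where
 "DW w y v = (\<Sum>j<q. w j *\<^sub>R frechet_derivative (Y j) (at y) v)"

text \<open>The matrix of the bracket with W = sum of w_j Y_j: [W, Y_l] is the sum over k of
  \<open>CM w k l\<close> times Y_k.\<close>

definition CM :: "(nat => real) => nat => nat => real^'n => real" where
 "CM w k l y = (\<Sum>j<q. w j*c j l k y)"

lemma linear_DY: "y : Om ==> j < q ==> linear (frechet_derivative (Y j) (at y))"
 using C1_on_derivative[OF C1] has_derivative_linear by blast

lemma DW_bound: "L < 1 ==> y : RR L ==> norm (DW w y v) <= l1 q w*A*norm v"
proof -
 assume y: "L < 1" "y : RR L"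
 have "norm (DW w y v) <= (\<Sum>j<q. norm (w j *\<^sub>R frechet_derivative (Y j) (at y) v))" unfolding DW_def by (rule norm_sum)
 also have "... <= (\<Sum>j<q. \<bar>w j\<bar>*(A*norm v))" using DY_bound[OF y] by (intro sum_mono) (auto intro!: mult_left_mono)
 finally show ?thesis by (simp add: l1_def sum_distrib_right mult.assoc)
qed

lemma CM_sum_bound: "L < 1 ==> y : RR L ==> k < q ==> (\<Sum>l<q. \<bar>CM w k l y\<bar>) <= real q*(A*l1 q w)"
proof -
 assume y: "L < 1" "y : RR L" "k < q"
 have "\<bar>CM w k l y\<bar> <= A*l1 q w" if "l < q" for l
 proof -
  have "\<bar>CM w k l y\<bar> <= (\<Sum>j<q. \<bar>w j*c j l k y\<bar>)" unfolding CM_def by (rule sum_abs)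
  also have "... <= (\<Sum>j<q. \<bar>w j\<bar>*A)" using c_bound[OF y(1,2) _ that y(3)] by (intro sum_mono) (auto simp: abs_mult intro!: mult_left_mono)
  finally show ?thesis by (simp add: l1_def sum_distrib_left mult.commute)
 qed
 then show ?thesis using sum_bounded_above[of "{..<q}" "%l. \<bar>CM w k l y\<bar>" "A*l1 q w"] by simp
qed

text \<open>Moving \<open>Y\<^sub>l\<close> along the flow of \<open>W = \<Sum>\<^sub>j w\<^sub>j Y\<^sub>j\<close> costs the bracket \<open>[W, Y\<^sub>l]\<close>, which is
  again a combination of the \<open>Y\<^sub>k\<close>; the equation for the coefficients \<open>ta\<close> absorbs it.\<close>

lemma transport_derivative:
 assumes s: "solves Om (lc q Y w) ga" and R: "!!t. t : {0..1} ==> ga t : RR L" and L: "L < 1"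
  and ta: "!!l s. l < q ==> s : {0..1} ==> (ta l has_real_derivative (f l - (\<Sum>m<q. CM w l m (ga s)*ta m s))) (at s within {0..1})"
  and t: "t : {0..1}"
 shows "((%s. lc q Y (%l. ta l s) (ga s)) has_vector_derivative (DW w (ga t) (lc q Y (%l. ta l t) (ga t)) + lc q Y f (ga t))) (at t within {0..1})"
proof -
 let ?y = "ga t" and ?D = "%l. frechet_derivative (Y l) (at (ga t))"
 have yOm: "?y : Om" using s t by (auto simp: solves_def)
 have dY: "((%s. Y l (ga s)) has_vector_derivative ?D l (lc q Y w ?y)) (at t within {0..1})" if "l < q" for l
 proof -
  have "(ga has_vector_derivative lc q Y w ?y) (at t within {0..1})" using s t by (auto simp: solves_def)
  moreover have "(Y l has_derivative ?D l) (at ?y within ga ` {0..1})"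
   using C1_on_derivative[OF C1[OF that] yOm] by (rule has_derivative_at_withinI)
  ultimately have "((Y l \<circ> ga) has_vector_derivative ?D l (lc q Y w ?y)) (at t within {0..1})"
   by (rule vector_derivative_diff_chain_within)
  then show ?thesis by (simp add: comp_def)
 qed
 have d: "((%s. \<Sum>l<q. ta l s *\<^sub>R Y l (ga s)) has_vector_derivative
   (\<Sum>l<q. ta l t *\<^sub>R ?D l (lc q Y w ?y) + (f l - (\<Sum>m<q. CM w l m ?y*ta m t)) *\<^sub>R Y l ?y)) (at t within {0..1})"
  by (intro has_vector_derivative_sum has_vector_derivative_scaleR ta dY t) auto
 \<comment> \<open>The bracket exchanges the two roles: the derivative of Y_l along W equals
   [W, Y_l], a combination of the fields, plus the derivative of W along Y_l.\<close>
 have DlW: "?D l (lc q Y w ?y) = (\<Sum>k<q. CM w k l ?y *\<^sub>R Y k ?y) + DW w ?y (Y l ?y)" if l: "l < q" for l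
 proof -
  interpret lin: linear "?D l" by (rule linear_DY[OF yOm l])
  have "?D l (lc q Y w ?y) = (\<Sum>j<q. w j *\<^sub>R ?D l (Y j ?y))" by (simp add: lc_def lin.sum lin.scale)
  also have "... = (\<Sum>j<q. w j *\<^sub>R ((\<Sum>k<q. c j l k ?y *\<^sub>R Y k ?y) + ?D j (Y l ?y)))"
  proof (intro sum.cong refl arg_cong[where f = "scaleR _"])
   fix j assume "j : {..<q}"
   then have "lie_bracket (Y j) (Y l) ?y = (\<Sum>k<q. c j l k ?y *\<^sub>R Y k ?y)" using bracket[OF L R[OF t]] l by auto
   then show "?D l (Y j ?y) = (\<Sum>k<q. c j l k ?y *\<^sub>R Y k ?y) + ?D j (Y l ?y)" by (simp add: lie_bracket_def algebra_simps)
  qed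
  also have "... = (\<Sum>j<q. \<Sum>k<q. (w j*c j l k ?y) *\<^sub>R Y k ?y) + DW w ?y (Y l ?y)"
   by (simp add: scaleR_add_right sum.distrib scaleR_sum_right DW_def)
  also have "(\<Sum>j<q. \<Sum>k<q. (w j*c j l k ?y) *\<^sub>R Y k ?y) = (\<Sum>k<q. \<Sum>j<q. (w j*c j l k ?y) *\<^sub>R Y k ?y)" by (rule sum.swap)
  also have "... = (\<Sum>k<q. CM w k l ?y *\<^sub>R Y k ?y)" by (simp add: CM_def scaleR_sum_left)
  finally show ?thesis .
 qed
 have DWlin: "DW w ?y (lc q Y (%l. ta l t) ?y) = (\<Sum>l<q. ta l t *\<^sub>R DW w ?y (Y l ?y))"
 proof -
  have "frechet_derivative (Y j) (at ?y) (lc q Y (%l. ta l t) ?y) = (\<Sum>l<q. ta l t *\<^sub>R frechet_derivative (Y j) (at ?y) (Y l ?y))" if "j < q" for j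
  proof -
   interpret lin: linear "?D j" by (rule linear_DY[OF yOm that])
   show ?thesis by (simp add: lc_def lin.sum lin.scale)
  qed
  then have "DW w ?y (lc q Y (%l. ta l t) ?y) = (\<Sum>j<q. \<Sum>l<q. ta l t *\<^sub>R w j *\<^sub>R ?D j (Y l ?y))"
   by (simp add: DW_def scaleR_sum_right mult.commute)
  also have "... = (\<Sum>l<q. \<Sum>j<q. ta l t *\<^sub>R w j *\<^sub>R ?D j (Y l ?y))" by (rule sum.swap)
  finally show ?thesis by (simp add: DW_def scaleR_sum_right)
 qed
 have "(\<Sum>l<q. ta l t *\<^sub>R ?D l (lc q Y w ?y) + (f l - (\<Sum>m<q. CM w l m ?y*ta m t)) *\<^sub>R Y l ?y)
   = (\<Sum>l<q. ta l t *\<^sub>R (\<Sum>k<q. CM w k l ?y *\<^sub>R Y k ?y)) + (\<Sum>l<q. ta l t *\<^sub>R DW w ?y (Y l ?y))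
    + (\<Sum>l<q. f l *\<^sub>R Y l ?y) - (\<Sum>l<q. (\<Sum>m<q. CM w l m ?y*ta m t) *\<^sub>R Y l ?y)"
  by (simp add: DlW scaleR_add_right sum.distrib scaleR_left_diff_distrib sum_subtractf)
 also have "(\<Sum>l<q. ta l t *\<^sub>R (\<Sum>k<q. CM w k l ?y *\<^sub>R Y k ?y)) = (\<Sum>l<q. (\<Sum>m<q. CM w l m ?y*ta m t) *\<^sub>R Y l ?y)"
 proof -
  have "(\<Sum>l<q. ta l t *\<^sub>R (\<Sum>k<q. CM w k l ?y *\<^sub>R Y k ?y)) = (\<Sum>l<q. \<Sum>k<q. (CM w k l ?y*ta l t) *\<^sub>R Y k ?y)"
   by (simp add: scaleR_sum_right mult.commute)
  also have "... = (\<Sum>k<q. \<Sum>l<q. (CM w k l ?y*ta l t) *\<^sub>R Y k ?y)" by (rule sum.swap)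
  finally show ?thesis by (simp add: scaleR_sum_left)
 qed
 finally show ?thesis using d DWlin unfolding lc_def by simp
qed

text \<open>Q^2*A*\<omega> bounds q times the row sums of \<open>CM\<close>, so \<mu> <= 1/2 is the
  contraction condition of \<open>linear_ode_exists\<close>. The coefficients end within 2*\<mu>*(T
  + F) of their initial value plus the forcing \<open>f\<close>.\<close>

lemma transport_exists:
 assumes s: "solves Om (lc q Y w) ga" and R: "!!t. t : {0..1} ==> ga t : RR L" and L: "L < 1"
  and w: "l1 q w <= \<omega>" and \<mu>: "(real Q)\<^sup>2*A * \<omega> <= \<mu>" "\<mu> <= 1/2"
  and T: "!!l. l < q ==> \<bar>ta0 l\<bar> <= T" and F: "!!l. l < q ==> \<bar>f l\<bar> <= F" and TF: "0 <= T" "0 <= F"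
 obtains ta where "!!l. l < q ==> ta l 0 = ta0 l"
  "!!l s. l < q ==> s : {0..1} ==> (ta l has_real_derivative (f l - (\<Sum>m<q. CM w l m (ga s)*ta m s))) (at s within {0..1})"
  "!!l. l < q ==> \<bar>ta l 1 - ta0 l - f l\<bar> <= 2 * \<mu>*(T + F)"
proof -
 have cg: "continuous_on {0..1} ga" by (rule solves_continuous[OF s])
 have cC: "continuous_on {0..1} (%s. CM w l m (ga s))" if "l < q" "m < q" for l m
  unfolding CM_def using that
  by (intro continuous_intros continuous_on_compose2[OF c_cont[OF L] cg]) (use R in auto)
 let ?c0 = "real q*(A*l1 q w)"
 have w0: "0 <= l1 q w" by (rule l1_nonneg)
 have q2: "real q*?c0 <= \<mu>"
 proof -
  have "real q*real q <= real Q*real Q" using qQ by (intro mult_mono) auto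
  then have "(real q*real q)*(A*l1 q w) <= (real Q*real Q)*(A * \<omega>)"
   using A1 w w0 by (intro mult_mono[OF _ mult_left_mono]) auto
  then show ?thesis using \<mu> by (simp add: power2_eq_square mult_ac)
 qed
 obtain ta where ta: "!!l. l < q ==> ta l 0 = ta0 l"
  "!!l s. l < q ==> s : {0..1} ==> (ta l has_real_derivative (f l - (\<Sum>m<q. CM w l m (ga s)*ta m s))) (at s within {0..1})"
  "!!l s. l < q ==> s : {0..1} ==> \<bar>ta l s - ta0 l - s*f l\<bar> <= 2*(real q*?c0)*(T + F)"
 proof (rule linear_ode_exists[where C = "%l m s. CM w l m (ga s)" and q = q and ?c0.0 = ?c0 and ?ta0.0 = ta0 and f = f and T = T and F = F])
  show "0 <= ?c0" using A1 w0 by simp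
  show "real q*?c0 <= 1/2" using q2 \<mu> by linarith
 qed (use cC CM_sum_bound[OF L R] T F TF in auto)
 show ?thesis
 proof (rule that[OF ta(1,2)])
  fix l assume "l < q"
  then have "\<bar>ta l 1 - ta0 l - f l\<bar> <= 2*(real q*?c0)*(T + F)" using ta(3)[of l 1] by simp
  also have "... <= 2 * \<mu>*(T + F)" using q2 TF by (intro mult_right_mono) auto
  finally show "\<bar>ta l 1 - ta0 l - f l\<bar> <= 2 * \<mu>*(T + F)" .
 qed auto
qed

text \<open>Without forcing, the transported combination v solves the variational equation v' = DW
  v, so its norm changes by a factor of at most exp (A*\<omega>). In particular a linear relation
  between the fields at one end is carried to a linear relation at the other.\<close>

lemma transport_norm:
 assumes s: "solves Om (lc q Y w) ga" and R: "!!t. t : {0..1} ==> ga t : RR L" and L: "L < 1" and w: "l1 q w <= \<omega>"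
  and ta: "!!l s. l < q ==> s : {0..1} ==> (ta l has_real_derivative (0 - (\<Sum>m<q. CM w l m (ga s)*ta m s))) (at s within {0..1})"
 shows "norm (lc q Y (%l. ta l 1) (ga 1)) <= exp (A * \<omega>)*norm (lc q Y (%l. ta l 0) (ga 0))"
  and "norm (lc q Y (%l. ta l 0) (ga 0)) <= exp (A * \<omega>)*norm (lc q Y (%l. ta l 1) (ga 1))"
proof -
 define v where "v s = lc q Y (%l. ta l s) (ga s)" for s
 have d: "(v has_vector_derivative DW w (ga t) (v t)) (at t within {0..1})" if "t : {0..1}" for t
  using transport_derivative[where f = "%_. 0", OF s R L ta that] by (simp add: v_def[abs_def] lc_def)
 have b: "norm (DW w (ga t) (v t)) <= A * \<omega>*norm (v t) + 0" if "t : {0..1}" for t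
 proof -
  have "l1 q w*A*norm (v t) <= \<omega>*A*norm (v t)" using w A1 by (intro mult_right_mono) auto
  then show ?thesis using DW_bound[OF L R[OF that], of w "v t"] by (simp add: mult_ac)
 qed
 have \<omega>0: "0 <= A * \<omega>" using A1 w l1_nonneg[of q w] by simp
 have "norm (v 1) <= (norm (v 0) + 0)*exp (A * \<omega>*1)" using gronwall_derivative[OF d b \<omega>0, of 1] by simp
 then show "norm (lc q Y (%l. ta l 1) (ga 1)) <= exp (A * \<omega>)*norm (lc q Y (%l. ta l 0) (ga 0))" by (simp add: v_def mult.commute)
 \<comment> \<open>The second estimate is the same argument in reversed time.\<close>
 have d': "((%t. v (1 - t)) has_vector_derivative - DW w (ga (1 - t)) (v (1 - t))) (at t within {0..1})" if "t : {0..1}" for t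
 proof -
  have "((v \<circ> (%t. 1 - t)) has_vector_derivative (-1) *\<^sub>R DW w (ga (1 - t)) (v (1 - t))) (at t within {0..1})"
  proof (rule vector_diff_chain_within)
   show "((%t. 1 - t) has_vector_derivative - 1) (at t within {0..1})"
    by (auto intro!: derivative_eq_intros simp: has_real_derivative_iff_has_vector_derivative[symmetric])
   have "(%t. 1 - t) ` {0..1} = {0..1::real}" by (auto simp: image_iff intro!: bexI[of _ "1 - _"])
   then show "(v has_vector_derivative DW w (ga (1 - t)) (v (1 - t))) (at (1 - t) within (%t. 1 - t) ` {0..1})"
    using d[of "1 - t"] that by simp
  qed
  then show ?thesis by (simp add: comp_def)
 qed
 have "norm (v (1 - 1)) <= (norm (v (1 - 0)) + 0)*exp (A * \<omega>*1)"
  by (rule gronwall_derivative[OF d' _ \<omega>0]) (use b in auto)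
 then show "norm (lc q Y (%l. ta l 0) (ga 0)) <= exp (A * \<omega>)*norm (lc q Y (%l. ta l 1) (ga 1))" by (simp add: v_def mult.commute)
qed

lemma linear_DW: "y : Om ==> linear (DW w y)"
 unfolding DW_def
 by (intro linear_compose_sum linear_compose_scale_right ballI linear_DY) auto

lemma lc_remainder:
 assumes "!!j. j < q ==> norm (Y j y' - Y j y - frechet_derivative (Y j) (at y) (y' - y)) <= R"
 shows "norm (lc q Y w y' - lc q Y w y - DW w y (y' - y)) <= l1 q w * R"
proof -
 have "lc q Y w y' - lc q Y w y - DW w y (y' - y) = lc q (%j _. Y j y' - Y j y - frechet_derivative (Y j) (at y) (y' - y)) w y"
  by (simp add: lc_def DW_def scaleR_diff_right sum_subtractf)
 then show ?thesis using lc_norm_le[of q "%j _. Y j y' - Y j y - frechet_derivative (Y j) (at y) (y' - y)" y R w] assms by simp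
qed

end

section \<open>Compositions of flows as parametrisations\<close>

locale cgeomI = cgeom Om Y q x A Q c for Om :: "(real^'n) set" and Y q x A Q c +
 fixes I :: "'n set" and ph :: "'n => nat"
 assumes phq: "!!i. i : I ==> ph i < q"
begin

text \<open>Coefficients, with respect to the whole list of fields, of the sum over \<open>P\<close>
  of h_i times the field with index \<open>ph i\<close>. A sum is taken since \<open>ph\<close> is
  not assumed injective.\<close>

definition iot :: "'n set => real^'n => nat => real" where
 "iot P h j = (\<Sum>i\<in>P. if ph i = j then h $ i else 0)"

definition S1 :: "'n set => real^'n => real" where "S1 P u = (\<Sum>i\<in>P. \<bar>u $ i\<bar>)"

lemma CARD1: "1 <= real CARD('n)" using zero_less_card_finite[where 'a='n] by linarith

lemma S1_nonneg: "0 <= S1 P u" by (simp add: S1_def sum_nonneg)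

lemma S1_le: "S1 P u <= real CARD('n)*norm u"
proof -
 have "S1 P u <= (\<Sum>i\<in>P. norm u)" unfolding S1_def by (intro sum_mono component_le_norm_cart)
 also have "... <= real CARD('n)*norm u" using card_mono[of UNIV P] by (auto intro!: mult_right_mono)
 finally show ?thesis .
qed

lemma S1_Un: "P \<inter> P' = {} ==> S1 (P \<union> P') u = S1 P u + S1 P' u"
 unfolding S1_def by (rule sum.union_disjoint) auto

lemma iot_Un: "P \<inter> P' = {} ==> iot (P \<union> P') h j = iot P h j + iot P' h j"
 unfolding iot_def by (rule sum.union_disjoint) auto

lemma iot_lc: "P \<subseteq> I ==> lc q Y (iot P h) y = (\<Sum>i\<in>P. h $ i *\<^sub>R Y (ph i) y)"
proof -
 assume P: "P \<subseteq> I"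
 have "lc q Y (iot P h) y = (\<Sum>j<q. \<Sum>i\<in>P. (if ph i = j then h $ i else 0) *\<^sub>R Y j y)"
  by (simp add: lc_def iot_def scaleR_sum_left)
 also have "... = (\<Sum>i\<in>P. \<Sum>j<q. (if ph i = j then h $ i else 0) *\<^sub>R Y j y)" by (rule sum.swap)
 also have "... = (\<Sum>i\<in>P. h $ i *\<^sub>R Y (ph i) y)"
 proof (intro sum.cong refl)
  fix i assume "i : P"
  then have "ph i < q" using P phq by auto
  have "(\<Sum>j<q. (if ph i = j then h $ i else 0) *\<^sub>R Y j y) = (\<Sum>j<q. if ph i = j then h $ i *\<^sub>R Y j y else 0)"
   by (intro sum.cong) auto
  then show "(\<Sum>j<q. (if ph i = j then h $ i else 0) *\<^sub>R Y j y) = h $ i *\<^sub>R Y (ph i) y" using \<open>ph i < q\<close> by simp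
 qed
 finally show ?thesis .
qed

lemma l1_iot: "P \<subseteq> I ==> l1 q (iot P h) <= S1 P h"
proof -
 assume P: "P \<subseteq> I"
 have "l1 q (iot P h) <= (\<Sum>j<q. \<Sum>i\<in>P. if ph i = j then \<bar>h $ i\<bar> else 0)"
  unfolding l1_def iot_def by (intro sum_mono order_trans[OF sum_abs]) (auto intro!: sum_mono)
 also have "... = (\<Sum>i\<in>P. \<Sum>j<q. if ph i = j then \<bar>h $ i\<bar> else 0)" by (rule sum.swap)
 also have "... <= (\<Sum>i\<in>P. \<bar>h $ i\<bar>)" by (intro sum_mono) (auto simp: sum.delta)
 finally show ?thesis by (simp add: S1_def)
qed

lemma iot_diff: "iot P (h - h') j = iot P h j - iot P h' j"
 unfolding iot_def sum_subtractf[symmetric] by (intro sum.cong) auto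

lemma iot_axis: "iot P h j = (\<Sum>i\<in>UNIV. h $ i*iot P (axis i 1) j)"
proof -
 have "iot P h j = (\<Sum>i'\<in>P. \<Sum>i\<in>UNIV. if i = i' then (if ph i' = j then h $ i else 0) else 0)" by (simp add: iot_def)
 also have "... = (\<Sum>i\<in>UNIV. \<Sum>i'\<in>P. if i = i' then (if ph i' = j then h $ i else 0) else 0)" by (rule sum.swap)
 also have "... = (\<Sum>i\<in>UNIV. h $ i*iot P (axis i 1) j)"
  unfolding iot_def sum_distrib_left by (intro sum.cong refl) (auto simp: axis_def)
 finally show ?thesis .
qed

lemma iot_axis_le: "\<bar>iot P (axis i 1) j\<bar> <= 1"
proof -
 have "\<bar>iot P (axis i 1) j\<bar> <= (\<Sum>i'\<in>P. \<bar>if ph i' = j then axis i (1::real) $ i' else 0\<bar>)" unfolding iot_def by (rule sum_abs)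
 also have "... <= (\<Sum>i'\<in>P. if i' = i then 1 else 0)" by (intro sum_mono) (auto simp: axis_def)
 also have "... <= 1" by (simp add: sum.delta)
 finally show ?thesis .
qed

text \<open>\<open>Ph\<close> is a composition of flows issuing from \<open>z\<close>: the matrix \<open>t\<close> transports combinations of the fields from \<open>z\<close>
 to \<open>Ph u\<close> with norms distorted by at most \<open>\<kappa>\<close>, and \<open>\<beta>\<close> expresses the derivative of \<open>Ph\<close> at \<open>u\<close> through the fields at \<open>Ph u\<close>.\<close>

definition pstruct :: "real => real^'n => real => (real^'n => real^'n) => 'n set => real => real => bool" where
 "pstruct Lz z rh Ph P ep \<kappa> \<longleftrightarrow> Ph 0 = z &
  (ALL u:cball 0 rh. ALL L'. Lz + S1 P u < L' --> L' < 1 --> Ph u : RR L') &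
  (ALL u:cball 0 rh. EX t :: nat => nat => real. (ALL m<q. ALL j<q. \<bar>t m j - (if m = j then 1 else 0)\<bar> <= ep) &
    (ALL ta. norm (lc q Y ta z) <= \<kappa>*norm (lc q Y (%j. \<Sum>m<q. ta m*t m j) (Ph u)) &
      norm (lc q Y (%j. \<Sum>m<q. ta m*t m j) (Ph u)) <= \<kappa>*norm (lc q Y ta z))) &
  (EX \<beta> :: real^'n => 'n => nat => real. (ALL u:cball 0 rh. ALL i. ALL j<q. \<bar>\<beta> u i j - iot P (axis i 1) j\<bar> <= ep) &
   (ALL e>0. EX h0>0. ALL u:cball 0 rh. ALL u':cball 0 rh. norm (u' - u) < h0 -->
    norm (Ph u' - Ph u - lc q Y (%j. \<Sum>i\<in>UNIV. (u' - u) $ i * \<beta> u i j) (Ph u)) <= e*norm (u' - u)))"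

lemma flow_zero: "y : Om ==> (!!j. j < q ==> w j = 0) ==> flow Om (lc q Y w) y = y"
 using flow_eq[of w "%_. y"] by (auto simp: solves_def lc_def)

text \<open>The empty composition, from which the inductions start: identity matrix for the
  transport and \<beta> = 0.\<close>

lemma pstruct_const:
 assumes z: "z : RR Lz" and "0 <= ep" "1 <= \<kappa>"
 shows "pstruct Lz z rh (%u. z) {} ep \<kappa>"
 unfolding pstruct_def
proof (intro conjI ballI allI impI)
 show "z : RR L'" if "Lz + S1 {} u < L'" for u L'
  using that subsetD[OF reach_mono[of Lz L'] z] by (simp add: S1_def)
next
 have k: "norm (lc q Y ta z) <= \<kappa>*norm (lc q Y ta z)" for ta using mult_right_mono[OF assms(3), of "norm (lc q Y ta z)"] by simp
 have "lc q Y (%j. \<Sum>m<q. ta m*(if m = j then 1 else 0)) z = lc q Y ta z" for ta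
  unfolding lc_def by (intro sum.cong refl) (simp add: if_distrib cong: if_cong)
 with k show "EX t::nat => nat => real. (ALL m<q. ALL j<q. \<bar>t m j - (if m = j then 1 else 0)\<bar> <= ep) &
    (ALL ta. norm (lc q Y ta z) <= \<kappa>*norm (lc q Y (%j. \<Sum>m<q. ta m*t m j) z) &
      norm (lc q Y (%j. \<Sum>m<q. ta m*t m j) z) <= \<kappa>*norm (lc q Y ta z))"
  using assms(2) by (intro exI[of _ "%m j. if m = j then 1 else 0"]) auto
next
 show "EX \<beta>. (ALL u:cball 0 rh. ALL i. ALL j<q. \<bar>\<beta> u i j - iot {} (axis i 1) j\<bar> <= ep) &
   (ALL e>0. EX h0>0. ALL u:cball 0 rh. ALL u':cball 0 rh. norm (u' - u) < h0 -->
    norm (z - z - lc q Y (%j. \<Sum>i\<in>UNIV. (u' - u) $ i * \<beta> u i j) z) <= e*norm (u' - u))"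
  using assms by (intro exI[of _ "%u i j. 0"]) (auto simp: iot_def lc_def intro!: exI[of _ 1])
qed simp

text \<open>The transport equation does both jobs. Without forcing it continues the matrix
  \<open>t\<close> along the new flow. With forcing \<open>iot P' (axis i 1)\<close>, the effect of
  varying the parameters of the new flow, it continues the coefficients \<beta> of the derivative.
  Coefficients of size at most 2 and forcing of size at most 1 give the increment 2*\<mu>*(2 + 1) =
  6*\<mu>. The candidate is the derivative, uniformly in \<open>u\<close>, because the true
  increment of the trajectories minus the candidate obeys a Gronwall inequality.\<close>

lemma pstruct_step:
 assumes st: "pstruct Lz z rh Ph P ep \<kappa>" and P: "P \<subseteq> I" "P' \<subseteq> I" "P \<inter> P' = {}" and rh: "0 < rh"
  and Lz: "0 <= Lz" "Lz + real CARD('n)*rh < 1" and \<mu>: "(real Q)\<^sup>2*A*(real CARD('n)*rh) <= \<mu>" "\<mu> <= 1/2"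
  and ep: "0 <= ep" "ep <= 1" and \<kappa>: "1 <= \<kappa>" and z: "z : Om"
 shows "pstruct Lz z rh (%u. flow Om (lc q Y (iot P' u)) (Ph u)) (P \<union> P') (ep + 6 * \<mu>) (\<kappa>*exp (A*(real CARD('n)*rh)))"
proof -
 let ?N = "real CARD('n)" and ?U = "cball (0::real^'n) rh" and ?\<omega> = "real CARD('n)*rh"
 let ?W = "%u. lc q Y (iot P' u)" and ?Ph = "%u. flow Om (lc q Y (iot P' u)) (Ph u)"
 have Ph0: "Ph 0 = z" and PhR: "!!u L'. u : ?U ==> Lz + S1 P u < L' ==> L' < 1 ==> Ph u : RR L'"
  and tr: "!!u. u : ?U ==> EX t :: nat => nat => real. (ALL m<q. ALL j<q. \<bar>t m j - (if m = j then 1 else 0)\<bar> <= ep) &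
    (ALL ta. norm (lc q Y ta z) <= \<kappa>*norm (lc q Y (%j. \<Sum>m<q. ta m*t m j) (Ph u)) &
      norm (lc q Y (%j. \<Sum>m<q. ta m*t m j) (Ph u)) <= \<kappa>*norm (lc q Y ta z))"
  using st unfolding pstruct_def by blast+
 obtain \<beta> where \<beta>: "!!u i j. u : ?U ==> j < q ==> \<bar>\<beta> u i j - iot P (axis i 1) j\<bar> <= ep"
  and expPh: "!!e. 0 < e ==> EX h0>0. ALL u:?U. ALL u':?U. norm (u' - u) < h0 -->
    norm (Ph u' - Ph u - lc q Y (%j. \<Sum>i\<in>UNIV. (u' - u) $ i * \<beta> u i j) (Ph u)) <= e*norm (u' - u)"
  using st unfolding pstruct_def by blast
 have \<omega>0: "0 < ?\<omega>" using rh CARD1 by simp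
 have "0 <= (real Q)\<^sup>2*A*?\<omega>" using rh A1 by (intro mult_nonneg_nonneg) auto
 then have \<mu>0: "0 <= \<mu>" using \<mu>(1) by linarith
 have S1U: "S1 P'' u <= ?\<omega>" if "u : ?U" for P'' u
 proof -
  have "?N*norm u <= ?\<omega>" using that by (intro mult_left_mono) auto
  then show ?thesis using S1_le[of P'' u] by linarith
 qed
 have wU: "l1 q (iot P' u) <= ?\<omega>" if "u : ?U" for u using l1_iot[OF P(2)] S1U[OF that] order_trans by blast
 have SUn: "S1 (P \<union> P') u = S1 P u + S1 P' u" for u by (rule S1_Un[OF P(3)])
 \<comment> \<open>\<open>L'\<close> is arbitrary above the sum; the intermediate \<open>Lm\<close>
   shares the margin between the old composition and the new flow.\<close>
 have pathL: "EX ga. solves Om (?W u) ga & ga 0 = Ph u & (ALL t:{0..1}. ga t : RR L')" if u: "u : ?U" and L': "Lz + S1 (P \<union> P') u < L'" "L' < 1" for u L'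
 proof -
  define Lm where "Lm = (Lz + S1 P u + L' - S1 P' u)/2"
  have "Lz + S1 P u < Lm" "Lm + S1 P' u < L'" using L' SUn[of u] by (auto simp: Lm_def field_simps)
  moreover have "l2 q (iot P' u) <= S1 P' u" using l2_le_l1 l1_iot[OF P(2)] order_trans by blast
  moreover have "0 <= S1 P' u" "0 <= S1 P u" by (rule S1_nonneg)+
  ultimately have "Ph u : RR Lm" "0 <= Lm" "Lm + l2 q (iot P' u) < L'" using L' Lz by (auto intro!: PhR u)
  then obtain ga where "solves Om (?W u) ga" "ga 0 = Ph u" "!!t. t : {0..1} ==> ga t : RR L'"
   by (rule extend_flow[of "Ph u" Lm "iot P' u" L']) (use L' in auto)
  then show ?thesis by blast
 qed
 \<comment> \<open>One bound below 1 that serves all parameters, so that all trajectories run inside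
   \<open>RR L1\<close>.\<close>
 obtain L1 where L1: "Lz + ?\<omega> < L1" "L1 < 1" using Lz(2) dense by blast
 have "ALL u:?U. EX ga. solves Om (?W u) ga & ga 0 = Ph u & (ALL t:{0..1}. ga t : RR L1)"
 proof
  fix u assume u: "u : ?U"
  show "EX ga. solves Om (?W u) ga & ga 0 = Ph u & (ALL t:{0..1}. ga t : RR L1)"
   by (rule pathL[OF u]) (use S1U[OF u, of "P \<union> P'"] L1 in linarith)+
 qed
 from bchoice[OF this] obtain ga where ga: "!!u. u : ?U ==> solves Om (?W u) (ga u)" "!!u. u : ?U ==> ga u 0 = Ph u"
  and gaR: "!!u t. u : ?U ==> t : {0..1} ==> ga u t : RR L1" by blast
 have fl: "?Ph u = ga' 1" if "u : ?U" "solves Om (?W u) ga'" "ga' 0 = Ph u" for u ga'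
  using flow_eq[OF that(2)] that(3) by simp
 have Ph1: "?Ph u = ga u 1" if "u : ?U" for u by (rule fl[OF that ga(1,2)[OF that]])
 have c0: "?Ph 0 = z"
 proof -
  have "iot P' 0 j = 0" for j by (auto simp: iot_def intro!: sum.neutral)
  then show ?thesis using flow_zero[of "Ph 0" "iot P' 0"] Ph0 z by simp
 qed
 have c1: "?Ph u : RR L'" if u: "u : ?U" and L': "Lz + S1 (P \<union> P') u < L'" "L' < 1" for u L'
 proof -
  obtain ga' where g: "solves Om (?W u) ga'" "ga' 0 = Ph u" "ALL t:{0..1}. ga' t : RR L'" using pathL[OF u L'] by blast
  show ?thesis using fl[OF u g(1,2)] g(3) by simp
 qed
 have c2: "EX t :: nat => nat => real. (ALL m<q. ALL j<q. \<bar>t m j - (if m = j then 1 else 0)\<bar> <= ep + 6 * \<mu>) &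
    (ALL ta. norm (lc q Y ta z) <= (\<kappa>*exp (A*?\<omega>))*norm (lc q Y (%j. \<Sum>m<q. ta m*t m j) (?Ph u)) &
      norm (lc q Y (%j. \<Sum>m<q. ta m*t m j) (?Ph u)) <= (\<kappa>*exp (A*?\<omega>))*norm (lc q Y ta z))"
  if u: "u : ?U" for u
 proof -
  obtain t :: "nat => nat => real" where t: "!!m j. m < q ==> j < q ==> \<bar>t m j - (if m = j then 1 else 0)\<bar> <= ep"
   and tk: "!!ta. norm (lc q Y ta z) <= \<kappa>*norm (lc q Y (%j. \<Sum>m<q. ta m*t m j) (Ph u))"
    "!!ta. norm (lc q Y (%j. \<Sum>m<q. ta m*t m j) (Ph u)) <= \<kappa>*norm (lc q Y ta z)"
   using tr[OF u] by blast
  have b1: "\<bar>t m j\<bar> <= 2" if "m < q" "j < q" for m j using t[OF that] ep by (auto split: if_splits)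
  have "EX ta2. m < q --> (ALL l<q. ta2 l 0 = t m l) &
   (ALL l<q. ALL s:{0..1}. (ta2 l has_real_derivative (0 - (\<Sum>m<q. CM (iot P' u) l m (ga u s)*ta2 m s))) (at s within {0..1})) &
   (ALL l<q. \<bar>ta2 l 1 - t m l - 0\<bar> <= 2 * \<mu>*(2 + 0))" for m
  proof (cases "m < q")
   case True
   obtain ta2 where "!!l. l < q ==> ta2 l 0 = t m l"
    "!!l s. l < q ==> s : {0..1} ==> (ta2 l has_real_derivative (0 - (\<Sum>m<q. CM (iot P' u) l m (ga u s)*ta2 m s))) (at s within {0..1})"
    "!!l. l < q ==> \<bar>ta2 l 1 - t m l - 0\<bar> <= 2 * \<mu>*(2 + 0)"
    by (rule transport_exists[where f="%_. 0" and F=0 and T=2 and ?ta0.0="t m", OF ga(1)[OF u] gaR[OF u] L1(2) wU[OF u] \<mu>]) (use b1[OF True] in auto)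
   then show ?thesis by (intro exI[of _ ta2]) blast
  qed auto
  then have "EX ta2. ALL m. m < q --> (ALL l<q. ta2 m l 0 = t m l) &
   (ALL l<q. ALL s:{0..1}. (ta2 m l has_real_derivative (0 - (\<Sum>m'<q. CM (iot P' u) l m' (ga u s)*ta2 m m' s))) (at s within {0..1})) &
   (ALL l<q. \<bar>ta2 m l 1 - t m l - 0\<bar> <= 2 * \<mu>*(2 + 0))" by (intro choice allI)
  then obtain ta2 where ta2: "!!m l. m < q ==> l < q ==> ta2 m l 0 = t m l"
   "!!m l s. m < q ==> l < q ==> s : {0..1} ==> (ta2 m l has_real_derivative (0 - (\<Sum>m'<q. CM (iot P' u) l m' (ga u s)*ta2 m m' s))) (at s within {0..1})"
   "!!m l. m < q ==> l < q ==> \<bar>ta2 m l 1 - t m l - 0\<bar> <= 2 * \<mu>*(2 + 0)" by blast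
  \<comment> \<open>The equation is linear: a combination of the rows of \<open>t\<close> is
    transported by the same combination of the transported rows.\<close>
  have comb: "((%s. \<Sum>m<q. ta m*ta2 m l s) has_real_derivative (0 - (\<Sum>m'<q. CM (iot P' u) l m' (ga u s)*(\<Sum>m<q. ta m*ta2 m m' s)))) (at s within {0..1})"
   if "l < q" "s : {0..1}" for ta l s
  proof -
   have "((%s. \<Sum>m<q. ta m*ta2 m l s) has_real_derivative (\<Sum>m<q. ta m*(0 - (\<Sum>m'<q. CM (iot P' u) l m' (ga u s)*ta2 m m' s)))) (at s within {0..1})"
    by (intro DERIV_sum DERIV_cmult ta2(2) that) auto
   moreover have "(\<Sum>m<q. ta m*(\<Sum>m'<q. CM (iot P' u) l m' (ga u s)*ta2 m m' s)) = (\<Sum>m'<q. CM (iot P' u) l m' (ga u s)*(\<Sum>m<q. ta m*ta2 m m' s))"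
   proof -
    have "(\<Sum>m<q. ta m*(\<Sum>m'<q. CM (iot P' u) l m' (ga u s)*ta2 m m' s)) = (\<Sum>m<q. \<Sum>m'<q. CM (iot P' u) l m' (ga u s)*(ta m*ta2 m m' s))"
     by (simp add: sum_distrib_left mult_ac)
    also have "... = (\<Sum>m'<q. \<Sum>m<q. CM (iot P' u) l m' (ga u s)*(ta m*ta2 m m' s))" by (rule sum.swap)
    finally show ?thesis by (simp add: sum_distrib_left)
   qed
   ultimately show ?thesis by (simp add: sum_negf)
  qed
  have l0: "lc q Y (%l. \<Sum>m<q. ta m*ta2 m l 0) (ga u 0) = lc q Y (%j. \<Sum>m<q. ta m*t m j) (Ph u)" for ta
   using ga(2)[OF u] ta2(1) by (simp add: lc_def)
  show ?thesis
  proof (intro exI[of _ "%m l. ta2 m l 1"] conjI allI impI)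
   fix m j assume mj: "m < q" "j < q"
   show "\<bar>ta2 m j 1 - (if m = j then 1 else 0)\<bar> <= ep + 6 * \<mu>"
   proof -
    have "\<bar>ta2 m j 1 - t m j\<bar> <= 4 * \<mu>" using ta2(3)[OF mj] by simp
    then show ?thesis using t[OF mj] \<mu>0 by (cases "m = j") auto
   qed
  next
   fix ta :: "nat => real"
   let ?l1 = "lc q Y (%l. \<Sum>m<q. ta m*ta2 m l 1) (ga u 1)" and ?l0 = "lc q Y (%j. \<Sum>m<q. ta m*t m j) (Ph u)"
   note tn = transport_norm[where ta="%l s. \<Sum>m<q. ta m*ta2 m l s", OF ga(1)[OF u] gaR[OF u] L1(2) wU[OF u] comb]
   have "norm ?l0 <= exp (A*?\<omega>)*norm ?l1" using tn(2) l0 by simp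
   then have "\<kappa>*norm ?l0 <= \<kappa>*(exp (A*?\<omega>)*norm ?l1)" using \<kappa> by (intro mult_left_mono) auto
   then show "norm (lc q Y ta z) <= (\<kappa>*exp (A*?\<omega>))*norm (lc q Y (%l. \<Sum>m<q. ta m*ta2 m l 1) (?Ph u))"
    using tk(1)[of ta] Ph1[OF u] by (simp add: mult.assoc)
   have "norm ?l1 <= exp (A*?\<omega>)*norm ?l0" using tn(1) l0 by simp
   also have "... <= exp (A*?\<omega>)*(\<kappa>*norm (lc q Y ta z))" using tk(2) by (intro mult_left_mono) auto
   finally show "norm (lc q Y (%l. \<Sum>m<q. ta m*ta2 m l 1) (?Ph u)) <= (\<kappa>*exp (A*?\<omega>))*norm (lc q Y ta z)"
    using Ph1[OF u] by (simp add: mult_ac)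
  qed
 qed
 have b\<beta>: "\<bar>\<beta> u i j\<bar> <= 2" if "u : ?U" "j < q" for u i j
  using \<beta>[OF that, of i] iot_axis_le[of P i j] ep by linarith
 \<comment> \<open>The choice ranges over pairs (u, i), as the trajectory depends on
   \<open>u\<close> and the forcing on \<open>i\<close>.\<close>
 have "EX ta. fst p : ?U --> (ALL l<q. ta l 0 = \<beta> (fst p) (snd p) l) &
   (ALL l<q. ALL s:{0..1}. (ta l has_real_derivative (iot P' (axis (snd p) 1) l - (\<Sum>m<q. CM (iot P' (fst p)) l m (ga (fst p) s)*ta m s))) (at s within {0..1})) &
   (ALL l<q. \<bar>ta l 1 - \<beta> (fst p) (snd p) l - iot P' (axis (snd p) 1) l\<bar> <= 6 * \<mu>)" for p :: "(real^'n) \<times> 'n"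
 proof (cases "fst p : ?U")
  case True
  obtain ta where "!!l. l < q ==> ta l 0 = \<beta> (fst p) (snd p) l"
   "!!l s. l < q ==> s : {0..1} ==> (ta l has_real_derivative (iot P' (axis (snd p) 1) l - (\<Sum>m<q. CM (iot P' (fst p)) l m (ga (fst p) s)*ta m s))) (at s within {0..1})"
   "!!l. l < q ==> \<bar>ta l 1 - \<beta> (fst p) (snd p) l - iot P' (axis (snd p) 1) l\<bar> <= 2 * \<mu>*(2 + 1)"
   by (rule transport_exists[where f="iot P' (axis (snd p) 1)" and F=1 and T=2 and ?ta0.0="\<beta> (fst p) (snd p)", OF ga(1)[OF True] gaR[OF True] L1(2) wU[OF True] \<mu>])
     (use b\<beta>[OF True] iot_axis_le in auto)
  then show ?thesis by (intro exI[of _ ta]) auto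
 qed auto
 then have "EX ta. ALL p. fst p : ?U --> (ALL l<q. ta p l 0 = \<beta> (fst p) (snd p) l) &
   (ALL l<q. ALL s:{0..1}. (ta p l has_real_derivative (iot P' (axis (snd p) 1) l - (\<Sum>m<q. CM (iot P' (fst p)) l m (ga (fst p) s)*ta p m s))) (at s within {0..1})) &
   (ALL l<q. \<bar>ta p l 1 - \<beta> (fst p) (snd p) l - iot P' (axis (snd p) 1) l\<bar> <= 6 * \<mu>)" by (intro choice allI)
 then obtain ta where H: "ALL p. fst p : ?U --> (ALL l<q. ta p l 0 = \<beta> (fst p) (snd p) l) &
   (ALL l<q. ALL s:{0..1}. (ta p l has_real_derivative (iot P' (axis (snd p) 1) l - (\<Sum>m<q. CM (iot P' (fst p)) l m (ga (fst p) s)*ta p m s))) (at s within {0..1})) &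
   (ALL l<q. \<bar>ta p l 1 - \<beta> (fst p) (snd p) l - iot P' (axis (snd p) 1) l\<bar> <= 6 * \<mu>)" by blast
 have ta0: "ta (u, i) l 0 = \<beta> u i l" if "u : ?U" "l < q" for u i l
  using H[rule_format, of "(u, i)"] that by simp
 have tad: "(ta (u, i) l has_real_derivative (iot P' (axis i 1) l - (\<Sum>m<q. CM (iot P' u) l m (ga u s)*ta (u, i) m s))) (at s within {0..1})"
  if "u : ?U" "l < q" "s : {0..1}" for u i l s
  using H[rule_format, of "(u, i)"] that by simp
 have ta1: "\<bar>ta (u, i) l 1 - \<beta> u i l - iot P' (axis i 1) l\<bar> <= 6 * \<mu>" if "u : ?U" "l < q" for u i l
  using H[rule_format, of "(u, i)"] that by simp
 have c3: "\<bar>ta (u, i) j 1 - iot (P \<union> P') (axis i 1) j\<bar> <= ep + 6 * \<mu>" if "u : ?U" "j < q" for u i j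
  using ta1[OF that, of i] \<beta>[OF that, of i] unfolding iot_Un[OF P(3)] by linarith
 have lcb: "l1 q (%j. \<Sum>i\<in>UNIV. h $ i * \<beta> u i j) <= real q*(?N*2)*norm h" if "u : ?U" for u h
 proof -
  have "\<bar>\<Sum>i\<in>UNIV. h $ i * \<beta> u i j\<bar> <= ?N*2*norm h" if "j < q" for j
  proof -
   have "\<bar>\<Sum>i\<in>UNIV. h $ i * \<beta> u i j\<bar> <= (\<Sum>i\<in>UNIV. \<bar>h $ i * \<beta> u i j\<bar>)" by (rule sum_abs)
   also have "... <= (\<Sum>i\<in>(UNIV::'n set). norm h*2)"
    using b\<beta>[OF \<open>u : ?U\<close> that] component_le_norm_cart[of h] by (intro sum_mono) (simp add: abs_mult mult_mono)
   finally show ?thesis by (simp add: mult_ac)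
  qed
  from l1_le[OF this] show ?thesis by (simp add: mult_ac)
 qed
 have contPh: "continuous_on ?U Ph"
 proof (rule continuous_onI)
  fix u and e :: real assume u: "u : ?U" and e: "0 < e"
  obtain h0 where h0: "h0 > 0" "ALL u:?U. ALL u':?U. norm (u' - u) < h0 -->
    norm (Ph u' - Ph u - lc q Y (%j. \<Sum>i\<in>UNIV. (u' - u) $ i * \<beta> u i j) (Ph u)) <= 1*norm (u' - u)" using expPh[of 1] by auto
  define Mu where "Mu = (\<Sum>j<q. norm (Y j (Ph u)))"
  have Mu: "norm (Y j (Ph u)) <= Mu" if "j < q" for j unfolding Mu_def using that by (intro member_le_sum) auto
  have Mu0: "0 <= Mu" by (simp add: Mu_def sum_nonneg)
  define K where "K = 1 + real q*(?N*2)*Mu"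
  have K: "1 <= K" using Mu0 by (simp add: K_def)
  have le: "norm (Ph u' - Ph u) <= K*norm (u' - u)" if u': "u' : ?U" "norm (u' - u) < h0" for u'
  proof -
   let ?l = "lc q Y (%j. \<Sum>i\<in>UNIV. (u' - u) $ i * \<beta> u i j) (Ph u)"
   have "norm ?l <= l1 q (%j. \<Sum>i\<in>UNIV. (u' - u) $ i * \<beta> u i j)*Mu" using Mu by (intro lc_norm_le)
   also have "... <= real q*(?N*2)*norm (u' - u)*Mu" by (rule mult_right_mono[OF lcb[OF u] Mu0])
   finally have "norm ?l <= real q*(?N*2)*norm (u' - u)*Mu" .
   moreover have "norm (Ph u' - Ph u - ?l) <= norm (u' - u)" using h0(2) u u' by auto
   ultimately show ?thesis using norm_triangle_sub[of "Ph u' - Ph u" ?l] by (simp add: K_def algebra_simps)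
  qed
  show "EX d>0. ALL u':?U. dist u' u < d --> dist (Ph u') (Ph u) <= e"
  proof (intro exI[of _ "min h0 (e/K)"] conjI ballI impI)
   show "0 < min h0 (e/K)" using h0 e K by simp
   fix u' assume "u' : ?U" "dist u' u < min h0 (e/K)"
   then have "norm (Ph u' - Ph u) <= K*norm (u' - u)" "norm (u' - u) < e/K" by (auto intro!: le simp: dist_norm)
   then show "dist (Ph u') (Ph u) <= e" using K by (simp add: dist_norm field_simps)
  qed
 qed
 \<comment> \<open>Joint continuity makes the union \<open>CC\<close> of all trajectories compact,
   so the radii and moduli obtained below are the same for every \<open>u\<close>.\<close>
 have contga: "continuous_on (?U \<times> {0..1}) (%p. ga (fst p) (snd p))"
 proof (rule continuous_onI)
  fix p :: "(real^'n) \<times> real" and e :: real assume p: "p : ?U \<times> {0..1}" and e: "0 < e"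
  obtain u s where us: "p = (u, s)" "u : ?U" "s : {0..1}" using p by auto
  have C: "compact (ga u ` {0..1})" "ga u ` {0..1} \<subseteq> Om" using solves_compact[OF ga(1)[OF us(2)]] by auto
  obtain Mc where Mc0: "0 <= Mc" and Mc: "!!j y. j < q ==> y : ga u ` {0..1} ==> norm (Y j y) <= Mc"
   using family_bounded[OF C] by blast
  have DYu: "norm (frechet_derivative (Y j) (at y) v) <= A*norm v" if "j < q" "y : ga u ` {0..1}" for j y v
   using DY_bound[OF L1(2) _ that(1)] gaR[OF us(2)] that(2) by auto
  obtain r where r: "0 < r" "!!w1 w2 ga1 ga2 t. solves Om (lc q Y w1) ga1 ==> solves Om (lc q Y w2) ga2 ==> ga1 ` {0..1} \<subseteq> ga u ` {0..1} ==>
   l1 q w2 <= 1 ==> (norm (ga1 0 - ga2 0) + l1 q (%j. w1 j - w2 j)*Mc)*exp (A + 1) < r ==> t : {0..1} ==>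
   norm (ga1 t - ga2 t) <= (norm (ga1 0 - ga2 0) + l1 q (%j. w1 j - w2 j)*Mc)*exp (A + 1)"
   by (rule flow_compare[OF C _ DYu Mc Mc0]) (use A1 in auto)
  have w1: "l1 q (iot P' u') <= 1" if "u' : ?U" for u' using wU[OF that] Lz by linarith
  define E where "E = exp (A + 1)"
  have E0: "0 < E" by (simp add: E_def)
  define m where "m = min r e/2"
  have m0: "0 < m" using r(1) e by (simp add: m_def)
  obtain d1 where d1: "0 < d1" "!!u'. u' : ?U ==> dist u' u < d1 ==> dist (Ph u') (Ph u) < m/(2*E)"
   using contPh[unfolded continuous_on_iff, rule_format, OF us(2), of "m/(2*E)"] m0 E0 by auto
  obtain d2 where d2: "0 < d2" "!!t. t : {0..1} ==> dist t s < d2 ==> dist (ga u t) (ga u s) < e/2"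
   using solves_continuous[OF ga(1)[OF us(2)], unfolded continuous_on_iff, rule_format, OF us(3), of "e/2"] e by auto
  define d3 where "d3 = m/(2*E*(?N*Mc + 1))"
  have pos: "0 < 2*E*(?N*Mc + 1)" using E0 Mc0 by (intro mult_pos_pos add_nonneg_pos) auto
  have d30: "0 < d3" unfolding d3_def using m0 pos by simp
  show "EX d>0. ALL p':?U \<times> {0..1}. dist p' p < d --> dist (ga (fst p') (snd p')) (ga (fst p) (snd p)) <= e"
  proof (intro exI[of _ "min d1 (min d2 d3)"] conjI ballI impI)
   show "0 < min d1 (min d2 d3)" using d1 d2 d30 by simp
   fix p' :: "(real^'n) \<times> real" assume p': "p' : ?U \<times> {0..1}" "dist p' p < min d1 (min d2 d3)"
   obtain u' s' where us': "p' = (u', s')" "u' : ?U" "s' : {0..1}" using p' by auto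
   have du: "dist u' u < d1" "dist u' u < d3" and ds: "dist s' s < d2"
    using p'(2) dist_fst_le[of p' p] dist_snd_le[of p' p] us us' by auto
   have "l1 q (%j. iot P' u j - iot P' u' j) <= ?N*norm (u - u')"
    using l1_iot[OF P(2), of "u - u'"] S1_le[of P' "u - u'"] unfolding iot_diff by linarith
   also have "... <= ?N*d3" using du(2) by (intro mult_left_mono) (auto simp: dist_norm norm_minus_commute)
   finally have "l1 q (%j. iot P' u j - iot P' u' j)*Mc <= ?N*d3*Mc" using Mc0 by (intro mult_right_mono)
   also have "... <= d3*(?N*Mc + 1)" using d30 by (simp add: algebra_simps)
   also have "... = m/(2*E)" using pos E0 unfolding d3_def by (simp add: field_simps)
   finally have l1M: "l1 q (%j. iot P' u j - iot P' u' j)*Mc <= m/(2*E)" .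
   have "norm (ga u 0 - ga u' 0) < m/(2*E)" using d1(2)[OF us'(2) du(1)] ga(2) us us' by (simp add: dist_norm norm_minus_commute)
   then have "norm (ga u 0 - ga u' 0) + l1 q (%j. iot P' u j - iot P' u' j)*Mc < m/E" using l1M by (simp add: field_simps)
   then have sm: "(norm (ga u 0 - ga u' 0) + l1 q (%j. iot P' u j - iot P' u' j)*Mc)*exp (A + 1) < m"
    using E0 by (simp add: E_def[symmetric] field_simps)
   have "norm (ga u s' - ga u' s') < m"
    using r(2)[OF ga(1)[OF us(2)] ga(1)[OF us'(2)] order_refl w1[OF us'(2)] _ us'(3)] sm r(1) e by (force simp: m_def)
   moreover have "m <= e/2" by (simp add: m_def)
   ultimately have "dist (ga u' s') (ga u s') < e/2" by (simp add: dist_norm norm_minus_commute)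
   then show "dist (ga (fst p') (snd p')) (ga (fst p) (snd p)) <= e"
    using d2(2)[OF us'(3) ds] dist_triangle[of "ga u' s'" "ga u s" "ga u s'"] us us' by simp
  qed
 qed
 define CC where "CC = (%p. ga (fst p) (snd p)) ` (?U \<times> {0..1})"
 have CC: "compact CC" "CC \<subseteq> Om"
  using ga(1) unfolding CC_def by (auto intro!: compact_continuous_image[OF contga] compact_Times simp: solves_def)
 have CCin: "ga u t : CC" if "u : ?U" "t : {0..1}" for u t
  unfolding CC_def by (rule image_eqI[of _ _ "(u, t)"]) (use that in auto)
 have CCD: "norm (frechet_derivative (Y j) (at y) v) <= A*norm v" if "j < q" "y : CC" for j y v
  using DY_bound[OF L1(2) _ that(1)] gaR that(2) by (auto simp: CC_def)
 obtain M where M0: "0 <= M" and M: "!!j y. j < q ==> y : CC ==> norm (Y j y) <= M"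
  using family_bounded[OF CC] by blast
 obtain r where r: "0 < r" "!!w1 w2 ga1 ga2 t. solves Om (lc q Y w1) ga1 ==> solves Om (lc q Y w2) ga2 ==> ga1 ` {0..1} \<subseteq> CC ==>
   l1 q w2 <= 1 ==> (norm (ga1 0 - ga2 0) + l1 q (%j. w1 j - w2 j)*M)*exp (A + 1) < r ==> t : {0..1} ==>
   norm (ga1 t - ga2 t) <= (norm (ga1 0 - ga2 0) + l1 q (%j. w1 j - w2 j)*M)*exp (A + 1)"
  by (rule flow_compare[OF CC _ CCD M M0]) (use A1 in auto)
 have c4: "EX h0>0. ALL u:?U. ALL u':?U. norm (u' - u) < h0 -->
    norm (?Ph u' - ?Ph u - lc q Y (%j. \<Sum>i\<in>UNIV. (u' - u) $ i*ta (u, i) j 1) (?Ph u)) <= e*norm (u' - u)" if e: "0 < e" for e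
 proof -
  define X where "X = exp (A*?\<omega>)"
  define E where "E = exp (A + 1)"
  define K where "K = 1 + real q*(?N*2)*M"
  define K2 where "K2 = (K + ?N*M)*E"
  have X0: "0 < X" by (simp add: X_def)
  have E0: "1 <= E" using A1 by (simp add: E_def)
  have K1: "1 <= K" using M0 by (simp add: K_def)
  have K20: "0 < K2" unfolding K2_def using E0 K1 M0 by (intro mult_pos_pos add_pos_nonneg) auto
  \<comment> \<open>Sized so that \<open>(?\<omega> + 1)*e1*K2\<close> is e/(3*X); \<open>K2\<close>
    bounds the distance of two trajectories per unit of parameter difference.\<close>
  define e1 where "e1 = e/(3*X*K2*(?\<omega> + 1))"
  have e10: "0 < e1" using e X0 K20 \<omega>0 by (simp add: e1_def)
  obtain r1 where r1: "0 < r1" "!!j y y'. j < q ==> y : CC ==> norm (y' - y) <= r1 ==>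
    norm (Y j y' - Y j y - frechet_derivative (Y j) (at y) (y' - y)) <= e1*norm (y' - y)"
   by (rule C1_family_tube[where q=q and Y=Y and e=e1, OF open_Om CC C1]) (use e10 in auto)
  obtain r2 where r2: "0 < r2" "!!j y y'. j < q ==> y : CC ==> norm (y' - y) <= r2 ==> norm (Y j y' - Y j y) <= (A + 1)*norm (y' - y)"
   by (rule C1_family_lipschitz_tube[where q=q and Y=Y and A=A, OF open_Om CC C1 CCD]) auto
  have e3: "0 < e/(3*X)" using e X0 by simp
  obtain h1 where h1: "h1 > 0" "ALL u:?U. ALL u':?U. norm (u' - u) < h1 -->
    norm (Ph u' - Ph u - lc q Y (%j. \<Sum>i\<in>UNIV. (u' - u) $ i * \<beta> u i j) (Ph u)) <= e/(3*X)*norm (u' - u)" using expPh[OF e3] by blast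
  obtain h2 where h2: "h2 > 0" "ALL u:?U. ALL u':?U. norm (u' - u) < h2 -->
    norm (Ph u' - Ph u - lc q Y (%j. \<Sum>i\<in>UNIV. (u' - u) $ i * \<beta> u i j) (Ph u)) <= 1*norm (u' - u)" using expPh[of 1] by auto
  define m where "m = min r (min r1 r2)"
  have m0: "0 < m" "m <= r" "m <= r1" "m <= r2" using r(1) r1(1) r2(1) by (auto simp: m_def)
  define h0 where "h0 = min (min h1 h2) (min (m/K2) (e/(3*X*(?N*(A + 1)*K2))))"
  have pos4: "0 < 3*X*(?N*(A + 1)*K2)" using X0 K20 A1 CARD1 by simp
  have h00: "0 < h0" using h1(1) h2(1) m0 K20 e pos4 by (simp add: h0_def)
  show ?thesis
  proof (intro exI[of _ h0] conjI ballI impI h00)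
   fix u u' assume u: "u : ?U" and u': "u' : ?U" and nh: "norm (u' - u) < h0"
   define h where "h = u' - u"
   let ?nh = "norm h"
   have nhs: "?nh < h1" "?nh < h2" "K2*?nh < m" "?nh*(3*X*(?N*(A + 1)*K2)) <= e"
    using nh K20 pos4 by (auto simp: h0_def h_def pos_less_divide_eq mult.commute)
   let ?y = "ga u" and ?y' = "ga u'"
   have ioth: "iot P' u' j = iot P' u j + iot P' h j" for j unfolding h_def iot_diff by simp
   have l1h: "l1 q (iot P' h) <= ?N*?nh" using l1_iot[OF P(2), of h] S1_le[of P' h] by linarith
   have d0: "norm (?y 0 - ?y' 0) <= K*?nh"
   proof -
    let ?l = "lc q Y (%j. \<Sum>i\<in>UNIV. h $ i * \<beta> u i j) (Ph u)"
    have "Ph u : CC" using CCin[OF u, of 0] ga(2)[OF u] by simp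
    then have "norm ?l <= l1 q (%j. \<Sum>i\<in>UNIV. h $ i * \<beta> u i j)*M" using M by (intro lc_norm_le)
    also have "... <= real q*(?N*2)*?nh*M" by (rule mult_right_mono[OF lcb[OF u] M0])
    finally have "norm ?l <= real q*(?N*2)*?nh*M" .
    moreover have "norm (Ph u' - Ph u - ?l) <= ?nh" using h2(2) u u' nhs(2) unfolding h_def by auto
    ultimately have "norm (Ph u' - Ph u) <= K*?nh"
     using norm_triangle_sub[of "Ph u' - Ph u" ?l] by (simp add: K_def algebra_simps)
    then show ?thesis using ga(2)[OF u] ga(2)[OF u'] by (simp add: norm_minus_commute)
   qed
   have l1d: "l1 q (%j. iot P' u j - iot P' u' j) <= ?N*?nh"
   proof -
    have "l1 q (%j. iot P' u j - iot P' u' j) = l1 q (iot P' h)" by (simp add: l1_def ioth)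
    then show ?thesis using l1h by simp
   qed
   have K2b: "(norm (?y 0 - ?y' 0) + l1 q (%j. iot P' u j - iot P' u' j)*M)*exp (A + 1) <= K2*?nh"
   proof -
    have "l1 q (%j. iot P' u j - iot P' u' j)*M <= ?N*?nh*M" by (rule mult_right_mono[OF l1d M0])
    then have "(norm (?y 0 - ?y' 0) + l1 q (%j. iot P' u j - iot P' u' j)*M)*E <= (K*?nh + ?N*?nh*M)*E"
     using d0 E0 by (intro mult_right_mono) auto
    then show ?thesis by (simp add: K2_def E_def algebra_simps)
   qed
   have w1: "l1 q (iot P' u') <= 1" using wU[OF u'] Lz by linarith
   have dt: "norm (?y' t - ?y t) <= K2*?nh" if t: "t : {0..1}" for t
   proof -
    have "?y ` {0..1} \<subseteq> CC" using CCin[OF u] by auto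
    from r(2)[OF ga(1)[OF u] ga(1)[OF u'] this w1 _ t] have "norm (?y t - ?y' t) <= (norm (?y 0 - ?y' 0) + l1 q (%j. iot P' u j - iot P' u' j)*M)*exp (A + 1)"
     using K2b nhs(3) m0(2) by linarith
    then show ?thesis using K2b by (simp add: norm_minus_commute)
   qed
   \<comment> \<open>By linearity the coefficients for the direction \<open>h\<close> are the
     combination of those for the axes.\<close>
   define tah where "tah l s = (\<Sum>i\<in>UNIV. h $ i*ta (u, i) l s)" for l s
   have tahd: "(tah l has_real_derivative (iot P' h l - (\<Sum>m<q. CM (iot P' u) l m (?y s)*tah m s))) (at s within {0..1})" if "l < q" "s : {0..1}" for l s
   proof -
    have "(tah l has_real_derivative (\<Sum>i\<in>UNIV. h $ i*(iot P' (axis i 1) l - (\<Sum>m<q. CM (iot P' u) l m (?y s)*ta (u, i) m s)))) (at s within {0..1})"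
     unfolding tah_def[abs_def] by (intro DERIV_sum DERIV_cmult tad u that)
    moreover have "(\<Sum>i\<in>UNIV. h $ i*(iot P' (axis i 1) l - (\<Sum>m<q. CM (iot P' u) l m (?y s)*ta (u, i) m s)))
      = iot P' h l - (\<Sum>m<q. CM (iot P' u) l m (?y s)*tah m s)"
    proof -
     have "(\<Sum>i\<in>UNIV. h $ i*(\<Sum>m<q. CM (iot P' u) l m (?y s)*ta (u, i) m s)) = (\<Sum>i\<in>UNIV. \<Sum>m<q. CM (iot P' u) l m (?y s)*(h $ i*ta (u, i) m s))"
      by (simp add: sum_distrib_left mult_ac)
     also have "... = (\<Sum>m<q. \<Sum>i\<in>UNIV. CM (iot P' u) l m (?y s)*(h $ i*ta (u, i) m s))" by (rule sum.swap)
     also have "... = (\<Sum>m<q. CM (iot P' u) l m (?y s)*tah m s)" by (simp add: tah_def sum_distrib_left)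
     finally show ?thesis unfolding right_diff_distrib sum_subtractf iot_axis[of P' h l] by simp
    qed
    ultimately show ?thesis by simp
   qed
   define v where "v s = lc q Y (%l. tah l s) (?y s)" for s
   have vd: "(v has_vector_derivative (DW (iot P' u) (?y t) (v t) + lc q Y (iot P' h) (?y t))) (at t within {0..1})" if "t : {0..1}" for t
    using transport_derivative[OF ga(1)[OF u] gaR[OF u] L1(2) tahd that] by (simp add: v_def[abs_def])
   define ee where "ee s = ?y' s - ?y s - v s" for s
   define ee' where "ee' t = lc q Y (iot P' u') (?y' t) - lc q Y (iot P' u) (?y t) - (DW (iot P' u) (?y t) (v t) + lc q Y (iot P' h) (?y t))" for t
   have eed: "(ee has_vector_derivative ee' t) (at t within {0..1})" if "t : {0..1}" for t
    unfolding ee_def[abs_def] ee'_def using ga(1)[OF u] ga(1)[OF u'] that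
    by (intro has_vector_derivative_diff vd) (auto simp: solves_def)
   \<comment> \<open>The final error has three sources, each at most e/(3*X) times |h|: the old
     expansion at time 0, the Taylor remainder of the field, and the variation of the additional
     field. \<open>X\<close> compensates the Gronwall factor.\<close>
   define b where "b = 2*(e/(3*X))*?nh"
   have eeb: "norm (ee' t) <= A*?\<omega>*norm (ee t) + b" if t: "t : {0..1}" for t
   proof -
    have yC: "?y t : CC" by (rule CCin[OF u t])
    have yOm: "?y t : Om" using yC CC by auto
    interpret lin: linear "DW (iot P' u) (?y t)" by (rule linear_DW[OF yOm])
    let ?d = "?y' t - ?y t"
    have nd: "norm ?d <= K2*?nh" by (rule dt[OF t])
    \<comment> \<open>Splitting into the Taylor remainder of the field with parameter
      \<open>u\<close>, its derivative applied to the error itself, and the change of the field with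
      coefficients \<open>iot P' h\<close> between the two trajectories.\<close>
    have "ee' t = (lc q Y (iot P' u) (?y' t) - lc q Y (iot P' u) (?y t) - DW (iot P' u) (?y t) ?d) + DW (iot P' u) (?y t) (ee t)
      + (lc q Y (iot P' h) (?y' t) - lc q Y (iot P' h) (?y t))"
    proof -
     have "lc q Y (iot P' u') (?y' t) = lc q Y (iot P' u) (?y' t) + lc q Y (iot P' h) (?y' t)"
      unfolding lc_add by (simp add: lc_def ioth)
     then show ?thesis unfolding ee'_def ee_def by (simp add: lin.diff lin.add algebra_simps)
    qed
    then have "norm (ee' t) <= norm (lc q Y (iot P' u) (?y' t) - lc q Y (iot P' u) (?y t) - DW (iot P' u) (?y t) ?d) + norm (DW (iot P' u) (?y t) (ee t))
      + norm (lc q Y (iot P' h) (?y' t) - lc q Y (iot P' h) (?y t))"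
     by (metis norm_triangle_ineq norm_triangle_mono order_refl)
    moreover have "norm (lc q Y (iot P' u) (?y' t) - lc q Y (iot P' u) (?y t) - DW (iot P' u) (?y t) ?d) <= e/(3*X)*?nh"
    proof -
     have "norm ?d <= r1" using nd nhs(3) m0(3) by linarith
     then have "norm (lc q Y (iot P' u) (?y' t) - lc q Y (iot P' u) (?y t) - DW (iot P' u) (?y t) ?d) <= l1 q (iot P' u)*(e1*norm ?d)"
      using r1(2) yC by (intro lc_remainder) auto
     also have "... <= (?\<omega> + 1)*(e1*(K2*?nh))"
      using wU[OF u] nd e10 \<omega>0 by (intro mult_mono mult_left_mono) auto
     also have "... = e/(3*X)*?nh" using \<omega>0 K20 X0 by (simp add: e1_def divide_simps add_pos_pos) (simp add: algebra_simps)?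
     finally show ?thesis .
    qed
    moreover have "norm (DW (iot P' u) (?y t) (ee t)) <= A*?\<omega>*norm (ee t)"
    proof -
     have "l1 q (iot P' u)*A*norm (ee t) <= ?\<omega>*A*norm (ee t)" using wU[OF u] A1 by (intro mult_right_mono) auto
     then show ?thesis using DW_bound[OF L1(2) gaR[OF u t], of "iot P' u" "ee t"] by (simp add: mult_ac)
    qed
    moreover have "norm (lc q Y (iot P' h) (?y' t) - lc q Y (iot P' h) (?y t)) <= e/(3*X)*?nh"
    proof -
     have "norm ?d <= r2" using nd nhs(3) m0(4) by linarith
     then have "norm (lc q Y (iot P' h) (?y' t) - lc q Y (iot P' h) (?y t)) <= l1 q (iot P' h)*((A + 1)*norm ?d)"
      using r2(2) yC by (intro lc_lipschitz) auto
     also have "... <= (?N*?nh)*((A + 1)*(K2*?nh))"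
      using l1h nd A1 by (intro mult_mono mult_left_mono) auto
     also have "... <= e/(3*X)*?nh"
     proof -
      have "?N*((A + 1)*(K2*?nh)) <= e/(3*X)" using nhs(4) X0 by (simp add: pos_le_divide_eq mult_ac)
      then have "?N*((A + 1)*(K2*?nh))*?nh <= e/(3*X)*?nh" by (intro mult_right_mono) auto
      then show ?thesis by (simp add: mult_ac)
     qed
     finally show ?thesis .
    qed
    ultimately show ?thesis unfolding b_def by linarith
   qed
   have b0: "0 <= b" using e X0 by (simp add: b_def)
   have A\<omega>: "0 <= A*?\<omega>" using A1 \<omega>0 by simp
   have "norm (ee 1) <= (norm (ee 0) + b)*exp (A*?\<omega>*1)" by (rule gronwall_derivative[OF eed eeb A\<omega> b0]) auto
   moreover have "norm (ee 0) <= e/(3*X)*?nh"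
   proof -
    have "ee 0 = Ph u' - Ph u - lc q Y (%j. \<Sum>i\<in>UNIV. (u' - u) $ i * \<beta> u i j) (Ph u)"
     using ga(2)[OF u] ga(2)[OF u'] ta0[OF u] by (simp add: ee_def v_def tah_def lc_def h_def)
    then show ?thesis using h1(2) u u' nhs(1) unfolding h_def by simp
   qed
   ultimately have "norm (ee 1) <= (e/(3*X)*?nh + b)*X"
    using X0 by (smt (verit) X_def mult_right_mono mult_1_right)
   also have "... = e*?nh" using X0 by (simp add: b_def field_simps)
   finally have "norm (ee 1) <= e*?nh" .
   moreover have "ee 1 = ?Ph u' - ?Ph u - lc q Y (%j. \<Sum>i\<in>UNIV. (u' - u) $ i*ta (u, i) j 1) (?Ph u)"
    by (simp add: ee_def v_def tah_def Ph1[OF u] Ph1[OF u'] h_def)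
   ultimately show "norm (?Ph u' - ?Ph u - lc q Y (%j. \<Sum>i\<in>UNIV. (u' - u) $ i*ta (u, i) j 1) (?Ph u)) <= e*norm (u' - u)"
    by (simp add: h_def)
  qed
 qed
 show ?thesis unfolding pstruct_def
 proof (intro conjI)
  show "EX \<beta>. (ALL u:?U. ALL i. ALL j<q. \<bar>\<beta> u i j - iot (P \<union> P') (axis i 1) j\<bar> <= ep + 6 * \<mu>) &
   (ALL e>0. EX h0>0. ALL u:?U. ALL u':?U. norm (u' - u) < h0 -->
    norm (?Ph u' - ?Ph u - lc q Y (%j. \<Sum>i\<in>UNIV. (u' - u) $ i * \<beta> u i j) (?Ph u)) <= e*norm (u' - u))"
   using c3 c4 by (intro exI[of _ "%u i j. ta (u, i) j 1"]) blast
 qed (use c0 c1 c2 in blast)+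
qed

end

section \<open>The parametrisation in frame coordinates\<close>

context cgeomI
begin

text \<open>R^I realised as a coordinate subspace of R^n, since the leaf dimension varies and cannot
  be fixed as a type.\<close>

definition RI :: "(real^'n) set" where "RI = {w. ALL i. i \<notin> I --> w $ i = 0}"

definition ZZ :: "real^'n => real^'n => real^'n" where "ZZ y w = (\<Sum>i\<in>I. w $ i *\<^sub>R Y (ph i) y)"

text \<open>Acting as the identity on the coordinates outside \<open>I\<close> makes such a map (for
  \<eta> < 1) invertible on all of R^n, from which its invertibility on \<open>RI\<close> is read
  off.\<close>

definition nearI :: "real => (real^'n => real^'n) => bool" where
 "nearI \<eta> B \<longleftrightarrow> linear B & (ALL h. norm (B h - h) <= \<eta>*norm h) & (ALL h:RI. B h : RI) & (ALL h. (ALL i:I. h $ i = 0) --> B h = h)"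

lemma subspace_RI: "subspace RI" unfolding RI_def subspace_def by auto
lemma closed_RI: "closed RI" using subspace_RI by (rule closed_subspace)

lemma linear_ZZ: "linear (ZZ y)"
 unfolding ZZ_def by (intro linearI) (simp_all add: scaleR_left_distrib sum.distrib scaleR_sum_right)

lemma ZZ_lc: "ZZ y w = lc q Y (iot I w) y" using iot_lc[of I w y] by (simp add: ZZ_def)

lemma sum_abs_le_card_norm: "(\<Sum>i\<in>P. \<bar>h $ i\<bar>) <= real CARD('n)*norm (h::real^'n)"
 using S1_le[of P h] by (simp add: S1_def)

lemma nearI_construct:
 assumes "!!i. i : I ==> w i : RI & norm (w i) <= dl" and "0 <= dl"
 shows "nearI (real CARD('n)*dl) (%h. h + (\<Sum>i\<in>I. h $ i *\<^sub>R w i))"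
 unfolding nearI_def
proof (intro conjI allI ballI impI)
 show "linear (%h. h + (\<Sum>i\<in>I. h $ i *\<^sub>R w i))"
  by (intro linearI) (simp_all add: scaleR_left_distrib sum.distrib scaleR_sum_right scaleR_add_right)
 fix h :: "real^'n"
 have "norm (\<Sum>i\<in>I. h $ i *\<^sub>R w i) <= (\<Sum>i\<in>I. norm (h $ i *\<^sub>R w i))" by (rule norm_sum)
 also have "... <= (\<Sum>i\<in>I. \<bar>h $ i\<bar>*dl)" using assms(1) by (intro sum_mono) (auto intro!: mult_left_mono)
 also have "... = (\<Sum>i\<in>I. \<bar>h $ i\<bar>)*dl" by (simp add: sum_distrib_right)
 also have "... <= real CARD('n)*norm h*dl" using assms(2) by (intro mult_right_mono sum_abs_le_card_norm)
 finally show "norm (h + (\<Sum>i\<in>I. h $ i *\<^sub>R w i) - h) <= real CARD('n)*dl*norm h" by (simp add: mult_ac)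
 show "h + (\<Sum>i\<in>I. h $ i *\<^sub>R w i) : RI" if "h : RI"
  using assms(1) that by (intro subspace_add[OF subspace_RI] subspace_sum[OF subspace_RI] subspace_scale[OF subspace_RI]) auto
qed simp

lemma l1_bound_lc:
 assumes "!!j. j < q ==> \<bar>ta j\<bar> <= T" "0 <= T" "!!j. j < q ==> norm (Y j y) <= M" "0 <= M"
 shows "norm (lc q Y ta y) <= real q*T*M"
proof -
 have "norm (lc q Y ta y) <= l1 q ta*M" using assms by (intro lc_norm_le)
 also have "... <= real q*T*M" using assms by (intro mult_right_mono l1_le) auto
 finally show ?thesis .
qed

text \<open>Neumann iteration. Let \<open>w\<close> be the frame coordinates at \<open>z\<close> of
  the combination \<open>ta\<close>. The difference \<xi> of the coefficients gives zero at
  \<open>z\<close>, hence its transport gives zero at \<open>Ph u\<close>, and subtracting that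
  transport leaves coefficients at most half as large. The geometric series accounts for the factor
  2.\<close>

lemma frame_bound:
 assumes st: "pstruct Lz z rh Ph I ep \<kappa>" and u: "u : cball 0 rh"
  and a: "!!m. m < q ==> EX a:RI. (ALL i. \<bar>a $ i\<bar> <= Ca) & Y m z = ZZ z a"
  and Ca: "0 <= Ca" and ep: "0 <= ep" "real Q*ep * (1 + real CARD('n)*(real Q*Ca)) <= 1/2"
  and ta: "!!j. j < q ==> \<bar>ta j\<bar> <= T" and T: "0 <= T"
 shows "EX w:RI. norm w <= 2*(real CARD('n)*(real Q*Ca))*T & lc q Y ta (Ph u) = ZZ (Ph u) w"
proof -
 let ?K = "real CARD('n)*(real Q*Ca)" and ?y = "Ph u"
 have K0: "0 <= ?K" using Ca by simp
 have tr: "ALL u:cball 0 rh. EX t :: nat => nat => real. (ALL m<q. ALL j<q. \<bar>t m j - (if m = j then 1 else 0)\<bar> <= ep) &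
    (ALL ta. norm (lc q Y ta z) <= \<kappa>*norm (lc q Y (%j. \<Sum>m<q. ta m*t m j) (Ph u)) &
      norm (lc q Y (%j. \<Sum>m<q. ta m*t m j) (Ph u)) <= \<kappa>*norm (lc q Y ta z))"
  using st unfolding pstruct_def by blast
 obtain t :: "nat => nat => real" where t: "!!m j. m < q ==> j < q ==> \<bar>t m j - (if m = j then 1 else 0)\<bar> <= ep"
   and tk: "!!ta. norm (lc q Y (%j. \<Sum>m<q. ta m*t m j) ?y) <= \<kappa>*norm (lc q Y ta z)"
  using bspec[OF tr u] by blast
 have "ALL m. EX a. m < q --> a : RI & (ALL i. \<bar>a $ i\<bar> <= Ca) & Y m z = ZZ z a" using a by blast
 from choice[OF this] obtain a where a: "!!m. m < q ==> a m : RI" "!!m i. m < q ==> \<bar>a m $ i\<bar> <= Ca" "!!m. m < q ==> Y m z = ZZ z (a m)" by blast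
 have step: "EX w:RI. EX ta'. norm w <= ?K*T & (ALL j<q. \<bar>ta' j\<bar> <= T/2) & lc q Y ta ?y = ZZ ?y w + lc q Y ta' ?y"
  if ta: "!!j. j < q ==> \<bar>ta j\<bar> <= T" and T: "0 <= T" for ta T
 proof -
  define w where "w = (\<Sum>m<q. ta m *\<^sub>R a m)"
  have wI: "w : RI" unfolding w_def using a(1) by (intro subspace_sum[OF subspace_RI] subspace_scale[OF subspace_RI]) auto
  have wi: "\<bar>w $ i\<bar> <= real Q*Ca*T" for i
  proof -
   have "w $ i = (\<Sum>m<q. ta m*a m $ i)" by (simp add: w_def)
   then have "\<bar>w $ i\<bar> <= (\<Sum>m<q. \<bar>ta m*a m $ i\<bar>)" by (simp only: sum_abs)
   also have "... <= (\<Sum>m<q. T*Ca)" using ta a(2) T by (intro sum_mono) (simp add: abs_mult mult_mono)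
   also have "... = real q*(T*Ca)" by simp
   also have "... <= real Q*(T*Ca)" using qQ T Ca by (intro mult_right_mono) auto
   finally show ?thesis by (simp add: mult_ac)
  qed
  have nw: "norm w <= ?K*T"
  proof -
   have "norm w <= (\<Sum>i\<in>UNIV. \<bar>w $ i\<bar>)" by (rule norm_le_l1_cart)
   also have "... <= (\<Sum>i\<in>(UNIV::'n set). real Q*Ca*T)" using wi by (intro sum_mono)
   finally show ?thesis by (simp add: mult_ac)
  qed
  define \<xi> where "\<xi> j = ta j - iot I w j" for j
  have iw: "\<bar>iot I w j\<bar> <= ?K*T" for j
  proof -
   have "\<bar>iot I w j\<bar> <= (\<Sum>i\<in>I. \<bar>if ph i = j then w $ i else 0\<bar>)" unfolding iot_def by (rule sum_abs)
   also have "... <= (\<Sum>i\<in>I. real Q*Ca*T)" using wi Ca T by (intro sum_mono) auto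
   also have "... = real (card I)*(real Q*Ca*T)" by simp
   also have "... <= real CARD('n)*(real Q*Ca*T)" using Ca T card_mono[of UNIV I] by (intro mult_right_mono) auto
   finally show ?thesis by (simp add: mult_ac)
  qed
  have \<xi>b: "\<bar>\<xi> j\<bar> <= (1 + ?K)*T" if "j < q" for j
  proof -
   have "\<bar>\<xi> j\<bar> <= T + ?K*T" using ta[OF that] iw[of j] unfolding \<xi>_def by linarith
   then show ?thesis by (simp add: algebra_simps)
  qed
  have lcz: "lc q Y \<xi> z = 0"
  proof -
   interpret lin: linear "ZZ z" by (rule linear_ZZ)
   have "lc q Y ta z = (\<Sum>m<q. ta m *\<^sub>R ZZ z (a m))" using a(3) by (simp add: lc_def)
   also have "... = ZZ z w" by (simp add: w_def lin.sum lin.scale)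
   finally have "lc q Y ta z = lc q Y (iot I w) z" by (simp add: ZZ_lc)
   then show ?thesis unfolding \<xi>_def[abs_def] lc_diff[symmetric] by simp
  qed
  define ta' where "ta' j = \<xi> j - (\<Sum>m<q. \<xi> m*t m j)" for j
  have "lc q Y (%j. \<Sum>m<q. \<xi> m*t m j) ?y = 0" using tk[of \<xi>] lcz by simp
  then have "lc q Y \<xi> ?y = lc q Y ta' ?y" unfolding ta'_def[abs_def] lc_diff[symmetric] by simp
  moreover have "lc q Y ta ?y = ZZ ?y w + lc q Y \<xi> ?y" unfolding ZZ_lc lc_add \<xi>_def by simp
  moreover have "\<bar>ta' j\<bar> <= T/2" if j: "j < q" for j
  proof -
   have "ta' j = (\<Sum>m<q. \<xi> m*((if m = j then 1 else 0) - t m j))"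
   proof -
    have "(\<Sum>m<q. \<xi> m*((if m = j then 1 else 0) - t m j)) = (\<Sum>m<q. (if m = j then \<xi> m else 0) - \<xi> m*t m j)"
     by (intro sum.cong refl) (auto simp: right_diff_distrib)
    then show ?thesis using j by (simp add: ta'_def sum_subtractf)
   qed
   also have "\<bar>...\<bar> <= (\<Sum>m<q. \<bar>\<xi> m*((if m = j then 1 else 0) - t m j)\<bar>)" by (rule sum_abs)
   also have "... <= (\<Sum>m<q. ((1 + ?K)*T)*ep)"
   proof (rule sum_mono)
    fix m assume m: "m : {..<q}"
    have "\<bar>(if m = j then 1 else 0) - t m j\<bar> <= ep" using t[of m j] m j by (simp only: abs_minus_commute lessThan_iff)
    then show "\<bar>\<xi> m*((if m = j then 1 else 0) - t m j)\<bar> <= ((1 + ?K)*T)*ep"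
     unfolding abs_mult using \<xi>b[of m] m K0 T by (intro mult_mono) auto
   qed
   also have "... = real q*(((1 + ?K)*T)*ep)" by simp
   also have "... <= real Q*(((1 + ?K)*T)*ep)" using qQ K0 T ep by (intro mult_right_mono) auto
   also have "... = (real Q*ep * (1 + ?K))*T" by (simp add: mult_ac)
   also have "... <= 1/2*T" using ep T by (intro mult_right_mono) auto
   finally show ?thesis by simp
  qed
  ultimately show ?thesis using wI nw by (intro bexI[of _ w] exI[of _ ta']) auto
 qed
 have iter: "EX w:RI. EX ta'. norm w <= ?K*T*(2 - 2*(1/2)^r) & (ALL j<q. \<bar>ta' j\<bar> <= T*(1/2)^r) & lc q Y ta ?y = ZZ ?y w + lc q Y ta' ?y" for r
 proof (induction r)
  case 0
  show ?case using ta subspace_0[OF subspace_RI] linear_0[OF linear_ZZ] by (intro bexI[of _ 0] exI[of _ ta]) auto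
 next
  case (Suc r)
  then obtain w ta' where w: "w : RI" "norm w <= ?K*T*(2 - 2*(1/2)^r)" "!!j. j < q ==> \<bar>ta' j\<bar> <= T*(1/2)^r" "lc q Y ta ?y = ZZ ?y w + lc q Y ta' ?y" by blast
  have "0 <= T*(1/2)^r" using T by simp
  from step[of ta' "T*(1/2)^r", OF w(3) this] obtain w' ta'' where w': "w' : RI" "norm w' <= ?K*(T*(1/2)^r)" "ALL j<q. \<bar>ta'' j\<bar> <= T*(1/2)^r/2" "lc q Y ta' ?y = ZZ ?y w' + lc q Y ta'' ?y" by blast
  have "norm (w + w') <= ?K*T*(2 - 2*(1/2)^r) + ?K*(T*(1/2)^r)" using norm_triangle_ineq[of w w'] w(2) w'(2) by linarith
  also have "... = ?K*T*(2 - 2*(1/2)^Suc r)" by (simp add: algebra_simps)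
  finally show ?case using w w' subspace_add[OF subspace_RI] linear_add[OF linear_ZZ]
   by (intro bexI[of _ "w + w'"] exI[of _ ta'']) auto
 qed
 define R where "R = 2*?K*T"
 define S where "S = ZZ ?y ` (cball 0 R \<inter> RI)"
 have "compact S" unfolding S_def
  by (intro compact_continuous_image linear_continuous_on linear_conv_bounded_linear[THEN iffD1] linear_ZZ compact_Int_closed compact_cball closed_RI)
 then have clS: "closed S" by (rule compact_imp_closed)
 obtain M where M0: "0 <= M" and M: "!!j. j < q ==> norm (Y j ?y) <= M"
 proof (rule that[of "\<Sum>j<q. norm (Y j ?y)"])
  show "norm (Y j ?y) <= (\<Sum>j<q. norm (Y j ?y))" if "j < q" for j using that by (intro member_le_sum) auto
 qed (simp add: sum_nonneg)
 \<comment> \<open>The remainders tend to zero and \<open>S\<close> is compact, so closedness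
   replaces the construction of a limit of the coordinates.\<close>
 have "lc q Y ta ?y : closure S"
  unfolding closure_approachable
 proof (intro allI impI)
  fix e :: real assume e: "0 < e"
  obtain r where r: "(1/2::real)^r < e/(real q*T*M + 1)"
   using real_arch_pow_inv[of "e/(real q*T*M + 1)" "1/2"] e T M0 by (auto simp: add_nonneg_pos)
  obtain w ta' where w: "w : RI" "norm w <= ?K*T*(2 - 2*(1/2)^r)" "!!j. j < q ==> \<bar>ta' j\<bar> <= T*(1/2)^r" "lc q Y ta ?y = ZZ ?y w + lc q Y ta' ?y"
   using iter[of r] by blast
  have "?K*T*(2 - 2*(1/2)^r) <= ?K*T*2" using K0 T by (intro mult_left_mono) auto
  then have "norm w <= R" using w(2) by (simp add: R_def mult_ac)
  then have "ZZ ?y w : S" unfolding S_def using w(1) by auto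
  moreover have "norm (lc q Y ta' ?y) < e"
  proof -
   have "norm (lc q Y ta' ?y) <= real q*(T*(1/2)^r)*M" using w(3) T M M0 by (intro l1_bound_lc) auto
   also have "... = (real q*T*M)*(1/2)^r" by (simp add: mult_ac)
   also have "... <= (real q*T*M + 1)*(1/2)^r" by (intro mult_right_mono) auto
   also have "... < e"
   proof -
    have "0 < real q*T*M + 1" using T M0 by (simp add: add_nonneg_pos)
    from r[unfolded pos_less_divide_eq[OF this]] show ?thesis by (simp add: mult.commute)
   qed
   finally show ?thesis .
  qed
  ultimately show "EX y:S. dist y (lc q Y ta ?y) < e" using w(4) by (intro bexI[of _ "ZZ ?y w"]) (auto simp: dist_norm norm_minus_commute)
 qed
 then have "lc q Y ta ?y : S" using clS by simp
 then show ?thesis by (auto simp: S_def R_def)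
qed

text \<open>The same data read in the frame \<open>Y (ph i)\<close>, \<open>i \<in> I\<close>: \<open>B u\<close> is the derivative of \<open>Ph\<close> at \<open>u\<close>, \<open>T u\<close> the transport from \<open>z\<close> to
  \<open>Ph u\<close>. Both are close to the identity.\<close>

definition zstruct :: "real^'n => real => (real^'n => real^'n) => real => real => real => (real^'n => real^'n => real^'n) => (real^'n => real^'n => real^'n) => bool" where
 "zstruct z rh Ph \<eta> \<kappa> Cw B T \<longleftrightarrow>
  (ALL u:cball 0 rh. nearI \<eta> (B u) & nearI \<eta> (T u) &
    (ALL w:RI. norm (ZZ z w) <= \<kappa>*norm (ZZ (Ph u) (T u w)) & norm (ZZ (Ph u) (T u w)) <= \<kappa>*norm (ZZ z w))) &
  (ALL u:cball 0 rh. ALL ta t. (ALL j<q. \<bar>ta j\<bar> <= t) --> 0 <= t --> (EX w:RI. norm w <= Cw*t & lc q Y ta (Ph u) = ZZ (Ph u) w)) &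
  (ALL e>0. EX h0>0. ALL u:cball 0 rh \<inter> RI. ALL u':cball 0 rh \<inter> RI. norm (u' - u) < h0 -->
    norm (Ph u' - Ph u - ZZ (Ph u) (B u (u' - u))) <= e*norm (u' - u))"

text \<open>The deviations of \<beta> and \<open>t\<close> from the identity have size at most
  \<open>ep\<close>; \<open>frame_bound\<close> rewrites each as a frame vector of norm at most
  \<open>Cw*ep\<close>. These vectors are the columns of \<open>B u\<close> and \<open>T u\<close>
  minus the identity, and summing over the coordinates gives \<eta>.\<close>

lemma zstruct_exists:
 assumes st: "pstruct Lz z rh Ph I ep \<kappa>"
  and a: "!!m. m < q ==> EX a:RI. (ALL i. \<bar>a $ i\<bar> <= Ca) & Y m z = ZZ z a"
  and Ca: "0 <= Ca" and ep: "0 <= ep" "real Q*ep * (1 + real CARD('n)*(real Q*Ca)) <= 1/2"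
  and Cw: "Cw = 2*(real CARD('n)*(real Q*Ca))" and \<eta>: "\<eta> = real CARD('n)*(Cw*ep)"
 shows "EX B T. zstruct z rh Ph \<eta> \<kappa> Cw B T"
proof -
 let ?U = "cball (0::real^'n) rh"
 have Cw0: "0 <= Cw" using Ca by (simp add: Cw)
 have fb: "EX w:RI. norm w <= Cw*T & lc q Y ta (Ph u) = ZZ (Ph u) w" if "u : ?U" "!!j. j < q ==> \<bar>ta j\<bar> <= T" "0 <= T" for u ta T
  unfolding Cw by (rule frame_bound[OF st that(1) a Ca ep that(2,3)])
 obtain \<beta> where \<beta>: "!!u i j. u : ?U ==> j < q ==> \<bar>\<beta> u i j - iot I (axis i 1) j\<bar> <= ep"
  and ex: "!!e. 0 < e ==> EX h0>0. ALL u:?U. ALL u':?U. norm (u' - u) < h0 -->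
    norm (Ph u' - Ph u - lc q Y (%j. \<Sum>i\<in>UNIV. (u' - u) $ i * \<beta> u i j) (Ph u)) <= e*norm (u' - u)"
  using st unfolding pstruct_def by blast
 have tr: "ALL u. EX t. u : ?U --> (ALL m<q. ALL j<q. \<bar>t m j - (if m = j then 1 else 0)\<bar> <= ep) &
    (ALL ta. norm (lc q Y ta z) <= \<kappa>*norm (lc q Y (%j. \<Sum>m<q. ta m*t m j) (Ph u)) &
      norm (lc q Y (%j. \<Sum>m<q. ta m*t m j) (Ph u)) <= \<kappa>*norm (lc q Y ta z))"
  using st unfolding pstruct_def by blast
 from choice[OF tr] obtain t where t: "!!u m j. u : ?U ==> m < q ==> j < q ==> \<bar>t u m j - (if m = j then 1 else 0)\<bar> <= ep"
  and tk: "!!u ta. u : ?U ==> norm (lc q Y ta z) <= \<kappa>*norm (lc q Y (%j. \<Sum>m<q. ta m*t u m j) (Ph u))"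
    "!!u ta. u : ?U ==> norm (lc q Y (%j. \<Sum>m<q. ta m*t u m j) (Ph u)) <= \<kappa>*norm (lc q Y ta z)" by blast
 have axRI: "iot I (axis i 1) j = (if ph i = j then 1 else 0)" if "i : I" for i j
 proof -
  have "iot I (axis i 1) j = (\<Sum>i'\<in>I. if i = i' then (if ph i' = j then 1 else 0) else 0)"
   unfolding iot_def by (intro sum.cong) (auto simp: axis_def)
  then show ?thesis using that by simp
 qed
 define wB where "wB u i = (SOME w. w : RI & norm w <= Cw*ep & lc q Y (%j. \<beta> u i j - iot I (axis i 1) j) (Ph u) = ZZ (Ph u) w)" for u i
 define wT where "wT u i = (SOME w. w : RI & norm w <= Cw*ep & lc q Y (%j. t u (ph i) j - iot I (axis i 1) j) (Ph u) = ZZ (Ph u) w)" for u i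
 have wB: "wB u i : RI" "norm (wB u i) <= Cw*ep" "lc q Y (%j. \<beta> u i j - iot I (axis i 1) j) (Ph u) = ZZ (Ph u) (wB u i)" if "u : ?U" for u i
 proof -
  have "EX w. w : RI & norm w <= Cw*ep & lc q Y (%j. \<beta> u i j - iot I (axis i 1) j) (Ph u) = ZZ (Ph u) w"
   using fb[OF that, of "%j. \<beta> u i j - iot I (axis i 1) j" ep] \<beta>[OF that] ep by blast
  from someI_ex[OF this] show "wB u i : RI" "norm (wB u i) <= Cw*ep" "lc q Y (%j. \<beta> u i j - iot I (axis i 1) j) (Ph u) = ZZ (Ph u) (wB u i)"
   unfolding wB_def by blast+
 qed
 have wT: "wT u i : RI" "norm (wT u i) <= Cw*ep" "lc q Y (%j. t u (ph i) j - iot I (axis i 1) j) (Ph u) = ZZ (Ph u) (wT u i)" if u: "u : ?U" and i: "i : I" for u i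
 proof -
  have "\<bar>t u (ph i) j - iot I (axis i 1) j\<bar> <= ep" if "j < q" for j using t[OF u phq[OF i] that] axRI[OF i, of j] by simp
  then have "EX w. w : RI & norm w <= Cw*ep & lc q Y (%j. t u (ph i) j - iot I (axis i 1) j) (Ph u) = ZZ (Ph u) w"
   using fb[OF u, of "%j. t u (ph i) j - iot I (axis i 1) j" ep] ep by blast
  from someI_ex[OF this] show "wT u i : RI" "norm (wT u i) <= Cw*ep" "lc q Y (%j. t u (ph i) j - iot I (axis i 1) j) (Ph u) = ZZ (Ph u) (wT u i)"
   unfolding wT_def by blast+
 qed
 define B where "B u h = h + (\<Sum>i\<in>I. h $ i *\<^sub>R wB u i)" for u h
 define T where "T u h = h + (\<Sum>i\<in>I. h $ i *\<^sub>R wT u i)" for u h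
 have nB: "nearI \<eta> (B u)" if "u : ?U" for u unfolding B_def[abs_def] \<eta> using wB[OF that] Cw0 ep by (intro nearI_construct) auto
 have nT: "nearI \<eta> (T u)" if "u : ?U" for u unfolding T_def[abs_def] \<eta> using wT[OF that] Cw0 ep by (intro nearI_construct) auto
 \<comment> \<open>Translates a map given by its columns in the frame back into a combination of all
   fields.\<close>
 have conv: "ZZ y (h + (\<Sum>i\<in>I. h $ i *\<^sub>R w i)) = lc q Y (%j. \<Sum>i\<in>I. h $ i*b i j) y"
  if h: "h : RI" and w: "!!i. i : I ==> lc q Y (%j. b i j - iot I (axis i 1) j) y = ZZ y (w i)" for y h b w
 proof -
  interpret lin: linear "ZZ y" by (rule linear_ZZ)
  have "ZZ y (h + (\<Sum>i\<in>I. h $ i *\<^sub>R w i)) = lc q Y (iot I h) y + (\<Sum>i\<in>I. h $ i *\<^sub>R lc q Y (%j. b i j - iot I (axis i 1) j) y)"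
   using w by (simp add: lin.add lin.sum lin.scale ZZ_lc[of y h])
  also have "(\<Sum>i\<in>I. h $ i *\<^sub>R lc q Y (%j. b i j - iot I (axis i 1) j) y) = lc q Y (%j. \<Sum>i\<in>I. h $ i*(b i j - iot I (axis i 1) j)) y"
   unfolding lc_def scaleR_sum_right scaleR_sum_left scaleR_scaleR by (rule sum.swap)
  also have "lc q Y (iot I h) y + ... = lc q Y (%j. iot I h j + (\<Sum>i\<in>I. h $ i*(b i j - iot I (axis i 1) j))) y" by (rule lc_add)
  also have "(%j. iot I h j + (\<Sum>i\<in>I. h $ i*(b i j - iot I (axis i 1) j))) = (%j. \<Sum>i\<in>I. h $ i*b i j)"
  proof
   fix j
   have "iot I h j = (\<Sum>i\<in>I. h $ i*iot I (axis i 1) j)"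
    unfolding iot_axis[of I h j] using h by (intro sum.mono_neutral_right) (auto simp: RI_def)
   then show "iot I h j + (\<Sum>i\<in>I. h $ i*(b i j - iot I (axis i 1) j)) = (\<Sum>i\<in>I. h $ i*b i j)"
    by (simp add: right_diff_distrib sum_subtractf)
  qed
  finally show ?thesis .
 qed
 have Tk: "norm (ZZ z w) <= \<kappa>*norm (ZZ (Ph u) (T u w)) & norm (ZZ (Ph u) (T u w)) <= \<kappa>*norm (ZZ z w)" if u: "u : ?U" and w: "w : RI" for u w
 proof -
  have "ZZ (Ph u) (T u w) = lc q Y (%j. \<Sum>i\<in>I. w $ i*t u (ph i) j) (Ph u)"
   unfolding T_def by (rule conv[OF w wT(3)[OF u]])
  also have "(%j. \<Sum>i\<in>I. w $ i*t u (ph i) j) = (%j. \<Sum>m<q. iot I w m*t u m j)"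
  proof
   fix j
   have "(\<Sum>m<q. iot I w m*t u m j) = (\<Sum>m<q. \<Sum>i\<in>I. if ph i = m then w $ i*t u m j else 0)"
    unfolding iot_def sum_distrib_right by (intro sum.cong) auto
   also have "... = (\<Sum>i\<in>I. \<Sum>m<q. if ph i = m then w $ i*t u m j else 0)" by (rule sum.swap)
   also have "... = (\<Sum>i\<in>I. w $ i*t u (ph i) j)" using phq by (intro sum.cong) auto
   finally show "(\<Sum>i\<in>I. w $ i*t u (ph i) j) = (\<Sum>m<q. iot I w m*t u m j)" by simp
  qed
  finally show ?thesis using tk[OF u, of "iot I w"] by (simp add: ZZ_lc)
 qed
 have exB: "EX h0>0. ALL u:?U \<inter> RI. ALL u':?U \<inter> RI. norm (u' - u) < h0 -->
    norm (Ph u' - Ph u - ZZ (Ph u) (B u (u' - u))) <= e*norm (u' - u)" if e: "0 < e" for e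
 proof -
  obtain h0 where h0: "h0 > 0" "ALL u:?U. ALL u':?U. norm (u' - u) < h0 -->
    norm (Ph u' - Ph u - lc q Y (%j. \<Sum>i\<in>UNIV. (u' - u) $ i * \<beta> u i j) (Ph u)) <= e*norm (u' - u)" using ex[OF e] by blast
  have eq: "ZZ (Ph u) (B u (u' - u)) = lc q Y (%j. \<Sum>i\<in>UNIV. (u' - u) $ i * \<beta> u i j) (Ph u)" if "u : ?U \<inter> RI" "u' : ?U \<inter> RI" for u u'
  proof -
   have h: "u' - u : RI" using that by (intro subspace_diff[OF subspace_RI]) auto
   have "ZZ (Ph u) (B u (u' - u)) = lc q Y (%j. \<Sum>i\<in>I. (u' - u) $ i * \<beta> u i j) (Ph u)"
    unfolding B_def by (rule conv[OF h wB(3)]) (use that in auto)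
   also have "(%j. \<Sum>i\<in>I. (u' - u) $ i * \<beta> u i j) = (%j. \<Sum>i\<in>UNIV. (u' - u) $ i * \<beta> u i j)"
    using h unfolding RI_def by (intro ext sum.mono_neutral_left) auto
   finally show ?thesis .
  qed
  show ?thesis
  proof (intro exI[of _ h0] conjI ballI impI h0(1))
   fix u u' assume *: "u : ?U \<inter> RI" "u' : ?U \<inter> RI" "norm (u' - u) < h0"
   show "norm (Ph u' - Ph u - ZZ (Ph u) (B u (u' - u))) <= e*norm (u' - u)"
    unfolding eq[OF *(1,2)] using h0(2)*by blast
  qed
 qed
 have "zstruct z rh Ph \<eta> \<kappa> Cw B T" unfolding zstruct_def using nB nT Tk fb exB by blast
 then show ?thesis by blast
qed

end

section \<open>Lifting paths through the parametrisation\<close>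

context cgeomI
begin

lemma nearI_mono: "nearI \<eta> B ==> \<eta> <= \<eta>' ==> nearI \<eta>' B"
 unfolding nearI_def by (meson mult_right_mono norm_ge_zero order_trans)

text \<open>8/7 = 1/(1 - 1/8). The preimage of a vector of \<open>RI\<close> lies in
  \<open>RI\<close>, because \<open>B\<close> fixes its component outside \<open>I\<close> and maps
  the rest into \<open>RI\<close>.\<close>

lemma nearI_inverse:
 assumes B: "nearI (1/8) B" and w: "w : RI"
 shows "EX k:RI. B k = w & norm k <= 8/7*norm w"
proof -
 have lin: "linear B" and near: "!!h. norm (B h - h) <= 1/8*norm h" and RI: "!!h. h : RI ==> B h : RI"
  and triv: "!!h. (ALL i:I. h $ i = 0) ==> B h = h" using B by (auto simp: nearI_def)
 have lower: "norm h <= 8/7*norm (B h)" for h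
  using near[of h] norm_triangle_sub[of h "B h"] by (simp add: norm_minus_commute)
 have "ALL h. B h = 0 --> h = 0" using lower by (metis mult_zero_right norm_eq_zero norm_le_zero_iff)
 then have "inj B" by (simp add: linear_injective_0[OF lin])
 then have "surj B" using linear_injective_imp_surjective[OF lin] by simp
 then obtain k where k: "B k = w" by (metis surjD)
 define kI where "kI = (\<chi> i. if i : I then k $ i else 0)"
 have kI: "kI : RI" by (simp add: kI_def RI_def)
 have "B (k - kI) = k - kI" by (rule triv) (simp add: kI_def)
 then have d: "k - kI = w - B kI" using k linear_diff[OF lin, of k kI] by simp
 have "w - B kI : RI" by (intro subspace_diff[OF subspace_RI] w RI kI)
 then have "k - kI : RI" using d by simp
 then have "k : RI" using subspace_add[OF subspace_RI _ kI] by fastforce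
 then show ?thesis using k lower[of k] by blast
qed

lemma lipschitz_on_compact:
 assumes C: "compact C" "C \<subseteq> Om"
 obtains L where "0 <= L" "!!j y y'. j < q ==> y : C ==> y' : C ==> norm (Y j y - Y j y') <= L*norm (y - y')"
proof -
 obtain A0 where A0: "0 <= A0" "!!j y v. j < q ==> y : C ==> norm (frechet_derivative (Y j) (at y) v) <= A0*norm v"
  by (rule C1_family_derivative_bounded[where Y=Y and q=q, OF C C1]) auto
 obtain r where r: "0 < r" "!!j y y'. j < q ==> y : C ==> norm (y' - y) <= r ==> norm (Y j y' - Y j y) <= (A0 + 1)*norm (y' - y)"
  by (rule C1_family_lipschitz_tube[where Y=Y and q=q and A=A0, OF open_Om C C1 A0(2)]) auto
 obtain M where M: "0 <= M" "!!j y. j < q ==> y : C ==> norm (Y j y) <= M" using family_bounded[OF C] by blast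
 show ?thesis
 proof (rule that[of "(A0 + 1) + 2*M/r"])
  show "0 <= (A0 + 1) + 2*M/r" using A0 M r by simp
  fix j y y' assume j: "j < q" and y: "y : C" and y': "y' : C"
  have p: "0 <= (A0 + 1)*norm (y - y')" "0 <= 2*M/r*norm (y - y')" using A0 M r by auto
  show "norm (Y j y - Y j y') <= ((A0 + 1) + 2*M/r)*norm (y - y')"
  proof (cases "norm (y' - y) <= r")
   case True
   then have "norm (Y j y - Y j y') <= (A0 + 1)*norm (y - y')" using r(2)[OF j y True] by (simp add: norm_minus_commute)
   then show ?thesis using p by (simp add: distrib_right)
  next
   case False
   then have "2*M <= 2*M/r*norm (y - y')" using r(1) M(1) by (simp add: field_simps norm_minus_commute mult_left_mono)
   moreover have "norm (Y j y - Y j y') <= M + M" using norm_triangle_ineq4[of "Y j y" "Y j y'"] M(2)[OF j y] M(2)[OF j y'] by linarith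
   ultimately show ?thesis using p by (simp add: distrib_right)
  qed
 qed
qed

lemma zstruct_continuous:
 assumes zs: "zstruct z rh Ph \<eta> \<kappa> Cw B T"
 shows "continuous_on (cball 0 rh \<inter> RI) Ph"
proof (rule continuous_onI)
 fix u and e :: real assume u: "u : cball 0 rh \<inter> RI" and e: "0 < e"
 obtain h0 where h0: "h0 > 0" "ALL u:cball 0 rh \<inter> RI. ALL u':cball 0 rh \<inter> RI. norm (u' - u) < h0 -->
    norm (Ph u' - Ph u - ZZ (Ph u) (B u (u' - u))) <= 1*norm (u' - u)" using zs unfolding zstruct_def by (meson zero_less_one)
 have "bounded_linear (%h. ZZ (Ph u) (B u h))"
  using zs u unfolding zstruct_def nearI_def
  by (auto simp: linear_conv_bounded_linear[symmetric] intro!: linear_compose[of "B u" "ZZ (Ph u)", unfolded comp_def] linear_ZZ)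
 then obtain K where K: "0 < K" "!!h. norm (ZZ (Ph u) (B u h)) <= norm h*K" using bounded_linear.pos_bounded by blast
 show "EX d>0. ALL u':cball 0 rh \<inter> RI. dist u' u < d --> dist (Ph u') (Ph u) <= e"
 proof (intro exI[of _ "min h0 (e/(K + 1))"] conjI ballI impI)
  show "0 < min h0 (e/(K + 1))" using h0 e K by simp
  fix u' assume u': "u' : cball 0 rh \<inter> RI" "dist u' u < min h0 (e/(K + 1))"
  then have "norm (Ph u' - Ph u - ZZ (Ph u) (B u (u' - u))) <= norm (u' - u)" using h0(2) u by (auto simp: dist_norm)
  then have "norm (Ph u' - Ph u) <= (K + 1)*norm (u' - u)"
   using K(2)[of "u' - u"] norm_triangle_sub[of "Ph u' - Ph u" "ZZ (Ph u) (B u (u' - u))"] by (simp add: algebra_simps)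
  also have "... <= e" using u'(2) K by (simp add: dist_norm field_simps)
  finally show "dist (Ph u') (Ph u) <= e" by (simp add: dist_norm)
 qed
qed

text \<open>Paths are lifted through \<open>Ph\<close> by Euler polygons in parameter space; since the image of a compact
  parameter set is closed, approximate lifts suffice.\<close>

lemma path_lifting:
 assumes zs: "zstruct z rh Ph (1/8) \<kappa> Cw B T" and u0: "u0 : cball 0 rh \<inter> RI" and ga0: "ga 0 = Ph u0"
  and h1: "!!e. 0 < e ==> EX d>0. ALL s t. 0 <= s --> s <= t --> t <= 1 --> t - s < d --> norm (ga t - ga s - V s t (ga s)) <= e*(t - s)"
  and h2: "!!s t u. 0 <= s ==> s <= t ==> t <= 1 ==> u : cball 0 rh \<inter> RI ==> norm (V s t (ga s) - V s t (Ph u)) <= L*(t - s)*norm (ga s - Ph u)"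
  and h3: "!!s t u. 0 <= s ==> s <= t ==> t <= 1 ==> u : cball 0 rh \<inter> RI ==> EX w:RI. V s t (Ph u) = ZZ (Ph u) w & norm (w - (t - s) *\<^sub>R g) <= dl*(t - s)"
  and L: "0 <= L" and dl: "0 <= dl" and g: "g : RI" and h4: "norm u0 + norm g + (8*dl + norm g)/7 <= rh"
 shows "EX u:cball 0 rh \<inter> RI. Ph u = ga 1 & norm (u - u0 - g) <= (8*dl + norm g)/7"
proof -
 let ?U = "cball 0 rh \<inter> RI"
 \<comment> \<open>Drift per unit time: inverting \<open>B\<close> gives steps of length up to
   \<open>G\<close> per unit time, and replacing \<open>w\<close> by its preimage costs a further
   eighth of \<open>G\<close>, in total \<open>dl + G/8\<close>.\<close>
 define dl' where "dl' = (8*dl + norm g)/7"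
 define G where "G = 8/7*(norm g + dl)"
 have dl'0: "0 <= dl'" and h4: "norm u0 + norm g + dl' <= rh" and Gdl: "dl + 1/8*G = dl'"
  using dl h4 by (auto simp: dl'_def G_def)
 have nB: "nearI (1/8) (B u)" if "u : ?U" for u using zs that unfolding zstruct_def by blast
 have G0: "0 <= G" using dl by (simp add: G_def)
 define S where "S = {u : ?U. norm (u - u0 - g) <= dl'}"
 have "S = ?U \<inter> cball (u0 + g) dl'" by (auto simp: S_def dist_norm norm_minus_commute algebra_simps)
 then have "compact S" by (simp add: compact_Int_closed closed_RI compact_Int)
 then have cS: "closed (Ph ` S)"
  by (intro compact_imp_closed compact_continuous_image continuous_on_subset[OF zstruct_continuous[OF zs]]) (auto simp: S_def)
 have "ga 1 : closure (Ph ` S)" unfolding closure_approachable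
 proof (intro allI impI)
  fix e0 :: real assume e0: "0 < e0"
  define e where "e = e0/(3*exp L)"
  have e: "0 < e" using e0 by (simp add: e_def)
  obtain d where d: "d > 0" "!!s t. 0 <= s ==> s <= t ==> t <= 1 ==> t - s < d ==> norm (ga t - ga s - V s t (ga s)) <= e*(t - s)" using h1[OF e] by blast
  have "0 < e/(G + 1)" using e G0 by simp
  then obtain h0 where h0: "h0 > 0" "!!u u'. u : ?U ==> u' : ?U ==> norm (u' - u) < h0 ==>
    norm (Ph u' - Ph u - ZZ (Ph u) (B u (u' - u))) <= e/(G + 1)*norm (u' - u)" using zs unfolding zstruct_def by blast
  obtain M :: nat where M: "M > 0" "1/real M < d" "G/real M < h0"
  proof -
   obtain M1 :: nat where M1: "max (1/d) (G/h0) < real M1" using reals_Archimedean2 by blast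
   have "0 < 1/d" using d(1) by simp
   then have "0 < real M1" using M1 by linarith
   then show ?thesis using M1 d(1) h0(1) that[of M1] by (simp add: field_simps)
  qed
  define hh where "hh = 1/real M"
  have hM: "0 < hh" "hh < d" "G*hh < h0" "real M*hh = 1" using M by (auto simp: hh_def)
  \<comment> \<open>After \<open>m\<close> steps of length \<open>hh\<close> the parameter has
    drifted at most proportionally to the elapsed time, and the distance to the path obeys a
    discrete Gronwall bound.\<close>
  have ind: "m <= M ==> EX u:?U. norm (u - u0 - (real m*hh) *\<^sub>R g) <= dl'*(real m*hh) &
    norm (Ph u - ga (real m*hh)) <= 2*e*(real m*hh)*(1 + L*hh) ^ m" for m
  proof (induction m)
   case 0
   then show ?case using u0 ga0 by (intro bexI[of _ u0]) auto
  next
   case (Suc m)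
   define s where "s = real m*hh"
   define t where "t = s + hh"
   from Suc obtain u where u: "u : ?U" "norm (u - u0 - s *\<^sub>R g) <= dl' * s"
    "norm (Ph u - ga s) <= 2*e * s*(1 + L*hh) ^ m" unfolding s_def by auto
   have tS: "real (Suc m)*hh = t" by (simp add: t_def s_def algebra_simps)
   have "real (Suc m)*hh <= real M*hh" using Suc.prems hM(1) by (intro mult_right_mono) auto
   then have st: "0 <= s" "s <= t" "t <= 1" "t - s = hh" using hM unfolding tS by (auto simp: s_def t_def)
   obtain w where w: "w : RI" "V s t (Ph u) = ZZ (Ph u) w" "norm (w - hh *\<^sub>R g) <= dl*hh" using h3[OF st(1-3) u(1)] unfolding st(4) by blast
   obtain k where k: "k : RI" "B u k = w" "norm k <= 8/7*norm w" using nearI_inverse[OF nB[OF u(1)] w(1)] by blast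
   have ng: "norm (hh *\<^sub>R g) = norm g*hh" using hM(1) by simp
   have nw: "norm w <= (norm g + dl)*hh"
    using norm_triangle_sub[of w "hh *\<^sub>R g"] w(3) unfolding ng distrib_right by linarith
   have "8/7*norm w <= 8/7*((norm g + dl)*hh)" using nw by (intro mult_left_mono) auto
   then have nk: "norm k <= G*hh" using k(3) unfolding G_def by (simp only: mult.assoc)
   have "norm (B u k - k) <= 1/8*norm k" using nB[OF u(1)] by (auto simp: nearI_def)
   then have kw: "norm (k - w) <= 1/8*(G*hh)" using nk k(2) by (simp add: norm_minus_commute)
   have kg: "norm (k - hh *\<^sub>R g) <= dl'*hh"
   proof -
    have "norm (k - hh *\<^sub>R g) <= 1/8*(G*hh) + dl*hh" using norm_triangle_ineq[of "k - w" "w - hh *\<^sub>R g"] w(3) kw by simp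
    also have "... = dl'*hh" unfolding Gdl[symmetric] by (simp add: algebra_simps)
    finally show ?thesis .
   qed
   define u' where "u' = u + k"
   have u'1: "norm (u' - u0 - t *\<^sub>R g) <= dl'*t"
   proof -
    have "u' - u0 - t *\<^sub>R g = (u - u0 - s *\<^sub>R g) + (k - hh *\<^sub>R g)" by (simp add: u'_def t_def algebra_simps)
    then have "norm (u' - u0 - t *\<^sub>R g) <= norm (u - u0 - s *\<^sub>R g) + norm (k - hh *\<^sub>R g)" by (simp only: norm_triangle_ineq)
    then have "norm (u' - u0 - t *\<^sub>R g) <= dl' * s + dl'*hh" using u(2) kg by linarith
    also have "... = dl'*t" by (simp add: t_def algebra_simps)
    finally show ?thesis .
   qed
   have u'U: "u' : ?U"
   proof -
    have "norm u' <= norm u0 + norm (t *\<^sub>R g) + norm (u' - u0 - t *\<^sub>R g)"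
     using norm_triangle_ineq[of "u0 + t *\<^sub>R g" "u' - u0 - t *\<^sub>R g"] norm_triangle_ineq[of u0 "t *\<^sub>R g"] by simp
    moreover have "norm (t *\<^sub>R g) <= norm g" using st by (simp add: mult_left_le_one_le)
    moreover have "norm (u' - u0 - t *\<^sub>R g) <= dl'" using u'1 st(3) dl'0 mult_left_le[of t dl'] by linarith
    ultimately have "norm u' <= rh" using h4 by linarith
    moreover have "u' : RI" unfolding u'_def using u(1) k(1) by (intro subspace_add[OF subspace_RI]) auto
    ultimately show ?thesis by simp
   qed
   have "norm (u' - u) < h0" using nk hM(3) by (simp add: u'_def)
   then have "norm (Ph u' - Ph u - ZZ (Ph u) w) <= e/(G + 1)*norm k" using h0(2)[OF u(1) u'U] k(2) by (simp add: u'_def)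
   also have "... <= e/(G + 1)*(G*hh)" using nk e G0 by (intro mult_left_mono) auto
   also have "... <= e*hh"
   proof -
    have "e/(G + 1)*G <= e" using e G0 by (simp add: field_simps)
    then have "e/(G + 1)*G*hh <= e*hh" using hM(1) by (intro mult_right_mono) auto
    then show ?thesis by (simp add: mult.assoc)
   qed
   finally have E1: "norm (Ph u' - Ph u - ZZ (Ph u) w) <= e*hh" .
   have E2: "norm (ga t - ga s - V s t (ga s)) <= e*hh" using d(2)[OF st(1-3)] st(4) hM(2) by simp
   have E3: "norm (V s t (ga s) - V s t (Ph u)) <= L*hh*norm (Ph u - ga s)" using h2[OF st(1-3) u(1)] unfolding st(4) by (simp only: norm_minus_commute)
   have "Ph u' - ga t = (Ph u' - Ph u - ZZ (Ph u) w) - (ga t - ga s - V s t (ga s)) + (Ph u - ga s) - (V s t (ga s) - V s t (Ph u))"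
    using w(2) by simp
   then have "norm (Ph u' - ga t) <= norm (Ph u' - Ph u - ZZ (Ph u) w) + norm (ga t - ga s - V s t (ga s)) + norm (Ph u - ga s) + norm (V s t (ga s) - V s t (Ph u))"
    by (smt (verit) norm_triangle_ineq norm_triangle_ineq4)
   also have "... <= e*hh + e*hh + norm (Ph u - ga s) + L*hh*norm (Ph u - ga s)"
    using E1 E2 E3 by linarith
   also have "... = 2*e*hh + (1 + L*hh)*norm (Ph u - ga s)" by (simp add: algebra_simps)
   also have "... <= 2*e*hh + (1 + L*hh)*(2*e * s*(1 + L*hh) ^ m)"
    using u(3) L hM by (intro add_left_mono mult_left_mono) auto
   also have "... <= 2*e*hh*(1 + L*hh) ^ Suc m + 2*e * s*(1 + L*hh) ^ Suc m"
   proof -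
    have "1 <= (1 + L*hh) ^ Suc m" using L hM by (intro one_le_power) auto
    then have "2*e*hh*1 <= 2*e*hh*(1 + L*hh) ^ Suc m" using e hM by (intro mult_left_mono) auto
    then show ?thesis by (simp add: mult_ac)
   qed
   also have "... = 2*e*t*(1 + L*hh) ^ Suc m" by (simp add: t_def distrib_left distrib_right)
   finally show ?case unfolding tS using u'U u'1 by (intro bexI[of _ u']) auto
  qed
  from ind[of M] obtain u where u: "u : ?U" "norm (u - u0 - g) <= dl'" "norm (Ph u - ga 1) <= 2*e*(1 + L*hh) ^ M" using hM(4) by auto
  have "(1 + L*hh) ^ M <= exp (L*hh) ^ M" using L hM by (intro power_mono exp_ge_add_one_self) auto
  also have "... = exp L" using M(1) by (simp add: exp_of_nat_mult[symmetric] hh_def)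
  finally have "2*e*(1 + L*hh) ^ M <= 2*e*exp L" using e by (intro mult_left_mono) auto
  also have "... < e0" using e0 by (simp add: e_def)
  finally have "dist (Ph u) (ga 1) < e0" using u(3) by (simp add: dist_norm)
  then show "EX y:Ph ` S. dist y (ga 1) < e0" using u by (auto simp: S_def)
 qed
 then show ?thesis using cS by (auto simp: S_def dl'_def)
qed

end

section \<open>The admissible radius and its numerical conditions\<close>

context cgeomI
begin

lemma zstruct_mono:
 assumes "zstruct z rh Ph \<eta> \<kappa> Cw B T" "\<eta> <= \<eta>'" "\<kappa> <= \<kappa>'"
 shows "zstruct z rh Ph \<eta>' \<kappa>' Cw B T"
proof -
 have m: "a <= \<kappa>'*norm v" if "a <= \<kappa>*norm v" for a and v :: "real^'n"
  using that mult_right_mono[OF assms(3), of "norm v"] by simp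
 show ?thesis using assms(1) nearI_mono[OF _ assms(2)] m unfolding zstruct_def by blast
qed

text \<open>With N for \<open>CARD('n)\<close>, the exponents are such that \<open>mu\<close>
  becomes 1/(200*N^3*Q^3), and the conditions in \<open>mu_bounds\<close> involve at most third
  powers of N and Q.\<close>

definition rad :: real where "rad = 1/(200*real CARD('n) ^ 4*real Q ^ 5*A)"
definition mu :: real where "mu = (real Q)\<^sup>2*A*(real CARD('n)*rad)"

lemma realQ1: "1 <= real Q" using Q1 by simp

lemma rad_pos: "0 < rad" using CARD1 realQ1 A1 by (simp add: rad_def)

lemma mu_eq: "mu = 1/(200*real CARD('n) ^ 3*real Q ^ 3)"
 using CARD1 realQ1 A1 by (simp add: mu_def rad_def field_simps power2_eq_square) (simp add: power_def numeral_eq_Suc mult_ac)?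

lemma mu_pos: "0 < mu" using rad_pos CARD1 realQ1 A1 by (simp add: mu_def)

lemma A_card_rad: "A*(real CARD('n)*rad)*real CARD('n) <= 1/200"
proof -
 have "A*(real CARD('n)*rad)*real CARD('n) = 1/(200*(real CARD('n) ^ 2*real Q ^ 5))"
  using CARD1 realQ1 A1 by (simp add: rad_def field_simps power2_eq_square numeral_eq_Suc)
 also have "... <= 1/(200*(1*1))"
  using CARD1 realQ1 by (intro divide_left_mono mult_left_mono mult_mono one_le_power mult_pos_pos) auto
 finally show ?thesis by simp
qed

lemma card_rad: "real CARD('n)*rad <= 1/200"
proof -
 have a: "0 <= real CARD('n)*rad" using rad_pos by simp
 have "1*(real CARD('n)*rad) <= A*(real CARD('n)*rad)" by (rule mult_right_mono[OF A1 a])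
 moreover have "A*(real CARD('n)*rad)*1 <= A*(real CARD('n)*rad)*real CARD('n)"
  using A1 a CARD1 by (intro mult_left_mono) auto
 ultimately show ?thesis using A_card_rad by linarith
qed

text \<open>The third and fourth are the requirements of \<open>zstruct_exists\<close> for the chart
  \<open>FF\<close>, where frame coefficients are at most 1 and the error is 6*mu for each of at
  most N flows. The fifth and sixth are those for \<open>EE\<close> based at a point
  \<open>FF u\<close>: a single flow, but frame coefficients up to 2*N*Q.\<close>

lemma mu_bounds:
 "mu <= 1/200" "6*(mu*real CARD('n)) <= 1"
 "real Q*(6*(mu*real CARD('n)))*(1 + real CARD('n)*(real Q*1)) <= 1/2"
 "real CARD('n)*(2*(real CARD('n)*(real Q*1))*(6*(mu*real CARD('n)))) <= 1/8"
 "real Q*(6*mu)*(1 + real CARD('n)*(real Q*(2*(real CARD('n)*real Q)))) <= 1/2"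
 "real CARD('n)*(2*(real CARD('n)*(real Q*(2*(real CARD('n)*real Q))))*(6*mu)) <= 1/8"
proof -
 let ?N = "real CARD('n)" and ?Q = "real Q"
 have N: "1 <= ?N" and Q: "1 <= ?Q" by (rule CARD1, rule realQ1)
 have NQ: "mu*(?N ^ 3*?Q ^ 3) = 1/200" using N Q by (simp add: mu_eq)
 have le: "mu*(?N ^ a*?Q ^ b) <= 1/200" if "a <= 3" "b <= 3" for a b
 proof -
  have "?N ^ a*?Q ^ b <= ?N ^ 3*?Q ^ 3" using that N Q by (intro mult_mono power_increasing) auto
  then have "mu*(?N ^ a*?Q ^ b) <= mu*(?N ^ 3*?Q ^ 3)" using mu_pos by (intro mult_left_mono) auto
  then show ?thesis using NQ by simp
 qed
 show "mu <= 1/200" using le[of 0 0] by simp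
 show "6*(mu*?N) <= 1" using le[of 1 0] by simp
 show "?Q*(6*(mu*?N))*(1 + ?N*(?Q*1)) <= 1/2"
  using le[of 1 1] le[of 2 2] by (simp add: algebra_simps power2_eq_square)
 show "?N*(2*(?N*(?Q*1))*(6*(mu*?N))) <= 1/8"
  using le[of 3 1] by (simp add: algebra_simps power3_eq_cube)
 show "?Q*(6*mu)*(1 + ?N*(?Q*(2*(?N*?Q)))) <= 1/2"
  using le[of 0 1] le[of 2 3] by (simp add: algebra_simps power2_eq_square power3_eq_cube)
 show "?N*(2*(?N*(?Q*(2*(?N*?Q))))*(6*mu)) <= 1/8"
  using le[of 3 2] by (simp add: algebra_simps power2_eq_square power3_eq_cube)
qed

end

section \<open>The chart of a leaf: injectivity and covering\<close>

locale cframe = cgeomI Om Y q x A Q c I ph for Om :: "(real^'n) set" and Y q x A Q c and I :: "'n set" and ph +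
 fixes il :: "'n list"
 assumes il: "distinct il" "set il = I"
  and frame: "!!m. m < q ==> EX a:RI. (ALL i. \<bar>a $ i\<bar> <= 1) & Y m x = ZZ x a"
  and indep: "!!w. w : RI ==> ZZ x w = 0 ==> w = 0"
begin

definition FF :: "real^'n => real^'n" where
 "FF u = foldl (%z i. flow Om (lc q Y (iot {i} u)) z) x il"

text \<open>The exponential of one combination instead of a composition of flows. \<open>FF\<close>
  fits one-parameter maximal functions, whereas \<open>EE\<close> joins two points by a single
  orbit, which makes injectivity accessible.\<close>

definition EE :: "real^'n => real^'n => real^'n" where
 "EE z v = flow Om (lc q Y (iot I v)) z"

lemma xOm: "x : Om" using base_in_RR[of 0] RR_sub by auto

text \<open>Induction from the right: each step puts one more flow after those already composed,
  adding 6*mu to the error and one factor to the distortion.\<close>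

lemma pstruct_foldl:
 "distinct l ==> set l \<subseteq> I ==>
  pstruct 0 x rad (%u. foldl (%z i. flow Om (lc q Y (iot {i} u)) z) x l) (set l) (6*(mu*real (length l))) (exp (A*(real CARD('n)*rad)) ^ length l)"
proof (induction l rule: rev_induct)
 case Nil
 show ?case using pstruct_const[OF base_in_RR[of 0], of 0 1 rad] by simp
next
 case (snoc i l)
 have len: "length l <= CARD('n)" using snoc.prems(1) distinct_card[of l] card_mono[of UNIV "set l"] by simp
 have st: "pstruct 0 x rad (%u. foldl (%z i. flow Om (lc q Y (iot {i} u)) z) x l) (set l) (6*(mu*real (length l))) (exp (A*(real CARD('n)*rad)) ^ length l)"
  using snoc by auto
 have "mu*real (length l) <= mu*real CARD('n)" using len mu_pos by (intro mult_left_mono) auto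
 then have e1: "6*(mu*real (length l)) <= 1" using mu_bounds(2) by linarith
 have "0 <= A*(real CARD('n)*rad)" using A1 rad_pos by simp
 then have k1: "1 <= exp (A*(real CARD('n)*rad)) ^ length l" by (intro one_le_power) simp
 have "pstruct 0 x rad (%u. flow Om (lc q Y (iot {i} u)) (foldl (%z i. flow Om (lc q Y (iot {i} u)) z) x l)) (set l \<union> {i})
   (6*(mu*real (length l)) + 6*mu) (exp (A*(real CARD('n)*rad)) ^ length l*exp (A*(real CARD('n)*rad)))"
 proof (rule pstruct_step[OF st])
  show "0 + real CARD('n)*rad < 1" using card_rad by simp
  show "(real Q)\<^sup>2*A*(real CARD('n)*rad) <= mu" by (simp add: mu_def)
  show "mu <= 1/2" using mu_bounds(1) by simp
  show "0 <= 6*(mu*real (length l))" using mu_pos by simp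
 qed (use snoc.prems rad_pos e1 k1 xOm in auto)
 then show ?case by (simp add: algebra_simps)
qed

lemma exp_small: "exp (A*(real CARD('n)*rad)) ^ m <= 2" if "m <= CARD('n)"
proof -
 have "A*(real CARD('n)*rad)*real m <= A*(real CARD('n)*rad)*real CARD('n)"
  using that A1 rad_pos by (intro mult_left_mono) auto
 then have "real m*(A*(real CARD('n)*rad)) <= 1/2" using A_card_rad by (simp add: mult.commute)
 then have "exp (real m*(A*(real CARD('n)*rad))) <= exp (1/2)" by simp
 also have "exp (1/2::real) <= 2" using exp_bound_half[of "1/2::real"] by simp
 finally show ?thesis by (simp add: exp_of_nat_mult)
qed

lemma length_il: "length il <= CARD('n)" using il distinct_card[of il] card_mono[of UNIV I] by simp

lemma pstruct_FF: "pstruct 0 x rad FF I (6*(mu*real (length il))) (exp (A*(real CARD('n)*rad)) ^ length il)"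
 using pstruct_foldl[of il] il unfolding FF_def[abs_def] by simp

lemma zstruct_FF: "EX B T. zstruct x rad FF (1/8) 2 (2*(real CARD('n)*real Q)) B T"
proof -
 let ?ep = "6*(mu*real (length il))"
 have "mu*real (length il) <= mu*real CARD('n)" using length_il mu_pos by (intro mult_left_mono) auto
 then have ep: "0 <= ?ep" "?ep <= 6*(mu*real CARD('n))" using mu_pos by auto
 have "real Q*?ep * (1 + real CARD('n)*(real Q*1)) <= real Q*(6*(mu*real CARD('n)))*(1 + real CARD('n)*(real Q*1))"
  by (intro mult_right_mono mult_left_mono ep(2)) auto
 then have ep2: "real Q*?ep * (1 + real CARD('n)*(real Q*1)) <= 1/2" using mu_bounds(3) by linarith
 have ep3: "real CARD('n)*(2*(real CARD('n)*(real Q*1))*?ep) <= 1/8"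
 proof -
  have "real CARD('n)*(2*(real CARD('n)*(real Q*1))*?ep) <= real CARD('n)*(2*(real CARD('n)*(real Q*1))*(6*(mu*real CARD('n))))"
   by (intro mult_left_mono ep(2)) auto
  then show ?thesis using mu_bounds(4) by linarith
 qed
 obtain B T where "zstruct x rad FF (real CARD('n)*(2*(real CARD('n)*(real Q*1))*?ep)) (exp (A*(real CARD('n)*rad)) ^ length il) (2*(real CARD('n)*(real Q*1))) B T"
  using zstruct_exists[OF pstruct_FF frame _ ep(1) ep2 refl refl] by auto
 from zstruct_mono[OF this ep3 exp_small[OF length_il]] show ?thesis by auto
qed

definition BTF where "BTF = (SOME p. zstruct x rad FF (1/8) 2 (2*(real CARD('n)*real Q)) (fst p) (snd p))"
abbreviation "BF \<equiv> fst BTF"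
abbreviation "TF \<equiv> snd BTF"

lemma zF: "zstruct x rad FF (1/8) 2 (2*(real CARD('n)*real Q)) BF TF"
proof -
 have "EX p. zstruct x rad FF (1/8) 2 (2*(real CARD('n)*real Q)) (fst p) (snd p)" using zstruct_FF by auto
 then show ?thesis unfolding BTF_def by (rule someI_ex)
qed

lemma FF_reach: "u : cball 0 rad ==> S1 I u < L ==> L < 1 ==> FF u : RR L"
 using pstruct_FF unfolding pstruct_def by simp

lemma S1_rad: "u : cball 0 rad ==> S1 P u <= 1/200"
proof -
 assume "u : cball 0 rad"
 then have "real CARD('n)*norm u <= real CARD('n)*rad" by (intro mult_left_mono) auto
 then show ?thesis using S1_le[of P u] card_rad by linarith
qed

lemma frac_mult_le: "0 <= e ==> 0 <= n ==> e/(n + 1)*n <= (e::real)"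
 by (simp add: field_simps)

lemma FF_reach': "u : cball 0 rad ==> FF u : RR (1/100)"
 using FF_reach[of u "1/100"] S1_rad[of u I] by simp

lemma FF_0: "FF 0 = x" using pstruct_FF unfolding pstruct_def by simp

text \<open>At \<open>FF u\<close> the frame still spans all the fields, with coefficients at most
  2*N*Q by \<open>zF\<close>, so the construction can be repeated there with one flow.\<close>

lemma zE:
 assumes u: "u : cball 0 rad"
 shows "EX B T Cw. zstruct (FF u) rad (EE (FF u)) (1/8) 2 Cw B T"
proof -
 let ?z = "FF u"
 have z: "?z : RR (1/100)" by (rule FF_reach'[OF u])
 then have zOm: "?z : Om" using RR_sub by auto
 have "pstruct (1/100) ?z rad (%v. flow Om (lc q Y (iot I v)) ?z) ({} \<union> I) (0 + 6*mu) (1*exp (A*(real CARD('n)*rad)))"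
 proof (rule pstruct_step[OF pstruct_const[OF z]])
  show "1/100 + real CARD('n)*rad < 1" using card_rad by simp
  show "(real Q)\<^sup>2*A*(real CARD('n)*rad) <= mu" by (simp add: mu_def)
  show "mu <= 1/2" using mu_bounds(1) by simp
 qed (use rad_pos zOm in auto)
 then have st: "pstruct (1/100) ?z rad (EE ?z) I (6*mu) (exp (A*(real CARD('n)*rad)))" by (simp add: EE_def[abs_def])
 have a: "EX a:RI. (ALL i. \<bar>a $ i\<bar> <= 2*(real CARD('n)*real Q)) & Y m ?z = ZZ ?z a" if m: "m < q" for m
 proof -
  have "ALL j<q. \<bar>if j = m then 1 else 0 :: real\<bar> <= 1" by simp
  then obtain w where w: "w : RI" "norm w <= 2*(real CARD('n)*real Q)*1" "lc q Y (%j. if j = m then 1 else 0) ?z = ZZ ?z w"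
   using zF u unfolding zstruct_def by (meson zero_le_one)
  have "lc q Y (%j. if j = m then 1 else 0) ?z = (\<Sum>j<q. if j = m then Y j ?z else 0)" unfolding lc_def by (intro sum.cong) auto
  then have "Y m ?z = ZZ ?z w" using m w(3) by simp
  moreover have "\<bar>w $ i\<bar> <= 2*(real CARD('n)*real Q)" for i using component_le_norm_cart[of w i] w(2) by simp
  ultimately show ?thesis using w(1) by blast
 qed
 have ep: "0 <= 6*mu" using mu_pos by simp
 have "EX B T. zstruct ?z rad (EE ?z) (real CARD('n)*(2*(real CARD('n)*(real Q*(2*(real CARD('n)*real Q))))*(6*mu))) (exp (A*(real CARD('n)*rad))) (2*(real CARD('n)*(real Q*(2*(real CARD('n)*real Q))))) B T"
  by (rule zstruct_exists[OF st a _ ep mu_bounds(5) refl refl]) auto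
 then obtain B T where zs: "zstruct ?z rad (EE ?z) (real CARD('n)*(2*(real CARD('n)*(real Q*(2*(real CARD('n)*real Q))))*(6*mu))) (exp (A*(real CARD('n)*rad))) (2*(real CARD('n)*(real Q*(2*(real CARD('n)*real Q))))) B T" by blast
 have "exp (A*(real CARD('n)*rad)) <= 2" using exp_small[of 1] CARD1 by simp
 from zstruct_mono[OF zs mu_bounds(6) this] show ?thesis by blast
qed

lemma EE_0: "u : cball 0 rad ==> EE (FF u) 0 = FF u"
proof -
 assume "u : cball 0 rad"
 then have "FF u : Om" using FF_reach' RR_sub by blast
 then show ?thesis unfolding EE_def by (intro flow_zero) (auto simp: iot_def intro!: sum.neutral)
qed

lemma EE_path:
 assumes y: "y : RR (1/50)" and v: "v : cball 0 rad"
 obtains ga where "solves Om (lc q Y (iot I v)) ga" "ga 0 = y" "ga 1 = EE y v" "!!t. t : {0..1} ==> ga t : RR (1/10)"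
proof -
 have "l2 q (iot I v) <= 1/200" using l2_le_l1[of q "iot I v"] l1_iot[of I v] S1_rad[OF v, of I] by simp
 then have "1/50 + l2 q (iot I v) < 1/10" by simp
 then obtain ga where ga: "solves Om (lc q Y (iot I v)) ga" "ga 0 = y" "!!t. t : {0..1} ==> ga t : RR (1/10)"
  using extend_flow[OF y, of "iot I v" "1/10"] by auto
 moreover have "ga 1 = EE y v" using flow_eq[OF ga(1)] ga(2) by (simp add: EE_def)
 ultimately show ?thesis using that by blast
qed

lemma FF_continuous: "continuous_on (cball 0 rad \<inter> RI) FF" by (rule zstruct_continuous[OF zF])

lemma EE_continuous: "u : cball 0 rad ==> continuous_on (cball 0 rad \<inter> RI) (EE (FF u))"
 using zE zstruct_continuous by blast

lemma l1_iot_norm: "l1 q (iot I w) <= real CARD('n)*norm w" using l1_iot[of I w] S1_le[of I w] by simp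

text \<open>The image of the segment from \<open>u\<close> to \<open>u'\<close> is a path issuing
  from \<open>FF u\<close>, and it is lifted through \<open>EE (FF u)\<close>. Its velocity has
  frame coordinates within |h|/8 of h = u' - u, so the lift ends within (8*|h|/8 + |h|)/7 = 2/7*|h|
  of h. The radius rad/4 keeps both the segment and the lift in the ball of radius
  \<open>rad\<close>.\<close>

lemma FF_step:
 assumes u: "u : cball 0 (rad/4) \<inter> RI" "u' : cball 0 (rad/4) \<inter> RI"
 shows "EX v:RI \<inter> cball 0 rad. EE (FF u) v = FF u' & norm (v - (u' - u)) <= 2/7*norm (u' - u)"
proof -
 let ?U = "cball 0 rad \<inter> RI"
 define h where "h = u' - u"
 have hRI: "h : RI" unfolding h_def using u by (intro subspace_diff[OF subspace_RI]) auto
 have nh: "norm h <= rad/2" using u norm_triangle_ineq4[of u' u] unfolding h_def by simp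
 have uU: "u : cball 0 rad" using u rad_pos by auto
 obtain B T Cw where zs: "zstruct (FF u) rad (EE (FF u)) (1/8) 2 Cw B T" using zE[OF uU] by blast
 have seg: "u + t *\<^sub>R h : ?U" if "t : {0..1}" for t
 proof -
  have "norm (u + t *\<^sub>R h) <= norm u + norm (t *\<^sub>R h)" by (rule norm_triangle_ineq)
  also have "norm (t *\<^sub>R h) <= norm h" using that by (simp add: mult_left_le_one_le)
  finally have "norm (u + t *\<^sub>R h) <= rad" using nh u rad_pos by simp
  moreover have "u + t *\<^sub>R h : RI" using u hRI by (intro subspace_add[OF subspace_RI] subspace_scale[OF subspace_RI]) auto
  ultimately show ?thesis by simp
 qed
 define ga where "ga t = FF (u + t *\<^sub>R h)" for t
 have nBF: "nearI (1/8) (BF v)" if "v : ?U" for v using zF that unfolding zstruct_def by blast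
 define V where "V s t y = ZZ y (BF (u + s *\<^sub>R h) ((t - s) *\<^sub>R h))" for s t :: real and y
 define C where "C = FF ` ?U \<union> EE (FF u) ` ?U"
 have cU: "compact ?U" by (simp add: compact_Int_closed closed_RI)
 have C: "compact C" "C \<subseteq> Om"
 proof -
  show "compact C" unfolding C_def by (intro compact_Un compact_continuous_image FF_continuous EE_continuous uU cU)
  have "FF v : Om" "EE (FF u) v : Om" if v: "v : ?U" for v
  proof -
   show "FF v : Om" using FF_reach'[of v] RR_sub v by blast
   obtain ga' where "solves Om (lc q Y (iot I v)) ga'" "ga' 1 = EE (FF u) v"
    using EE_path[of "FF u" v] subsetD[OF reach_mono[of "1/100" "1/50"] FF_reach'[OF uU]] v by auto
   then show "EE (FF u) v : Om" unfolding solves_def by (metis atLeastAtMost_iff order_refl zero_le_one)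
  qed
  then show "C \<subseteq> Om" unfolding C_def by auto
 qed
 obtain L0 where L0: "0 <= L0" "!!j y y'. j < q ==> y : C ==> y' : C ==> norm (Y j y - Y j y') <= L0*norm (y - y')"
  using lipschitz_on_compact[OF C] by blast
 have nBh: "norm (BF (u + s *\<^sub>R h) ((t - s) *\<^sub>R h) - (t - s) *\<^sub>R h) <= 1/8*norm h*(t - s)" if "0 <= s" "s <= t" "t <= 1" for s t
 proof -
  have "norm (BF (u + s *\<^sub>R h) ((t - s) *\<^sub>R h) - (t - s) *\<^sub>R h) <= 1/8*norm ((t - s) *\<^sub>R h)"
  proof -
   have "ALL k. norm (BF (u + s *\<^sub>R h) k - k) <= 1/8*norm k" using nBF[OF seg[of s]] that unfolding nearI_def by auto
   then show ?thesis by blast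
  qed
  also have "norm ((t - s) *\<^sub>R h) = norm h*(t - s)" using that by simp
  finally show ?thesis by (simp only: mult.assoc)
 qed
 have "EX v:?U. EE (FF u) v = ga 1 & norm (v - 0 - h) <= (8*(1/8*norm h) + norm h)/7"
 proof (rule path_lifting[OF zs, where V = V and L = "real CARD('n)*(2*norm h)*L0"])
  show "ga 0 = EE (FF u) 0" by (simp add: ga_def EE_0[OF uU])
  show "0 : ?U" using rad_pos subspace_0[OF subspace_RI] by simp
  show "EX d>0. ALL s t. 0 <= s --> s <= t --> t <= 1 --> t - s < d --> norm (ga t - ga s - V s t (ga s)) <= e*(t - s)" if e: "0 < e" for e
  proof -
   have "0 < e/(norm h + 1)" using e by (simp add: add_nonneg_pos)
   then obtain h0 where h0: "h0 > 0" "!!v v'. v : ?U ==> v' : ?U ==> norm (v' - v) < h0 ==>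
    norm (FF v' - FF v - ZZ (FF v) (BF v (v' - v))) <= e/(norm h + 1)*norm (v' - v)" using zF unfolding zstruct_def by blast
   show ?thesis
   proof (intro exI[of _ "h0/(norm h + 1)"] conjI allI impI)
    show "0 < h0/(norm h + 1)" using h0(1) by (simp add: add_nonneg_pos)
    fix s t :: real assume st: "0 <= s" "s <= t" "t <= 1" "t - s < h0/(norm h + 1)"
    have d: "u + t *\<^sub>R h - (u + s *\<^sub>R h) = (t - s) *\<^sub>R h" by (simp add: algebra_simps)
    have nd: "norm ((t - s) *\<^sub>R h) = (t - s)*norm h" using st by simp
    have "(t - s)*norm h <= (t - s)*(norm h + 1)" using st by (intro mult_left_mono) auto
    also have "... < h0" using st(4) by (simp add: pos_less_divide_eq add_nonneg_pos)
    finally have "norm (FF (u + t *\<^sub>R h) - FF (u + s *\<^sub>R h) - ZZ (FF (u + s *\<^sub>R h)) (BF (u + s *\<^sub>R h) ((t - s) *\<^sub>R h))) <= e/(norm h + 1)*((t - s)*norm h)"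
     using h0(2)[OF seg[of s] seg[of t]] st unfolding d nd by auto
    also have "... <= e*(t - s)"
    proof -
     have "e/(norm h + 1)*norm h <= e" using e by (intro frac_mult_le) auto
     then have "e/(norm h + 1)*norm h*(t - s) <= e*(t - s)" using st by (intro mult_right_mono) auto
     then show ?thesis by (simp add: mult_ac)
    qed
    finally show "norm (ga t - ga s - V s t (ga s)) <= e*(t - s)" unfolding ga_def V_def .
   qed
  qed
  show "norm (V s t (ga s) - V s t (EE (FF u) v)) <= real CARD('n)*(2*norm h)*L0*(t - s)*norm (ga s - EE (FF u) v)"
   if st: "0 <= s" "s <= t" "t <= 1" and v: "v : ?U" for s t v
  proof -
   let ?w = "BF (u + s *\<^sub>R h) ((t - s) *\<^sub>R h)"
   have "norm ((t - s) *\<^sub>R h) = norm h*(t - s)" using st by simp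
   moreover have "0 <= norm h*(t - s)" using st by simp
   ultimately have nw: "norm ?w <= 2*(norm h*(t - s))"
    using nBh[OF st] norm_triangle_sub[of ?w "(t - s) *\<^sub>R h"] by linarith
   have "ga s : C" "EE (FF u) v : C" unfolding C_def ga_def using seg[of s] st v by auto
   then have "norm (V s t (ga s) - V s t (EE (FF u) v)) <= l1 q (iot I ?w)*(L0*norm (ga s - EE (FF u) v))"
    unfolding V_def ZZ_lc using L0(2) by (intro lc_lipschitz) auto
   also have "... <= (real CARD('n)*(2*(norm h*(t - s))))*(L0*norm (ga s - EE (FF u) v))"
    using L0(1) by (intro mult_right_mono order_trans[OF l1_iot_norm mult_left_mono[OF nw]]) auto
   finally show ?thesis by (simp only: mult_ac)
  qed
  show "EX w:RI. V s t (EE (FF u) v) = ZZ (EE (FF u) v) w & norm (w - (t - s) *\<^sub>R h) <= 1/8*norm h*(t - s)"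
   if st: "0 <= s" "s <= t" "t <= 1" and v: "v : ?U" for s t v
  proof (intro bexI[of _ "BF (u + s *\<^sub>R h) ((t - s) *\<^sub>R h)"] conjI nBh[OF st])
   show "BF (u + s *\<^sub>R h) ((t - s) *\<^sub>R h) : RI" using nBF[OF seg[of s]] st subspace_scale[OF subspace_RI hRI] by (auto simp: nearI_def)
  qed (simp add: V_def)
  show "norm 0 + norm h + (8*(1/8*norm h) + norm h)/7 <= rad" using nh rad_pos by simp
 qed (use hRI L0(1) in auto)
 then obtain v where "v : ?U" "EE (FF u) v = FF u'" "norm (v - h) <= 2/7*norm h" by (auto simp: ga_def h_def)
 then show ?thesis unfolding h_def by auto
qed

text \<open>Transport from \<open>x\<close> is onto \<open>RI\<close> and distorts norms by at most
  2, so independence at the centre persists.\<close>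

lemma ZZ_indep:
 assumes u: "u : cball 0 rad" and v: "v : RI" "ZZ (FF u) v = 0"
 shows "v = 0"
proof -
 have T: "nearI (1/8) (TF u)" and k: "!!w. w : RI ==> norm (ZZ x w) <= 2*norm (ZZ (FF u) (TF u w))" using zF u unfolding zstruct_def by blast+
 obtain w where w: "w : RI" "TF u w = v" using nearI_inverse[OF T v(1)] by blast
 then have "w = 0" using k[OF w(1)] v(2) indep by auto
 then show ?thesis using w(2) T linear_0 by (auto simp: nearI_def)
qed

text \<open>An orbit that closes within unit time must be constant: its velocity varies by at most
  half of its initial value, so it cannot integrate to zero unless it vanishes.\<close>

lemma EE_fixpoint:
 assumes u: "u : cball 0 rad" and v: "v : RI \<inter> cball 0 rad" and fp: "EE (FF u) v = FF u"
 shows "v = 0"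
proof -
 let ?w = "iot I v" and ?z = "FF u"
 obtain ga where ga: "solves Om (lc q Y ?w) ga" "ga 0 = ?z" "ga 1 = ?z" "!!t. t : {0..1} ==> ga t : RR (1/10)"
  using EE_path[of ?z v] subsetD[OF reach_mono[of "1/100" "1/50"] FF_reach'[OF u]] v fp by auto
 define g where "g t = lc q Y ?w (ga t)" for t
 have gd: "(g has_vector_derivative DW ?w (ga t) (g t)) (at t within {0..1})" if t: "t : {0..1}" for t
 proof -
  have d: "(ga has_vector_derivative g t) (at t within {0..1})" and yOm: "ga t : Om" using ga(1) t unfolding solves_def g_def by auto
  have "((%s. Y j (ga s)) has_vector_derivative frechet_derivative (Y j) (at (ga t)) (g t)) (at t within {0..1})" if "j < q" for j
   using vector_derivative_diff_chain_within[OF d has_derivative_at_withinI[OF C1_on_derivative[OF C1[OF that] yOm]]] by (simp add: comp_def)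
  then show ?thesis unfolding g_def[abs_def] lc_def DW_def
   by (intro has_vector_derivative_sum has_vector_derivative_scaleR[where f="%_. _" and f'=0, simplified]) (auto simp: lc_def)
 qed
 have "real CARD('n)*norm v <= real CARD('n)*rad" using v by (intro mult_left_mono) auto
 then have l1w: "l1 q ?w <= real CARD('n)*rad" using l1_iot_norm[of v] by linarith
 define \<omega> where "\<omega> = real CARD('n)*rad*A"
 have "A*(real CARD('n)*rad)*1 <= A*(real CARD('n)*rad)*real CARD('n)" using A1 CARD1 rad_pos by (intro mult_left_mono) auto
 then have "A*(real CARD('n)*rad) <= 1/200" using A_card_rad by linarith
 then have \<omega>: "0 <= \<omega>" "\<omega> <= 1/200" using A1 rad_pos by (auto simp: \<omega>_def mult_ac)
 have gb: "norm (DW ?w (ga t) (g t)) <= \<omega>*norm (g t) + 0" if t: "t : {0..1}" for t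
 proof -
  have "l1 q ?w*A*norm (g t) <= \<omega>*norm (g t)" unfolding \<omega>_def using l1w A1 by (intro mult_right_mono) auto
  then show ?thesis using DW_bound[OF _ ga(4)[OF t], of ?w "g t"] by simp
 qed
 have g2: "norm (g t) <= 2*norm (g 0)" if t: "t : {0..1}" for t
 proof -
  have "norm (g t) <= (norm (g 0) + 0)*exp (\<omega>*t)" by (rule gronwall_derivative[OF gd gb \<omega>(1) _ t]) auto
  also have "... <= norm (g 0)*2"
  proof -
   have "exp (\<omega>*t) <= exp (1/2)" using \<omega> t mult_left_le[of t \<omega>] by simp
  moreover have "exp (1/2::real) <= 2" using exp_bound_half[of "1/2::real"] by simp
  ultimately have "exp (\<omega>*t) <= 2" by linarith
  then show ?thesis by (intro mult_mono) auto
  qed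
  finally show ?thesis by simp
 qed
 have gdiff: "norm (g t - g 0) <= norm (g 0)/2" if t: "t : {0..1}" for t
 proof -
  have K: "norm (DW ?w (ga s) (g s)) <= norm (g 0)/2" if s: "s : {0..1}" for s
  proof -
   have "\<omega>*norm (g s) <= 1/200*(2*norm (g 0))" using \<omega> g2[OF s] by (intro mult_mono) auto
   then show ?thesis using gb[OF s] norm_ge_zero[of "g 0"] by linarith
  qed
  have "norm (g t - g 0) <= (norm (g 0 - g 0) + norm (g 0)/2)*exp (0*t)"
  proof (rule gronwall_derivative[OF _ _ _ _ t, where v="%t. g t - g 0"])
   show "((%t. g t - g 0) has_vector_derivative DW ?w (ga s) (g s) - 0) (at s within {0..1})" if "s : {0..1}" for s
    by (intro has_vector_derivative_diff gd that has_vector_derivative_const)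
  qed (use K in auto)
  then show ?thesis by simp
 qed
 have "norm ((ga 1 - 1 *\<^sub>R g 0) - (ga 0 - 0 *\<^sub>R g 0)) <= (norm ((ga 0 - 0 *\<^sub>R g 0) - (ga 0 - 0 *\<^sub>R g 0)) + norm (g 0)/2)*exp (0*1)"
 proof (rule gronwall_derivative[where v="%t. (ga t - t *\<^sub>R g 0) - (ga 0 - 0 *\<^sub>R g 0)"])
  show "((%t. (ga t - t *\<^sub>R g 0) - (ga 0 - 0 *\<^sub>R g 0)) has_vector_derivative (g s - (s *\<^sub>R 0 + 1 *\<^sub>R g 0)) - 0) (at s within {0..1})" if "s : {0..1}" for s
   using ga(1) that unfolding solves_def g_def
   by (intro has_vector_derivative_diff has_vector_derivative_const has_vector_derivative_scaleR) (auto intro!: DERIV_ident)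
  show "norm ((g s - (s *\<^sub>R 0 + 1 *\<^sub>R g 0)) - 0) <= 0*norm ((ga s - s *\<^sub>R g 0) - (ga 0 - 0 *\<^sub>R g 0)) + norm (g 0)/2" if "s : {0..1}" for s
   using gdiff[OF that] by simp
 qed auto
 then have "norm (g 0) <= norm (g 0)/2" using ga(2,3) by simp
 then have "g 0 = 0" by simp
 then have "ZZ ?z v = 0" by (simp add: g_def ga(2) ZZ_lc)
 then show ?thesis using ZZ_indep[OF u] v by auto
qed

text \<open>Equal images produce an orbit that closes up, so \<open>v = 0\<close>, and then |u' - u|
  <= 2/7*|u' - u|.\<close>

lemma FF_inj: "inj_on FF (cball 0 (rad/4) \<inter> RI)"
proof (rule inj_onI)
 fix u u' assume u: "u : cball 0 (rad/4) \<inter> RI" "u' : cball 0 (rad/4) \<inter> RI" and eq: "FF u = FF u'"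
 obtain v where v: "v : RI \<inter> cball 0 rad" "EE (FF u) v = FF u'" "norm (v - (u' - u)) <= 2/7*norm (u' - u)" using FF_step[OF u] by blast
 have "u : cball 0 rad" using u rad_pos by auto
 then have "v = 0" using EE_fixpoint[OF _ v(1)] v(2) eq by simp
 then have "norm (u' - u) <= 2/7*norm (u' - u)" using v(3) by (simp add: norm_minus_commute)
 then show "u = u'" by simp
qed

lemma has_integral_interval_bound:
 fixes f :: "real => 'b::real_normed_vector"
 assumes "(f has_integral i) {s..t}" "s <= t" "!!r. r : {s..t} ==> norm (f r) <= K" "0 <= K"
 shows "norm i <= K*(t - s)"
 using has_integral_bound_real[of K "{}" f i s t] assms by simp

lemma control_integrable:
 assumes a: "is_ctrl q L a" and j: "j < q"
 shows "a j integrable_on {s..t}" and "s <= t ==> \<bar>integral {s..t} (a j)\<bar> <= L*(t - s)"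
proof -
 have m: "a j : borel_measurable borel" and b: "\<bar>a j r\<bar> <= L" for r
  using a j l2_component[OF j, of "%j. a j r"] unfolding is_ctrl_def by (auto intro: order_trans)
 have "a j : borel_measurable lebesgue" using m by (simp add: measurable_completion)
 then have "a j : borel_measurable (lebesgue_on {s..t})" by (rule measurable_restrict_space1)
 then show i: "a j integrable_on {s..t}"
  by (rule measurable_bounded_by_integrable_imp_integrable[where g="%_. L"]) (use b in auto)
 assume "s <= t"
 then show "\<bar>integral {s..t} (a j)\<bar> <= L*(t - s)"
  using has_integral_interval_bound[of "a j" "integral {s..t} (a j)" s t L] i b is_ctrl_nonneg[OF a] by (auto simp: has_integral_integral)
qed

lemma zF_frame:
 assumes "u : cball 0 rad" "ALL j<q. \<bar>ta j\<bar> <= t" "0 <= t"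
 shows "EX w:RI. norm w <= 2*(real CARD('n)*real Q)*t & lc q Y ta (FF u) = ZZ (FF u) w"
proof -
 have "ALL u:cball 0 rad. ALL ta t. (ALL j<q. \<bar>ta j\<bar> <= t) --> 0 <= t -->
   (EX w:RI. norm w <= 2*(real CARD('n)*real Q)*t & lc q Y ta (FF u) = ZZ (FF u) w)"
  using zF unfolding zstruct_def by (elim conjE)
 then show ?thesis using assms by blast
qed

text \<open>A controlled path from \<open>x\<close> is lifted through \<open>FF\<close>; over a
  short interval its increment is that of the fields frozen at the left end, with coefficients
  \<open>integral {s..t} (a j)\<close>. There is no preferred direction, so \<open>g = 0\<close>,
  and the drift rad/8 leads to the radius rad/7.\<close>

lemma reach_subset_FF:
 assumes y: "y : RR (rad/(16*(real CARD('n)*real Q)))"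
 shows "EX u:cball 0 (rad/7) \<inter> RI. FF u = y"
proof -
 let ?U = "cball 0 rad \<inter> RI"
 define ms where "ms = rad/(16*(real CARD('n)*real Q))"
 \<comment> \<open>2*N*Q is the cost of expressing a combination in the frame, so \<open>ms\<close>
   is the control bound that produces the drift rad/8.\<close>
 have ms8: "2*(real CARD('n)*real Q)*ms = rad/8" using CARD1 realQ1 by (simp add: ms_def field_simps)
 obtain ga a where a: "is_ctrl q ms a" and p: "cpath Om Y q x a ga" and y1: "ga 1 = y" using y by (auto simp: reach_def ms_def)
 have \<mu>0: "0 <= ms" by (rule is_ctrl_nonneg[OF a])
 have I: "((%s. lc q Y (%j. a j s) (ga s)) has_integral (ga t - x)) {0..t}" if "t : {0..1}" for t using p that by (auto simp: cpath_def)
 have cga: "continuous_on {0..1} ga" and ga0: "ga 0 = x" using integral_curve_continuous[OF I] by auto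
 have gaOm: "ga t : Om" if "t : {0..1}" for t using p that by (auto simp: cpath_def)
 define C where "C = ga ` {0..1} \<union> FF ` ?U"
 have cU: "compact ?U" by (simp add: compact_Int_closed closed_RI)
 have "FF u : Om" if "u : ?U" for u using FF_reach'[of u] RR_sub that by blast
 then have C: "compact C" "C \<subseteq> Om" unfolding C_def using gaOm
  by (auto intro!: compact_Un compact_continuous_image cga FF_continuous cU)
 obtain L0 where L0: "0 <= L0" "!!j y y'. j < q ==> y : C ==> y' : C ==> norm (Y j y - Y j y') <= L0*norm (y - y')"
  using lipschitz_on_compact[OF C] by blast
 define V where "V s t y = lc q Y (%j. integral {s..t} (a j)) y" for s t :: real and y
 have aq: "l1 q (%j. a j s) <= real q*ms" for s
  using a l2_component[of _ q "%j. a j s"] unfolding is_ctrl_def by (intro l1_le) (meson order_trans)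
 have iq: "l1 q (%j. integral {s..t} (a j)) <= real q*(ms*(t - s))" if "s <= t" for s t
  using control_integrable(2)[OF a _ that] by (intro l1_le)
 have "EX u:?U. FF u = ga 1 & norm (u - 0 - 0) <= (8*(rad/8) + norm (0::real^'n))/7"
 proof (rule path_lifting[OF zF, where V = V and L = "real q*ms*L0"])
  show "0 : ?U" using rad_pos subspace_0[OF subspace_RI] by simp
  show "ga 0 = FF 0" by (simp add: ga0 FF_0)
  show "EX d>0. ALL s t. 0 <= s --> s <= t --> t <= 1 --> t - s < d --> norm (ga t - ga s - V s t (ga s)) <= e*(t - s)" if e: "0 < e" for e
  proof -
   let ?K = "real q*ms*L0"
   have K0: "0 <= ?K" by (intro mult_nonneg_nonneg \<mu>0 L0(1)) auto
   have "uniformly_continuous_on {0..1} ga" by (intro compact_uniformly_continuous cga) auto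
   moreover have "0 < e/(?K + 1)" using e K0 by (simp add: add_nonneg_pos)
   ultimately obtain d where d: "0 < d" "!!s t. s : {0..1} ==> t : {0..1} ==> dist t s < d ==> dist (ga t) (ga s) < e/(?K + 1)"
    unfolding uniformly_continuous_on_def by metis
   show ?thesis
   proof (intro exI[of _ d] conjI allI impI d(1))
    fix s t :: real assume st: "0 <= s" "s <= t" "t <= 1" "t - s < d"
    have i1: "((%r. lc q Y (%j. a j r) (ga r)) has_integral (ga t - ga s)) {s..t}"
     by (rule has_integral_subinterval[OF I st(1-3)])
    have i2: "((%r. lc q Y (%j. a j r) (ga s)) has_integral V s t (ga s)) {s..t}"
     unfolding V_def lc_def using control_integrable(1)[OF a] by (intro has_integral_sum has_integral_scaleR_left) (auto simp: has_integral_integral)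
    show "norm (ga t - ga s - V s t (ga s)) <= e*(t - s)"
    proof (rule has_integral_interval_bound)
     show "((%r. lc q Y (%j. a j r) (ga r) - lc q Y (%j. a j r) (ga s)) has_integral (ga t - ga s - V s t (ga s))) {s..t}"
      by (rule has_integral_diff[OF i1 i2])
     fix r assume r: "r : {s..t}"
     have "dist (ga r) (ga s) < e/(?K + 1)" using r st by (intro d(2)) (auto simp: dist_real_def)
     then have "norm (ga r - ga s) <= e/(?K + 1)" by (simp add: dist_norm)
     then have dr: "L0*norm (ga r - ga s) <= L0*(e/(?K + 1))" using L0(1) by (intro mult_left_mono)
     have "norm (lc q Y (%j. a j r) (ga r) - lc q Y (%j. a j r) (ga s)) <= l1 q (%j. a j r)*(L0*norm (ga r - ga s))"
      using L0(2) r st by (intro lc_lipschitz) (auto simp: C_def)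
     also have "... <= (real q*ms)*(L0*(e/(?K + 1)))"
      using \<mu>0 L0(1) by (intro mult_mono[OF aq[of r] dr]) auto
     also have "... = e/(?K + 1)*?K" by simp
     also have "... <= e" using e K0 by (intro frac_mult_le) auto
     finally show "norm (lc q Y (%j. a j r) (ga r) - lc q Y (%j. a j r) (ga s)) <= e" .
    qed (use e st in auto)
   qed
  qed
  show "norm (V s t (ga s) - V s t (FF u)) <= real q*ms*L0*(t - s)*norm (ga s - FF u)"
   if st: "0 <= s" "s <= t" "t <= 1" and u: "u : ?U" for s t u
  proof -
   have "norm (V s t (ga s) - V s t (FF u)) <= l1 q (%j. integral {s..t} (a j))*(L0*norm (ga s - FF u))"
    unfolding V_def using L0(2) st u by (intro lc_lipschitz) (auto simp: C_def)
   also have "... <= (real q*(ms*(t - s)))*(L0*norm (ga s - FF u))"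
    using L0(1) by (intro mult_right_mono iq st) auto
   finally show ?thesis by (simp only: mult_ac)
  qed
  show "EX w:RI. V s t (FF u) = ZZ (FF u) w & norm (w - (t - s) *\<^sub>R 0) <= rad/8*(t - s)"
   if st: "0 <= s" "s <= t" "t <= 1" and u: "u : ?U" for s t u
  proof -
   have b: "ALL j<q. \<bar>integral {s..t} (a j)\<bar> <= ms*(t - s)" using control_integrable(2)[OF a _ st(2)] by blast
   have "0 <= ms*(t - s)" using \<mu>0 st by simp
   then obtain w where w: "w : RI" "norm w <= 2*(real CARD('n)*real Q)*(ms*(t - s))" "lc q Y (%j. integral {s..t} (a j)) (FF u) = ZZ (FF u) w"
    using zF_frame[OF _ b] u by blast
   have e: "2*(real CARD('n)*real Q)*(ms*(t - s)) = rad/8*(t - s)" unfolding ms8[symmetric] by (simp only: mult.assoc)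
   have "norm w <= rad/8*(t - s)" using w(2) unfolding e .
   then show ?thesis using w(1,3) unfolding V_def by (intro bexI[of _ w]) auto
  qed
  show "norm 0 + norm 0 + (8*(rad/8) + norm (0::real^'n))/7 <= rad" using rad_pos by simp
  show "0 <= real q*ms*L0" by (intro mult_nonneg_nonneg \<mu>0 L0(1)) auto
 qed (use rad_pos subspace_0[OF subspace_RI] in auto)
 then show ?thesis using y1 by auto
qed

end

section \<open>Hausdorff measure of images of small cubes\<close>

lemma norm_le_card_cart: "(!!i. \<bar>w $ i\<bar> <= s) ==> norm (w::real^'n) <= real CARD('n) * s"
 using norm_le_l1_cart[of w] sum_bounded_above[of UNIV "%i. \<bar>w $ i\<bar>" s] by simp

text \<open>Two maps on one parameter set say that \<open>f\<close> is Lipschitz as a function of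
  \<open>g\<close> without naming an inverse of \<open>g\<close>. Members of a cover of the image of
  \<open>g\<close> are pulled back to \<open>S\<close> and pushed forward by \<open>f\<close>, which
  multiplies diameters by at most \<open>L\<close>.\<close>

lemma haus_outer_lipschitz:
 fixes f :: "'c => 'a::metric_space" and g :: "'c => 'b::metric_space"
 assumes L: "0 < L" and lip: "!!u v. u : S ==> v : S ==> dist (f u) (f v) <= L*dist (g u) (g v)"
 shows "haus_outer k (f ` S) <= ennreal (L ^ k)*haus_outer k (g ` S)"
proof (rule haus_outer_leI)
 fix ep :: real assume ep: "0 < ep"
 have inv: "ennreal (L ^ k)*(ennreal (1/L ^ k)*z) = z" for z
  using L by (simp add: mult.assoc[symmetric] ennreal_mult[symmetric])
 have "ennreal (1/L ^ k)*haus_pre k ep (f ` S) <= (\<Sum>i. haus_weight k (C i))" if C: "C : haus_covers (ep/L) (g ` S)" for C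
 proof -
  define D where "D i = f ` {u : S. g u : C i}" for i
  have Cb: "bounded (C i)" "diameter (C i) <= ep/L" for i using C by (auto simp: haus_covers_def)
  have dd: "dist y z <= L*diameter (C i)" if yz: "y : D i" "z : D i" for y z i
  proof -
   obtain u v where uv: "u : S" "v : S" "g u : C i" "g v : C i" "y = f u" "z = f v" using yz by (auto simp: D_def)
   have "dist y z <= L*dist (g u) (g v)" using lip uv by simp
   also have "... <= L*diameter (C i)" using diameter_bounded_bound[OF Cb(1) uv(3,4)] L by simp
   finally show ?thesis .
  qed
  have D: "bounded (D i) & diameter (D i) <= L*diameter (C i)" for i
  proof (cases "D i = {}")
   case True
   then show ?thesis using L diameter_ge_0[OF Cb(1)] by (simp add: diameter_def)
  next
   case False
   then obtain y0 where "y0 : D i" by blast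
   then have "bounded (D i)" using dd unfolding bounded_def by blast
   moreover have "diameter (D i) <= L*diameter (C i)"
    unfolding diameter_def[of "D i"] if_not_P[OF False] by (rule cSUP_least) (use False dd in auto)
   ultimately show ?thesis by simp
  qed
  have "haus_pre k ep (f ` S) <= (\<Sum>i. haus_weight k (D i))"
  proof (rule haus_pre_leI)
   have "diameter (D i) <= ep" for i
   proof -
    have "diameter (D i) <= L*(ep/L)" using D[of i] mult_left_mono[OF Cb(2)[of i], of L] L by linarith
    then show ?thesis using L by simp
   qed
   moreover have "f ` S \<subseteq> (\<Union>i. D i)" using C by (fastforce simp: haus_covers_def D_def)
   ultimately show "D : haus_covers ep (f ` S)" using D by (auto simp: haus_covers_def)
  qed
  also have "... <= (\<Sum>i. ennreal (L ^ k)*haus_weight k (C i))"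
  proof (intro suminf_le)
   fix i
   show "haus_weight k (D i) <= ennreal (L ^ k)*haus_weight k (C i)"
   proof (cases "D i = {}")
    case False
    then have ne: "C i ~= {}" by (auto simp: D_def)
    have nn: "0 <= diameter (D i)" "0 <= diameter (C i)" using D[of i] Cb(1)[of i] by (simp_all add: diameter_ge_0)
    have "unit_ball_vol (real k)*(diameter (D i)/2) ^ k <= unit_ball_vol (real k)*(L*(diameter (C i)/2)) ^ k"
     using D[of i] nn by (intro mult_left_mono power_mono) auto
    also have "... = L ^ k*(unit_ball_vol (real k)*(diameter (C i)/2) ^ k)" unfolding power_mult_distrib by (simp only: mult_ac)
    finally show ?thesis using False ne L nn by (simp add: haus_weight_def ennreal_mult[symmetric])
   qed (simp add: haus_weight_def)
  qed auto
  also have "... = ennreal (L ^ k)*(\<Sum>i. haus_weight k (C i))" by (rule ennreal_suminf_cmult)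
  finally have "ennreal (1/L ^ k)*haus_pre k ep (f ` S) <= ennreal (1/L ^ k)*(ennreal (L ^ k)*(\<Sum>i. haus_weight k (C i)))" by (rule mult_left_mono) simp
  also have "... = (\<Sum>i. haus_weight k (C i))" using L by (simp add: mult.assoc[symmetric] ennreal_mult[symmetric])
  finally show ?thesis .
 qed
 then have "ennreal (1/L ^ k)*haus_pre k ep (f ` S) <= haus_pre k (ep/L) (g ` S)" unfolding haus_pre_def[of k "ep/L"] by (rule INF_greatest)
 also have "... <= haus_outer k (g ` S)" using ep L by (intro haus_pre_le_outer) simp
 finally have "ennreal (L ^ k)*(ennreal (1/L ^ k)*haus_pre k ep (f ` S)) <= ennreal (L ^ k)*haus_outer k (g ` S)" by (rule mult_left_mono) simp
 then show "haus_pre k ep (f ` S) <= ennreal (L ^ k)*haus_outer k (g ` S)" unfolding inv .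
qed

lemma haus_outer_finite_UN_le:
 assumes "finite F"
 shows "haus_outer k (\<Union>i\<in>F. A i) <= (\<Sum>i\<in>F. haus_outer k (A i :: 'a::metric_space set))"
 using assms
proof (induction F)
 case (insert i F)
 have "haus_outer k (\<Union>i\<in>insert i F. A i) <= haus_outer k (A i) + haus_outer k (\<Union>i\<in>F. A i)" using haus_outer_Un_le[of k "A i" "\<Union>i\<in>F. A i"] by simp
 also have "... <= haus_outer k (A i) + (\<Sum>i\<in>F. haus_outer k (A i))" by (rule add_left_mono[OF insert.IH])
 finally show ?case using insert by simp
qed simp

context cframe
begin

definition pI :: "real^'n => real^'n" where "pI w = (\<chi> i. if i : I then w $ i else 0)"

lemma pI_RI: "pI w : RI" by (simp add: pI_def RI_def)
lemma pI_component: "pI w $ i = (if i : I then w $ i else 0)" by (simp add: pI_def)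

abbreviation "kk \<equiv> card I"

text \<open>This constant degenerates with the frame and is not admissible. It serves to fix how
  small cubes have to be and to see that \<open>tau\<close> is positive.\<close>

lemma ZZ_coercive: "EX s>0. ALL w:RI. s*norm w <= norm (ZZ x w)"
proof -
 have "ALL w:RI. ZZ x w = 0 --> w = 0" using indep by blast
 from injective_imp_isometric[OF closed_RI subspace_RI linear_conv_bounded_linear[THEN iffD1, OF linear_ZZ] this]
 show ?thesis by auto
qed

text \<open>The derivative of \<open>FF\<close> at \<open>u\<close> is
  \<open>ZZ (FF u) (BF u w)\<close>, that is \<open>ZZ (FF u) (TF u (GG u w))\<close>, and transport
  compares this with \<open>ZZ x (GG u w)\<close>. Derivatives at all points are thus read in the
  one tangent space at \<open>x\<close>.\<close>

definition GG :: "real^'n => real^'n => real^'n" where "GG u w = inv (TF u) (BF u w)"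

lemma GG:
 assumes u: "u : cball 0 rad"
 shows "nearI (1/2) (GG u)" "TF u (GG u w) = BF u w"
proof -
 have B: "nearI (1/8) (BF u)" and T: "nearI (1/8) (TF u)" using zF u unfolding zstruct_def by blast+
 have linT: "linear (TF u)" and linB: "linear (BF u)" and nT: "!!h. norm (TF u h - h) <= 1/8*norm h" and nB: "!!h. norm (BF u h - h) <= 1/8*norm h"
  and cT: "!!h. (ALL i:I. h $ i = 0) ==> TF u h = h" and cB: "!!h. (ALL i:I. h $ i = 0) ==> BF u h = h"
  and BRI: "!!h. h : RI ==> BF u h : RI" using B T by (auto simp: nearI_def)
 have low: "norm h <= 8/7*norm (TF u h)" for h using nT[of h] norm_triangle_sub[of h "TF u h"] by (simp add: norm_minus_commute)
 have inj: "inj (TF u)" unfolding linear_injective_0[OF linT]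
 proof (intro allI impI)
  fix h assume "TF u h = 0"
  then show "h = 0" using low[of h] by simp
 qed
 then have surj: "surj (TF u)" using linear_injective_imp_surjective[OF linT] by simp
 show TG: "TF u (GG u w) = BF u w" for w unfolding GG_def by (rule surj_f_inv_f[OF surj])
 have sf: "TF u (inv (TF u) a) = a" for a by (rule surj_f_inv_f[OF surj])
 have linI: "linear (inv (TF u))"
 proof (rule linearI)
  fix a b :: "real^'n" and r :: real
  have "TF u (inv (TF u) (a + b)) = TF u (inv (TF u) a + inv (TF u) b)" by (simp only: linear_add[OF linT] sf)
  then show "inv (TF u) (a + b) = inv (TF u) a + inv (TF u) b" by (rule injD[OF inj])
  have "TF u (inv (TF u) (r *\<^sub>R a)) = TF u (r *\<^sub>R inv (TF u) a)" by (simp only: linear_scale[OF linT] sf)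
  then show "inv (TF u) (r *\<^sub>R a) = r *\<^sub>R inv (TF u) a" by (rule injD[OF inj])
 qed
 show "nearI (1/2) (GG u)" unfolding nearI_def
 proof (intro conjI allI ballI impI)
  show "linear (GG u)" unfolding GG_def[abs_def] using linear_compose[OF linB linI] by (simp add: comp_def)
  fix h :: "real^'n"
  have "norm (BF u h) <= 9/8*norm h" using nB[of h] norm_triangle_sub[of "BF u h" h] by simp
  then have "norm (GG u h) <= 9/7*norm h" using low[of "GG u h"] TG[of h] by simp
  moreover have "norm (GG u h - h) <= norm (GG u h - TF u (GG u h)) + norm (BF u h - h)"
   using norm_triangle_ineq[of "GG u h - TF u (GG u h)" "BF u h - h"] TG[of h] by simp
  moreover have "norm (GG u h - TF u (GG u h)) <= 1/8*norm (GG u h)" using nT[of "GG u h"] by (simp add: norm_minus_commute)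
  ultimately show "norm (GG u h - h) <= 1/2*norm h" using nB[of h] norm_ge_zero[of h] by linarith
 next
  fix h :: "real^'n" assume "h : RI"
  then obtain k where "k : RI" "TF u k = BF u h" using nearI_inverse[OF T BRI] by blast
  then show "GG u h : RI" using TG[of h] inj by (metis injD)
 next
  fix h :: "real^'n" assume h: "ALL i:I. h $ i = 0"
  have "TF u (GG u h) = TF u h" using TG[of h] cB[OF h] cT[OF h] by simp
  then show "GG u h = h" by (rule injD[OF inj])
 qed
qed

lemma GG_linear: "u : cball 0 rad ==> linear (GG u)" and GG_near: "u : cball 0 rad ==> norm (GG u h - h) <= 1/2*norm (h::real^'n)"
 and GG_RI: "u : cball 0 rad ==> h : RI ==> GG u h : RI"
 using GG(1)[of u] unfolding nearI_def by auto

lemma GG_inverse: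
 assumes u: "u : cball 0 rad" and v: "v : RI"
 shows "EX k:RI. GG u k = v & norm k <= 2*norm v"
proof -
 have B: "nearI (1/8) (BF u)" and T: "nearI (1/8) (TF u)" using zF u unfolding zstruct_def by blast+
 have linT: "linear (TF u)" and nT: "!!h. norm (TF u h - h) <= 1/8*norm h" and TRI: "TF u v : RI" using T v by (auto simp: nearI_def)
 obtain k where k: "k : RI" "BF u k = TF u v" "norm k <= 8/7*norm (TF u v)" using nearI_inverse[OF B TRI] by blast
 have "TF u (GG u k - v) = 0" using GG(2)[OF u, of k] k(2) by (simp add: linear_diff[OF linT])
 then have "norm (GG u k - v) <= 1/8*norm (GG u k - v)" using nT[of "GG u k - v"] by (simp add: norm_minus_commute)
 then have "GG u k = v" by simp
 moreover have "norm k <= 2*norm v" using k(3) nT[of v] norm_triangle_sub[of "TF u v" v] norm_ge_zero[of v] by linarith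
 ultimately show ?thesis using k(1) by blast
qed

text \<open>Linear model of the derivative of \<open>FF\<close> at \<open>u\<close>, with values in
  the span of the fields at \<open>x\<close>; \<open>DF_compare\<close> makes it faithful up to the
  factor 2.\<close>

definition MG :: "real^'n => real^'n => real^'n" where "MG u w = ZZ x (GG u w)"

lemma linear_MG: "u : cball 0 rad ==> linear (MG u)"
 unfolding MG_def[abs_def] using linear_compose[OF GG_linear linear_ZZ] by (simp add: comp_def)

lemma DF_compare:
 assumes u: "u : cball 0 rad" and w: "w : RI"
 shows "norm (MG u w) <= 2*norm (ZZ (FF u) (BF u w))" "norm (ZZ (FF u) (BF u w)) <= 2*norm (MG u w)"
proof -
 have k: "ALL w:RI. norm (ZZ x w) <= 2*norm (ZZ (FF u) (TF u w)) & norm (ZZ (FF u) (TF u w)) <= 2*norm (ZZ x w)"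
  using zF u unfolding zstruct_def by blast
 have "MG u w = ZZ x (GG u w)" by (rule MG_def)
 then show "norm (MG u w) <= 2*norm (ZZ (FF u) (BF u w))" "norm (ZZ (FF u) (BF u w)) <= 2*norm (MG u w)"
  using bspec[OF k GG_RI[OF u w]] GG(2)[OF u, of w] by auto
qed

lemma MG_coercive: "EX s>0. ALL u:cball 0 rad. ALL w:RI. s*norm w <= norm (MG u w)"
proof -
 obtain s where s: "s > 0" "ALL w:RI. s*norm w <= norm (ZZ x w)" using ZZ_coercive by blast
 have "s/2*norm w <= norm (MG u w)" if u: "u : cball 0 rad" and w: "w : RI" for u w
 proof -
  have "norm w <= 2*norm (GG u w)" using GG_near[OF u, of w] norm_triangle_sub[of w "GG u w"] by (simp add: norm_minus_commute)
  then have "s/2*norm w <= s/2*(2*norm (GG u w))" using s(1) by (intro mult_left_mono) auto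
  then show ?thesis using bspec[OF s(2) GG_RI[OF u w]] by (simp add: MG_def)
 qed
 then show ?thesis using s(1) by (intro exI[of _ "s/2"]) auto
qed

text \<open>\<open>BF\<close> comes from choices without continuity. The uniform first-order
  expansion recovers the derivative from increments of a fixed length \<open>s\<close>, and these
  depend continuously on the base point; four errors of size e/4*s arise.\<close>

lemma DF_uniformly_continuous:
 assumes e: "0 < e"
 shows "EX d>0. ALL u:cball 0 (rad/2) \<inter> RI. ALL v:cball 0 (rad/2) \<inter> RI. norm (u - v) < d -->
   (ALL w:RI. norm (ZZ (FF u) (BF u w) - ZZ (FF v) (BF v w)) <= e*norm w)"
proof -
 let ?U = "cball 0 rad \<inter> RI"
 have "0 < e/4" using e by simp
 then obtain h0 where h0: "h0 > 0" "!!u u'. u : ?U ==> u' : ?U ==> norm (u' - u) < h0 ==>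
   norm (FF u' - FF u - ZZ (FF u) (BF u (u' - u))) <= e/4*norm (u' - u)" using zF unfolding zstruct_def by blast
 define s where "s = min (h0/2) (rad/2)"
 have s: "0 < s" "s < h0" "s <= rad/2" using h0(1) rad_pos by (auto simp: s_def)
 have "uniformly_continuous_on ?U FF" by (intro compact_uniformly_continuous FF_continuous) (simp add: compact_Int_closed closed_RI)
 moreover have "0 < e/4 * s" using e s by simp
 ultimately obtain d where d: "0 < d" "!!u v. u : ?U ==> v : ?U ==> dist v u < d ==> dist (FF v) (FF u) < e/4 * s"
  unfolding uniformly_continuous_on_def by blast
 show ?thesis
 proof (intro exI[of _ d] conjI ballI impI d(1))
  fix u v w assume u: "u : cball 0 (rad/2) \<inter> RI" and v: "v : cball 0 (rad/2) \<inter> RI" and uv: "norm (u - v) < d" and w: "w : RI"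
  have uU: "u : ?U" "v : ?U" using u v rad_pos by auto
  let ?D = "%u w. ZZ (FF u) (BF u w)"
  have linD: "linear (?D u)" if "u : ?U" for u
   using zF that linear_compose[of "BF u" "ZZ (FF u)"] linear_ZZ unfolding zstruct_def nearI_def by (auto simp: comp_def)
  show "norm (?D u w - ?D v w) <= e*norm w"
  proof (cases "w = 0")
   case True
   then show ?thesis using linear_0[OF linD[OF uU(1)]] linear_0[OF linD[OF uU(2)]] by simp
  next
   case False
   define w' where "w' = (s/norm w) *\<^sub>R w"
   have w': "w' : RI" "norm w' = s" using subspace_scale[OF subspace_RI w] False s by (auto simp: w'_def)
   have in': "a + w' : ?U" if "a : cball 0 (rad/2) \<inter> RI" for a
    using that w' s norm_triangle_ineq[of a w'] subspace_add[OF subspace_RI, of a w'] by auto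
   have 1: "norm (FF (u + w') - FF u - ?D u w') <= e/4 * s" using h0(2)[OF uU(1) in'[OF u]] w' s by simp
   have 2: "norm (FF (v + w') - FF v - ?D v w') <= e/4 * s" using h0(2)[OF uU(2) in'[OF v]] w' s by simp
   have 3: "norm (FF (u + w') - FF (v + w')) <= e/4 * s" using d(2)[OF in'[OF v] in'[OF u]] uv by (simp add: dist_norm)
   have 4: "norm (FF u - FF v) <= e/4 * s" using d(2)[OF uU(2) uU(1)] uv by (simp add: dist_norm)
   have "?D u w' - ?D v w' = (FF (v + w') - FF v - ?D v w') - (FF (u + w') - FF u - ?D u w') + (FF (u + w') - FF (v + w')) - (FF u - FF v)" by simp
   then have "norm (?D u w' - ?D v w') <= e/4 * s + e/4 * s + e/4 * s + e/4 * s"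
    using 1 2 3 4 norm_triangle_ineq4[of "(FF (v + w') - FF v - ?D v w') - (FF (u + w') - FF u - ?D u w') + (FF (u + w') - FF (v + w'))" "FF u - FF v"]
     norm_triangle_ineq[of "(FF (v + w') - FF v - ?D v w') - (FF (u + w') - FF u - ?D u w')" "FF (u + w') - FF (v + w')"]
     norm_triangle_ineq4[of "FF (v + w') - FF v - ?D v w'" "FF (u + w') - FF u - ?D u w'"] by simp
   moreover have "?D u w' - ?D v w' = (s/norm w) *\<^sub>R (?D u w - ?D v w)"
    unfolding w'_def by (simp add: linear_scale[OF linD[OF uU(1)]] linear_scale[OF linD[OF uU(2)]] scaleR_diff_right)
   ultimately have "(s/norm w)*norm (?D u w - ?D v w) <= e * s" using s by simp
   then show ?thesis using s(1) False by (simp add: field_simps)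
  qed
 qed
qed

text \<open>The errors are taken proportional to the coercivity constant \<open>s\<close>, so that a
  quarter of |MG a h| absorbs them. Hence the factor 4 is absolute, and only the size
  \<open>h1\<close> depends on the frame.\<close>

lemma FF_bilipschitz:
 "EX h1>0. ALL a:cball 0 (rad/2) \<inter> RI. ALL u:cball 0 (rad/2) \<inter> RI. ALL u':cball 0 (rad/2) \<inter> RI. norm (u - a) < h1 --> norm (u' - u) < h1 -->
   norm (FF u' - FF u) <= 4*norm (MG a (u' - u)) & norm (MG a (u' - u)) <= 4*norm (FF u' - FF u)"
proof -
 from MG_coercive obtain s where s1: "s > 0" and s2: "ALL u:cball 0 rad. ALL w:RI. s*norm w <= norm (MG u w)" by (elim exE conjE)
 note s = s1 s2[rule_format]
 have e: "0 < s/8" using s by simp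
 from DF_uniformly_continuous[OF e] obtain d where d1: "d > 0" and d2: "ALL u:cball 0 (rad/2) \<inter> RI. ALL v:cball 0 (rad/2) \<inter> RI. norm (u - v) < d -->
   (ALL w:RI. norm (ZZ (FF u) (BF u w) - ZZ (FF v) (BF v w)) <= s/8*norm w)" by (elim exE conjE)
 have d: "norm (ZZ (FF u) (BF u w) - ZZ (FF v) (BF v w)) <= s/8*norm w"
  if "u : cball 0 (rad/2) \<inter> RI" "v : cball 0 (rad/2) \<inter> RI" "norm (u - v) < d" "w : RI" for u v w
  using d2 that by blast
 have "EX h0>0. ALL u:cball 0 rad \<inter> RI. ALL u':cball 0 rad \<inter> RI. norm (u' - u) < h0 -->
   norm (FF u' - FF u - ZZ (FF u) (BF u (u' - u))) <= s/8*norm (u' - u)" proof -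
  from zF have "ALL e>0. EX h0>0. ALL u:cball 0 rad \<inter> RI. ALL u':cball 0 rad \<inter> RI. norm (u' - u) < h0 -->
    norm (FF u' - FF u - ZZ (FF u) (BF u (u' - u))) <= e*norm (u' - u)" unfolding zstruct_def by (elim conjE)
  then show ?thesis using e by (elim allE impE)
 qed
 then obtain h0 where h01: "h0 > 0" and h02: "ALL u:cball 0 rad \<inter> RI. ALL u':cball 0 rad \<inter> RI. norm (u' - u) < h0 -->
   norm (FF u' - FF u - ZZ (FF u) (BF u (u' - u))) <= s/8*norm (u' - u)" by (elim exE conjE)
 show ?thesis
 proof (intro exI[of _ "min d h0"] conjI ballI impI)
  show "0 < min d h0" using d1 h01 by simp
  fix a u u' assume a: "a : cball 0 (rad/2) \<inter> RI" and u: "u : cball 0 (rad/2) \<inter> RI" and u': "u' : cball 0 (rad/2) \<inter> RI"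
   and ua: "norm (u - a) < min d h0" and uu: "norm (u' - u) < min d h0"
  let ?h = "u' - u" and ?D = "ZZ (FF a) (BF a (u' - u))"
  have h: "?h : RI" using u u' by (intro subspace_diff[OF subspace_RI]) auto
  have aU: "a : cball 0 rad" using a rad_pos by auto
  have 1: "norm (FF u' - FF u - ZZ (FF u) (BF u ?h)) <= s/8*norm ?h" proof -
   have "u : cball 0 rad \<inter> RI" "u' : cball 0 rad \<inter> RI" "norm (u' - u) < h0" using u u' uu rad_pos by simp_all
   then show ?thesis using h02 by blast
  qed
  have 2: "norm (ZZ (FF u) (BF u ?h) - ?D) <= s/8*norm ?h" using d[OF u a _ h] ua by simp
  have 3: "norm (FF u' - FF u - ?D) <= s/4*norm ?h"
   using norm_triangle_ineq[of "FF u' - FF u - ZZ (FF u) (BF u ?h)" "ZZ (FF u) (BF u ?h) - ?D"] 1 2 unfolding diff_add_cancel add.assoc[symmetric] diff_add_eq by (simp add: algebra_simps)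
  have 4: "s/4*norm ?h <= 1/4*norm (MG a ?h)" using s(2)[OF aU h] by simp
  note c = DF_compare[OF aU h]
  show "norm (FF u' - FF u) <= 4*norm (MG a ?h)"
   using norm_triangle_sub[of "FF u' - FF u" ?D] 3 4 c(2) norm_ge_zero[of "MG a ?h"] by linarith
  show "norm (MG a ?h) <= 4*norm (FF u' - FF u)"
   using norm_triangle_sub[of ?D "FF u' - FF u"] 3 4 c(1) by (simp add: norm_minus_commute)
 qed
qed

definition BX :: "real^'n => real => (real^'n) set" where
 "BX a s = {u : RI. ALL i:I. a $ i <= u $ i & u $ i <= a $ i + s}"

text \<open>The common yardstick for numerator and denominator of an average. It cancels, so its
  value is never computed; scaling and positivity suffice.\<close>

definition tau :: "real => ennreal" where "tau s = haus_outer kk (ZZ x ` BX 0 s)"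

lemma RI_component: "w : RI ==> i \<notin> I ==> w $ i = 0" by (auto simp: RI_def)

lemma BX_dist: assumes "a : RI" "u : BX a s" "u' : BX a s" "0 <= s" shows "norm (u' - u) <= real CARD('n) * s"
proof (rule norm_le_card_cart)
 fix i
 show "\<bar>(u' - u) $ i\<bar> <= s"
 proof (cases "i : I")
  case True
  then have "a $ i <= u $ i" "u $ i <= a $ i + s" "a $ i <= u' $ i" "u' $ i <= a $ i + s" using assms(2,3) by (auto simp: BX_def)
  then show ?thesis by simp
 next
  case False
  then have "u $ i = 0" "u' $ i = 0" using assms(2,3) RI_component by (auto simp: BX_def)
  then show ?thesis using assms(4) by simp
 qed
qed

lemma BX_base: "a : RI ==> 0 <= s ==> a : BX a s" by (simp add: BX_def)

lemma BX_RI: "u : BX a s ==> u : RI" by (simp add: BX_def)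

lemma compact_BX: assumes "a : RI" "0 <= s" shows "compact (BX a s)"
unfolding compact_eq_bounded_closed
proof (rule conjI)
 have "norm u <= norm a + real CARD('n) * s" if "u : BX a s" for u
  using BX_dist[OF assms(1) BX_base[OF assms] that assms(2)] norm_triangle_sub[of u a] by simp
 then show "bounded (BX a s)" by (auto simp: bounded_iff)
 have "BX a s = RI \<inter> (\<Inter>i\<in>I. {u. a $ i <= u $ i} \<inter> {u. u $ i <= a $ i + s})" by (auto simp: BX_def)
 then show "closed (BX a s)"
  by (simp only:) (intro closed_Int closed_RI closed_INT ballI closed_Collect_le continuous_intros)
qed

lemma haus_translate: assumes a: "a : RI" shows "haus_outer kk (ZZ x ` BX a s) = tau s"
proof -
 have e: "ZZ x ` BX a s = (%w. ZZ x (a + w)) ` BX 0 s"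
 proof (safe)
  fix u assume u: "u : BX a s"
  have "u - a : BX 0 s" using u subspace_diff[OF subspace_RI BX_RI[OF u] a] by (auto simp: BX_def algebra_simps)
  moreover have "ZZ x u = ZZ x (a + (u - a))" by simp
  ultimately show "ZZ x u : (%w. ZZ x (a + w)) ` BX 0 s" by (rule rev_image_eqI)
 next
  fix w assume w: "w : BX 0 s"
  have "a + w : BX a s" using w subspace_add[OF subspace_RI a BX_RI[OF w]] by (auto simp: BX_def)
  then show "ZZ x (a + w) : ZZ x ` BX a s" by simp
 qed
 have d: "dist (ZZ x (a + u)) (ZZ x (a + v)) = dist (ZZ x u) (ZZ x v)" for u v
  by (simp add: linear_add[OF linear_ZZ])
 have "haus_outer kk ((%w. ZZ x (a + w)) ` BX 0 s) <= ennreal (1 ^ kk)*haus_outer kk (ZZ x ` BX 0 s)"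
  by (rule haus_outer_lipschitz) (simp_all add: d)
 moreover have "haus_outer kk (ZZ x ` BX 0 s) <= ennreal (1 ^ kk)*haus_outer kk ((%w. ZZ x (a + w)) ` BX 0 s)"
  by (rule haus_outer_lipschitz) (simp_all add: d)
 ultimately show ?thesis unfolding e tau_def by simp
qed

text \<open>A cube of side m*s is covered by m^kk translates of the cube of side s, whose images all
  have the same measure.\<close>

lemma tau_mult: assumes s: "0 < s" and m: "0 < m" shows "tau (real m * s) <= ennreal (real m ^ kk)*tau s"
proof -
 let ?P = "PiE I (%_. {..<m})"
 define v where "v z = (\<chi> i. if i : I then real (z i) * s else 0)" for z :: "'n => nat"
 have fin: "finite ?P" by (rule finite_PiE) simp_all
 have vRI: "v z : RI" for z by (simp add: v_def RI_def)
 have "ZZ x ` BX 0 (real m * s) \<subseteq> (\<Union>z\<in>?P. ZZ x ` BX (v z) s)"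
 proof
  fix y assume "y : ZZ x ` BX 0 (real m * s)"
  then obtain u where u: "u : BX 0 (real m * s)" and y: "y = ZZ x u" by blast
  have "EX z<m. real z * s <= t & t <= real z * s + s" if t: "0 <= t" "t <= real m * s" for t
  \<comment> \<open>On the upper face the integer part of t/s would be \<open>m\<close>, one too
    large.\<close>
  proof (cases "t = real m * s")
   case True
   then show ?thesis using m s by (intro exI[of _ "m - 1"]) (auto simp: of_nat_diff algebra_simps)
  next
   case False
   define z where "z = nat \<lfloor>t/s\<rfloor>"
   have z: "real z = of_int \<lfloor>t/s\<rfloor>" using t s by (simp add: z_def)
   have 1: "real z <= t/s" "t/s < real z + 1" unfolding z by linarith+
   then have 2: "real z * s <= t" "t < real z * s + s" using s by (simp_all add: field_simps)
   then have "real z * s < real m * s" using t False by linarith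
   then have "z < m" using s by simp
   then show ?thesis using 2 by (intro exI[of _ z]) auto
  qed
  then have "ALL i:I. EX z<m. real z * s <= u $ i & u $ i <= real z * s + s" using u by (auto simp: BX_def)
  then obtain z0 where z0: "ALL i:I. z0 i < m & real (z0 i) * s <= u $ i & u $ i <= real (z0 i) * s + s" by metis
  define z where "z = restrict z0 I"
  have "z : ?P" using z0 by (auto simp: z_def)
  moreover have "u : BX (v z) s" using z0 u by (auto simp: BX_def v_def z_def)
  ultimately show "y : (\<Union>z\<in>?P. ZZ x ` BX (v z) s)" using y by blast
 qed
 moreover have "card ?P = m ^ kk" by (simp add: card_PiE)
 moreover have "haus_outer kk (\<Union>z\<in>?P. ZZ x ` BX (v z) s) <= of_nat (card ?P)*tau s"
  using haus_outer_finite_UN_le[OF fin, of kk "%z. ZZ x ` BX (v z) s"] haus_translate[OF vRI] by simp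
 ultimately show ?thesis unfolding tau_def[of "real m * s"]
  using order_trans[OF haus_outer_mono[of "ZZ x ` BX 0 (real m * s)" "\<Union>z\<in>?P. ZZ x ` BX (v z) s" kk]] by (simp add: ennreal_of_nat_eq_real_of_nat)
qed

lemma emeasure_cbox_cart:
 fixes l h :: "'n => real"
 assumes "!!i. l i <= h i"
 shows "emeasure lborel (cbox (\<chi> i. l i) (\<chi> i. h i)) = ennreal (\<Prod>i\<in>UNIV. h i - l i)"
  "emeasure lborel (box (\<chi> i. l i) (\<chi> i. h i)) = ennreal (\<Prod>i\<in>UNIV. h i - l i)"
proof -
 have le: "(\<chi> i. l i) \<bullet> b <= (\<chi> i. h i) \<bullet> b" if "b : Basis" for b :: "real^'n"
  using that assms by (auto simp: Basis_vec_def inner_axis)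
 have ne: "cbox (\<chi> i. l i) (\<chi> i. h i) ~= {}" using assms by (simp add: interval_ne_empty_cart)
 have "measure lborel (cbox (\<chi> i. l i) (\<chi> i. h i)) = (\<Prod>i\<in>UNIV. h i - l i)" using content_cbox_cart[OF ne] by simp
 moreover have "measure lborel (cbox (\<chi> i. l i) (\<chi> i. h i)) = (\<Prod>b\<in>Basis. ((\<chi> i. h i) - (\<chi> i. l i)) \<bullet> b)"
  using content_cbox[of "\<chi> i. l i" "\<chi> i. h i"] le by (simp add: inner_diff_left)
 ultimately have p: "(\<Prod>b\<in>Basis. ((\<chi> i. h i) - (\<chi> i. l i)) \<bullet> b) = (\<Prod>i\<in>UNIV. h i - l i)" by simp
 show "emeasure lborel (cbox (\<chi> i. l i) (\<chi> i. h i)) = ennreal (\<Prod>i\<in>UNIV. h i - l i)"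
  "emeasure lborel (box (\<chi> i. l i) (\<chi> i. h i)) = ennreal (\<Prod>i\<in>UNIV. h i - l i)"
  using emeasure_lborel_cbox[OF le] emeasure_lborel_box[OF le] p by simp_all
qed

lemma prod_I: "(\<Prod>i\<in>UNIV. if i : I then a else (b::real)) = a ^ kk*b ^ (CARD('n) - kk)"
proof -
 have "(\<Prod>i\<in>UNIV. if i : I then a else b) = (\<Prod>i\<in>I. a)*(\<Prod>i\<in>-I. b)" using prod.If_cases[of UNIV "%i. i : I" "%_. a" "%_. b"] by simp
 then show ?thesis by (simp add: Compl_eq_Diff_UNIV card_Diff_subset)
qed

text \<open>Lebesgue measure on R^n bounds the Hausdorff sums from below. The preimages of the
  covering sets are enclosed in boxes, extended by [0,1] in the coordinates outside
  \<open>I\<close>, and these boxes cover a box of volume s^kk.\<close>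

lemma tau_pos: assumes s: "0 < s" shows "0 < tau s"
proof -
 obtain e where e: "e > 0" "ALL w:RI. e*norm w <= norm (ZZ x w)" using ZZ_coercive by blast
 let ?b = "unit_ball_vol (real kk)"
 \<comment> \<open>A box of half-side diameter/e contributes (2*diameter/e)^kk; the factor (e/4)^kk
   turns this into (diameter/2)^kk.\<close>
 define K where "K = ?b*(e/4) ^ kk"
 have K: "0 < K" using e by (simp add: K_def)
 have main: "ennreal (s ^ kk)*ennreal K <= (\<Sum>i. haus_weight kk (C i))" if C: "C : haus_covers 1 (ZZ x ` BX 0 s)" for C
 proof -
  define E where "E i = {u : BX 0 s. ZZ x u : C i}" for i :: nat
  define a where "a i = (SOME u. u : E i)" for i
  define r where "r i = diameter (C i)/e" for i
  define W where "W i = (if E i = {} then {} else cbox (\<chi> l. if l : I then a i $ l - r i else 0) (\<chi> l. if l : I then a i $ l + r i else 1))" for i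
  have r0: "0 <= r i" for i using diameter_ge_0[of "C i"] C e by (auto simp: r_def haus_covers_def)
  have aE: "a i : E i" if "E i ~= {}" for i unfolding a_def by (rule someI_ex) (use that in blast)
  have E: "\<bar>u $ l - a i $ l\<bar> <= r i" if u: "u : E i" for u i l
  proof -
   have ai: "a i : E i" using aE u by blast
   then have d: "u - a i : RI" using u by (auto simp: E_def BX_def intro: subspace_diff[OF subspace_RI])
   have "e*norm (u - a i) <= norm (ZZ x u - ZZ x (a i))" using bspec[OF e(2) d] linear_diff[OF linear_ZZ] by simp
   also have "... <= diameter (C i)" using diameter_bounded_bound[of "C i" "ZZ x u" "ZZ x (a i)"] C u ai
    by (auto simp: haus_covers_def E_def dist_norm)
   finally have "norm (u - a i) <= r i" using e by (simp add: r_def field_simps)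
   then show ?thesis using component_le_norm_cart[of "u - a i" l] by simp
  qed
  have cov: "cbox 0 (\<chi> l. if l : I then s else 1) \<subseteq> (\<Union>i. W i)"
  proof
   fix u :: "real^'n" assume u: "u : cbox 0 (\<chi> l. if l : I then s else 1)"
   then have u': "0 <= u $ l" "u $ l <= (if l : I then s else 1)" for l by (auto simp: mem_box_cart)
   have "pI u : BX 0 s" unfolding BX_def
   proof (intro CollectI conjI ballI pI_RI)
    fix i assume "i : I"
    then show "0 $ i <= pI u $ i" "pI u $ i <= 0 $ i + s" using u'[of i] by (auto simp: pI_component)
   qed
   then obtain i where i: "pI u : E i" using C by (auto simp: haus_covers_def E_def)
   have "u : W i"
   proof -
    have bd: "\<bar>u $ l - a i $ l\<bar> <= r i" if "l : I" for l using E[OF i, of l] that by (simp add: pI_component)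
    have "u : cbox (\<chi> l. if l : I then a i $ l - r i else 0) (\<chi> l. if l : I then a i $ l + r i else 1)"
     unfolding mem_box_cart
    proof (intro allI)
     fix l
     show "(\<chi> l. if l : I then a i $ l - r i else 0) $ l <= u $ l & u $ l <= (\<chi> l. if l : I then a i $ l + r i else 1) $ l"
      using u'[of l] bd[of l] by (cases "l : I") (auto simp: abs_le_iff)
    qed
    then show ?thesis using i by (auto simp: W_def)
   qed
   then show "u : (\<Union>i. W i)" by blast
  qed
  have Wm: "W i : sets lborel" for i by (simp add: W_def)
  have Wle: "emeasure lborel (W i)*ennreal K <= haus_weight kk (C i)" for i
  proof (cases "E i = {}")
   case True
   then show ?thesis by (simp add: W_def)
  next
   case False
   then have ne: "C i ~= {}" by (auto simp: E_def)
   have "emeasure lborel (W i) = ennreal (\<Prod>l\<in>UNIV. (if l : I then a i $ l + r i else 1) - (if l : I then a i $ l - r i else 0))"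
    using False r0[of i] by (simp add: W_def emeasure_cbox_cart(1))
   also have "(\<Prod>l\<in>UNIV. (if l : I then a i $ l + r i else 1) - (if l : I then a i $ l - r i else 0)) = (\<Prod>l\<in>UNIV. if l : I then 2*r i else 1)"
    by (intro prod.cong) auto
   also have "... = (2*r i) ^ kk" by (simp add: prod_I)
   finally have "emeasure lborel (W i)*ennreal K = ennreal ((2*r i) ^ kk*K)" using r0[of i] K by (simp add: ennreal_mult)
   also have "(2*r i) ^ kk*K = ?b*((2*r i)*(e/4)) ^ kk" unfolding K_def power_mult_distrib by simp
   also have "(2*r i)*(e/4) = diameter (C i)/2" using e by (simp add: r_def)
   finally show ?thesis using ne by (simp add: haus_weight_def)
  qed
  have "ennreal (s ^ kk) = emeasure lborel (cbox (\<chi> l. 0) (\<chi> l. if l : I then s else 1))"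
   using emeasure_cbox_cart(1)[of "%l. 0" "%l. if l : I then s else 1"] s prod_I[of s 1] by simp
  also have "(\<chi> l. 0) = (0::real^'n)" by (simp add: vec_eq_iff)
  also have "emeasure lborel (cbox 0 (\<chi> l. if l : I then s else 1)) <= emeasure lborel (\<Union>i. W i)"
   by (rule emeasure_mono[OF cov]) (use Wm in auto)
  also have "... <= (\<Sum>i. emeasure lborel (W i))" by (rule emeasure_subadditive_countably) (use Wm in auto)
  finally have "ennreal (s ^ kk)*ennreal K <= (\<Sum>i. emeasure lborel (W i))*ennreal K" by (rule mult_right_mono) simp
  also have "... = (\<Sum>i. emeasure lborel (W i)*ennreal K)" by (rule ennreal_suminf_multc[symmetric])
  also have "... <= (\<Sum>i. haus_weight kk (C i))" by (intro suminf_le Wle) auto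
  finally show ?thesis .
 qed
 have "ennreal (s ^ kk)*ennreal K <= haus_pre kk 1 (ZZ x ` BX 0 s)"
  unfolding haus_pre_def by (rule INF_greatest) (rule main)
 also have "... <= tau s" unfolding tau_def by (rule haus_pre_le_outer) simp
 finally have "ennreal (s ^ kk*K) <= tau s" using s K by (simp add: ennreal_mult)
 moreover have "0 < ennreal (s ^ kk*K)" using s K by simp
 ultimately show ?thesis by (rule less_le_trans[rotated])
qed

text \<open>Up to the factor 4 of \<open>FF_bilipschitz\<close> the image of a cube is its image
  under \<open>MG a\<close>, that is under \<open>GG a\<close> followed by \<open>ZZ x\<close>. As
  \<open>GG a\<close> is within 1/2 of the identity, it maps a cube into a cube of side 4*N*h, and
  the image of the half cube contains one of side h/(8*N). This gives 4*4*N and 4*8*N. Half cubes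
  appear in the lower bound because they are the ones that can be packed disjointly.\<close>

lemma FF_box_measure:
 "EX h1>0. ALL a:cball 0 (rad/4) \<inter> RI. ALL h. 0 < h --> real CARD('n)*h < h1 -->
   haus_outer kk (FF ` BX a h) <= ennreal ((16*real CARD('n)) ^ kk)*tau h &
   tau h <= ennreal ((32*real CARD('n)) ^ kk)*haus_outer kk (FF ` BX a (h/2))"
proof -
 let ?N = "real CARD('n)"
 have N: "1 <= ?N" by (rule CARD1)
 from FF_bilipschitz obtain h1 where h1: "h1 > 0" and bl: "ALL a:cball 0 (rad/2) \<inter> RI. ALL u:cball 0 (rad/2) \<inter> RI. ALL u':cball 0 (rad/2) \<inter> RI. norm (u - a) < h1 --> norm (u' - u) < h1 -->
   norm (FF u' - FF u) <= 4*norm (MG a (u' - u)) & norm (MG a (u' - u)) <= 4*norm (FF u' - FF u)" by (elim exE conjE)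
 show ?thesis
 proof (intro exI[of _ "min h1 (rad/4)"] conjI ballI allI impI)
  show "0 < min h1 (rad/4)" using h1 rad_pos by simp
  fix a h assume a: "a : cball 0 (rad/4) \<inter> RI" and h: "0 < h" and hh: "?N*h < min h1 (rad/4)"
  have aR: "a : RI" and aU: "a : cball 0 rad" and aU2: "a : cball 0 (rad/2) \<inter> RI" using a rad_pos by auto
  have inU: "u : cball 0 (rad/2) \<inter> RI" "norm (u - a) < h1" if "u : BX a h" for u
  proof -
   have n: "norm (u - a) <= ?N*h" using BX_dist[OF aR BX_base[OF aR] that] h by simp
   have "norm a <= rad/4" using a by simp
   then have "norm u <= rad/2" using n hh norm_triangle_sub[of u a] by simp
   then show "u : cball 0 (rad/2) \<inter> RI" using BX_RI[OF that] by simp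
   show "norm (u - a) < h1" using n hh by simp
  qed
  have cmp: "dist (FF u) (FF v) <= 4*dist (MG a u) (MG a v) & dist (MG a u) (MG a v) <= 4*dist (FF u) (FF v)"
   if u: "u : BX a h" and v: "v : BX a h" for u v
  proof -
   have "norm (u - v) < h1" using BX_dist[OF aR v u] h hh by simp
   then have "norm (FF u - FF v) <= 4*norm (MG a (u - v)) & norm (MG a (u - v)) <= 4*norm (FF u - FF v)"
    using bl aU2 inU[OF u] inU[OF v] by blast
   then show ?thesis by (simp add: dist_norm linear_diff[OF linear_MG[OF aU]])
  qed
  have one: "(\<chi> i. if i : I then r else 0) : RI" for r :: real by (simp add: RI_def)
  have GR: "GG a w : RI" if "w : RI" for w by (rule GG_RI[OF aU that])
  show "haus_outer kk (FF ` BX a h) <= ennreal ((16*?N) ^ kk)*tau h"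
  proof -
   \<comment> \<open>The corner of a cube of side 4*N*h centred at \<open>GG a a\<close>; the image
     of \<open>BX a h\<close> stays within 2*N*h of that centre.\<close>
   define b where "b = GG a a - (\<chi> i. if i : I then 2*(?N*h) else 0)"
   have b: "b : RI" unfolding b_def by (intro subspace_diff[OF subspace_RI] GR one aR)
   have sub: "MG a ` BX a h \<subseteq> ZZ x ` BX b (4*(?N*h))"
   proof safe
    fix u assume u: "u : BX a h"
    have "norm (GG a (u - a)) <= 2*norm (u - a)"
     using GG_near[OF aU, of "u - a"] norm_triangle_sub[of "GG a (u - a)" "u - a"] norm_ge_zero[of "u - a"] by linarith
    then have n: "norm (GG a u - GG a a) <= 2*(?N*h)" using BX_dist[OF aR BX_base[OF aR] u] h by (simp add: linear_diff[OF GG_linear[OF aU]])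
    have "GG a u : BX b (4*(?N*h))" unfolding BX_def
    proof (intro CollectI conjI ballI GR BX_RI[OF u])
     fix i assume i: "i : I"
     have bi: "b $ i = GG a a $ i - 2*(?N*h)" using i by (simp add: b_def)
     have "\<bar>GG a u $ i - GG a a $ i\<bar> <= 2*(?N*h)" using component_le_norm_cart[of "GG a u - GG a a" i] n by simp
     then show "b $ i <= GG a u $ i" "GG a u $ i <= b $ i + 4*(?N*h)"
      using bi unfolding abs_le_iff by linarith+
    qed
    then show "MG a u : ZZ x ` BX b (4*(?N*h))" by (simp add: MG_def)
   qed
   have 1: "haus_outer kk (FF ` BX a h) <= ennreal (4 ^ kk)*haus_outer kk (MG a ` BX a h)"
    by (rule haus_outer_lipschitz) (use cmp in auto)
   have 2: "haus_outer kk (MG a ` BX a h) <= tau (real (4*CARD('n))*h)"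
    using haus_outer_mono[OF sub, of kk] unfolding haus_translate[OF b] by (simp add: mult.assoc)
   have 3: "... <= ennreal (real (4*CARD('n)) ^ kk)*tau h" by (rule tau_mult[OF h]) simp
   have "haus_outer kk (FF ` BX a h) <= ennreal (4 ^ kk)*(ennreal (real (4*CARD('n)) ^ kk)*tau h)"
    by (rule order_trans[OF 1 mult_left_mono[OF order_trans[OF 2 3]]]) simp
   also have "... = ennreal (4 ^ kk*(4*?N) ^ kk)*tau h" by (simp add: ennreal_mult mult.assoc)
   also have "4 ^ kk*(4*?N) ^ kk = (16*?N) ^ kk" unfolding power_mult_distrib[symmetric] by simp
   finally show ?thesis .
  qed
  show "tau h <= ennreal ((32*?N) ^ kk)*haus_outer kk (FF ` BX a (h/2))"
  proof -
   \<comment> \<open>The centre of the half cube: adding a vector of norm at most h/4 in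
     \<open>RI\<close> does not leave it.\<close>
   define c where "c = a + (\<chi> i. if i : I then h/4 else 0)"
   have cR: "c : RI" unfolding c_def by (intro subspace_add[OF subspace_RI] one aR)
   define s where "s = h/(8*?N)"
   have s: "0 < s" "?N * s = h/8" "real (8*CARD('n)) * s = h" using h N by (auto simp: s_def field_simps)
   have sub: "ZZ x ` BX (GG a c) s \<subseteq> MG a ` BX a (h/2)"
   proof safe
    fix w assume w: "w : BX (GG a c) s"
    let ?v = "w - GG a c"
    have n: "norm ?v <= h/8" using BX_dist[OF GR[OF cR] BX_base[OF GR[OF cR]] w] s by auto
    have v: "?v : RI" by (intro subspace_diff[OF subspace_RI] BX_RI[OF w] GR cR)
    obtain k where k: "k : RI" "GG a k = ?v" "norm k <= 2*norm ?v" using GG_inverse[OF aU v] by blast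
    have "c + k : BX a (h/2)" unfolding BX_def
    proof (intro CollectI conjI ballI subspace_add[OF subspace_RI] cR k(1))
     fix i assume i: "i : I"
     have "\<bar>k $ i\<bar> <= h/4" using component_le_norm_cart[of k i] k(3) n by simp
     then show "a $ i <= (c + k) $ i" "(c + k) $ i <= a $ i + h/2" using i by (auto simp: c_def)
    qed
    moreover have "MG a (c + k) = ZZ x w" unfolding MG_def linear_add[OF GG_linear[OF aU]] k(2) by simp
    ultimately show "ZZ x w : MG a ` BX a (h/2)" by (intro image_eqI[of _ _ "c + k"]) auto
   qed
   have sb: "BX a (h/2) \<subseteq> BX a h"
   proof
    fix u assume u: "u : BX a (h/2)"
    show "u : BX a h" unfolding BX_def
    proof (intro CollectI conjI ballI BX_RI[OF u])
     fix i assume "i : I"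
     then have "a $ i <= u $ i" "u $ i <= a $ i + h/2" using u by (auto simp: BX_def)
     then show "a $ i <= u $ i" "u $ i <= a $ i + h" using h by linarith+
    qed
   qed
   have 1: "tau h <= ennreal (real (8*CARD('n)) ^ kk)*tau s" using tau_mult[OF s(1), of "8*CARD('n)"] unfolding s(3) by simp
   have 2: "tau s <= haus_outer kk (MG a ` BX a (h/2))" using haus_outer_mono[OF sub, of kk] haus_translate[OF GR[OF cR]] by simp
   have 3: "... <= ennreal (4 ^ kk)*haus_outer kk (FF ` BX a (h/2))"
    by (rule haus_outer_lipschitz) (use cmp sb in auto)
   have "tau h <= ennreal (real (8*CARD('n)) ^ kk)*(ennreal (4 ^ kk)*haus_outer kk (FF ` BX a (h/2)))"
    by (rule order_trans[OF 1 mult_left_mono[OF order_trans[OF 2 3]]]) simp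
   also have "... = ennreal ((8*?N) ^ kk*4 ^ kk)*haus_outer kk (FF ` BX a (h/2))" by (simp add: ennreal_mult mult.assoc)
   also have "(8*?N) ^ kk*4 ^ kk = (32*?N) ^ kk" unfolding power_mult_distrib[symmetric] by simp
   finally show ?thesis .
  qed
 qed
qed

end

section \<open>Averages over leaf balls\<close>

context cframe
begin

lemma FF_pI: "FF (pI u) = FF u"
proof -
 have "foldl (%z i. flow Om (lc q Y (iot {i} (pI u))) z) z l = foldl (%z i. flow Om (lc q Y (iot {i} u)) z) z l" if "set l \<subseteq> I" for l z
  using that
 proof (induction l arbitrary: z)
  case (Cons i l)
  have "iot {i} (pI u) = iot {i} u" using Cons.prems by (simp add: iot_def fun_eq_iff pI_component)
  then show ?case using Cons by simp
 qed simp
 then show ?thesis unfolding FF_def using il by simp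
qed

text \<open>The parameter domain thickened to full dimension: coordinates outside \<open>I\<close>
  range over [-rad, rad] without affecting \<open>FF\<close>, so Lebesgue measure on R^n serves for
  every leaf dimension.\<close>

definition DD :: "(real^'n) set" where "DD = {u. (ALL i. \<bar>u $ i\<bar> <= rad) & norm (pI u) <= rad/2}"

lemma continuous_pI: "continuous_on S pI"
proof -
 have "linear pI" by (intro linearI) (simp_all add: pI_def vec_eq_iff)
 then show ?thesis by (rule linear_continuous_on_compose[OF continuous_on_id])
qed

lemma FF_Om: "u : cball 0 rad ==> FF u : Om" using FF_reach' RR_sub by blast

lemma closed_DD: "closed DD"
proof -
 have "DD = (\<Inter>i. {u. \<bar>u $ i\<bar> <= rad}) \<inter> {u. norm (pI u) <= rad/2}" by (auto simp: DD_def)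
 then show ?thesis
  by (simp only:) (intro closed_Int closed_INT ballI closed_Collect_le continuous_intros continuous_pI)
qed

lemma FF_continuous_DD: "continuous_on DD FF"
proof -
 have "continuous_on DD (%u. FF (pI u))"
  by (rule continuous_on_compose2[OF FF_continuous continuous_pI]) (use rad_pos pI_RI in \<open>auto simp: DD_def\<close>)
 then show ?thesis by (simp add: FF_pI)
qed

text \<open>Comparison of Riemann sums on a grid of mesh \<open>h\<close>. The integral over
  \<open>B\<close> is at most a constant times \<open>tau h\<close> times the sum of the values at
  grid corners; the measure of \<open>B\<close> is at least a constant times m^kk times
  \<open>tau h\<close>, by disjoint images of half cubes inside \<open>BX 0 rh\<close>. The factor
  \<open>tau h\<close> cancels, and sending the oscillation \<open>ep\<close> to zero removes the
  error.\<close>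

theorem average_bound:
 fixes g :: "real^'n => real"
 assumes B: "B : sets borel" "FF ` BX 0 rh \<subseteq> B" "B \<subseteq> FF ` (cball 0 (rad/7) \<inter> RI)"
  and rh: "0 < rh" "real CARD('n)*rh <= rad/8"
  and g: "continuous_on Om g" "!!y. 0 <= g y"
 shows "(\<integral>\<^sup>+ y\<in>B. ennreal (g y) \<partial>hausdorff_measure kk)/emeasure (hausdorff_measure kk) B
  <= ennreal ((512*(real CARD('n))\<^sup>2) ^ kk/(rh ^ kk*(2*rad) ^ (CARD('n) - kk)))*(\<integral>\<^sup>+ u\<in>DD. ennreal (g (FF u)) \<partial>lborel)"
proof -
 let ?N = "real CARD('n)" and ?M = "hausdorff_measure kk :: (real^'n) measure"
 let ?J = "\<integral>\<^sup>+ u\<in>DD. ennreal (g (FF u)) \<partial>lborel"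
 define W where "W = rh ^ kk*(2*rad) ^ (CARD('n) - kk)"
 define C where "C = (512*?N\<^sup>2) ^ kk/W"
 have N: "1 <= ?N" by (rule CARD1)
 have W: "0 < W" using rh rad_pos by (simp add: W_def)
 have C: "0 < C" using W N by (simp add: C_def)
 let ?U = "cball 0 (rad/2) \<inter> RI"
 have U: "?U \<subseteq> cball 0 rad \<inter> RI" using rad_pos by auto
 have Uc: "compact ?U" by (simp add: compact_Int_closed closed_RI)
 have gF: "continuous_on ?U (%u. g (FF u))"
  by (rule continuous_on_compose2[OF g(1) continuous_on_subset[OF FF_continuous U]]) (use U FF_Om in blast)
 have gD: "continuous_on DD (%u. g (FF u))"
 proof (rule continuous_on_compose2[OF g(1) FF_continuous_DD])
  show "FF ` DD \<subseteq> Om"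
  proof safe
   fix u assume "u : DD"
   then have "pI u : cball 0 rad" using rad_pos by (simp add: DD_def)
   then show "FF u : Om" using FF_Om[of "pI u"] by (simp add: FF_pI)
  qed
 qed
 have Jm: "(%u. ennreal (g (FF u))*indicator DD u) : borel_measurable lborel"
 proof -
  have "(%u. indicator DD u *\<^sub>R g (FF u)) : borel_measurable borel"
   by (rule borel_measurable_continuous_on_indicator[OF _ gD]) (use closed_DD in auto)
  then have "(%u. ennreal (indicator DD u *\<^sub>R g (FF u))) : borel_measurable lborel" by simp
  moreover have "ennreal (indicator DD u *\<^sub>R g (FF u)) = ennreal (g (FF u))*indicator DD u" for u by (simp split: split_indicator)
  ultimately show ?thesis by simp
 qed
 from FF_box_measure obtain h1 where h1: "h1 > 0" and bm: "ALL a:cball 0 (rad/4) \<inter> RI. ALL h. 0 < h --> ?N*h < h1 -->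
   haus_outer kk (FF ` BX a h) <= ennreal ((16*?N) ^ kk)*tau h &
   tau h <= ennreal ((32*?N) ^ kk)*haus_outer kk (FF ` BX a (h/2))" by (elim exE conjE)
 have main: "(\<integral>\<^sup>+ y\<in>B. ennreal (g y) \<partial>?M)/emeasure ?M B <= ennreal C*(?J + ennreal (2*ep * (2*rad) ^ CARD('n)))" if ep: "0 < ep" for ep
 proof -
  have "uniformly_continuous_on ?U (%u. g (FF u))" by (rule compact_uniformly_continuous[OF gF Uc])
  then obtain dl where dl: "0 < dl" "ALL u:?U. ALL v:?U. dist v u < dl --> dist (g (FF v)) (g (FF u)) < ep"
   unfolding uniformly_continuous_on_def using ep by blast
  define h' where "h' = min h1 (min dl (rad/16))"
  have h': "0 < h'" using h1 dl rad_pos by (simp add: h'_def)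
  obtain m where m2: "?N*rh/h' < real m" using reals_Archimedean2 by blast
  have "0 <= ?N*rh/h'" using rh h' by simp
  then have "0 < real m" using m2 by linarith
  then have m: "m > 0" "?N*rh/h' < real m" using m2 by simp_all
  \<comment> \<open>\<open>rh\<close> is an exact multiple of the mesh, so that m^kk grid cubes fit
    into \<open>BX 0 rh\<close>.\<close>
  define h where "h = rh/real m"
  have h: "0 < h" "?N*h < h'" using m rh h' by (auto simp: h_def field_simps)
  have hh: "?N*h < h1" "?N*h < dl" "?N*h < rad/16" using h(2) by (auto simp: h'_def)
  have mh: "real m*h = rh" using m by (simp add: h_def)
  define cz where "cz z = (\<chi> i. if i : I then h * of_int (z i) else 0)" for z :: "'n => int"
  have czR: "cz z : RI" for z by (simp add: cz_def RI_def)
  have cz_comp: "i : I ==> cz z $ i = h * of_int (z i)" for z i by (simp add: cz_def)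
  define M where "M = \<lceil>rad/h\<rceil> + 1"
  \<comment> \<open>The grid cubes meeting the ball of radius rad/7; their corners stay in the ball
    of radius rad/4 where \<open>FF_box_measure\<close> applies.\<close>
  define Z where "Z = {z : PiE I (%_. {-M..M}). BX (cz z) h \<inter> cball 0 (rad/7) ~= {}}"
  have finZ: "finite Z" unfolding Z_def by (rule finite_subset[of _ "PiE I (%_. {-M..M})"]) (auto intro: finite_PiE)
  have BXn: "norm (u - cz z) <= ?N*h" if "u : BX (cz z) h" for u z using BX_dist[OF czR BX_base[OF czR] that] h by simp
  have Zn: "norm (cz z) <= rad/7 + rad/16" if zZ: "z : Z" for z
  proof -
   obtain u where u: "u : BX (cz z) h" "u : cball 0 (rad/7)" using zZ unfolding Z_def by blast
   then have "u : BX (cz z) h" "norm u <= rad/7" by simp_all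
   then show ?thesis using BXn[of u z] hh(3) norm_triangle_sub[of "cz z" u] by (simp add: norm_minus_commute)
  qed
  have Z4: "cz z : cball 0 (rad/4) \<inter> RI" if "z : Z" for z using Zn[OF that] rad_pos czR by simp
  have osc: "g (FF u) <= g (FF (cz z)) + ep" "g (FF (cz z)) <= g (FF u) + ep" if z: "z : Z" and u: "u : BX (cz z) h" for z u
  proof -
   have "norm u <= rad/2" using BXn[OF u] Zn[OF z] hh(3) norm_triangle_sub[of u "cz z"] rad_pos by simp
   then have "u : ?U" "cz z : ?U" using BX_RI[OF u] Z4[OF z] rad_pos by auto
   moreover have "dist u (cz z) < dl" using BXn[OF u] hh(2) by (simp add: dist_norm)
   ultimately have "dist (g (FF u)) (g (FF (cz z))) < ep" using dl(2) by blast
   then show "g (FF u) <= g (FF (cz z)) + ep" "g (FF (cz z)) <= g (FF u) + ep" by (auto simp: dist_real_def)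
  qed
  have FFc: "compact (FF ` BX a s)" if "a : RI" "0 <= s" "BX a s \<subseteq> cball 0 rad" for a s
   by (rule compact_continuous_image[OF continuous_on_subset[OF FF_continuous] compact_BX[OF that(1,2)]]) (use that BX_RI in blast)
  have FFb: "FF ` BX (cz z) h : sets borel" if "z : Z" for z
  proof (rule borel_compact[OF FFc[OF czR less_imp_le[OF h(1)]]])
   show "BX (cz z) h \<subseteq> cball 0 rad"
   proof
    fix u assume u: "u : BX (cz z) h"
    then show "u : cball 0 rad" using BXn[OF u] Zn[OF that] hh(3) norm_triangle_sub[of u "cz z"] rad_pos by simp
   qed
  qed
  define S where "S = (\<Sum>z\<in>Z. ennreal (g (FF (cz z)) + ep))"
  have I1: "(\<integral>\<^sup>+ y\<in>B. ennreal (g y) \<partial>?M) <= ennreal ((16*?N) ^ kk)*tau h*S"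
  proof -
   have "(\<integral>\<^sup>+ y\<in>B. ennreal (g y) \<partial>?M) <= (\<integral>\<^sup>+ y. (\<Sum>z\<in>Z. ennreal (g (FF (cz z)) + ep)*indicator (FF ` BX (cz z) h) y) \<partial>?M)"
   proof (rule nn_integral_mono)
    fix y
    show "ennreal (g y)*indicator B y <= (\<Sum>z\<in>Z. ennreal (g (FF (cz z)) + ep)*indicator (FF ` BX (cz z) h) y)"
    proof (cases "y : B")
     case True
     then obtain u where u: "norm u <= rad/7" "u : RI" "y = FF u" using B(3) by auto
     define z where "z = restrict (%i. \<lfloor>u $ i/h\<rfloor>) I"
     have zz: "h * of_int (z i) <= u $ i" "u $ i <= h * of_int (z i) + h" "z i : {-M..M}" if i: "i : I" for i
     proof -
      have "of_int (z i) <= u $ i/h" "u $ i/h < of_int (z i) + 1" using i by (simp_all add: z_def)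
      then show "h * of_int (z i) <= u $ i" "u $ i <= h * of_int (z i) + h" using h by (auto simp: field_simps)
      have "\<bar>u $ i\<bar> <= rad" using component_le_norm_cart[of u i] u(1) rad_pos by simp
      then have "\<bar>u $ i/h\<bar> <= rad/h" using h by (simp add: divide_right_mono)
      then have "u $ i/h <= rad/h" "- (rad/h) <= u $ i/h" by linarith+
      then show "z i : {-M..M}" using i by (simp add: z_def M_def) linarith
     qed
     have ub: "u : BX (cz z) h" unfolding BX_def using u(2) zz by (simp add: cz_comp)
     have "z : PiE I (%_. {-M..M})" using zz(3) by (auto simp: z_def)
     then have zZ: "z : Z" unfolding Z_def using ub u(1) by auto
     have "ennreal (g y)*indicator B y <= ennreal (g (FF (cz z)) + ep)*indicator (FF ` BX (cz z) h) y"
      using osc(1)[OF zZ ub] u(3) ub True by (simp add: ennreal_leI)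
     also have "... <= (\<Sum>z\<in>Z. ennreal (g (FF (cz z)) + ep)*indicator (FF ` BX (cz z) h) y)"
      by (rule member_le_sum[OF zZ _ finZ]) simp
     finally show ?thesis .
    qed simp
   qed
   also have "... = (\<Sum>z\<in>Z. ennreal (g (FF (cz z)) + ep)*emeasure ?M (FF ` BX (cz z) h))"
   proof (subst nn_integral_sum)
    show "(%y. ennreal (g (FF (cz z)) + ep)*indicator (FF ` BX (cz z) h) y) : borel_measurable ?M" if z: "z : Z" for z
    proof -
    have "FF ` BX (cz z) h : sets ?M" using FFb[OF z] by simp
    then show ?thesis by (intro borel_measurable_times_ennreal borel_measurable_indicator borel_measurable_const)
    qed
    show "(\<Sum>z\<in>Z. \<integral>\<^sup>+ y. ennreal (g (FF (cz z)) + ep)*indicator (FF ` BX (cz z) h) y \<partial>?M) = (\<Sum>z\<in>Z. ennreal (g (FF (cz z)) + ep)*emeasure ?M (FF ` BX (cz z) h))"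
     by (intro sum.cong refl nn_integral_cmult_indicator) (simp add: FFb)
   qed
   also have "... <= (\<Sum>z\<in>Z. ennreal (g (FF (cz z)) + ep)*(ennreal ((16*?N) ^ kk)*tau h))"
   proof (rule sum_mono)
    fix z assume z: "z : Z"
    have "emeasure ?M (FF ` BX (cz z) h) <= ennreal ((16*?N) ^ kk)*tau h"
     unfolding emeasure_hausdorff_measure[OF FFb[OF z]] by (rule bm[rule_format, OF Z4[OF z] h(1) hh(1), THEN conjunct1])
    then show "ennreal (g (FF (cz z)) + ep)*emeasure ?M (FF ` BX (cz z) h) <= ennreal (g (FF (cz z)) + ep)*(ennreal ((16*?N) ^ kk)*tau h)"
     by (rule mult_left_mono) simp
   qed
   also have "... = ennreal ((16*?N) ^ kk)*tau h*S" unfolding S_def sum_distrib_right[symmetric] by (rule mult.commute)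
   finally show ?thesis .
  qed
  define V where "V = h ^ kk*(2*rad) ^ (CARD('n) - kk)"
  have V0: "0 < V" using h rad_pos by (simp add: V_def)
  \<comment> \<open>Open boxes are disjoint for distinct grid indices and have the volume of the
    closed ones.\<close>
  define cyl where "cyl z = box (\<chi> i. if i : I then h * of_int (z i) else - rad) (\<chi> i. if i : I then h * of_int (z i) + h else rad)" for z :: "'n => int"
  have cylV: "emeasure lborel (cyl z) = ennreal V" for z
  proof -
   have "emeasure lborel (cyl z) = ennreal (\<Prod>i\<in>UNIV. (if i : I then h * of_int (z i) + h else rad) - (if i : I then h * of_int (z i) else - rad))"
    unfolding cyl_def by (rule emeasure_cbox_cart(2)) (use h rad_pos in auto)
   also have "(\<Prod>i\<in>UNIV. (if i : I then h * of_int (z i) + h else rad) - (if i : I then h * of_int (z i) else - rad)) = (\<Prod>i\<in>UNIV. if i : I then h else 2*rad)"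
    by (intro prod.cong) auto
   finally show ?thesis by (simp add: prod_I V_def)
  qed
  have cylD: "h * of_int (z i) < u $ i & u $ i < h * of_int (z i) + h" if "u : cyl z" "i : I" for u z i
   using that by (auto simp: cyl_def mem_box_cart dest!: spec[of _ i])
  have cyl_in: "u : DD" "pI u : BX (cz z) h" if z: "z : Z" and u: "u : cyl z" for u z
  proof -
   show p: "pI u : BX (cz z) h" unfolding BX_def
    using cylD[OF u] pI_RI by (auto simp: pI_component cz_comp less_imp_le)
   have n: "norm (pI u) <= rad/2" using BXn[OF p] Zn[OF z] hh(3) norm_triangle_sub[of "pI u" "cz z"] rad_pos by simp
   have "\<bar>u $ i\<bar> <= rad" for i
   proof (cases "i : I")
    case True
    then show ?thesis using component_le_norm_cart[of "pI u" i] n rad_pos by (simp add: pI_component)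
   next
    case False
    then show ?thesis using u by (auto simp: cyl_def mem_box_cart abs_le_iff dest!: spec[of _ i])
   qed
   then show "u : DD" using n by (simp add: DD_def)
  qed
  have cyl_dis: "z = z'" if "z : Z" "z' : Z" "u : cyl z" "u : cyl z'" for z z' u
  proof (rule PiE_ext)
   show "z : PiE I (%_. {-M..M})" "z' : PiE I (%_. {-M..M})" using that by (auto simp: Z_def)
   fix i assume i: "i : I"
   have "h * of_int (z i) < h*(of_int (z' i) + 1)" "h * of_int (z' i) < h*(of_int (z i) + 1)"
    using cylD[OF that(3) i] cylD[OF that(4) i] by (auto simp: algebra_simps)
   then have "real_of_int (z i) < of_int (z' i) + 1" "real_of_int (z' i) < of_int (z i) + 1"
    using h(1) by (simp_all only: mult_less_cancel_left_pos)
   then show "z i = z' i" by linarith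
  qed
  have I2: "S*ennreal V <= ?J + ennreal (2*ep * (2*rad) ^ CARD('n))"
  proof -
   have "S*ennreal V = (\<Sum>z\<in>Z. ennreal (g (FF (cz z)) + ep)*emeasure lborel (cyl z))"
    unfolding S_def cylV by (rule sum_distrib_right)
   also have "... = (\<integral>\<^sup>+ u. (\<Sum>z\<in>Z. ennreal (g (FF (cz z)) + ep)*indicator (cyl z) u) \<partial>lborel)"
    by (subst nn_integral_sum) (auto simp: nn_integral_cmult_indicator cyl_def)
   also have "... <= (\<integral>\<^sup>+ u. ennreal (g (FF u))*indicator DD u + ennreal (2*ep)*indicator DD u \<partial>lborel)"
   proof (rule nn_integral_mono)
    fix u
    show "(\<Sum>z\<in>Z. ennreal (g (FF (cz z)) + ep)*indicator (cyl z) u) <= ennreal (g (FF u))*indicator DD u + ennreal (2*ep)*indicator DD u"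
    proof (cases "EX z:Z. u : cyl z")
     case True
     then obtain z where z: "z : Z" "u : cyl z" by blast
     have "(\<Sum>z\<in>Z. ennreal (g (FF (cz z)) + ep)*indicator (cyl z) u) = (\<Sum>z\<in>{z}. ennreal (g (FF (cz z)) + ep)*indicator (cyl z) u)"
      by (rule sum.mono_neutral_right[OF finZ]) (use z cyl_dis in \<open>auto simp: indicator_def\<close>)
     also have "... = ennreal (g (FF (cz z)) + ep)" using z by simp
     also have "... <= ennreal (g (FF u) + 2*ep)"
      using osc(2)[OF z(1) cyl_in(2)[OF z]] by (intro ennreal_leI) (simp add: FF_pI)
     also have "... = ennreal (g (FF u))*indicator DD u + ennreal (2*ep)*indicator DD u"
      using cyl_in(1)[OF z] g(2) ep by simp
     finally show ?thesis .
    next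
     case False
     then have "(\<Sum>z\<in>Z. ennreal (g (FF (cz z)) + ep)*indicator (cyl z) u) = 0" by (intro sum.neutral) auto
     then show ?thesis by simp
    qed
   qed
   also have "... = ?J + ennreal (2*ep)*emeasure lborel DD"
    using closed_DD by (subst nn_integral_add[OF Jm]) (auto simp: nn_integral_cmult_indicator)
   also have "emeasure lborel DD <= ennreal ((2*rad) ^ CARD('n))"
   proof -
    have "DD \<subseteq> cbox (\<chi> i. - rad) (\<chi> i. rad)" by (auto simp: DD_def mem_box_cart abs_le_iff minus_le_iff)
    then have "emeasure lborel DD <= emeasure lborel (cbox (\<chi> i. - rad) (\<chi> i. rad) :: (real^'n) set)" by (rule emeasure_mono) simp
    also have "... = ennreal ((2*rad) ^ CARD('n))" using emeasure_cbox_cart(1)[of "%_. - rad" "%_. rad"] rad_pos by simp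
    finally show ?thesis .
   qed
   finally have "S*ennreal V <= ?J + ennreal (2*ep)*ennreal ((2*rad) ^ CARD('n))" by (simp add: add_left_mono mult_left_mono)
   then show ?thesis using ep rad_pos by (simp add: ennreal_mult[symmetric])
  qed
  \<comment> \<open>Closed half cubes at distinct grid points are disjoint and \<open>FF\<close> is
    injective, so the measures of their images add up.\<close>
  have I3: "ennreal (real m ^ kk)*tau h <= ennreal ((32*?N) ^ kk)*emeasure ?M B"
  proof -
   let ?P = "PiE I (%_. {0..<int m})"
   have fP: "finite ?P" by (rule finite_PiE) simp_all
   have cP: "card ?P = m ^ kk" by (simp add: card_PiE)
   have sub: "BX (cz z) (h/2) \<subseteq> BX 0 rh" if z: "z : ?P" for z
   proof
    fix u assume u: "u : BX (cz z) (h/2)"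
    show "u : BX 0 rh" unfolding BX_def
    proof (intro CollectI conjI ballI BX_RI[OF u])
     fix i assume i: "i : I"
     have b: "h * of_int (z i) <= u $ i" "u $ i <= h * of_int (z i) + h/2" using u i by (auto simp: BX_def cz_comp)
     have zi: "0 <= z i" "z i + 1 <= int m" using PiE_mem[OF z i] by auto
     then have "real_of_int (z i) + 1 <= real m" by linarith
     then have "h*(of_int (z i) + 1) <= h*real m" using h by (intro mult_left_mono) auto
     then show "u $ i <= 0 $ i + rh" using b(2) h mh by (simp add: algebra_simps)
     have "0 <= h*real_of_int (z i)" using zi h by simp
     then show "0 $ i <= u $ i" using b(1) by simp
    qed
   qed
   have in4: "BX 0 rh \<subseteq> cball 0 (rad/4) \<inter> RI"
   proof
    fix u assume u: "u : BX 0 rh"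
    have "norm (u - 0) <= ?N*rh" by (rule BX_dist[OF _ BX_base u]) (use rh subspace_0[OF subspace_RI] in auto)
    then show "u : cball 0 (rad/4) \<inter> RI" using rh(2) rad_pos BX_RI[OF u] by simp
   qed
   have Fb: "FF ` BX (cz z) (h/2) : sets borel" if z: "z : ?P" for z
    by (rule borel_compact[OF FFc[OF czR]]) (use h sub[OF z] in4 rad_pos in \<open>auto simp: subset_iff\<close>)
   have z4: "cz z : cball 0 (rad/4) \<inter> RI" if z: "z : ?P" for z
    using BX_base[OF czR, of "h/2" z] sub[OF z] in4 h by auto
   have dis: "disjoint_family_on (%z. FF ` BX (cz z) (h/2)) ?P"
    unfolding disjoint_family_on_def
   proof (intro ballI impI)
    fix z z' assume z: "z : ?P" and z': "z' : ?P" and ne: "z ~= z'"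
    have "u ~= u'" if u: "u : BX (cz z) (h/2)" and u': "u' : BX (cz z') (h/2)" for u u'
    proof
     assume e: "u = u'"
     have "z = z'"
     proof (rule PiE_ext[OF z z'])
      fix i assume i: "i : I"
      have "h * of_int (z i) < h*(of_int (z' i) + 1)" "h * of_int (z' i) < h*(of_int (z i) + 1)"
       using u u' i h(1) unfolding e by (auto simp: BX_def cz_comp algebra_simps dest!: bspec[of _ _ i])
      then have "real_of_int (z i) < of_int (z' i) + 1" "real_of_int (z' i) < of_int (z i) + 1"
       using h(1) by (simp_all only: mult_less_cancel_left_pos)
      then show "z i = z' i" by linarith
     qed
     then show False using ne by simp
    qed
    then have "BX (cz z) (h/2) \<inter> BX (cz z') (h/2) = {}" by blast
    then show "FF ` BX (cz z) (h/2) \<inter> FF ` BX (cz z') (h/2) = {}"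
     using inj_on_image_Int[OF FF_inj order_trans[OF sub[OF z] in4] order_trans[OF sub[OF z'] in4]] by simp
   qed
   have "ennreal (real m ^ kk)*tau h = (\<Sum>z\<in>?P. tau h)" using cP by (simp add: ennreal_of_nat_eq_real_of_nat)
   also have "... <= (\<Sum>z\<in>?P. ennreal ((32*?N) ^ kk)*emeasure ?M (FF ` BX (cz z) (h/2)))"
   proof (rule sum_mono)
    fix z assume z: "z : ?P"
    show "tau h <= ennreal ((32*?N) ^ kk)*emeasure ?M (FF ` BX (cz z) (h/2))"
     unfolding emeasure_hausdorff_measure[OF Fb[OF z]] by (rule bm[rule_format, OF z4[OF z] h(1) hh(1), THEN conjunct2])
   qed
   also have "... = ennreal ((32*?N) ^ kk)*(\<Sum>z\<in>?P. emeasure ?M (FF ` BX (cz z) (h/2)))" by (rule sum_distrib_left[symmetric])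
   also have "(\<Sum>z\<in>?P. emeasure ?M (FF ` BX (cz z) (h/2))) = emeasure ?M (\<Union>z\<in>?P. FF ` BX (cz z) (h/2))"
    by (rule sum_emeasure[OF _ dis fP]) (use Fb in auto)
   also have "... <= emeasure ?M B" by (rule emeasure_mono) (use sub B(1,2) in auto)
   finally show ?thesis by (simp add: mult_left_mono)
  qed
  have VW: "V*real m ^ kk = W" unfolding V_def W_def mh[symmetric] power_mult_distrib by (simp only: mult_ac)
  let ?I = "\<integral>\<^sup>+ y\<in>B. ennreal (g y) \<partial>?M" and ?E = "?J + ennreal (2*ep * (2*rad) ^ CARD('n))" and ?H = "emeasure ?M B"
  have H0: "?H ~= 0"
  proof
   assume "?H = 0"
   then have "ennreal (real m ^ kk)*tau h = 0" using I3 by simp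
   then show False using tau_pos[OF h(1)] m(1) by simp
  qed
  have "ennreal W*?I = (ennreal V*ennreal (real m ^ kk))*?I"
   by (rule arg_cong[where f="%t. t*?I"]) (use V0 in \<open>simp add: VW[symmetric] ennreal_mult\<close>)
  also have "... <= (ennreal V*ennreal (real m ^ kk))*(ennreal ((16*?N) ^ kk)*tau h*S)" by (rule mult_left_mono[OF I1]) simp
  also have "... = ennreal ((16*?N) ^ kk)*((ennreal (real m ^ kk)*tau h)*(S*ennreal V))" by (simp only: mult_ac)
  also have "... <= ennreal ((16*?N) ^ kk)*((ennreal ((32*?N) ^ kk)*?H)*?E)" by (intro mult_left_mono mult_mono I2 I3) simp_all
  also have "... = ennreal ((512*?N\<^sup>2) ^ kk)*(?H*?E)"
  proof -
   have "(16*?N) ^ kk*(32*?N) ^ kk = (512*?N\<^sup>2) ^ kk" unfolding power_mult_distrib[symmetric] by (simp add: power2_eq_square)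
   then have "ennreal ((512*?N\<^sup>2) ^ kk) = ennreal ((16*?N) ^ kk)*ennreal ((32*?N) ^ kk)" by (simp add: ennreal_mult[symmetric])
   then show ?thesis by (simp only: mult.assoc)
  qed
  finally have "ennreal W*?I <= ennreal ((512*?N\<^sup>2) ^ kk)*(?H*?E)" .
  then have "ennreal (1/W)*(ennreal W*?I) <= ennreal (1/W)*(ennreal ((512*?N\<^sup>2) ^ kk)*(?H*?E))" by (rule mult_left_mono) simp
  also have "ennreal (1/W)*(ennreal W*?I) = ?I"
  proof -
   have "ennreal (1/W)*ennreal W = 1" using W by (simp add: ennreal_mult[symmetric])
   then show ?thesis unfolding mult.assoc[symmetric] by simp
  qed
  also have "ennreal (1/W)*(ennreal ((512*?N\<^sup>2) ^ kk)*(?H*?E)) = ?H*(ennreal C*?E)"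
  proof -
   have "ennreal C = ennreal (1/W)*ennreal ((512*?N\<^sup>2) ^ kk)" using W by (simp add: C_def ennreal_mult[symmetric])
   then show ?thesis by (simp only: mult_ac)
  qed
  finally have le: "?I <= ?H*(ennreal C*?E)" .
  show ?thesis
  \<comment> \<open>Division by infinity gives 0, which settles a ball of infinite measure.\<close>
  proof (cases "?H = \<infinity>")
   case True
   then show ?thesis by simp
  next
   case False
   have "?I/?H <= ?H*(ennreal C*?E)/?H" by (rule divide_right_mono_ennreal[OF le])
   also have "... = ennreal C*?E" unfolding mult.commute[of ?H] by (rule ennreal_mult_divide_eq) (use H0 False in simp_all)
   finally show ?thesis .
  qed
 qed
 have "(\<integral>\<^sup>+ y\<in>B. ennreal (g y) \<partial>?M)/emeasure ?M B <= ennreal C*?J"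
 proof (rule ennreal_le_epsilon)
  fix e :: real assume e: "0 < e"
  define ep where "ep = e/(C*2*(2*rad) ^ CARD('n))"
  have "0 < ep" using e C rad_pos by (simp add: ep_def)
  from main[OF this] have "(\<integral>\<^sup>+ y\<in>B. ennreal (g y) \<partial>?M)/emeasure ?M B <= ennreal C*?J + ennreal C*ennreal (2*ep * (2*rad) ^ CARD('n))"
   by (simp add: distrib_left)
  also have "ennreal C*ennreal (2*ep * (2*rad) ^ CARD('n)) = ennreal e"
   using C rad_pos e by (simp add: ennreal_mult[symmetric] ep_def)
  finally show "(\<integral>\<^sup>+ y\<in>B. ennreal (g y) \<partial>?M)/emeasure ?M B <= ennreal C*?J + ennreal e" .
 qed
 then show ?thesis unfolding C_def W_def .
qed

text \<open>By \<open>FF_step\<close> nearby parameters are joined by a short exponential, so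
  stability of \<open>B\<close> under short exponentials makes its preimage open. An open set is a
  countable union of compact sets, and their images are compact.\<close>

lemma borel_of_local_flow:
 assumes B: "B \<subseteq> FF ` (cball 0 (rad/7) \<inter> RI)"
  and loc: "!!y. y : B ==> EX e>0. ALL v:RI. norm v < e --> EE y v : B"
 shows "B : sets borel"
proof -
 let ?V = "ball 0 (rad/4)"
 define VV where "VV = {u : ?V. FF (pI u) : B & pI u : ?V}"
 have contpI: "continuous (at u) pI" for u using continuous_pI[of UNIV] by (simp add: continuous_on_eq_continuous_at)
 have "open VV" unfolding open_dist
 proof
  fix u assume u: "u : VV"
  then have p: "pI u : cball 0 (rad/4) \<inter> RI" "FF (pI u) : B" "pI u : ?V" "u : ?V" using pI_RI by (auto simp: VV_def)
  obtain e where e: "e > 0" "ALL v:RI. norm v < e --> EE (FF (pI u)) v : B" using loc[OF p(2)] by blast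
  obtain d1 where d1: "d1 > 0" "ball (pI u) d1 \<subseteq> ?V" using p(3) open_ball openE by blast
  obtain d2 where d2: "d2 > 0" "ball u d2 \<subseteq> ?V" using p(4) open_ball openE by blast
  have "0 < min d1 (e/2)" using d1 e by simp
  then obtain d3 where d3: "d3 > 0" "ALL w. dist w u < d3 --> dist (pI w) (pI u) < min d1 (e/2)" using contpI[of u] unfolding continuous_at_eps_delta by blast
  have "w : VV" if w: "dist w u < min d2 d3" for w
  proof -
   have a: "dist (pI w) (pI u) < d1" "dist (pI w) (pI u) < e/2" using d3(2) w by auto
   have wV: "w : ?V" "pI w : ?V" using subsetD[OF d1(2), of "pI w"] subsetD[OF d2(2), of w] w a(1) by (simp_all add: dist_commute)
   then have w4: "pI w : cball 0 (rad/4) \<inter> RI" using pI_RI by simp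
   obtain v where v: "v : RI" "EE (FF (pI u)) v = FF (pI w)" "norm (v - (pI w - pI u)) <= 2/7*norm (pI w - pI u)"
    using FF_step[OF p(1) w4] by blast
   have "norm v <= norm (pI w - pI u) + 2/7*norm (pI w - pI u)" using v(3) norm_triangle_sub[of v "pI w - pI u"] by simp
   then have "norm v < e" using a(2) norm_ge_zero[of "pI w - pI u"] unfolding dist_norm by linarith
   then have "FF (pI w) : B" using bspec[OF e(2) v(1)] v(2) by simp
   then show ?thesis using wV by (simp add: VV_def)
  qed
  then show "EX e>0. ALL y. dist y u < e --> y : VV" using d2 d3 by (intro exI[of _ "min d2 d3"]) auto
 qed
 then obtain F where F: "!!n::nat. compact (F n)" "!!n. F n \<subseteq> VV" "(\<Union>n. F n) = VV" by (rule open_Union_compact_subsets) metis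
 have "VV \<subseteq> DD"
 proof
  fix u assume "u : VV"
  then have u: "norm u <= rad/4" "norm (pI u) <= rad/4" by (simp_all add: VV_def)
  have "\<bar>u $ i\<bar> <= rad" for i using component_le_norm_cart[of u i] u(1) rad_pos by linarith
  then show "u : DD" using u(2) rad_pos by (simp add: DD_def)
 qed
 then have c: "continuous_on VV FF" by (rule continuous_on_subset[OF FF_continuous_DD])
 have "B = (\<Union>n. FF ` F n)"
 proof
  show "B \<subseteq> (\<Union>n. FF ` F n)"
  proof
   fix y assume y: "y : B"
   then obtain u where u: "norm u <= rad/7" "u : RI" "y = FF u" using B by auto
   have pu: "pI u = u" using u(2) by (auto simp: pI_def RI_def vec_eq_iff)
   have "u : VV" unfolding VV_def mem_Collect_eq pu using u y rad_pos by simp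
   then show "y : (\<Union>n. FF ` F n)" using F(3) u(3) by blast
  qed
  show "(\<Union>n. FF ` F n) \<subseteq> B"
  proof safe
   fix n u assume "u : F n"
   then have "u : VV" using F(2) by blast
   then show "FF u : B" by (simp add: VV_def FF_pI)
  qed
 qed
 moreover have "FF ` F n : sets borel" for n
  by (rule borel_compact[OF compact_continuous_image[OF continuous_on_subset[OF c F(2)] F(1)]])
 ultimately show ?thesis by auto
qed

end

section \<open>Lipschitz change of variables and transference\<close>

lemma emeasure_cube_cart:
 fixes l h :: "real^'n"
 assumes "!!i. h $ i - l $ i = s" "0 <= s"
 shows "emeasure lborel (cbox l h) = ennreal (s ^ CARD('n))" "emeasure lborel (box l h) = ennreal (s ^ CARD('n))"
proof -
 have d: "(h - l) \<bullet> b = s" if "b : Basis" for b using that assms by (auto simp: Basis_vec_def inner_axis)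
 have le: "l \<bullet> b <= h \<bullet> b" if "b : Basis" for b using d[OF that] assms(2) by (simp add: inner_diff_left)
 show "emeasure lborel (cbox l h) = ennreal (s ^ CARD('n))" "emeasure lborel (box l h) = ennreal (s ^ CARD('n))"
  using emeasure_lborel_cbox[OF le] emeasure_lborel_box[OF le] d by simp_all
qed

text \<open>Outer regularity and a covering by almost disjoint cubes adapted to a gauge: the part of
  \<open>T\<close> in a cube of side s is mapped into a cube of side 2*L*N*s. The cubes are small,
  so the Lipschitz bound for close points is enough.\<close>

lemma lipschitz_image_measure:
 fixes f :: "real^'n => real^'n"
 assumes T: "T : sets borel" "bounded T" and S: "S : sets borel" "S \<subseteq> f ` T" and dl: "0 < dl" and L: "0 <= L"
  and lip: "!!y y'. y : T ==> y' : T ==> dist y y' < dl ==> dist (f y) (f y') <= L*dist y y'"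
 shows "emeasure lborel S <= ennreal ((2*L*real CARD('n)) ^ CARD('n))*emeasure lborel T"
proof -
 let ?N = "real CARD('n)"
 define c where "c = (2*L*?N) ^ CARD('n)"
 have c0: "0 <= c" using L by (simp add: c_def)
 obtain R where R: "R > 0" "!!y. y : T ==> norm y <= R" using T(2) by (metis bounded_pos)
 have key: "emeasure lborel S <= ennreal c*(emeasure lborel T + ennreal e)" if e: "0 < e" for e :: real
 proof -
  obtain U where U: "open U" "T \<subseteq> U" "emeasure lborel (U - T) < ennreal e" using outer_regular_lborel[OF T(1) e] by blast
  \<comment> \<open>The gauge keeps the cubes inside \<open>U\<close> and small enough for the local
    Lipschitz bound.\<close>
  define g where "g y = ball y (dl/2) \<inter> (if y : U then U else UNIV)" for y
  have "gauge g" unfolding gauge_def g_def using U(1) dl by auto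
  moreover have "T \<subseteq> cbox (\<chi> i. - R) (\<chi> i. R)"
  proof
   fix y assume "y : T"
   then have "\<bar>y $ i\<bar> <= R" for i using R(2)[of y] component_le_norm_cart[of y i] by linarith
   then have "- R <= y $ i" "y $ i <= R" for i by (simp_all add: abs_le_iff minus_le_iff)
   then show "y : cbox (\<chi> i. - R) (\<chi> i. R)" by (simp add: mem_box_cart)
  qed
  moreover have "box (\<chi> i. - R) (\<chi> i. R) ~= ({} :: (real^'n) set)" using R(1) by (simp add: interval_ne_empty_cart)
  ultimately obtain \<D> where D: "countable \<D>" "!!K. K : \<D> ==> interior K ~= {} & (EX c d. K = cbox c d)"
    "pairwise (%A B. interior A \<inter> interior B = {}) \<D>" "!!K. K : \<D> ==> EX y : T \<inter> K. K \<subseteq> g y"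
    "!!u v. cbox u v : \<D> ==> EX n. ALL i : Basis. v \<bullet> i - u \<bullet> i = ((\<chi> i. R) \<bullet> i - (\<chi> i. - R) \<bullet> i)/2^n" "T \<subseteq> \<Union>\<D>"
   using covering_lemma[of T "\<chi> i. - R" "\<chi> i. R" g] by metis
  have ex: "EX l h. f ` (T \<inter> K) \<subseteq> cbox l h & emeasure lborel (cbox l h) = ennreal c*emeasure lborel (interior K)" if K: "K : \<D>" for K
  proof -
   obtain u v where uv: "K = cbox u v" using D(2)[OF K] by blast
   obtain m where m: "ALL i : Basis. v \<bullet> i - u \<bullet> i = ((\<chi> i. R) \<bullet> i - (\<chi> i. - R) \<bullet> i)/2^m" using D(5) K uv by blast
   define s where "s = 2 * R/2 ^ m"
   have s0: "0 <= s" using R by (simp add: s_def)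
   have s: "v $ i - u $ i = s" for i
   proof -
    have "axis i 1 : (Basis :: (real^'n) set)" by (auto simp: Basis_vec_def)
    from bspec[OF m this] show ?thesis by (simp add: inner_axis s_def)
   qed
   obtain y where y: "y : T" "y : K" "K \<subseteq> g y" using D(4)[OF K] by blast
   let ?l = "\<chi> i. f y $ i - L*(?N * s)" and ?h = "\<chi> i. f y $ i + L*(?N * s)"
   have "f ` (T \<inter> K) \<subseteq> cbox ?l ?h"
   proof safe
    fix z assume z: "z : T" "z : K"
    have "dist z y < dl" using y(3) z(2) dl by (auto simp: g_def dist_commute)
    then have "dist (f z) (f y) <= L*dist z y" using lip[OF z(1) y(1)] by simp
    moreover have "norm (z - y) <= ?N * s"
    proof (rule norm_le_card_cart)
     fix i
     have "u $ i <= z $ i" "z $ i <= v $ i" "u $ i <= y $ i" "y $ i <= v $ i" using z(2) y(2) unfolding uv mem_box_cart by blast+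
     then show "\<bar>(z - y) $ i\<bar> <= s" using s[of i] by simp
    qed
    ultimately have n: "norm (f z - f y) <= L*(?N * s)" using mult_left_mono[OF _ L, of "norm (z - y)" "?N * s"] by (simp add: dist_norm)
    have "\<bar>(f z - f y) $ i\<bar> <= L*(?N * s)" for i using component_le_norm_cart[of "f z - f y" i] n by linarith
    then have "f y $ i - L*(?N * s) <= f z $ i & f z $ i <= f y $ i + L*(?N * s)" for i
     unfolding abs_le_iff vector_minus_component by (metis add.commute diff_le_eq le_diff_eq minus_diff_eq)
    then show "f z : cbox ?l ?h" by (simp only: mem_box_cart vec_lambda_beta simp_thms)
   qed
   moreover have "emeasure lborel (cbox ?l ?h) = ennreal c*emeasure lborel (interior K)"
   proof -
    have "emeasure lborel (cbox ?l ?h) = ennreal ((2*L*?N * s) ^ CARD('n))"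
     by (rule emeasure_cube_cart) (use L s0 in \<open>auto simp: mult.assoc\<close>)
    also have "(2*L*?N * s) ^ CARD('n) = c * s ^ CARD('n)" by (simp add: c_def power_mult_distrib)
    also have "ennreal ... = ennreal c*ennreal (s ^ CARD('n))" using c0 s0 by (simp add: ennreal_mult)
    also have "ennreal (s ^ CARD('n)) = emeasure lborel (interior K)" unfolding uv interior_cbox using emeasure_cube_cart(2)[of v u s] s s0 by simp
    finally show ?thesis .
   qed
   ultimately show ?thesis by blast
  qed
  then obtain l h where lh: "!!K. K : \<D> ==> f ` (T \<inter> K) \<subseteq> cbox (l K) (h K) & emeasure lborel (cbox (l K) (h K)) = ennreal c*emeasure lborel (interior K)" by metis
  have "S \<subseteq> (\<Union>K\<in>\<D>. cbox (l K) (h K))"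
  proof
   fix y assume "y : S"
   then obtain z where z: "z : T" "y = f z" using S(2) by blast
   then obtain K where "K : \<D>" "z : K" using D(6) by blast
   then show "y : (\<Union>K\<in>\<D>. cbox (l K) (h K))" using lh[of K] z by blast
  qed
  then have "emeasure lborel S <= emeasure lborel (\<Union>K\<in>\<D>. cbox (l K) (h K))"
   by (rule emeasure_mono) (auto intro: sets.countable_UN'' D(1))
  also have "... <= (\<integral>\<^sup>+K. emeasure lborel (cbox (l K) (h K)) \<partial>count_space \<D>)" by (rule emeasure_UN_countable_le) (use D(1) in auto)
  also have "... = (\<integral>\<^sup>+K. ennreal c*emeasure lborel (interior K) \<partial>count_space \<D>)" by (rule nn_integral_cong) (use lh in simp)
  also have "... = ennreal c*(\<integral>\<^sup>+K. emeasure lborel (interior K) \<partial>count_space \<D>)" by (rule nn_integral_cmult) simp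
  also have "(\<integral>\<^sup>+K. emeasure lborel (interior K) \<partial>count_space \<D>) = emeasure lborel (\<Union>K\<in>\<D>. interior K)"
   by (rule emeasure_UN_countable[symmetric]) (use D(1,3) in \<open>auto simp: disjoint_family_on_def pairwise_def\<close>)
  also have "... <= emeasure lborel U"
  proof (rule emeasure_mono)
   show "(\<Union>K\<in>\<D>. interior K) \<subseteq> U"
   proof safe
    fix z K assume K: "K : \<D>" "z : interior K"
    obtain y where "y : T" "K \<subseteq> g y" using D(4)[OF K(1)] by blast
    moreover have "z : K" using K(2) interior_subset by blast
    ultimately show "z : U" using U(2) by (auto simp: g_def split: if_splits)
   qed
  qed (use U in simp)
  also have "emeasure lborel U <= emeasure lborel T + emeasure lborel (U - T)"
  proof -
   have "emeasure lborel (T \<union> (U - T)) <= emeasure lborel T + emeasure lborel (U - T)" by (rule emeasure_subadditive) (use T U in auto)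
   moreover have "T \<union> (U - T) = U" using U(2) by blast
   ultimately show ?thesis by simp
  qed
  also have "... <= emeasure lborel T + ennreal e" using U(3) by (intro add_left_mono) simp
  finally show ?thesis by (simp add: mult_left_mono)
 qed
 have "emeasure lborel S <= ennreal c*emeasure lborel T"
 proof (rule ennreal_le_epsilon)
  fix e :: real assume e: "0 < e"
  have "emeasure lborel S <= ennreal c*(emeasure lborel T + ennreal (e/(c + 1)))" by (rule key) (use e c0 in simp)
  also have "... = ennreal c*emeasure lborel T + ennreal (c*(e/(c + 1)))" using ennreal_mult[of c "e/(c + 1)"] c0 e by (simp add: distrib_left)
  also have "... <= ennreal c*emeasure lborel T + ennreal e"
   using c0 e by (intro add_left_mono ennreal_leI) (simp add: field_simps)
  finally show "emeasure lborel S <= ennreal c*emeasure lborel T + ennreal e" .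
 qed
 then show ?thesis by (simp add: c_def)
qed

text \<open>An inequality between push-forward measures on Borel sets passes to integrals. This is
  how changes of variables are done here without Jacobians.\<close>

lemma nn_integral_transfer:
 fixes f h :: "real^'n => real^'n"
 assumes K: "K : sets borel" "K' : sets borel" and f: "f : borel_measurable borel" and h: "h : borel_measurable borel"
  and le: "!!A. A : sets borel ==> emeasure lborel (K \<inter> f -` A) <= c*emeasure lborel (K' \<inter> h -` A)"
  and F: "F : borel_measurable borel"
 shows "(\<integral>\<^sup>+z\<in>K. F (f z) \<partial>lborel) <= c*(\<integral>\<^sup>+z\<in>K'. F (h z) \<partial>lborel)"
proof -
 let ?M = "distr (density lborel (indicator K)) borel f" and ?N = "scale_measure c (distr (density lborel (indicator K')) borel h)"
 have em: "emeasure (distr (density lborel (indicator K)) borel f) A = emeasure lborel (K \<inter> f -` A)"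
  if "A : sets borel" "K : sets borel" "f : borel_measurable borel" for A K and f :: "real^'n => real^'n"
  using that measurable_sets[OF that(3,1)] by (subst emeasure_distr) (auto simp: emeasure_density nn_integral_indicator indicator_inter_arith[symmetric])
 have "?M <= ?N"
 proof (subst le_measure)
  show "ALL A:sets ?M. emeasure ?M A <= emeasure ?N A" using le em K f h by (simp add: emeasure_scale_measure)
 qed simp
 then have "nn_integral ?M F <= nn_integral ?N F" by (intro nn_integral_mono_measure) auto
 moreover have "nn_integral ?M F = (\<integral>\<^sup>+z\<in>K. F (f z) \<partial>lborel)"
  using K f F by (subst nn_integral_distr) (auto simp: nn_integral_density mult.commute)
 moreover have "nn_integral ?N F = c*(\<integral>\<^sup>+z\<in>K'. F (h z) \<partial>lborel)"
  using K h F by (subst nn_integral_scale_measure) (auto simp: nn_integral_distr nn_integral_density mult.commute)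
 ultimately show ?thesis by simp
qed

definition flow_max :: "real => (real => real^'n => real^'n) => (real^'n => ennreal) => real^'n => ennreal" where
 "flow_max r0 \<psi> g y = (SUP m::nat. (\<integral>\<^sup>+t. g (\<psi> t y)*indicator {-(r0/2^m)..r0/2^m} t \<partial>lborel)/ennreal (2*(r0/2^m)))"

lemma flow_max_measurable [measurable]:
 assumes [measurable]: "(%(t,y). \<psi> t y) : borel_measurable (borel \<Otimes>\<^sub>M borel)" "g : borel_measurable borel"
 shows "flow_max r0 \<psi> g : borel_measurable borel"
 unfolding flow_max_def[abs_def] by measurable

text \<open>Calderon's transference. The integral over \<open>K0\<close> is moved by the flow of
  time \<open>s\<close> and averaged over |s| <= r0; along the orbit of a fixed point
  \<open>flow_max\<close> is the one-dimensional maximal function of \<open>G z\<close>, to which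
  \<open>hl_max_strong\<close> applies. Each of the two changes of variables costs a factor
  \<open>c\<close>, and the 2 is the ratio of the time intervals of lengths 4*r0 and 2*r0.\<close>

lemma flow_max_transference:
 fixes \<psi> :: "real => real^'n => real^'n"
 assumes r0: "0 < r0" and p: "1 < p" and K: "compact K0" "compact K1" "compact K3" "K1 \<subseteq> K3"
  and \<psi>m [measurable]: "(%(t,y). \<psi> t y) : borel_measurable (borel \<Otimes>\<^sub>M borel)"
  and a: "!!s y. \<bar>s\<bar> <= r0 ==> y : K0 ==> \<psi> (-s) y : K1 & \<psi> s (\<psi> (-s) y) = y"
  and b: "!!s y. \<bar>s\<bar> <= 2*r0 ==> y : K1 ==> \<psi> s y : K3 & \<psi> (-s) (\<psi> s y) = y"
  and grp: "!!s t y. \<bar>s\<bar> <= r0 ==> \<bar>t\<bar> <= r0 ==> y : K1 ==> \<psi> t (\<psi> s y) = \<psi> (s + t) y"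
  and lip: "!!s. \<bar>s\<bar> <= 2*r0 ==> EX dl>0. ALL y:K3. ALL y':K3. dist y y' < dl --> dist (\<psi> s y) (\<psi> s y') <= L*dist y y'" and L: "0 <= L"
  and g [measurable]: "g : borel_measurable borel"
 shows "(\<integral>\<^sup>+y\<in>K0. enn_powr (flow_max r0 \<psi> g y) p \<partial>lborel)
   <= ennreal (2*((2*L*real CARD('n)) ^ CARD('n))\<^sup>2*(10 * p * 4 powr (p - 1)/(p - 1)))*(\<integral>\<^sup>+y\<in>K3. enn_powr (g y) p \<partial>lborel)"
proof -
 define c where "c = (2*L*real CARD('n)) ^ CARD('n)"
 define H where "H = 10 * p * 4 powr (p - 1)/(p - 1)"
 have c0: "0 <= c" using L by (simp add: c_def)
 have H0: "0 <= H" using p by (simp add: H_def)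
 have Kb [measurable]: "K0 : sets borel" "K1 : sets borel" "K3 : sets borel" using K by (auto intro: borel_compact)
 have \<psi>s [measurable]: "\<psi> s : borel_measurable borel" for s
  using measurable_compose[OF measurable_Pair1' \<psi>m, of s] by simp
 have meas: "emeasure lborel S <= ennreal c*emeasure lborel T"
  if "T : sets borel" "T \<subseteq> K3" "S : sets borel" "S \<subseteq> \<psi> s ` T" "\<bar>s\<bar> <= 2*r0" for S T s
 proof -
  obtain dl where d: "dl > 0" "ALL y:K3. ALL y':K3. dist y y' < dl --> dist (\<psi> s y) (\<psi> s y') <= L*dist y y'" using lip[OF \<open>\<bar>s\<bar> <= 2*r0\<close>] by blast
  have bT: "bounded T" using that(2) K(3) compact_imp_bounded bounded_subset by blast
  have lT: "dist (\<psi> s y) (\<psi> s y') <= L*dist y y'" if "y : T" "y' : T" "dist y y' < dl" for y y'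
   using d(2) that \<open>T \<subseteq> K3\<close> by blast
  show ?thesis unfolding c_def by (rule lipschitz_image_measure[OF that(1) bT that(3,4) d(1) L lT])
 qed
 have Q1: "(\<integral>\<^sup>+y\<in>K0. F y \<partial>lborel) <= ennreal c*(\<integral>\<^sup>+z\<in>K1. F (\<psi> s z) \<partial>lborel)"
  if s: "\<bar>s\<bar> <= r0" and F: "F : borel_measurable borel" for s F
 proof (rule nn_integral_transfer[of K0 K1 "%y. y" "\<psi> s" "ennreal c" F])
  fix A :: "(real^'n) set" assume A [measurable]: "A : sets borel"
  show "emeasure lborel (K0 \<inter> (%y. y) -` A) <= ennreal c*emeasure lborel (K1 \<inter> \<psi> s -` A)"
  proof (rule meas[of _ _ s])
   show "K1 \<inter> \<psi> s -` A : sets borel" using measurable_sets[OF \<psi>s A, of s] by auto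
   show "K0 \<inter> (%y. y) -` A \<subseteq> \<psi> s ` (K1 \<inter> \<psi> s -` A)"
   proof
    fix y assume "y : K0 \<inter> (%y. y) -` A"
    then have y: "y : K0" "y : A" by auto
    then show "y : \<psi> s ` (K1 \<inter> \<psi> s -` A)" using a[OF s y(1)] by (intro image_eqI[of _ _ "\<psi> (-s) y"]) auto
   qed
  qed (use K s r0 A in auto)
 qed (use F in auto)
 have Q2: "(\<integral>\<^sup>+z\<in>K1. F (\<psi> s z) \<partial>lborel) <= ennreal c*(\<integral>\<^sup>+y\<in>K3. F y \<partial>lborel)"
  if s: "\<bar>s\<bar> <= 2*r0" and F: "F : borel_measurable borel" for s F
 proof (rule nn_integral_transfer[of K1 K3 "\<psi> s" "%y. y" "ennreal c" F])
  fix A :: "(real^'n) set" assume A [measurable]: "A : sets borel"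
  show "emeasure lborel (K1 \<inter> \<psi> s -` A) <= ennreal c*emeasure lborel (K3 \<inter> (%y. y) -` A)"
  proof (rule meas[of _ _ "-s"])
   show "K1 \<inter> \<psi> s -` A : sets borel" using measurable_sets[OF \<psi>s A, of s] by auto
   show "K1 \<inter> \<psi> s -` A \<subseteq> \<psi> (-s) ` (K3 \<inter> (%y. y) -` A)"
   proof
    fix y assume y: "y : K1 \<inter> \<psi> s -` A"
    then show "y : \<psi> (-s) ` (K3 \<inter> (%y. y) -` A)" using b[OF s, of y] by (intro image_eqI[of _ _ "\<psi> s y"]) auto
   qed
  qed (use K s r0 A in auto)
 qed (use F in auto)
 note [measurable] = enn_powr_measurable
 let ?M = "flow_max r0 \<psi> g"
 let ?A = "\<integral>\<^sup>+y\<in>K0. enn_powr (?M y) p \<partial>lborel" and ?B = "\<integral>\<^sup>+y\<in>K3. enn_powr (g y) p \<partial>lborel"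
 have pm [measurable]: "(%y. enn_powr (?M y) p) : borel_measurable borel" "(%y. enn_powr (g y) p) : borel_measurable borel" by measurable
 \<comment> \<open>With |s| and |t| at most r0 all times s + t lie in the cut-off interval, so
   nothing is lost there, while the orbit integral remains over a bounded interval.\<close>
 define G where "G z s = g (\<psi> s z)*indicator {-(2*r0)..2*r0} s" for z s
 have Gm: "G z : borel_measurable borel" for z unfolding G_def[abs_def] by measurable
 have "ennreal (2*r0)*?A = (\<integral>\<^sup>+s. ?A*indicator {-r0..r0} s \<partial>lborel)"
  using r0 by (subst nn_integral_cmult_indicator) (auto simp: mult.commute)
 also have "... <= (\<integral>\<^sup>+s. ennreal c*(\<integral>\<^sup>+z. enn_powr (?M (\<psi> s z)) p * indicator K1 z*indicator {-r0..r0} s \<partial>lborel) \<partial>lborel)"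
 proof (rule nn_integral_mono)
  fix s
  show "?A*indicator {-r0..r0} s <= ennreal c*(\<integral>\<^sup>+z. enn_powr (?M (\<psi> s z)) p * indicator K1 z*indicator {-r0..r0} s \<partial>lborel)"
   using Q1[OF _ pm(1), of s] by (cases "s : {-r0..r0}") auto
 qed
 also have "... = ennreal c*(\<integral>\<^sup>+s. \<integral>\<^sup>+z. enn_powr (?M (\<psi> s z)) p * indicator K1 z*indicator {-r0..r0} s \<partial>lborel \<partial>lborel)"
  by (rule nn_integral_cmult) measurable
 also have "(\<integral>\<^sup>+s. \<integral>\<^sup>+z. enn_powr (?M (\<psi> s z)) p * indicator K1 z*indicator {-r0..r0} s \<partial>lborel \<partial>lborel)
   = (\<integral>\<^sup>+z. \<integral>\<^sup>+s. enn_powr (?M (\<psi> s z)) p * indicator K1 z*indicator {-r0..r0} s \<partial>lborel \<partial>lborel)"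
  by (rule lborel_pair.Fubini') measurable
 also have "... <= (\<integral>\<^sup>+z. ennreal H*(\<integral>\<^sup>+s. enn_powr (g (\<psi> s z)) p * indicator K1 z*indicator {-(2*r0)..2*r0} s \<partial>lborel) \<partial>lborel)"
 proof (rule nn_integral_mono)
  fix z :: "real^'n"
  show "(\<integral>\<^sup>+s. enn_powr (?M (\<psi> s z)) p * indicator K1 z*indicator {-r0..r0} s \<partial>lborel) <= ennreal H*(\<integral>\<^sup>+s. enn_powr (g (\<psi> s z)) p * indicator K1 z*indicator {-(2*r0)..2*r0} s \<partial>lborel)"
  proof (cases "z : K1")
   case True
   have eq: "?M (\<psi> s z) = hl_max r0 (G z) s" if s: "\<bar>s\<bar> <= r0" for s
   proof -
    have "g (\<psi> t (\<psi> s z))*indicator {-(r0/2^m)..r0/2^m} t = G z (s + t)*indicator {-(r0/2^m)..r0/2^m} t" for t and m :: nat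
    proof (cases "t : {-(r0/2^m)..r0/2^m}")
     case True
     have "r0/2 ^ m <= r0" using r0 by (simp add: field_simps)
     then have t: "\<bar>t\<bar> <= r0" using True by auto
     then have "s + t : {-(2*r0)..2*r0}" using s by auto
     then show ?thesis using grp[OF s t \<open>z : K1\<close>] by (simp add: G_def)
    qed simp
    then show ?thesis unfolding flow_max_def hl_max_def by simp
   qed
   have "(\<integral>\<^sup>+s. enn_powr (?M (\<psi> s z)) p * indicator K1 z*indicator {-r0..r0} s \<partial>lborel) <= (\<integral>\<^sup>+s. enn_powr (hl_max r0 (G z) s) p \<partial>lborel)"
    by (intro nn_integral_mono) (use eq in \<open>auto simp: indicator_def\<close>)
   also have "... <= ennreal H*(\<integral>\<^sup>+s. enn_powr (G z s) p \<partial>lborel)" unfolding H_def by (rule hl_max_strong) (use r0 p Gm in auto)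
   also have "(\<integral>\<^sup>+s. enn_powr (G z s) p \<partial>lborel) = (\<integral>\<^sup>+s. enn_powr (g (\<psi> s z)) p * indicator K1 z*indicator {-(2*r0)..2*r0} s \<partial>lborel)"
    using True p by (intro nn_integral_cong) (auto simp: G_def indicator_def enn_powr_def)
   finally show ?thesis .
  qed simp
 qed
 also have "... = ennreal H*(\<integral>\<^sup>+z. \<integral>\<^sup>+s. enn_powr (g (\<psi> s z)) p * indicator K1 z*indicator {-(2*r0)..2*r0} s \<partial>lborel \<partial>lborel)"
  by (rule nn_integral_cmult) measurable
 also have "(\<integral>\<^sup>+z. \<integral>\<^sup>+s. enn_powr (g (\<psi> s z)) p * indicator K1 z*indicator {-(2*r0)..2*r0} s \<partial>lborel \<partial>lborel)
   = (\<integral>\<^sup>+s. \<integral>\<^sup>+z. enn_powr (g (\<psi> s z)) p * indicator K1 z*indicator {-(2*r0)..2*r0} s \<partial>lborel \<partial>lborel)"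
  by (rule lborel_pair.Fubini'[symmetric]) measurable
 also have "... <= (\<integral>\<^sup>+s. ennreal c*?B*indicator {-(2*r0)..2*r0} s \<partial>lborel)"
 proof (rule nn_integral_mono)
  fix s
  show "(\<integral>\<^sup>+z. enn_powr (g (\<psi> s z)) p * indicator K1 z*indicator {-(2*r0)..2*r0} s \<partial>lborel) <= ennreal c*?B*indicator {-(2*r0)..2*r0} s"
   using Q2[OF _ pm(2), of s] by (cases "s : {-(2*r0)..2*r0}") auto
 qed
 also have "... = ennreal c*?B*ennreal (4*r0)" using r0 by (subst nn_integral_cmult_indicator) auto
 finally have le: "ennreal (2*r0)*?A <= ennreal c*(ennreal H*(ennreal c*?B*ennreal (4*r0)))" by (simp add: mult_left_mono)
 have "?A = ennreal (1/(2*r0))*(ennreal (2*r0)*?A)"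
 proof -
  have "ennreal (1/(2*r0))*ennreal (2*r0) = 1" using r0 by (simp add: ennreal_mult[symmetric])
  then show ?thesis unfolding mult.assoc[symmetric] by simp
 qed
 also have "... <= ennreal (1/(2*r0))*(ennreal c*(ennreal H*(ennreal c*?B*ennreal (4*r0))))" by (rule mult_left_mono[OF le]) simp
 also have "... = ennreal (2*c\<^sup>2*H)*?B"
 proof -
  have "2*c\<^sup>2*H = 1/(2*r0)*(c*(H*(c*(4*r0))))" using r0 by (simp add: power2_eq_square field_simps)
  then have "ennreal (2*c\<^sup>2*H) = ennreal (1/(2*r0))*(ennreal c*(ennreal H*(ennreal c*ennreal (4*r0))))"
   using r0 c0 H0 by (simp only:) (simp add: ennreal_mult[symmetric])
  then show ?thesis by (simp only: mult_ac)
 qed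
 finally show ?thesis unfolding c_def H_def .
qed

section \<open>Flows of single fields from a compact set\<close>

definition ej :: "nat => real => nat => real" where "ej j t = (%i. if i = j then t else 0)"

lemma ej_scale: "(%i. c*ej j t i) = ej j (c*t)" by (auto simp: ej_def)
lemma l2_ej: "l2 q (ej j t) <= \<bar>t\<bar>"
proof -
 have "(\<Sum>i<q. (ej j t i)\<^sup>2) = (\<Sum>i<q. if i = j then t\<^sup>2 else 0)" by (intro sum.cong) (auto simp: ej_def)
 also have "... <= t\<^sup>2" by simp
 finally have "sqrt (\<Sum>i<q. (ej j t i)\<^sup>2) <= sqrt (t\<^sup>2)" by (rule real_sqrt_le_mono)
 then show ?thesis by (simp add: l2_def)
qed
lemma l1_ej: "l1 q (ej j t) <= \<bar>t\<bar>"
proof -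
 have "l1 q (ej j t) = (\<Sum>i<q. if i = j then \<bar>t\<bar> else 0)" unfolding l1_def by (intro sum.cong) (auto simp: ej_def)
 then show ?thesis by simp
qed
lemma ej_diff: "(%i. ej j s i - ej j t i) = ej j (s - t)" by (auto simp: ej_def)

locale ctrans = cfields +
 fixes K :: "(real^'n) set" and A r0 :: real and Lm :: nat
 assumes K: "compact K" and A0: "0 <= A"
  and ex: "!!x a L. x : K ==> L < 1 ==> is_ctrl q L a ==> EX ga. cpath Om Y q x a ga"
  and r0: "0 < r0" "(real Lm + 3)*r0 < 1"
  and DY: "!!x L y j v. x : K ==> L < 1 ==> y : reach Om Y q x L ==> j < q ==> norm (frechet_derivative (Y j) (at y) v) <= A*norm v"
begin

definition psi :: "nat => real => real^'n => real^'n" where "psi j t y = flow Om (lc q Y (ej j t)) y"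

text \<open>Points reached from \<open>K\<close> by at most \<open>l\<close> single-field flows of
  time at most \<open>r0\<close>. The index records how much of the available room has been used
  up.\<close>

primrec KK :: "nat => (real^'n) set" where
 "KK 0 = K"
| "KK (Suc l) = KK l \<union> (\<Union>j<q. (%(t,y). psi j t y) ` ({-r0..r0} \<times> KK l))"

definition sol :: "nat => real => real^'n => bool" where
 "sol j t y \<longleftrightarrow> (EX ga. solves Om (lc q Y (ej j t)) ga & ga 0 = y)"

lemma psi_solves:
 assumes "solves Om (lc q Y (ej j t)) ga" "a : {0..1}" "b : {0..1}"
 shows "psi j ((b - a)*t) (ga a) = ga b"
 using flow_between[OF assms] by (simp add: psi_def ej_scale)

lemma psi_zero: "sol j t y ==> psi j 0 y = y"
 unfolding sol_def using psi_solves[of j t _ 0 0] by auto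

text \<open>A solution on [0,1] for the coefficient t provides the flow only for times between 0 and
  t. The group law is therefore assembled by cases: equal signs use the solution for
  \<open>s + t\<close>, opposite signs retrace the longer of the two orbits.\<close>

lemma psi_group:
 assumes s: "sol j s y" and t: "sol j t (psi j s y)" and st: "sol j (s + t) y"
 shows "psi j t (psi j s y) = psi j (s + t) y"
proof -
 have bck: "psi j t (psi j s y) = psi j (s + t) y" if h: "s ~= 0" "0 <= (s + t)/s" "(s + t)/s <= 1" "sol j s y" for s t y
 proof -
  obtain ga where g: "solves Om (lc q Y (ej j s)) ga" "ga 0 = y" using h(4) unfolding sol_def by blast
  let ?b = "(s + t)/s"
  have b: "?b : {0..1}" using h by simp
  have 1: "psi j s y = ga 1" using psi_solves[OF g(1), of 0 1] g(2) by simp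
  have "psi j ((?b - 1) * s) (ga 1) = ga ?b" by (rule psi_solves[OF g(1) _ b]) simp
  moreover have "(?b - 1) * s = t" using h(1) by (simp add: field_simps)
  moreover have "psi j ((?b - 0) * s) (ga 0) = ga ?b" by (rule psi_solves[OF g(1) _ b]) simp
  moreover have "(?b - 0) * s = s + t" using h(1) by simp
  ultimately show ?thesis using 1 g(2) by simp
 qed
 consider "s = 0" | "t = 0" | "s ~= 0" "t ~= 0" "0 < s*t" | "s ~= 0" "t ~= 0" "s*t < 0" "\<bar>t\<bar> <= \<bar>s\<bar>" | "s ~= 0" "t ~= 0" "s*t < 0" "\<bar>s\<bar> < \<bar>t\<bar>"
  using mult_eq_0_iff[of s t] by linarith
 then show ?thesis
 proof cases
  case 1
  then show ?thesis using psi_zero[OF s] by simp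
 next
  case 2
  then show ?thesis using psi_zero[OF t] by simp
 next
  case 3
  obtain ga where g: "solves Om (lc q Y (ej j (s + t))) ga" "ga 0 = y" using st unfolding sol_def by blast
  have st0: "s + t ~= 0" using 3 by (auto simp: zero_less_mult_iff)
  let ?b = "s/(s + t)"
  have b: "?b : {0..1}" using 3 by (auto simp: zero_less_mult_iff field_simps divide_simps)
  have "psi j ((?b - 0)*(s + t)) (ga 0) = ga ?b" by (rule psi_solves[OF g(1) _ b]) simp
  moreover have "psi j ((1 - ?b)*(s + t)) (ga ?b) = ga 1" by (rule psi_solves[OF g(1) b]) simp
  moreover have "psi j ((1 - 0)*(s + t)) (ga 0) = ga 1" by (rule psi_solves[OF g(1)]) simp_all
  moreover have "(?b - 0)*(s + t) = s" "(1 - ?b)*(s + t) = t" using st0 by (simp_all add: field_simps)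
  ultimately show ?thesis using g(2) by simp
 next
  case 4
  have "0 <= (s + t)/s" "(s + t)/s <= 1" using 4 by (auto simp: mult_less_0_iff divide_simps)
  then show ?thesis by (rule bck[OF 4(1) _ _ s])
 next
  case 5
  let ?z = "psi j s y"
  have y: "psi j (-s) ?z = y" using bck[OF 5(1) _ _ s, of "-s"] psi_zero[OF s] by simp
  have "psi j (s + t) (psi j (-s) ?z) = psi j t ?z"
  proof -
   obtain ga where g: "solves Om (lc q Y (ej j t)) ga" "ga 0 = ?z" using t unfolding sol_def by blast
   let ?b = "- s/t"
   have b: "?b : {0..1}" using 5 by (auto simp: mult_less_0_iff divide_simps)
   have "psi j ((?b - 0)*t) (ga 0) = ga ?b" by (rule psi_solves[OF g(1) _ b]) simp
   moreover have "psi j ((1 - ?b)*t) (ga ?b) = ga 1" by (rule psi_solves[OF g(1) b]) simp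
   moreover have "psi j ((1 - 0)*t) (ga 0) = ga 1" by (rule psi_solves[OF g(1)]) simp_all
   moreover have "(?b - 0)*t = - s" "(1 - ?b)*t = s + t" using 5(2) by (simp_all add: field_simps)
   ultimately show ?thesis using g(2) by simp
  qed
  then show ?thesis using y by simp
 qed
qed

lemma sol_reach:
 assumes x: "x : K" and y: "!!L. rh < L ==> L < 1 ==> y : reach Om Y q x L" and rh: "0 <= rh" "rh + \<bar>t\<bar> < 1"
 shows "sol j t y" "!!L. rh + \<bar>t\<bar> < L ==> L < 1 ==> psi j t y : reach Om Y q x L"
proof -
 interpret cb: cbase Om Y q x by unfold_locales (use ex[OF x] in blast)
 have main: "sol j t y & psi j t y : reach Om Y q x L" if L: "rh + \<bar>t\<bar> < L" "L < 1" for L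
 proof -
  define L1 where "L1 = (rh + (L - \<bar>t\<bar>))/2"
  have L1: "rh < L1" "L1 < 1" "L1 + \<bar>t\<bar> < L" using L by (auto simp: L1_def field_simps)
  have y1: "y : cb.RR L1" by (rule y[OF L1(1,2)])
  have L2: "L1 + l2 q (ej j t) < L" using L1(3) l2_ej[of q j t] by linarith
  have L0: "0 <= L1" using rh L1 by linarith
  obtain ga where g: "solves Om (lc q Y (ej j t)) ga" "ga 0 = y" "!!s. s : {0..1} ==> ga s : cb.RR L"
   using cb.extend_flow[OF y1 L0 L2 L(2)] by blast
  have "psi j t y = ga 1" using psi_solves[OF g(1), of 0 1] g(2) by simp
  then show ?thesis using g unfolding sol_def by auto
 qed
 have "sol j t y & psi j t y : reach Om Y q x ((rh + \<bar>t\<bar> + 1)/2)" by (rule main) (use rh in \<open>auto simp: field_simps\<close>)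
 then show "sol j t y" by blast
 show "psi j t y : reach Om Y q x L" if "rh + \<bar>t\<bar> < L" "L < 1" for L using main[OF that] by blast
qed

text \<open>Each step costs at most \<open>r0\<close> of the control bound. The conclusion ranges
  over all \<open>L\<close> strictly above l*r0 because \<open>extend_flow\<close> needs a strict
  margin.\<close>

lemma KK_reach: "real l*r0 < 1 ==> y : KK l ==> EX x:K. ALL L. real l*r0 < L --> L < 1 --> y : reach Om Y q x L"
proof (induction l arbitrary: y)
 case 0
 then have y: "y : K" by simp
 interpret cb: cbase Om Y q y by unfold_locales (use ex[OF y] in blast)
 show ?case using y cb.base_in_RR by (intro bexI[of _ y]) auto
next
 case (Suc l)
 have l: "real l*r0 + r0 < 1" using Suc.prems(1) by (simp add: algebra_simps)
 have l1: "real l*r0 < 1" using l r0 by linarith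
 from Suc.prems(2) consider "y : KK l" | j t z where "t : {-r0..r0}" "z : KK l" "y = psi j t z" by auto
 then show ?case
 proof cases
  case 1
  then obtain x where "x : K" "ALL L. real l*r0 < L --> L < 1 --> y : reach Om Y q x L" using Suc.IH[OF l1] by blast
  moreover have "real l*r0 < real (Suc l)*r0" using r0 by (simp add: algebra_simps)
  ultimately show ?thesis by (meson less_trans)
 next
  case 2
  obtain x where x: "x : K" "!!L. real l*r0 < L ==> L < 1 ==> z : reach Om Y q x L" using Suc.IH[OF l1 2(2)] by blast
  have t: "\<bar>t\<bar> <= r0" using 2(1) by auto
  have "psi j t z : reach Om Y q x L" if L: "real (Suc l)*r0 < L" "L < 1" for L
  proof (rule sol_reach(2)[OF x(1) x(2) _ _ _ L(2)])
   show "real l*r0 + \<bar>t\<bar> < L" using L(1) t by (simp add: algebra_simps)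
  qed (use l t r0 in auto)
  then show ?thesis using x(1) 2(3) by blast
 qed
qed

lemma KK_sol: assumes "y : KK l" "real l*r0 + \<bar>t\<bar> < 1" shows "sol j t y"
proof -
 have "real l*r0 < 1" using assms(2) by linarith
 then obtain x where x: "x : K" "!!L. real l*r0 < L ==> L < 1 ==> y : reach Om Y q x L" using KK_reach assms(1) by blast
 show ?thesis by (rule sol_reach(1)[OF x _ assms(2)]) (use r0 in auto)
qed

lemma KK_Om: "real l*r0 < 1 ==> KK l \<subseteq> Om"
proof
 fix y assume l: "real l*r0 < 1" and "y : KK l"
 then obtain x where x: "x : K" "ALL L. real l*r0 < L --> L < 1 --> y : reach Om Y q x L" using KK_reach by blast
 have "y : reach Om Y q x ((real l*r0 + 1)/2)" using l x(2) by (auto simp: field_simps)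
 then show "y : Om" unfolding reach_def cpath_def by auto
qed

lemma KK_step: "y : KK l ==> \<bar>t\<bar> <= r0 ==> j < q ==> psi j t y : KK (Suc l)"
 by (force simp: abs_le_iff)

lemma KK_mono: "l <= m ==> KK l \<subseteq> KK m"
 by (rule lift_Suc_mono_le) auto

lemma psi_continuous:
 assumes l: "real l*r0 + ta < 1"
 shows "continuous_on ({-ta..ta} \<times> KK l) (%(t,y). psi j t y)"
 unfolding continuous_on_iff
proof (intro ballI allI impI)
 fix p e assume p: "p : {-ta..ta} \<times> KK l" and e: "0 < (e::real)"
 obtain t1 y1 where p1: "p = (t1, y1)" "\<bar>t1\<bar> <= ta" "y1 : KK l" using p by (cases p) auto
 have so: "sol j t y" if "\<bar>t\<bar> <= ta" "y : KK l" for t y by (rule KK_sol[OF that(2)]) (use that l in linarith)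
 obtain ga1 where g1: "solves Om (lc q Y (ej j t1)) ga1" "ga1 0 = y1" using so[OF p1(2,3)] unfolding sol_def by blast
 let ?C = "ga1 ` {0..1}"
 have C: "compact ?C" "?C \<subseteq> Om" using solves_compact[OF g1(1)] by auto
 obtain M where M: "0 <= M" "!!j y. j < q ==> y : ?C ==> norm (Y j y) <= M" using family_bounded[OF C] by metis
 obtain A' where A': "0 <= A'" "!!j y v. j < q ==> y : ?C ==> norm (frechet_derivative (Y j) (at y) v) <= A'*norm v"
  using C1_family_derivative_bounded[OF C, of q Y] C1 by metis
 obtain r where r: "0 < r" and cmp: "!!w1 w2 ga1 ga2 t. solves Om (lc q Y w1) ga1 ==> solves Om (lc q Y w2) ga2 ==> ga1 ` {0..1} \<subseteq> ?C ==>
   l1 q w2 <= 1 ==> (norm (ga1 0 - ga2 0) + l1 q (%j. w1 j - w2 j)*M)*exp (A' + 1) < r ==> t : {0..1} ==>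
   norm (ga1 t - ga2 t) <= (norm (ga1 0 - ga2 0) + l1 q (%j. w1 j - w2 j)*M)*exp (A' + 1)"
  using flow_compare[OF C A'(1) A'(2) M(2) M(1)] by blast
 define E where "E = (1 + M)*exp (A' + 1)"
 have E: "0 < E" using M by (simp add: E_def add_pos_nonneg)
 show "EX d>0. ALL p':{-ta..ta} \<times> KK l. dist p' p < d --> dist (case p' of (t,y) => psi j t y) (case p of (t,y) => psi j t y) < e"
 proof (intro exI[of _ "min e r/E"] conjI ballI impI)
  show "0 < min e r/E" using e r E by simp
  fix p' assume p': "p' : {-ta..ta} \<times> KK l" and d: "dist p' p < min e r/E"
  obtain t2 y2 where p2: "p' = (t2, y2)" "\<bar>t2\<bar> <= ta" "y2 : KK l" using p' by (cases p') auto
  obtain ga2 where g2: "solves Om (lc q Y (ej j t2)) ga2" "ga2 0 = y2" using so[OF p2(2,3)] unfolding sol_def by blast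
  have dt: "\<bar>t1 - t2\<bar> <= dist p' p" "norm (y1 - y2) <= dist p' p"
   using dist_fst_le[of p' p] dist_snd_le[of p' p] p1(1) p2(1) by (simp_all add: dist_real_def dist_norm norm_minus_commute abs_minus_commute)
  let ?Q = "(norm (ga1 0 - ga2 0) + l1 q (%i. ej j t1 i - ej j t2 i)*M)*exp (A' + 1)"
  have "l1 q (%i. ej j t1 i - ej j t2 i)*M <= dist p' p * M"
   using l1_ej[of q j "t1 - t2"] dt(1) M(1) by (intro mult_right_mono) (simp_all add: ej_diff)
  then have "?Q <= (dist p' p + dist p' p * M)*exp (A' + 1)" using dt(2) g1(2) g2(2) by (intro mult_right_mono[OF add_mono]) auto
  also have "... = dist p' p * E" by (simp add: E_def algebra_simps)
  also have "... < min e r" using d E by (simp add: pos_less_divide_eq)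
  finally have Q: "?Q < min e r" .
  have "real l*r0 >= 0" using r0 by simp
  then have "l1 q (ej j t2) <= 1" using l1_ej[of q j t2] p2(2) l by linarith
  then have "norm (ga1 1 - ga2 1) <= ?Q" using cmp[OF g1(1) g2(1), of 1] Q by simp
  then have "dist (ga2 1) (ga1 1) < e" using Q by (simp add: dist_norm norm_minus_commute)
  moreover have "psi j t1 y1 = ga1 1" "psi j t2 y2 = ga2 1" using psi_solves[OF g1(1), of 0 1] g1(2) psi_solves[OF g2(1), of 0 1] g2(2) by simp_all
  ultimately show "dist (case p' of (t,y) => psi j t y) (case p of (t,y) => psi j t y) < e" using p1(1) p2(1) by simp
 qed
qed

lemma KK_compact: "real l*r0 < 1 ==> compact (KK l)"
proof (induction l)
 case 0
 then show ?case using K by simp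
next
 case (Suc l)
 have l: "real l*r0 + r0 < 1" using Suc.prems by (simp add: algebra_simps)
 then have "compact (KK l)" using Suc.IH r0 by simp
 then have "compact ((%(t,y). psi j t y) ` ({-r0..r0} \<times> KK l))" for j
  by (intro compact_continuous_image psi_continuous l compact_Times) auto
 then show ?case using \<open>compact (KK l)\<close> by (simp add: compact_Un compact_UN)
qed

lemma sol_KK: assumes "y : KK l" "l <= Lm" "\<bar>t\<bar> <= 3*r0" shows "sol j t y"
proof (rule KK_sol[OF assms(1)])
 have "real l*r0 <= real Lm*r0" using assms(2) r0 by (intro mult_right_mono) auto
 then show "real l*r0 + \<bar>t\<bar> < 1" using r0(2) assms(3) by (simp add: algebra_simps)
qed

lemma Lm_lt: "l <= Lm + 2 ==> real l*r0 < 1"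
proof -
 assume "l <= Lm + 2"
 then have "real l*r0 <= (real Lm + 3)*r0" using r0 by (intro mult_right_mono) auto
 then show ?thesis using r0(2) by linarith
qed

lemma psi_grp: "y : KK l ==> Suc l <= Lm ==> j < q ==> \<bar>s\<bar> <= r0 ==> \<bar>t\<bar> <= 2*r0 ==> psi j t (psi j s y) = psi j (s + t) y"
proof (rule psi_group)
 assume y: "y : KK l" and l: "Suc l <= Lm" and j: "j < q" and s: "\<bar>s\<bar> <= r0" and t: "\<bar>t\<bar> <= 2*r0"
 show "sol j s y" by (rule sol_KK[OF y]) (use l s r0 in auto)
 show "sol j t (psi j s y)" by (rule sol_KK[OF KK_step[OF y s j] l]) (use t r0 in auto)
 show "sol j (s + t) y" by (rule sol_KK[OF y]) (use l s t in auto)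
qed

lemma KK_step2: assumes "y : KK l" "Suc l <= Lm" "\<bar>t\<bar> <= 2*r0" "j < q" shows "psi j t y : KK (Suc (Suc l))"
proof -
 have "psi j (t/2) (psi j (t/2) y) = psi j t y" using psi_grp[OF assms(1,2,4), of "t/2" "t/2"] assms(3) r0 by simp
 moreover have "psi j (t/2) (psi j (t/2) y) : KK (Suc (Suc l))" using assms by (intro KK_step) auto
 ultimately show ?thesis by simp
qed

text \<open>Orbits of time up to 2*r0 stay in \<open>KK (l + 2)\<close>, where the derivative bound
  \<open>A\<close> holds. Hence the constant exp (A + 1) is admissible, whereas \<open>dl\<close> is
  not controlled.\<close>

lemma psi_lip:
 assumes l: "Suc l <= Lm" and s: "\<bar>s\<bar> <= 2*r0" and j: "j < q"
 shows "EX dl>0. ALL y:KK l. ALL y':KK l. dist y y' < dl --> dist (psi j s y) (psi j s y') <= exp (A + 1)*dist y y'"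
proof -
 let ?C = "KK (Suc (Suc l))"
 have lt: "real (Suc (Suc l))*r0 < 1" by (rule Lm_lt) (use l in simp)
 have C: "compact ?C" "?C \<subseteq> Om" using KK_compact[OF lt] KK_Om[OF lt] by auto
 obtain M where M: "0 <= M" "!!j y. j < q ==> y : ?C ==> norm (Y j y) <= M" using family_bounded[OF C] by metis
 have D: "norm (frechet_derivative (Y j) (at y) v) <= A*norm v" if jy: "j < q" "y : ?C" for j y v
 proof -
  obtain x where x: "x : K" "ALL L. real (Suc (Suc l))*r0 < L --> L < 1 --> y : reach Om Y q x L" using KK_reach[OF lt jy(2)] by blast
  obtain L where L: "real (Suc (Suc l))*r0 < L" "L < 1" using dense[OF lt] by blast
  show ?thesis by (rule DY[OF x(1) L(2) _ jy(1)]) (use x(2) L in blast)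
 qed
 obtain r where r: "0 < r" and cmp: "!!w1 w2 ga1 ga2 t. solves Om (lc q Y w1) ga1 ==> solves Om (lc q Y w2) ga2 ==> ga1 ` {0..1} \<subseteq> ?C ==>
   l1 q w2 <= 1 ==> (norm (ga1 0 - ga2 0) + l1 q (%j. w1 j - w2 j)*M)*exp (A + 1) < r ==> t : {0..1} ==>
   norm (ga1 t - ga2 t) <= (norm (ga1 0 - ga2 0) + l1 q (%j. w1 j - w2 j)*M)*exp (A + 1)"
  using flow_compare[OF C A0 D M(2) M(1)] by blast
 show ?thesis
 proof (intro exI[of _ "r/exp (A + 1)"] conjI ballI impI)
  show "0 < r/exp (A + 1)" using r by simp
  fix y y' assume y: "y : KK l" "y' : KK l" and d: "dist y y' < r/exp (A + 1)"
  have so: "sol j s z" if "z : KK l" for z by (rule sol_KK[OF that]) (use l s r0 in auto)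
  obtain ga where g: "solves Om (lc q Y (ej j s)) ga" "ga 0 = y" using so[OF y(1)] unfolding sol_def by blast
  obtain ga' where g': "solves Om (lc q Y (ej j s)) ga'" "ga' 0 = y'" using so[OF y(2)] unfolding sol_def by blast
  have im: "ga ` {0..1} \<subseteq> ?C"
  proof safe
   fix u :: real assume u: "u : {0..1}"
   have e: "psi j (u * s) y = ga u" using psi_solves[OF g(1), of 0 u] u g(2) by simp
   have "\<bar>u * s\<bar> <= 1 * \<bar>s\<bar>" unfolding abs_mult using u by (intro mult_right_mono) auto
   then have "psi j (u * s) y : ?C" using KK_step2[OF y(1) l _ j] s by simp
   then show "ga u : ?C" unfolding e .
  qed
  have z: "l1 q (%i. 0) = 0" by (simp add: l1_def)
  have "0 <= real Lm*r0" using r0 by simp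
  then have "2*r0 <= 1" using r0(2) by (simp add: algebra_simps)
  then have "l1 q (ej j s) <= 1" using l1_ej[of q j s] s by linarith
  moreover have "norm (y - y')*exp (A + 1) < r" using d by (simp add: pos_less_divide_eq dist_norm)
  ultimately have "norm (ga 1 - ga' 1) <= norm (y - y')*exp (A + 1)"
   using cmp[OF g(1) g'(1) im, of 1] g(2) g'(2) by (simp add: z)
  moreover have "psi j s y = ga 1" "psi j s y' = ga' 1" using psi_solves[OF g(1), of 0 1] g(2) psi_solves[OF g'(1), of 0 1] g'(2) by simp_all
  ultimately show "dist (psi j s y) (psi j s y') <= exp (A + 1)*dist y y'" by (simp add: dist_norm mult.commute)
 qed
qed

text \<open>A Borel version of \<open>psi\<close>, cut off to a compact set on which
  \<open>psi\<close> is continuous.\<close>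

definition psit :: "nat => real => real^'n => real^'n" where
 "psit j t y = indicator ({-(2*r0)..2*r0} \<times> KK Lm) (t, y) *\<^sub>R psi j t y"

lemma psit_eq: "\<bar>t\<bar> <= 2*r0 ==> y : KK l ==> l <= Lm ==> psit j t y = psi j t y"
 using KK_mono[of l Lm] by (auto simp: psit_def indicator_def abs_le_iff)

lemma psit_measurable [measurable]: "(%(t,y). psit j t y) : borel_measurable (borel \<Otimes>\<^sub>M borel)"
proof -
 have "real Lm*r0 + 2*r0 < 1" using r0 by (simp add: algebra_simps)
 then have c: "continuous_on ({-(2*r0)..2*r0} \<times> KK Lm) (%p. case p of (t,y) => psi j t y)" by (rule psi_continuous)
 have "closed ({-(2*r0)..2*r0} \<times> KK Lm)" using KK_compact[OF Lm_lt, of Lm] by (intro closed_Times compact_imp_closed) auto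
 then have "({-(2*r0)..2*r0} \<times> KK Lm) : sets borel" by (rule borel_closed)
 from borel_measurable_continuous_on_indicator[OF this c]
 have "(%p. indicator ({-(2*r0)..2*r0} \<times> KK Lm) p *\<^sub>R (case p of (t,y) => psi j t y)) : borel_measurable (borel \<Otimes>\<^sub>M borel)" unfolding borel_prod .
 moreover have "(%p. indicator ({-(2*r0)..2*r0} \<times> KK Lm) p *\<^sub>R (case p of (t,y) => psi j t y)) = (%(t,y). psit j t y)"
  by (auto simp: psit_def fun_eq_iff)
 ultimately show ?thesis by simp
qed

definition TC :: "real => real" where
 "TC p = 2*((2*exp (A + 1)*real CARD('n)) ^ CARD('n))\<^sup>2*(10 * p * 4 powr (p - 1)/(p - 1))"

text \<open>In the transference the three compact sets are \<open>KK l\<close>,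
  \<open>KK (l + 1)\<close> and \<open>KK (l + 3)\<close>: times up to \<open>r0\<close> cost one
  level, times up to 2*r0 two more. The Lipschitz bound on the last set requires one further level
  below \<open>Lm\<close>.\<close>

lemma flow_max_KK:
 assumes l: "l + 4 <= Lm" and j: "j < q" and p: "1 < p" and g: "g : borel_measurable borel"
 shows "(\<integral>\<^sup>+y\<in>KK l. enn_powr (flow_max r0 (psit j) g y) p \<partial>lborel) <= ennreal (TC p)*(\<integral>\<^sup>+y\<in>KK (l + 3). enn_powr (g y) p \<partial>lborel)"
 unfolding TC_def
proof (rule flow_max_transference[OF r0(1) p _ _ _ _ psit_measurable, where ?K1.0="KK (Suc l)"])
 show "compact (KK l)" "compact (KK (Suc l))" "compact (KK (l + 3))" by (intro KK_compact Lm_lt; use l in simp)+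
 show "KK (Suc l) \<subseteq> KK (l + 3)" by (rule KK_mono) simp
 have 0: "psi j 0 y = y" if "y : KK m" "m <= Lm" for y m by (rule psi_zero[OF sol_KK[OF that, of 0]]) (use r0 in simp)
 have e3: "Suc (Suc (Suc l)) = l + 3" by simp
 show "psit j (-s) y : KK (Suc l) & psit j s (psit j (-s) y) = y" if s: "\<bar>s\<bar> <= r0" and y: "y : KK l" for s y
 proof -
  have s2: "\<bar>s\<bar> <= 2*r0" "\<bar>-s\<bar> <= 2*r0" "\<bar>-s\<bar> <= r0" using s r0 by auto
  have st: "psi j (-s) y : KK (Suc l)" by (rule KK_step[OF y s2(3) j])
  have "psi j s (psi j (-s) y) = psi j (- s + s) y" by (rule psi_grp[OF y _ j s2(3) s2(1)]) (use l in simp)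
  then have "psi j s (psi j (-s) y) = y" using 0[OF y] l by simp
  then show ?thesis using psit_eq[OF s2(2) y, of j] psit_eq[OF s2(1) st, of j] st l by simp
 qed
 show "psit j s y : KK (l + 3) & psit j (-s) (psit j s y) = y" if s: "\<bar>s\<bar> <= 2*r0" and y: "y : KK (Suc l)" for s y
 proof -
  have s2: "\<bar>-s\<bar> <= 2*r0" using s by simp
  have st: "psi j s y : KK (l + 3)" using KK_step2[OF y _ s j] l unfolding e3 by simp
  have "psi j (-s) (psi j s y) = psi j (s + - s) y"
   by (rule psi_group) (rule sol_KK[OF y] sol_KK[OF st]; use l s r0 in simp)+
  then have "psi j (-s) (psi j s y) = y" using 0[OF y] l by simp
  then show ?thesis using psit_eq[OF s y, of j] psit_eq[OF s2 st, of j] st l by simp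
 qed
 show "psit j t (psit j s y) = psit j (s + t) y" if s: "\<bar>s\<bar> <= r0" and t: "\<bar>t\<bar> <= r0" and y: "y : KK (Suc l)" for s t y
 proof -
  have s2: "\<bar>s\<bar> <= 2*r0" "\<bar>t\<bar> <= 2*r0" "\<bar>s + t\<bar> <= 2*r0" using s t by auto
  have st: "psi j s y : KK (Suc (Suc l))" by (rule KK_step[OF y s j])
  have "psi j t (psi j s y) = psi j (s + t) y" by (rule psi_grp[OF y _ j s s2(2)]) (use l in simp)
  then show ?thesis using psit_eq[OF s2(1) y, of j] psit_eq[OF s2(2) st, of j] psit_eq[OF s2(3) y, of j] l by simp
 qed
 show "EX dl>0. ALL y:KK (l + 3). ALL y':KK (l + 3). dist y y' < dl --> dist (psit j s y) (psit j s y') <= exp (A + 1)*dist y y'" if s: "\<bar>s\<bar> <= 2*r0" for s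
 proof -
  have l3: "Suc (l + 3) <= Lm" "l + 3 <= Lm" using l by auto
  show ?thesis using psi_lip[OF l3(1) s j] psit_eq[OF s _ l3(2), of _ j] by simp
 qed
qed (use g in auto)

end

section \<open>Averages over a box and iterated maximal functions\<close>

context ctrans
begin

primrec TT :: "nat list => (real^'n => ennreal) => real^'n => ennreal" where
 "TT [] g = g"
| "TT (j # js) g = flow_max r0 (psit j) (TT js g)"

lemma TT_measurable: "g : borel_measurable borel ==> TT js g : borel_measurable borel"
 by (induction js) (auto intro!: flow_max_measurable psit_measurable)

lemma TT_snoc: "TT (js @ [j]) g = TT js (flow_max r0 (psit j) g)"
 by (induction js) auto

text \<open>Each maximal function uses up three levels of \<open>KK\<close> and contributes one
  factor \<open>TC p\<close>.\<close>

lemma TT_bound: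
 assumes p: "1 < p" and g: "g : borel_measurable borel"
 shows "set js \<subseteq> {..<q} ==> l + 3*length js + 1 <= Lm ==>
  (\<integral>\<^sup>+y\<in>KK l. enn_powr (TT js g y) p \<partial>lborel) <= ennreal (TC p ^ length js)*(\<integral>\<^sup>+y\<in>KK (l + 3*length js). enn_powr (g y) p \<partial>lborel)"
proof (induction js arbitrary: l)
 case (Cons j js)
 have TC0: "0 <= TC p" using p by (simp add: TC_def)
 have j: "j < q" and l: "l + 4 <= Lm" using Cons.prems by auto
 have "(\<integral>\<^sup>+y\<in>KK l. enn_powr (TT (j # js) g y) p \<partial>lborel) <= ennreal (TC p)*(\<integral>\<^sup>+y\<in>KK (l + 3). enn_powr (TT js g y) p \<partial>lborel)"
  using flow_max_KK[OF l j p TT_measurable[OF g]] by simp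
 also have "... <= ennreal (TC p)*(ennreal (TC p ^ length js)*(\<integral>\<^sup>+y\<in>KK (l + 3 + 3*length js). enn_powr (g y) p \<partial>lborel))"
  by (rule mult_left_mono[OF Cons.IH]) (use Cons.prems in auto)
 also have "... = ennreal (TC p ^ length (j # js))*(\<integral>\<^sup>+y\<in>KK (l + 3*length (j # js)). enn_powr (g y) p \<partial>lborel)"
  using TC0 by (simp add: ennreal_mult mult.assoc add.assoc)
 finally show ?case .
qed simp

text \<open>A cube of half-side \<open>rh\<close>, doubled in the directions \<open>P\<close> that
  have already been averaged.\<close>

definition bx :: "real => 'n set => (real^'n) set" where
 "bx rh P = {u. ALL i. \<bar>u $ i\<bar> <= (if i : P then 2*rh else rh)}"

lemma closed_bx: "closed (bx rh P)"
 unfolding bx_def by (intro closed_Collect_all closed_Collect_le continuous_intros)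

lemma bx_measurable [measurable]: "bx rh P : sets borel" using closed_bx by (rule borel_closed)

lemma bx_measure: assumes "0 <= rh" shows "emeasure lborel (bx rh P) <= ennreal ((4*rh) ^ CARD('n))"
proof -
 have "bx rh P \<subseteq> cbox (\<chi> i. - (2*rh)) (\<chi> i. 2*rh)"
 proof
  fix u assume u: "u : bx rh P"
  have "\<bar>u $ i\<bar> <= 2*rh" for i
  proof -
   have "\<bar>u $ i\<bar> <= (if i : P then 2*rh else rh)" using u by (simp add: bx_def)
   then show ?thesis using assms by (auto split: if_splits)
  qed
  then have "- (2*rh) <= u $ i & u $ i <= 2*rh" for i by (simp add: abs_le_iff minus_le_iff)
  then show "u : cbox (\<chi> i. - (2*rh)) (\<chi> i. 2*rh)" by (simp add: mem_box_cart)
 qed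
 then have "emeasure lborel (bx rh P) <= emeasure lborel (cbox (\<chi> i. - (2*rh)) (\<chi> i. 2*rh) :: (real^'n) set)" by (rule emeasure_mono) simp
 also have "... = ennreal ((4*rh) ^ CARD('n))" by (rule emeasure_cube_cart) (use assms in auto)
 finally show ?thesis .
qed

text \<open>Averaging over translations in the direction \<open>i\<close> splits off a
  one-dimensional integral, at the price of doubling the box in that direction.\<close>

lemma box_peel:
 fixes F :: "real^'n => ennreal"
 assumes F [measurable]: "F : borel_measurable borel" and rh: "0 < rh" and i: "i \<notin> P"
 shows "ennreal (2*rh)*(\<integral>\<^sup>+u\<in>bx rh P. F u \<partial>lborel)
   <= (\<integral>\<^sup>+u\<in>bx rh (insert i P). (\<integral>\<^sup>+t\<in>{-rh..rh}. F (u + t *\<^sub>R axis i 1) \<partial>lborel) \<partial>lborel)"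
proof -
 let ?J = "\<integral>\<^sup>+u\<in>bx rh P. F u \<partial>lborel"
 have sh: "?J*indicator {-rh..rh} t <= (\<integral>\<^sup>+u. F (u + t *\<^sub>R axis i 1)*indicator (bx rh (insert i P)) u*indicator {-rh..rh} t \<partial>lborel)" for t
 proof (cases "t : {-rh..rh}")
  case True
  have "?J = (\<integral>\<^sup>+u. F u*indicator (bx rh P) u \<partial>distr lborel borel ((+) (t *\<^sub>R axis i 1)))" by (simp add: lborel_distr_plus)
  also have "... = (\<integral>\<^sup>+u. F (t *\<^sub>R axis i 1 + u)*indicator (bx rh P) (t *\<^sub>R axis i 1 + u) \<partial>lborel)" by (rule nn_integral_distr) measurable
  also have "... <= (\<integral>\<^sup>+u. F (u + t *\<^sub>R axis i 1)*indicator (bx rh (insert i P)) u \<partial>lborel)"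
  proof (rule nn_integral_mono)
   fix u :: "real^'n"
   have "u : bx rh (insert i P)" if "t *\<^sub>R axis i 1 + u : bx rh P"
    unfolding bx_def mem_Collect_eq
   proof
    fix k
    have k: "\<bar>(t *\<^sub>R axis i 1 + u) $ k\<bar> <= (if k : P then 2*rh else rh)" using that by (simp add: bx_def)
    show "\<bar>u $ k\<bar> <= (if k : insert i P then 2*rh else rh)"
    proof (cases "k = i")
     case True
     then have "\<bar>t + u $ i\<bar> <= rh" using k i by (simp add: axis_def)
     then show ?thesis using True \<open>t : {-rh..rh}\<close> by auto
    next
     case False
     then show ?thesis using k by (simp add: axis_def)
    qed
   qed
   then show "F (t *\<^sub>R axis i 1 + u)*indicator (bx rh P) (t *\<^sub>R axis i 1 + u) <= F (u + t *\<^sub>R axis i 1)*indicator (bx rh (insert i P)) u"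
    by (auto simp: indicator_def add.commute)
  qed
  finally show ?thesis using True by simp
 qed simp
 have "ennreal (2*rh)*?J = (\<integral>\<^sup>+t. ?J*indicator {-rh..rh} t \<partial>lborel)" using rh by (subst nn_integral_cmult_indicator) (auto simp: mult.commute)
 also have "... <= (\<integral>\<^sup>+t. \<integral>\<^sup>+u. F (u + t *\<^sub>R axis i 1)*indicator (bx rh (insert i P)) u*indicator {-rh..rh} t \<partial>lborel \<partial>lborel)"
  by (rule nn_integral_mono) (rule sh)
 also have "... = (\<integral>\<^sup>+u. \<integral>\<^sup>+t. F (u + t *\<^sub>R axis i 1)*indicator (bx rh (insert i P)) u*indicator {-rh..rh} t \<partial>lborel \<partial>lborel)"
  by (rule lborel_pair.Fubini') measurable
 also have "... = (\<integral>\<^sup>+u\<in>bx rh (insert i P). (\<integral>\<^sup>+t\<in>{-rh..rh}. F (u + t *\<^sub>R axis i 1) \<partial>lborel) \<partial>lborel)"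
 proof (rule nn_integral_cong)
  fix u :: "real^'n"
  have "(\<integral>\<^sup>+t. F (u + t *\<^sub>R axis i 1)*indicator (bx rh (insert i P)) u*indicator {-rh..rh} t \<partial>lborel)
   = (\<integral>\<^sup>+t. (F (u + t *\<^sub>R axis i 1)*indicator {-rh..rh} t)*indicator (bx rh (insert i P)) u \<partial>lborel)" by (simp only: mult_ac)
  also have "... = (\<integral>\<^sup>+t\<in>{-rh..rh}. F (u + t *\<^sub>R axis i 1) \<partial>lborel)*indicator (bx rh (insert i P)) u" by (rule nn_integral_multc) measurable
  finally show "(\<integral>\<^sup>+t. F (u + t *\<^sub>R axis i 1)*indicator (bx rh (insert i P)) u*indicator {-rh..rh} t \<partial>lborel)
   = (\<integral>\<^sup>+t\<in>{-rh..rh}. F (u + t *\<^sub>R axis i 1) \<partial>lborel)*indicator (bx rh (insert i P)) u" .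
 qed
 finally show ?thesis .
qed

lemma flow_max_segment:
 assumes g [measurable]: "g : borel_measurable borel" and c: "0 < c" "c <= 1" and rh: "0 < rh" "3*rh <= r0" and v: "\<bar>v\<bar> <= 2*rh"
 shows "(\<integral>\<^sup>+t\<in>{-rh..rh}. g (psit j (c*(v + t)) z) \<partial>lborel) <= ennreal (12*rh)*flow_max r0 (psit j) g z"
proof -
 have [measurable]: "(%t. psit j t z) : borel_measurable borel"
 proof -
  have "(%t. (t, z)) : borel \<rightarrow>\<^sub>M borel \<Otimes>\<^sub>M borel" by simp
  from measurable_compose[OF this psit_measurable[of j]] show ?thesis by simp
 qed
 have "(\<integral>\<^sup>+t\<in>{-rh..rh}. g (psit j (c*(v + t)) z) \<partial>lborel) <= (\<integral>\<^sup>+t. g (psit j (c * v + c*t) z)*indicator {-(3*c*rh)..3*c*rh} (c * v + c*t) \<partial>lborel)"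
 proof (rule nn_integral_mono)
  fix t
  have "\<bar>c * v + c*t\<bar> <= 3*c*rh" if "t : {-rh..rh}"
  proof -
   have "\<bar>v + t\<bar> <= 3*rh" using that v by auto
   then have "c * \<bar>v + t\<bar> <= c*(3*rh)" using c by (intro mult_left_mono) auto
   moreover have "\<bar>c * v + c*t\<bar> = c * \<bar>v + t\<bar>" using c by (simp add: distrib_left[symmetric] abs_mult)
   ultimately show ?thesis by simp
  qed
  then show "g (psit j (c*(v + t)) z)*indicator {-rh..rh} t <= g (psit j (c * v + c*t) z)*indicator {-(3*c*rh)..3*c*rh} (c * v + c*t)"
   by (auto simp: indicator_def distrib_left abs_le_iff)
 qed
 also have "... = ennreal (1/c)*(\<integral>\<^sup>+t. g (psit j t z)*indicator {-(3*c*rh)..3*c*rh} t \<partial>lborel)"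
 proof -
  have "(\<integral>\<^sup>+t. g (psit j t z)*indicator {-(3*c*rh)..3*c*rh} t \<partial>lborel) = ennreal c*(\<integral>\<^sup>+t. g (psit j (c * v + c*t) z)*indicator {-(3*c*rh)..3*c*rh} (c * v + c*t) \<partial>lborel)"
   using nn_integral_real_affine[of "%t. g (psit j t z)*indicator {-(3*c*rh)..3*c*rh} t" c "c * v"] c by simp
  moreover have "ennreal (1/c)*ennreal c = 1" using c by (simp add: ennreal_mult[symmetric])
  ultimately show ?thesis by (simp add: mult.assoc[symmetric])
 qed
 also have "(\<integral>\<^sup>+t. g (psit j t z)*indicator {-(3*c*rh)..3*c*rh} t \<partial>lborel) <= ennreal (12*c*rh)*flow_max r0 (psit j) g z"
 proof -
  let ?s = "3*c*rh"
  have s: "0 < ?s" "?s <= r0"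
  proof -
   show "0 < ?s" using c rh by simp
   have "c*(3*rh) <= 1*(3*rh)" using c rh by (intro mult_right_mono) auto
   moreover have "?s = c*(3*rh)" by simp
   ultimately show "?s <= r0" using rh by linarith
  qed
  \<comment> \<open>The largest \<open>m\<close> with 3*c*rh <= r0/2^m; it exists because 3*rh <= r0
    and c <= 1.\<close>
  obtain m :: nat where m: "?s <= r0/2 ^ m" "r0/2 ^ m < 2*?s"
  proof -
   obtain n0 where n0: "r0/?s < 2 ^ n0" using real_arch_pow[of 2 "r0/?s"] by auto
   define n where "n = (LEAST n. r0/?s < 2 ^ n)"
   have n1: "r0/?s < 2 ^ n" unfolding n_def by (rule LeastI[of "%n. r0/?s < 2 ^ n", OF n0])
   have "n ~= 0" using n1 s by (intro notI) (simp add: field_simps)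
   then obtain m where nm: "n = Suc m" using not0_implies_Suc by blast
   have "~ r0/?s < 2 ^ m" using not_less_Least[of m "%n. r0/?s < 2 ^ n"] nm unfolding n_def by simp
   then have "?s <= r0/2 ^ m" using s(1) by (simp add: field_simps)
   moreover have "r0/2 ^ m < 2*?s" using n1 s(1) unfolding nm by (simp add: field_simps)
   ultimately show ?thesis using that by blast
  qed
  let ?r = "r0/2 ^ m" and ?I = "%r. \<integral>\<^sup>+t. g (psit j t z)*indicator {-r..r} t \<partial>lborel"
  have r: "0 < ?r" using r0 by simp
  have "?I ?s <= ?I ?r" using m(1) by (intro nn_integral_mono) (auto simp: indicator_def)
  also have "... = ennreal (2*?r)*(?I ?r/ennreal (2*?r))"
  proof -
   define R where "R = 2*?r"
   have "0 < R" using r by (simp only: R_def mult_pos_pos zero_less_numeral)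
   then have "ennreal R ~= 0" "ennreal R ~= top" by simp_all
   then have "?I ?r = ennreal R*(?I ?r/ennreal R)"
    unfolding ennreal_times_divide mult.commute[of "ennreal R"] by (intro ennreal_mult_divide_eq[symmetric])
   then show ?thesis unfolding R_def .
  qed
  also have "... <= ennreal (12*c*rh)*flow_max r0 (psit j) g z"
  proof (rule mult_mono)
   show "ennreal (2*?r) <= ennreal (12*c*rh)" using m(2) by (intro ennreal_leI) linarith
   show "?I ?r/ennreal (2*?r) <= flow_max r0 (psit j) g z" unfolding flow_max_def by (rule SUP_upper) simp
  qed simp_all
  finally show ?thesis .
 qed
 finally have "(\<integral>\<^sup>+t\<in>{-rh..rh}. g (psit j (c*(v + t)) z) \<partial>lborel) <= ennreal (1/c)*(ennreal (12*c*rh)*flow_max r0 (psit j) g z)" by (simp add: mult_left_mono)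
 also have "... = ennreal (12*rh)*flow_max r0 (psit j) g z"
 proof -
  have "ennreal (1/c)*ennreal (12*c*rh) = ennreal (12*rh)" using c rh by (simp add: ennreal_mult[symmetric])
  then show ?thesis by (simp add: mult.assoc[symmetric])
 qed
 finally show ?thesis .
qed

lemma iterated_measurable:
 "(%u. foldl (%z i. psit (ph i) (c i*u $ i) z) x il) : borel_measurable (borel :: (real^'n) measure)"
proof (induction il rule: rev_induct)
 case (snoc i il)
 have "(%u::real^'n. (c i*u $ i, foldl (%z i. psit (ph i) (c i*u $ i) z) x il)) : borel \<rightarrow>\<^sub>M borel \<Otimes>\<^sub>M borel"
  by (intro measurable_Pair snoc borel_measurable_times borel_measurable_const borel_measurable_continuous_onI continuous_intros)
 from measurable_compose[OF this psit_measurable[of "ph i"]] show ?case by simp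
qed simp

text \<open>The last flow is peeled off: \<open>box_peel\<close> frees its time,
  \<open>flow_max_segment\<close> replaces the function by its maximal function, and induction
  handles the shorter composition with the coordinate \<open>i\<close> moved into \<open>P\<close>.
  Each step contributes 12*rh/(2*rh) = 6.\<close>

lemma iterated_average_bound:
 assumes rh: "0 < rh" "3*rh <= r0" and c: "!!i. i : set il ==> 0 < c i & c i <= 1"
 shows "distinct il ==> P \<inter> set il = {} ==> set il \<subseteq> S ==> (!!i. i : S ==> 0 < c i & c i <= 1) ==> g : borel_measurable borel ==>
  (\<integral>\<^sup>+u\<in>bx rh P. g (foldl (%z i. psit (ph i) (c i*u $ i) z) x il) \<partial>lborel) <= ennreal (6 ^ length il*(4*rh) ^ CARD('n))*TT (map ph il) g x"
proof (induction il arbitrary: g P rule: rev_induct)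
 case Nil
 have "(\<integral>\<^sup>+u\<in>bx rh P. g x \<partial>lborel) = g x*emeasure lborel (bx rh P)" by (rule nn_integral_cmult_indicator) simp
 also have "... <= g x*ennreal ((4*rh) ^ CARD('n))" by (rule mult_left_mono[OF bx_measure]) (use rh in auto)
 finally show ?case by (simp add: mult.commute)
next
 case (snoc i il)
 note g [measurable] = snoc.prems(5)
 let ?H = "%u::real^'n. foldl (%z i. psit (ph i) (c i*u $ i) z) x il"
 let ?F = "%u. g (foldl (%z i. psit (ph i) (c i*u $ i) z) x (il @ [i]))"
 let ?M = "flow_max r0 (psit (ph i)) g"
 have Mm: "?M : borel_measurable borel" by (rule flow_max_measurable[OF psit_measurable g])
 have Fm: "?F : borel_measurable borel" by (rule measurable_compose[OF iterated_measurable g])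
 have ci: "0 < c i" "c i <= 1" using snoc.prems by auto
 have iil: "i \<notin> set il" "i \<notin> P" using snoc.prems by auto
 \<comment> \<open>Translating a coordinate that is absent from the list leaves the composition
   unchanged, so in the inner integral only the last flow moves.\<close>
 have ind: "foldl (%z i. psit (ph i) (c i*(u + t *\<^sub>R axis i' 1) $ i) z) x l = foldl (%z i. psit (ph i) (c i*u $ i) z) x l" if "i' \<notin> set l" for u t l and i' :: 'n
  using that by (induction l rule: rev_induct) (auto simp: axis_def)
 have "ennreal (2*rh)*(\<integral>\<^sup>+u\<in>bx rh P. ?F u \<partial>lborel) <= (\<integral>\<^sup>+u\<in>bx rh (insert i P). (\<integral>\<^sup>+t\<in>{-rh..rh}. ?F (u + t *\<^sub>R axis i 1) \<partial>lborel) \<partial>lborel)"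
  by (rule box_peel[OF Fm rh(1) iil(2)])
 also have "... <= (\<integral>\<^sup>+u. ennreal (12*rh)*(?M (?H u)*indicator (bx rh (insert i P)) u) \<partial>lborel)"
 proof (rule nn_integral_mono)
  fix u :: "real^'n"
  show "(\<integral>\<^sup>+t\<in>{-rh..rh}. ?F (u + t *\<^sub>R axis i 1) \<partial>lborel)*indicator (bx rh (insert i P)) u <= ennreal (12*rh)*(?M (?H u)*indicator (bx rh (insert i P)) u)"
  proof (cases "u : bx rh (insert i P)")
   case True
   then have v: "\<bar>u $ i\<bar> <= 2*rh" by (auto simp: bx_def dest!: spec[of _ i])
   have "?F (u + t *\<^sub>R axis i 1) = g (psit (ph i) (c i*(u $ i + t)) (?H u))" for t
    using ind[OF iil(1), of u t] by (simp add: axis_def)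
   then show ?thesis using flow_max_segment[OF g ci rh v, of "ph i" "?H u"] True by simp
  qed simp
 qed
 also have "... = ennreal (12*rh)*(\<integral>\<^sup>+u\<in>bx rh (insert i P). ?M (?H u) \<partial>lborel)"
  using measurable_compose[OF iterated_measurable Mm, of ph c x il]
  by (intro nn_integral_cmult borel_measurable_times_ennreal borel_measurable_indicator) simp_all
 also have "... <= ennreal (12*rh)*(ennreal (6 ^ length il*(4*rh) ^ CARD('n))*TT (map ph il) ?M x)"
  by (intro mult_left_mono snoc.IH Mm) (use snoc.prems in auto)
 finally have le: "ennreal (2*rh)*(\<integral>\<^sup>+u\<in>bx rh P. ?F u \<partial>lborel) <= ennreal (12*rh)*(ennreal (6 ^ length il*(4*rh) ^ CARD('n))*TT (map ph il) ?M x)" .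
 have one: "ennreal (1/(2*rh))*ennreal (2*rh) = 1" using rh by (simp add: ennreal_mult[symmetric])
 have "(\<integral>\<^sup>+u\<in>bx rh P. ?F u \<partial>lborel) = ennreal (1/(2*rh))*(ennreal (2*rh)*(\<integral>\<^sup>+u\<in>bx rh P. ?F u \<partial>lborel))" unfolding mult.assoc[symmetric] one by simp
 also have "... <= ennreal (1/(2*rh))*(ennreal (12*rh)*(ennreal (6 ^ length il*(4*rh) ^ CARD('n))*TT (map ph il) ?M x))" by (rule mult_left_mono[OF le]) simp
 also have "... = ennreal (6 ^ length (il @ [i])*(4*rh) ^ CARD('n))*TT (map ph (il @ [i])) g x"
 proof -
  have "ennreal (1/(2*rh))*ennreal (12*rh)*ennreal (6 ^ length il*(4*rh) ^ CARD('n)) = ennreal (6 ^ length (il @ [i])*(4*rh) ^ CARD('n))"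
  proof -
   define Q where "Q = 6 ^ length il*(4*rh) ^ CARD('n)"
   have "ennreal (1/(2*rh))*ennreal (12*rh) = ennreal 6" using rh by (simp add: ennreal_mult[symmetric])
   moreover have "ennreal 6*ennreal Q = ennreal (6*Q)" by (rule ennreal_mult[symmetric]) (use rh in \<open>auto simp: Q_def\<close>)
   ultimately show ?thesis by (simp add: Q_def mult.assoc)
  qed
  then show ?thesis by (simp add: TT_snoc mult.assoc[symmetric])
 qed
 finally show ?case .
qed

end

section \<open>Choice of the frame and change of scale\<close>

text \<open>Coefficients of size at most 1 come from Cramer's rule: replacing a column of the frame
  by another field multiplies the determinant by the corresponding coefficient, and the determinant
  was maximal. To have square matrices, a basis of the span is completed to a basis of R^n labelled
  by the coordinates; the labels of the original basis form \<open>I\<close>, and columns outside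
  \<open>I\<close> stay fixed.\<close>

lemma frame_exists:
 fixes Yv :: "nat => real^'n"
 shows "EX (I::'n set) ph. card I = dim {Yv j |j. j < q} & (ALL i:I. ph i < q) &
  (ALL w. (ALL i. i \<notin> I --> w $ i = 0) --> (\<Sum>i\<in>I. w $ i *\<^sub>R Yv (ph i)) = 0 --> w = 0) &
  (ALL m<q. EX a. (ALL i. i \<notin> I --> a $ i = 0) & (ALL i. \<bar>a $ i\<bar> <= 1) & Yv m = (\<Sum>i\<in>I. a $ i *\<^sub>R Yv (ph i)))"
proof -
 let ?V = "{Yv j |j. j < q}"
 obtain B where B: "B \<subseteq> ?V" "independent B" "?V \<subseteq> span B" "card B = dim ?V" by (rule basis_exists)
 obtain C where C: "B \<subseteq> C" "independent C" "UNIV \<subseteq> span C" using maximal_independent_subset_extend[of B UNIV] B(2) by auto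
 have finC: "finite C" using independent_imp_finite[OF C(2)] .
 have "card C = dim (UNIV :: (real^'n) set)" by (rule basis_card_eq_dim) (use C in auto)
 then have "card C = card (UNIV :: 'n set)" by simp
 then obtain f where f: "bij_betw f (UNIV :: 'n set) C" using finite_same_card_bij[of "UNIV :: 'n set" C] finC by auto
 define I where "I = {i. f i : B}"
 have fI: "bij_betw f I B"
 proof -
  have "f ` I = B" using f C(1) unfolding I_def bij_betw_def by auto
  then show ?thesis using f unfolding bij_betw_def by (auto intro: inj_on_subset)
 qed
 have cI: "card I = dim ?V" using bij_betw_same_card[OF fI] B(4) by simp
 define col where "col ph i = (if i : I then Yv (ph i) else f i)" for ph i
 define M where "M ph = (\<chi> r i. col ph i $ r)" for ph
 have Mv: "M ph *v w = (\<Sum>i\<in>UNIV. w $ i *\<^sub>R col ph i)" for ph w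
  by (simp add: vec_eq_iff matrix_vector_mult_def M_def mult.commute)
 have MI: "M ph *v w = (\<Sum>i\<in>I. w $ i *\<^sub>R Yv (ph i))" if "ALL i. i \<notin> I --> w $ i = 0" for ph w
 proof -
  have "(\<Sum>i\<in>UNIV. w $ i *\<^sub>R col ph i) = (\<Sum>i\<in>I. w $ i *\<^sub>R col ph i)"
   by (rule sum.mono_neutral_right) (use that in auto)
  also have "... = (\<Sum>i\<in>I. w $ i *\<^sub>R Yv (ph i))" by (rule sum.cong) (auto simp: col_def)
  finally show ?thesis unfolding Mv .
 qed
 have det0: "w = 0" if "det (M ph) ~= 0" "M ph *v w = 0" for ph w
 proof -
  have "inj ((*v) (M ph))" using that(1) det_nz_iff_inj[of "(*v) (M ph)"] by (simp add: matrix_of_matrix_vector_mul)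
  then show ?thesis using that(2) by (metis injD matrix_vector_mult_0_right)
 qed
 let ?P = "PiE I (%_. {..<q})"
 have finP: "finite ?P" by (rule finite_PiE) simp_all
 have "ALL i:I. EX j. j < q & Yv j = f i" using B(1) unfolding I_def by fastforce
 then obtain ph' where ph': "ALL i:I. ph' i < q & Yv (ph' i) = f i" by metis
 define ph0 where "ph0 = restrict ph' I"
 have ph0: "ph0 : ?P" using ph' by (auto simp: ph0_def)
 have col0: "col ph0 i = f i" for i using ph' by (simp add: col_def ph0_def)
 have "det (M ph0) ~= 0"
 proof -
  have "inj ((*v) (M ph0))"
  proof (subst linear_injective_0)
   show "ALL w. M ph0 *v w = 0 --> w = 0"
   proof (intro allI impI)
    fix w assume w: "M ph0 *v w = 0"
    let ?u = "%v. w $ (inv f v)"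
    have injf: "inj f" using f by (simp add: bij_betw_def)
    have "(\<Sum>v\<in>C. ?u v *\<^sub>R v) = (\<Sum>i\<in>UNIV. ?u (f i) *\<^sub>R f i)" using sum.reindex_bij_betw[OF f, of "%v. ?u v *\<^sub>R v"] by simp
    also have "... = 0" using w unfolding Mv col0 by (simp add: inv_f_f[OF injf])
    finally have z: "(\<Sum>v\<in>C. ?u v *\<^sub>R v) = 0" .
    have "w $ i = 0" for i
    proof -
     have "f i : C" using f by (auto simp: bij_betw_def)
     then have "?u (f i) = 0" using independentD[OF C(2) finC subset_refl z] by blast
     then show ?thesis by (simp add: inv_f_f[OF injf])
    qed
    then show "w = 0" by (simp add: vec_eq_iff)
   qed
  qed simp
  then show ?thesis using det_nz_iff_inj[of "(*v) (M ph0)"] by (simp add: matrix_of_matrix_vector_mul)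
 qed
 \<comment> \<open>A maximum over finitely many choices; it is nonzero because of the choice
   \<open>ph0\<close>.\<close>
 define m where "m = Max ((%ph. \<bar>det (M ph)\<bar>) ` ?P)"
 have "m : (%ph. \<bar>det (M ph)\<bar>) ` ?P" unfolding m_def by (rule Max_in) (use finP ph0 in auto)
 then obtain ph where ph: "ph : ?P" "\<bar>det (M ph)\<bar> = m" by auto
 have mx: "\<bar>det (M ph'')\<bar> <= \<bar>det (M ph)\<bar>" if "ph'' : ?P" for ph'' unfolding ph(2) m_def using finP that by (intro Max_ge) auto
 have dn: "det (M ph) ~= 0" using mx[OF ph0] \<open>det (M ph0) ~= 0\<close> by auto
 have ind: "w = 0" if "ALL i. i \<notin> I --> w $ i = 0" "(\<Sum>i\<in>I. w $ i *\<^sub>R Yv (ph i)) = 0" for w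
  by (rule det0[OF dn]) (use MI[OF that(1)] that(2) in simp)
 let ?S = "(%i. Yv (ph i)) ` I"
 have inj: "inj_on (%i. Yv (ph i)) I"
 proof (rule inj_onI, rule ccontr)
  fix i k assume ik: "i : I" "k : I" "Yv (ph i) = Yv (ph k)" "i ~= k"
  let ?w = "axis i 1 - axis k 1 :: real^'n"
  have "M ph *v ?w = col ph i - col ph k" by (simp add: matrix_vector_mult_diff_distrib matrix_vector_mult_basis) (simp add: column_def M_def vec_eq_iff)
  then have "M ph *v ?w = 0" using ik by (simp add: col_def)
  then have "?w = 0" by (rule det0[OF dn])
  then have "?w $ i = 0" by simp
  then show False using ik by (simp add: axis_def)
 qed
 have indS: "independent ?S"
 proof (rule independent_if_scalars_zero)
  show "finite ?S" by simp
  fix g v assume z: "(\<Sum>v\<in>?S. g v *\<^sub>R v) = 0" and v: "v : ?S"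
  let ?w = "\<chi> i. if i : I then g (Yv (ph i)) else 0"
  have "(\<Sum>i\<in>I. ?w $ i *\<^sub>R Yv (ph i)) = (\<Sum>v\<in>?S. g v *\<^sub>R v)" by (simp add: sum.reindex[OF inj])
  then have "?w = 0" using ind[of ?w] z by simp
  moreover obtain i where i: "i : I" "v = Yv (ph i)" using v by blast
  ultimately have "?w $ i = 0" by simp
  then show "g v = 0" using i by simp
 qed
 have S: "?S \<subseteq> ?V" using PiE_mem[OF ph(1)] by blast
 have "?V \<subseteq> span ?S" by (rule card_ge_dim_independent[OF S indS]) (simp add: card_image[OF inj] cI)
 have fr: "EX a. (ALL i. i \<notin> I --> a $ i = 0) & (ALL i. \<bar>a $ i\<bar> <= 1) & Yv m = (\<Sum>i\<in>I. a $ i *\<^sub>R Yv (ph i))" if m: "m < q" for m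
 proof -
  have "Yv m : span ?S" using \<open>?V \<subseteq> span ?S\<close> m by blast
  then obtain g where g: "Yv m = (\<Sum>v\<in>?S. g v *\<^sub>R v)" by (auto simp: span_finite)
  define a where "a = (\<chi> i. if i : I then g (Yv (ph i)) else 0)"
  have aI: "ALL i. i \<notin> I --> a $ i = 0" by (simp add: a_def)
  have ae: "Yv m = (\<Sum>i\<in>I. a $ i *\<^sub>R Yv (ph i))" unfolding g by (simp add: sum.reindex[OF inj] a_def)
  have Ma: "M ph *v a = Yv m" using MI[OF aI] ae by simp
  have "\<bar>a $ k\<bar> <= 1" for k
  proof (cases "k : I")
   case True
   have "ph(k := m) : ?P" using ph(1) True m by (auto simp: PiE_iff extensional_def)
   moreover have "M (ph(k := m)) = (\<chi> i j. if j = k then (M ph *v a) $ i else M ph $ i $ j)"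
    using True unfolding Ma by (auto simp: M_def col_def vec_eq_iff)
   ultimately have "\<bar>a $ k*det (M ph)\<bar> <= \<bar>det (M ph)\<bar>" using mx[of "ph(k := m)"] cramer_lemma[where A="M ph" and k=k and x=a] by simp
   then show ?thesis using dn by (simp add: abs_mult)
  next
   case False
   then show ?thesis using aI by simp
  qed
  then show ?thesis using aI ae by blast
 qed
 show ?thesis using cI PiE_mem[OF ph(1)] ind fr by (intro exI[of _ I] exI[of _ ph]) auto
qed

lemma lc_sX:
 assumes "0 < dl" "0 < dl'"
 shows "lc q (sX X d dl) w = lc q (sX X d dl') (%j. (dl/dl') powr d j*w j)"
proof -
 have "(dl/dl') powr e*dl' powr e = dl powr e" for e using assms by (simp add: powr_divide)
 then have e: "((dl/dl') powr d j*w j)*dl' powr d j = w j*dl powr d j" for j by (metis mult.commute mult.left_commute)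
 show ?thesis unfolding lc_def sX_def scaleR_scaleR e ..
qed

lemma l2_weight:
 assumes "!!j. j < q ==> 0 <= \<kappa> j & \<kappa> j <= m" "0 <= m"
 shows "l2 q (%j. \<kappa> j*w j) <= m*l2 q w"
proof -
 have "(\<Sum>j<q. (\<kappa> j*w j)\<^sup>2) <= (\<Sum>j<q. m\<^sup>2*(w j)\<^sup>2)"
  unfolding power_mult_distrib by (intro sum_mono mult_right_mono power_mono) (use assms in auto)
 then have "sqrt (\<Sum>j<q. (\<kappa> j*w j)\<^sup>2) <= sqrt (m\<^sup>2*(\<Sum>j<q. (w j)\<^sup>2))" by (simp add: sum_distrib_left)
 then show ?thesis using assms(2) by (simp add: l2_def real_sqrt_mult)
qed

lemma is_ctrl_weight:
 assumes "is_ctrl q L a" "!!j. j < q ==> 0 <= \<kappa> j & \<kappa> j <= m" "0 <= m"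
 shows "is_ctrl q (m*L) (%j s. \<kappa> j*a j s)"
 unfolding is_ctrl_def
proof (intro conjI allI impI)
 fix j assume "j < q"
 then show "(%s. \<kappa> j*a j s) : borel_measurable borel" using assms(1) by (auto simp: is_ctrl_def)
next
 fix s
 have "l2 q (%j. \<kappa> j*a j s) <= m*l2 q (%j. a j s)" by (rule l2_weight[OF assms(2,3)])
 also have "... <= m*L" using assms(1,3) by (auto simp: is_ctrl_def intro: mult_left_mono)
 finally show "l2 q (%j. \<kappa> j*a j s) <= m*L" .
qed

lemma cpath_sX:
 assumes "0 < dl" "0 < dl'"
 shows "cpath Om (sX X d dl) q x a ga \<longleftrightarrow> cpath Om (sX X d dl') q x (%j s. (dl/dl') powr d j*a j s) ga"
 unfolding cpath_def lc_sX[OF assms] ..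

text \<open>A change of scale multiplies the control of the j-th field by (dl/dl')^(d j), so
  \<open>m\<close> bounds the loss in the control bound.\<close>

lemma reach_sX:
 assumes dl: "0 < dl" "0 < dl'" and m: "!!j. j < q ==> (dl/dl') powr d j <= m" "0 <= m"
 shows "reach Om (sX X d dl) q x L \<subseteq> reach Om (sX X d dl') q x (m*L)"
proof
 fix y assume "y : reach Om (sX X d dl) q x L"
 then obtain a ga where a: "is_ctrl q L a" "cpath Om (sX X d dl) q x a ga" "y = ga 1" unfolding reach_def by blast
 have "is_ctrl q (m*L) (%j s. (dl/dl') powr d j*a j s)" by (rule is_ctrl_weight[OF a(1)]) (use m in auto)
 moreover have "cpath Om (sX X d dl') q x (%j s. (dl/dl') powr d j*a j s) ga" using a(2) cpath_sX[OF dl] by blast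
 ultimately show "y : reach Om (sX X d dl') q x (m*L)" unfolding reach_def using a(3) by blast
qed

lemma is_ctrl_admissible: "is_ctrl q L a ==> L < 1 ==> ctrl_admissible q a"
 unfolding ctrl_admissible_def is_ctrl_def l2_def
 by (auto intro!: measurable_restrict_space1 exI[of _ L])

lemma cpath_iff_ctrl_path: "cpath Om (sX X d dl) q x a ga \<longleftrightarrow> ctrl_path Om X d q x dl a ga"
 unfolding cpath_def ctrl_path_def lc_def ..

text \<open>A control may be set to zero on the null set where its bound fails, and outside [0,1],
  without affecting the integral equation. An essential bound \<open>r < 1\<close> thereby becomes a
  pointwise one.\<close>

lemma CC_ball_eq: "CC_ball Om X d q x dl = (\<Union>L\<in>{..<1}. reach Om (sX X d dl) q x L)"
proof
 show "(\<Union>L\<in>{..<1}. reach Om (sX X d dl) q x L) \<subseteq> CC_ball Om X d q x dl"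
  unfolding CC_ball_def reach_def using is_ctrl_admissible cpath_iff_ctrl_path by blast
 show "CC_ball Om X d q x dl \<subseteq> (\<Union>L\<in>{..<1}. reach Om (sX X d dl) q x L)"
 proof
  fix y assume "y : CC_ball Om X d q x dl"
  then obtain a ga where a: "ctrl_admissible q a" "ctrl_path Om X d q x dl a ga" "y = ga 1" unfolding CC_ball_def by blast
  obtain r where r: "r < 1" "AE s in lborel. s : {0..1} --> sqrt (\<Sum>j<q. (a j s)\<^sup>2) <= r" using a(1) unfolding ctrl_admissible_def by blast
  define b where "b j s = (if s : {0..1} then a j s else 0)" for j s
  have bm: "b j : borel_measurable borel" if "j < q" for j
  proof -
   have "a j : borel_measurable (restrict_space lborel {0..1})" using a(1) that unfolding ctrl_admissible_def by blast
   then have "(%s. if s : {0..1} then a j s else 0) : borel_measurable lborel" by (subst (asm) measurable_restrict_space_iff) auto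
   then show ?thesis unfolding b_def[abs_def] by simp
  qed
  define a' where "a' j s = (if l2 q (%j. b j s) <= r then b j s else 0)" for j s
  have "(%s. \<Sum>j<q. (b j s)\<^sup>2) : borel_measurable borel" by (intro borel_measurable_sum borel_measurable_power bm) auto
  then have l2m: "(%s. l2 q (%j. b j s)) : borel_measurable borel" unfolding l2_def
   by (rule measurable_compose) (intro borel_measurable_continuous_onI continuous_intros)
  \<comment> \<open>\<open>r\<close> is not assumed nonnegative, while the zero values of
    \<open>a'\<close> need a nonnegative bound.\<close>
  have ctrl: "is_ctrl q (max r 0) a'" unfolding is_ctrl_def
  proof (intro conjI allI impI)
   fix j assume j: "j < q"
   have "{s : space borel. l2 q (%j. b j s) <= r} : sets borel" using l2m by measurable
   then show "a' j : borel_measurable borel" unfolding a'_def[abs_def] using bm[OF j] l2m by (intro measurable_If) auto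
  next
   fix s
   show "l2 q (%j. a' j s) <= max r 0" by (cases "l2 q (%j. b j s) <= r") (auto simp: a'_def l2_def)
  qed
  obtain N where N: "N : null_sets lborel" "{s. ~ (s : {0..1} --> sqrt (\<Sum>j<q. (a j s)\<^sup>2) <= r)} \<subseteq> N"
   using r(2) by (auto simp: eventually_ae_filter)
  have negl: "negligible N" using N(1) by (simp add: negligible_iff_null_sets null_sets_completionI)
  have eq: "a' j s = a j s" if "s : {0..1}" "s \<notin> N" for j s
  proof -
   have "sqrt (\<Sum>j<q. (a j s)\<^sup>2) <= r" using N(2) that by blast
   then show ?thesis using that(1) by (simp add: a'_def b_def l2_def)
  qed
  have "cpath Om (sX X d dl) q x a' ga" unfolding cpath_def
  proof (intro ballI conjI)
   fix t :: real assume t: "t : {0..1}"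
   then show "ga t : Om" using a(2) unfolding ctrl_path_def by blast
   have "((%s. \<Sum>j<q. a j s *\<^sub>R sX X d dl j (ga s)) has_integral (ga t - x)) {0..t}" using a(2) t unfolding ctrl_path_def by blast
   then show "((%s. lc q (sX X d dl) (%j. a' j s) (ga s)) has_integral (ga t - x)) {0..t}"
    by (rule has_integral_spike[OF negl, rotated]) (use eq t in \<open>auto simp: lc_def\<close>)
  qed
  then have "y : reach Om (sX X d dl) q x (max r 0)" unfolding reach_def using ctrl a(3) by blast
  then show "y : (\<Union>L\<in>{..<1}. reach Om (sX X d dl) q x L)" using r(1) by (intro UN_I[of "max r 0"]) auto
 qed
qed

text \<open>A control at a smaller radius becomes, after multiplication by weights at most 1, an
  admissible control at radius \<xi>, where the hypothesis applies.\<close>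

lemma cond_C_cpath:
 assumes C: "cond_C Om X d q x \<xi>" and dl: "0 < dl" "dl <= \<xi>" and d: "!!j. j < q ==> 0 <= d j" and a: "is_ctrl q L a" "L < 1"
 shows "EX ga. cpath Om (sX X d dl) q x a ga"
proof -
 have \<xi>: "0 < \<xi>" using dl by linarith
 have "(dl/\<xi>) powr d j <= 1" if "j < q" for j
  using powr_mono2[of "d j" "dl/\<xi>" 1] d[OF that] dl \<xi> by simp
 then have "is_ctrl q (1*L) (%j s. (dl/\<xi>) powr d j*a j s)" by (intro is_ctrl_weight[OF a(1)]) auto
 then have "ctrl_admissible q (%j s. (dl/\<xi>) powr d j*a j s)" using a(2) by (intro is_ctrl_admissible) auto
 then obtain ga where "ctrl_path Om X d q x \<xi> (%j s. (dl/\<xi>) powr d j*a j s) ga" using C unfolding cond_C_def by blast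
 then have "cpath Om (sX X d \<xi>) q x (%j s. (dl/\<xi>) powr d j*a j s) ga" by (simp only: cpath_iff_ctrl_path)
 then have "cpath Om (sX X d dl) q x a ga" by (rule cpath_sX[OF dl(1) \<xi>, THEN iffD2])
 then show ?thesis by (intro exI[of _ ga])
qed

lemma C1_on_sX: assumes "C1_on (X j) Om" shows "C1_on (sX X d dl j) Om"
proof -
 obtain D where D: "ALL y:Om. (X j has_derivative blinfun_apply (D y)) (at y)" "continuous_on Om D" using assms unfolding C1_on_def by blast
 show ?thesis unfolding C1_on_def sX_def
 proof (intro exI[of _ "%y. (dl powr d j) *\<^sub>R D y"] conjI ballI)
  fix y assume "y : Om"
  then have "((%y. (dl powr d j) *\<^sub>R X j y) has_derivative (%v. (dl powr d j) *\<^sub>R blinfun_apply (D y) v)) (at y)"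
   using D(1) by (intro has_derivative_scaleR_right) auto
  then show "((%y. (dl powr d j) *\<^sub>R X j y) has_derivative blinfun_apply ((dl powr d j) *\<^sub>R D y)) (at y)" by (simp add: scaleR_blinfun.rep_eq)
  next
  show "continuous_on Om (%y. (dl powr d j) *\<^sub>R D y)" by (intro continuous_on_scaleR continuous_on_const D(2))
 qed
qed

lemma frechet_derivative_sX:
 assumes "X j differentiable (at y)"
 shows "frechet_derivative (sX X d dl j) (at y) v = (dl powr d j) *\<^sub>R frechet_derivative (X j) (at y) v"
proof -
 have "(X j has_derivative frechet_derivative (X j) (at y)) (at y)" using assms by (simp add: frechet_derivative_works)
 then have "(sX X d dl j has_derivative (%v. (dl powr d j) *\<^sub>R frechet_derivative (X j) (at y) v)) (at y)"
  unfolding sX_def by (rule has_derivative_scaleR_right)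
 from fun_cong[OF frechet_derivative_at[OF this, symmetric]] show ?thesis by simp
qed

lemma C2_norm_derivative:
 fixes F :: "real^'n => real^'n"
 assumes y: "y : U" "F differentiable (at y)" and A: "C2_norm U F <= ennreal A1"
 shows "norm (frechet_derivative F (at y) v) <= max 0 A1*norm v"
proof -
 let ?D = "frechet_derivative F (at y)"
 have lin: "linear ?D" using y(2) by (rule linear_frechet_derivative)
 have "ennreal (\<Sum>i\<in>UNIV. norm (pd F i y)) = (\<Sum>i\<in>UNIV. ennreal (norm (pd F i y)))" by (rule sum_ennreal[symmetric]) simp
 also have "... <= (\<Sum>i\<in>UNIV. SUP y\<in>U. ennreal (norm (pd F i y)))" by (intro sum_mono SUP_upper y(1))
 also have "... <= C2_norm U F" unfolding C2_norm_def by (simp add: add_increasing add_increasing2)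
 also have "... <= ennreal (max 0 A1)" using order_trans[OF A ennreal_leI[of A1 "max 0 A1"]] by simp
 finally have s: "(\<Sum>i\<in>UNIV. norm (pd F i y)) <= max 0 A1" by (simp add: ennreal_le_iff)
 have "v = (\<Sum>i\<in>UNIV. v $ i *\<^sub>R axis i 1)" by (simp add: vec_eq_iff axis_def if_distrib sum.delta cong: if_cong)
 then have "?D v = (\<Sum>i\<in>UNIV. v $ i *\<^sub>R pd F i y)" unfolding pd_def using linear_sum[OF lin, of "%i. v $ i *\<^sub>R axis i 1" UNIV] linear_scale[OF lin] by simp
 then have "norm (?D v) <= (\<Sum>i\<in>UNIV. norm (v $ i *\<^sub>R pd F i y))" using norm_sum[of "%i. v $ i *\<^sub>R pd F i y" UNIV] by simp
 also have "... <= (\<Sum>i\<in>UNIV. norm v * norm (pd F i y))" by (intro sum_mono) (simp add: mult_right_mono component_le_norm_cart)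
 also have "... = norm v * (\<Sum>i\<in>UNIV. norm (pd F i y))" by (simp add: sum_distrib_left)
 also have "... <= norm v * max 0 A1" by (rule mult_left_mono[OF s]) simp
 finally show ?thesis by (simp add: mult.commute)
qed

lemma vf_deriv_bound_C0:
 assumes "vf_deriv_bound q Y U c (ennreal A2)"
 shows "continuous_on U c" "!!y. y : U ==> \<bar>c y\<bar> <= max 0 A2"
proof -
 let ?S = "{\<alpha>. length \<alpha> <= 2 & set \<alpha> \<subseteq> {..<q}}"
 obtain g where g: "ALL y:U. g [] y = c y" "ALL \<alpha>. length \<alpha> <= 2 --> set \<alpha> \<subseteq> {..<q} --> continuous_on U (g \<alpha>)"
  "(\<Sum>\<alpha>\<in>?S. SUP y\<in>U. ennreal \<bar>g \<alpha> y\<bar>) <= ennreal A2" using assms unfolding vf_deriv_bound_def by blast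
 have "continuous_on U (g [])" using g(2) by simp
 then show "continuous_on U c" using g(1) continuous_on_cong[of U U "g []" c] by simp
 fix y assume y: "y : U"
 have fin: "finite ?S" using finite_lists_length_le[of "{..<q}" 2] by (simp add: conj_commute)
 have "ennreal \<bar>g [] y\<bar> <= (SUP y\<in>U. ennreal \<bar>g [] y\<bar>)" by (rule SUP_upper[OF y])
 also have "... <= (\<Sum>\<alpha>\<in>?S. SUP y\<in>U. ennreal \<bar>g \<alpha> y\<bar>)" by (rule member_le_sum) (use fin in auto)
 also have "... <= ennreal (max 0 A2)" using order_trans[OF g(3) ennreal_leI[of A2 "max 0 A2"]] by simp
 finally show "\<bar>c y\<bar> <= max 0 A2" using g(1) y by (simp add: ennreal_le_iff)
qed

lemma dim_sX: assumes "0 < dl" shows "dim {sX X d dl j x |j. j < q} = leaf_dim X q x"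
proof -
 have "span {sX X d dl j x |j. j < q} = span {X j x |j. j < q}"
 proof (rule span_eq[THEN iffD2], intro conjI subsetI)
  fix v assume "v : {sX X d dl j x |j. j < q}"
  then obtain j where "j < q" "v = (dl powr d j) *\<^sub>R X j x" unfolding sX_def by blast
  moreover from this have "X j x : span {X j x |j. j < q}" by (intro span_base) blast
  ultimately show "v : span {X j x |j. j < q}" by (simp add: span_scale)
 next
  fix v assume "v : {X j x |j. j < q}"
  then obtain j where j: "j < q" "v = X j x" by blast
  have "v = (1/dl powr d j) *\<^sub>R sX X d dl j x" using assms j by (simp add: sX_def)
  moreover have "sX X d dl j x : span {sX X d dl j x |j. j < q}" using j(1) by (intro span_base) blast
  ultimately show "v : span {sX X d dl j x |j. j < q}" by (simp add: span_scale)
 qed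
 then show ?thesis unfolding leaf_dim_def using dim_span[of "{sX X d dl j x |j. j < q}"] dim_span[of "{X j x |j. j < q}"] by simp
qed

lemma ratio_powr_le:
 fixes \<eta> :: real
 assumes "0 < \<eta>" "\<eta> <= 1"
 shows "a <= b ==> \<eta> powr b <= \<eta> powr a" "a <= b ==> (1/\<eta>) powr a <= (1/\<eta>) powr b"
 using assms by (auto intro: powr_mono' powr_mono)

section \<open>Estimates uniform in the point and the radius\<close>

text \<open>\<open>rd\<close> is the chart radius. The condition on \<eta> puts the ball of radius
  \<eta>*th into the chart built at scale th; the last condition on \<open>rh\<close> puts the image
  of the cube of side \<open>rh\<close> into that ball. As \<eta> <= 1, the first involves the lower
  bound \<open>dlo\<close> of the degrees and the second the upper bound \<open>dhi\<close>.\<close>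

locale setting =
 fixes Om :: "(real^'n) set" and X :: "nat => real^'n => real^'n" and d :: "nat => real" and q :: nat and K :: "(real^'n) set" and \<xi> :: real
  and dlo dhi A1 A2 A rd \<eta> rh :: real and Q :: nat
 assumes dlo: "0 < dlo" and open_Om: "open Om" and qQ: "q <= Q" and Q1: "1 <= Q"
  and d: "!!j. j < q ==> dlo <= d j & d j <= dhi" and C1X: "!!j. j < q ==> C1_on (X j) Om"
  and K: "compact K" "K \<subseteq> Om" and \<xi>: "0 < \<xi>" and condC: "!!x. x : K ==> cond_C Om X d q x \<xi>"
  and C2: "!!x j. x : K ==> j < q ==> C2_ok (CC_ball Om X d q x \<xi>) (X j) & C2_norm (CC_ball Om X d q x \<xi>) (X j) <= ennreal A1"
  and br: "!!dl x. dl : {0<..\<xi>} ==> x : K ==> EX c :: nat => nat => nat => real^'n => real.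
      (ALL i<q. ALL j<q. ALL y:CC_ball Om X d q x dl.
        lie_bracket (sX X d dl i) (sX X d dl j) y = (\<Sum>k<q. c i j k y *\<^sub>R sX X d dl k y))
     & (ALL i<q. ALL j<q. ALL k<q.
        vf_deriv_bound q (sX X d dl) (CC_ball Om X d q x dl) (c i j k) (ennreal A2))"
  and A: "1 <= A" "A1 <= A" "A2 <= A" and rd: "rd = 1/(200*real CARD('n) ^ 4*real Q ^ 5*A)"
  and \<eta>: "0 < \<eta>" "\<eta> <= 1" "\<eta> powr dlo <= rd/(16*(real CARD('n)*real Q))"
  and rh: "0 < rh" "real CARD('n)*rh <= rd/8" "4*real CARD('n)*rh <= \<eta> powr dhi"
begin

text \<open>At most 1, so that th^(d j) <= 1 for th up to this value and rescaling does not increase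
  derivatives.\<close>

definition \<xi>1 :: real where "\<xi>1 = min 1 \<xi>"

lemma \<xi>1: "0 < \<xi>1" "\<xi>1 <= 1" "\<xi>1 <= \<xi>" using \<xi> by (auto simp: \<xi>1_def)

lemma dpos: "j < q ==> 0 < d j" using d dlo by (meson less_le_trans)

lemma cfields_at: "cfields Om (sX X d th) q"
 by unfold_locales (auto intro: open_Om C1_on_sX[OF C1X])

lemma cbase_at: assumes "x : K" "0 < th" "th <= \<xi>" shows "cbase Om (sX X d th) q x"
proof -
 interpret cfields Om "sX X d th" q by (rule cfields_at)
 show ?thesis
 proof unfold_locales
  fix a L assume "L < (1::real)" "is_ctrl q L a"
  then show "EX ga. cpath Om (sX X d th) q x a ga"
   by (intro cond_C_cpath[OF condC[OF assms(1)] assms(2,3)]) (use dpos in \<open>auto intro: less_imp_le\<close>)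
 qed
qed

lemma reach_CC: "L < 1 ==> reach Om (sX X d th) q x L \<subseteq> CC_ball Om X d q x th"
 unfolding CC_ball_eq by blast

lemma reach_CC_\<xi>: assumes "0 < th" "th <= \<xi>" "L < 1" shows "reach Om (sX X d th) q x L \<subseteq> CC_ball Om X d q x \<xi>"
proof -
 have "(th/\<xi>) powr d j <= 1" if "j < q" for j
  using powr_mono2[of "d j" "th/\<xi>" 1] dpos[OF that] assms \<xi> by simp
 then have "reach Om (sX X d th) q x L \<subseteq> reach Om (sX X d \<xi>) q x (1*L)" by (intro reach_sX assms \<xi>) auto
 then show ?thesis using reach_CC[of L \<xi> x] assms(3) by simp
qed

lemma DY_at:
 assumes x: "x : K" and th: "0 < th" "th <= \<xi>1" and L: "L < 1" and y: "y : reach Om (sX X d th) q x L" and j: "j < q"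
 shows "norm (frechet_derivative (sX X d th j) (at y) v) <= A*norm v"
proof -
 have yC: "y : CC_ball Om X d q x \<xi>" using reach_CC_\<xi>[OF th(1) _ L] th(2) \<xi>1(3) y by auto
 have diff: "X j differentiable (at y)" using C2[OF x j] yC unfolding C2_ok_def by blast
 have "norm (frechet_derivative (X j) (at y) v) <= max 0 A1*norm v" using C2_norm_derivative[OF yC diff] C2[OF x j] by blast
 also have "... <= A*norm v" using A by (intro mult_right_mono) auto
 finally have 1: "norm (frechet_derivative (X j) (at y) v) <= A*norm v" .
 have "th powr d j <= 1" using powr_mono2[of "d j" th 1] dpos[OF j] th \<xi>1 by simp
 then have "th powr d j*norm (frechet_derivative (X j) (at y) v) <= 1*(A*norm v)" using 1 by (intro mult_mono) auto
 then show ?thesis unfolding frechet_derivative_sX[of X j y d th v, OF diff] by simp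
qed

text \<open>The structure functions and the frame are chosen anew for every \<open>x\<close> and
  \<open>th\<close>; what stays fixed is the pair of bounds \<open>A\<close> and
  \<open>Q\<close>.\<close>

lemma cframe_at:
 assumes x: "x : K" and th: "0 < th" "th <= \<xi>1"
 shows "EX c I ph il. cframe Om (sX X d th) q x A Q c I ph il & card I = leaf_dim X q x"
proof -
 have th\<xi>: "th <= \<xi>" using th \<xi>1 by simp
 interpret b: cbase Om "sX X d th" q x by (rule cbase_at[OF x th(1) th\<xi>])
 have "th : {0<..\<xi>}" using th(1) th\<xi> by simp
 from br[OF this x] obtain c where c1: "ALL i<q. ALL j<q. ALL y:CC_ball Om X d q x th. lie_bracket (sX X d th i) (sX X d th j) y = (\<Sum>k<q. c i j k y *\<^sub>R sX X d th k y)"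
  and c2: "ALL i<q. ALL j<q. ALL k<q. vf_deriv_bound q (sX X d th) (CC_ball Om X d q x th) (c i j k) (ennreal A2)" by blast
 obtain I :: "'n set" and ph where cI: "card I = dim {sX X d th j x |j. j < q}" and phq: "ALL i:I. ph i < q"
  and ind: "ALL w. (ALL i. i \<notin> I --> w $ i = 0) --> (\<Sum>i\<in>I. w $ i *\<^sub>R sX X d th (ph i) x) = 0 --> w = 0"
  and fr: "ALL m<q. EX a. (ALL i. i \<notin> I --> a $ i = 0) & (ALL i. \<bar>a $ i\<bar> <= 1) & sX X d th m x = (\<Sum>i\<in>I. a $ i *\<^sub>R sX X d th (ph i) x)"
  using frame_exists[of "%j. sX X d th j x" q] by blast
 obtain il where il: "set il = I" "distinct il" using finite_distinct_list[of I] by auto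
 have sub: "b.RR L \<subseteq> CC_ball Om X d q x th" if "L < 1" for L by (rule reach_CC[OF that])
 interpret g: cgeom Om "sX X d th" q x A Q c
 proof unfold_locales
  show "1 <= A" "q <= Q" "1 <= Q" using A qQ Q1 by auto
  fix L i j k y v assume L: "L < (1::real)"
  show "y : b.RR L ==> j < q ==> norm (frechet_derivative (sX X d th j) (at y) v) <= A*norm v" by (rule DY_at[OF x th L])
  show "y : b.RR L ==> i < q ==> j < q ==> lie_bracket (sX X d th i) (sX X d th j) y = (\<Sum>k<q. c i j k y *\<^sub>R sX X d th k y)"
   using c1 sub[OF L] by blast
  assume ijk: "i < q" "j < q" "k < q"
  then have vf: "vf_deriv_bound q (sX X d th) (CC_ball Om X d q x th) (c i j k) (ennreal A2)" using c2 by blast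
  show "continuous_on (b.RR L) (c i j k)" by (rule continuous_on_subset[OF vf_deriv_bound_C0(1)[OF vf] sub[OF L]])
  show "\<bar>c i j k y\<bar> <= A" if "y : b.RR L"
  proof -
   have "\<bar>c i j k y\<bar> <= max 0 A2" by (rule vf_deriv_bound_C0(2)[OF vf]) (use that sub[OF L] in blast)
   then show ?thesis using A by simp
  qed
 qed
 interpret gI: cgeomI Om "sX X d th" q x A Q c I ph by unfold_locales (use phq in blast)
 have "cframe Om (sX X d th) q x A Q c I ph il"
 proof unfold_locales
  show "distinct il" "set il = I" using il by auto
  show "EX a:gI.RI. (ALL i. \<bar>a $ i\<bar> <= 1) & sX X d th m x = gI.ZZ x a" if "m < q" for m
   using fr[rule_format, OF that] unfolding gI.RI_def gI.ZZ_def by blast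
  show "w = 0" if "w : gI.RI" "gI.ZZ x w = 0" for w
   using ind[rule_format, of w] that unfolding gI.RI_def gI.ZZ_def by blast
 qed
 moreover have "card I = leaf_dim X q x" using cI dim_sX[OF th(1), of X d x q] by simp
 ultimately show ?thesis by (intro exI conjI)
qed

lemma N1: "1 <= real CARD('n)" by simp

lemma rd_pos: "0 < rd" using A(1) Q1 by (simp add: rd)

lemma rd_small: "real CARD('n)*rd <= 1/200"
proof -
 have "real CARD('n)*1 <= real CARD('n) ^ 4*(real Q ^ 5*A)"
 proof (rule mult_mono)
  show "real CARD('n) <= real CARD('n) ^ 4" using power_increasing[of 1 4 "real CARD('n)"] by simp
  have "1*1 <= real Q ^ 5*A" using Q1 A(1) by (intro mult_mono one_le_power) auto
  then show "1 <= real Q ^ 5*A" by simp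
 qed auto
 moreover have "0 < real CARD('n) ^ 4*(real Q ^ 5*A)" using Q1 A(1) by simp
 ultimately have "real CARD('n)/(real CARD('n) ^ 4*(real Q ^ 5*A)) <= 1" by (simp add: pos_divide_le_eq)
 then have "(real CARD('n)/(real CARD('n) ^ 4*(real Q ^ 5*A)))/200 <= 1/200" by (rule divide_right_mono) simp
 moreover have "real CARD('n)*rd = (real CARD('n)/(real CARD('n) ^ 4*(real Q ^ 5*A)))/200" unfolding rd by (simp add: mult.assoc)
 ultimately show ?thesis by (simp only:)
qed

lemma rd_le: "rd <= 1/200"
 using rd_small mult_right_mono[OF N1, of rd] rd_pos by linarith

text \<open>At most N maximal functions with three levels each, and one level of slack, make 3*N +
  1. The time 3*rd is three times the half-side of the parameter box, as
  \<open>flow_max_segment\<close> demands.\<close>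

lemma ctrans_at: "ctrans Om (sX X d \<xi>1) q K A (3*rd) (3*CARD('n) + 1)"
proof -
 interpret cfields Om "sX X d \<xi>1" q by (rule cfields_at)
 show ?thesis
 proof unfold_locales
  show "compact K" by (rule K(1))
  show "0 <= A" using A by simp
  show "0 < 3*rd" using rd_pos by simp
  have "(real (3*CARD('n) + 1) + 3)*(3*rd) = 9*(real CARD('n)*rd) + 12*rd" by (simp add: algebra_simps)
  then show "(real (3*CARD('n) + 1) + 3)*(3*rd) < 1" using rd_small rd_le by linarith
  fix x a L assume x: "x : K" and L: "L < (1::real)"
  interpret b: cbase Om "sX X d \<xi>1" q x by (rule cbase_at[OF x \<xi>1(1,3)])
  show "is_ctrl q L a ==> EX ga. cpath Om (sX X d \<xi>1) q x a ga" by (rule b.ex_path[OF L])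
  show "y : reach Om (sX X d \<xi>1) q x L ==> j < q ==> norm (frechet_derivative (sX X d \<xi>1 j) (at y) v) <= A*norm v" for y j v
   by (rule DY_at[OF x \<xi>1(1) order_refl L])
 qed
qed

sublocale T: ctrans Om "sX X d \<xi>1" q K A "3*rd" "3*CARD('n) + 1" by (rule ctrans_at)

text \<open>The constants of \<open>average_bound\<close> and \<open>iterated_average_bound\<close>
  multiplied, with leaf dimension and list length replaced by N. Since \<open>rh\<close> and
  \<open>2*rd\<close> are at most 1 this covers all smaller cases.\<close>

definition Cst :: real where
 "Cst = ((512*(real CARD('n))\<^sup>2) ^ CARD('n)/(rh ^ CARD('n)*(2*rd) ^ CARD('n)))*(6 ^ CARD('n)*(4*rd) ^ CARD('n))"

lemma measurable_abs_indicator: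
 fixes f :: "real^'n => real"
 assumes f: "continuous_on Om f"
 shows "(%y. ennreal \<bar>f y\<bar>*indicator Om y) : borel_measurable borel" (is "?gt : _")
 proof -
  have "(%y. indicator Om y *\<^sub>R \<bar>f y\<bar>) : borel_measurable borel"
   by (rule borel_measurable_continuous_on_indicator) (use open_Om f in \<open>auto intro: continuous_intros\<close>)
  then have "(%y. ennreal (indicator Om y *\<^sub>R \<bar>f y\<bar>)) : borel_measurable borel" by simp
  moreover have "(%y. ennreal (indicator Om y *\<^sub>R \<bar>f y\<bar>)) = ?gt" by (auto simp: fun_eq_iff split: split_indicator)
  ultimately show ?thesis by (simp only:)
 qed

text \<open>The list \<open>js\<close> depends on \<open>x\<close> and \<open>dl\<close> through the
  frame; only its length and range are controlled. The flows of the chart at scale \<open>th\<close>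
  are flows of single fields at the fixed scale \<xi>1, with times shortened by \<open>cc\<close>,
  so that the same maximal operators serve all radii.\<close>

lemma average_le:
 fixes f :: "real^'n => real"
 assumes x: "x : K" and dl: "0 < dl" "dl <= \<eta> * \<xi>1" and f: "continuous_on Om f"
 shows "CC_ball Om X d q x dl : sets borel" (is "?B : _")
  "EX js. set js \<subseteq> {..<q} & length js <= CARD('n) &
   (\<integral>\<^sup>+ y\<in>CC_ball Om X d q x dl. ennreal \<bar>f y\<bar> \<partial>leaf_measure X q x)/emeasure (leaf_measure X q x) (CC_ball Om X d q x dl)
    <= ennreal Cst*T.TT js (%y. ennreal \<bar>f y\<bar>*indicator Om y) x"
proof -
 let ?N = "real CARD('n)"
 \<comment> \<open>The chart is built at this larger scale, in which the ball of radius
   \<open>dl\<close> is small, but not smaller than a fixed cube.\<close>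
 define th where "th = dl/\<eta>"
 have th: "0 < th" "th <= \<xi>1" using dl \<eta> by (auto simp: th_def field_simps)
 have rat: "dl/th = \<eta>" "th/dl = 1/\<eta>" using dl \<eta> by (auto simp: th_def)
 have th\<xi>: "th <= \<xi>" using th \<xi>1 by simp
 have "dl <= th" using \<eta> dl by (simp add: th_def field_simps)
 then have dl\<xi>: "dl <= \<xi>" using th\<xi> by simp
 obtain c I ph il where fr: "cframe Om (sX X d th) q x A Q c I ph il" and cI: "card I = leaf_dim X q x" using cframe_at[OF x th] by blast
 interpret F: cframe Om "sX X d th" q x A Q c I ph il by (rule fr)
 interpret b: cbase Om "sX X d dl" q x by (rule cbase_at[OF x dl(1) dl\<xi>])
 have rad: "F.rad = rd" unfolding F.rad_def rd ..
 define m where "m = (1/\<eta>) powr dhi"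
 have m0: "0 < m" using \<eta> by (simp add: m_def)
 have mle: "(th/dl) powr d j <= m" if "j < q" for j unfolding rat m_def by (rule ratio_powr_le[OF \<eta>(1,2)]) (use d[OF that] in blast)
 have mN: "m*(2*?N*rh) < 1"
 proof -
  have "m*(4*?N*rh) <= m * \<eta> powr dhi" by (rule mult_left_mono[OF rh(3)]) (use m0 in simp)
  also have "... = 1" using \<eta> by (simp add: m_def powr_divide)
  finally show ?thesis by (simp add: algebra_simps)
 qed
 have B3: "?B \<subseteq> F.FF ` (cball 0 (F.rad/7) \<inter> F.RI)"
 proof
  fix y assume "y : ?B"
  then obtain L where L: "L < 1" "y : reach Om (sX X d dl) q x L" unfolding CC_ball_eq by blast
  have "reach Om (sX X d dl) q x L \<subseteq> reach Om (sX X d th) q x (\<eta> powr dlo*L)"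
  proof (rule reach_sX[OF dl(1) th(1)])
   fix j assume "j < q"
   then show "(dl/th) powr d j <= \<eta> powr dlo" unfolding rat by (intro ratio_powr_le[OF \<eta>(1,2)]) (use d in blast)
  qed simp
  moreover have "\<eta> powr dlo*L <= F.rad/(16*(?N*real Q))"
  proof -
   have "\<eta> powr dlo*L <= \<eta> powr dlo*1" using L by (intro mult_left_mono) auto
   then show ?thesis using \<eta>(3) rad by simp
  qed
  ultimately have "y : F.RR (F.rad/(16*(?N*real Q)))" using L(2) reach_mono by blast
  from F.reach_subset_FF[OF this] show "y : F.FF ` (cball 0 (F.rad/7) \<inter> F.RI)" by blast
 qed
 have B2: "F.FF ` F.BX 0 rh \<subseteq> ?B"
 proof safe
  fix u assume u: "u : F.BX 0 rh"
  have z: "0 : F.RI" by (rule subspace_0[OF F.subspace_RI])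
  have "norm (u - 0) <= ?N*rh" by (rule F.BX_dist[OF z F.BX_base[OF z] u]) (use rh in auto)
  then have ur: "u : cball 0 F.rad" using rh(2) rd_pos unfolding rad by simp
  have "F.S1 I u <= (\<Sum>i\<in>I. rh)" unfolding F.S1_def by (rule sum_mono) (use u in \<open>auto simp: F.BX_def\<close>)
  also have "... <= ?N*rh" using card_mono[of UNIV I] rh(1) by (simp add: mult_right_mono)
  also have "... < 2*?N*rh" using rh(1) by simp
  finally have S: "F.S1 I u < 2*?N*rh" .
  have l1: "2*?N*rh < 1" using rh(2) rd_le rd_pos by simp
  have "F.FF u : F.RR (2*?N*rh)" by (rule F.FF_reach[OF ur S l1])
  also have "F.RR (2*?N*rh) \<subseteq> reach Om (sX X d dl) q x (m*(2*?N*rh))"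
   by (rule reach_sX[OF th(1) dl(1)]) (use mle m0 in auto)
  also have "... \<subseteq> ?B" by (rule reach_CC[OF mN])
  finally show "F.FF u : ?B" .
 qed
 \<comment> \<open>A point reached with a bound \<open>L < 1\<close> leaves the margin (1 - L)/2 for
   a further short flow, so the ball is stable under short exponentials.\<close>
 show B1: "?B : sets borel"
 proof (rule F.borel_of_local_flow[OF B3])
  fix y assume "y : ?B"
  then obtain L where L: "L < 1" "y : b.RR L" unfolding CC_ball_eq by blast
  have L0: "0 <= L" using L(2) is_ctrl_nonneg unfolding reach_def by blast
  define e where "e = (1 - L)/(2*(m*?N))"
  have e0: "0 < e" using L(1) m0 by (simp add: e_def)
  show "EX e>0. ALL v:F.RI. norm v < e --> F.EE y v : ?B"
  proof (intro exI[of _ e] conjI e0 ballI impI)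
   fix v assume v: "v : F.RI" "norm v < e"
   let ?w = "%j. (th/dl) powr d j*F.iot I v j"
   have "l2 q ?w <= m*l2 q (F.iot I v)" by (rule l2_weight) (use mle m0 in auto)
   also have "... <= m*(?N*norm v)" using l2_le_l1[of q "F.iot I v"] F.l1_iot_norm[of v] m0 by (intro mult_left_mono) auto
   also have "... < m*(?N*e)" using v(2) m0 by (intro mult_strict_left_mono) auto
   also have "... = (1 - L)/2" using m0 by (simp add: e_def)
   finally have "L + l2 q ?w < (1 + L)/2" by (simp add: field_simps)
   then obtain ga where g: "solves Om (lc q (sX X d dl) ?w) ga" "ga 0 = y" "!!t. t : {0..1} ==> ga t : b.RR ((1 + L)/2)"
    using b.extend_flow[OF L(2) L0, of ?w "(1 + L)/2"] L(1) by (auto simp: field_simps)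
   have "F.EE y v = ga 1" unfolding F.EE_def lc_sX[OF th(1) dl(1)] using b.flow_eq[OF g(1)] g(2) by simp
   then have "F.EE y v : b.RR ((1 + L)/2)" using g(3)[of 1] by simp
   then show "F.EE y v : ?B" using reach_CC[of "(1 + L)/2" dl x] L(1) by auto
  qed
 qed
 let ?gt = "%y. ennreal \<bar>f y\<bar>*indicator Om y"
 have gtm: "?gt : borel_measurable borel" by (rule measurable_abs_indicator[OF f])
 have av: "(\<integral>\<^sup>+ y\<in>?B. ennreal \<bar>f y\<bar> \<partial>hausdorff_measure (card I))/emeasure (hausdorff_measure (card I)) ?B
  <= ennreal ((512*?N\<^sup>2) ^ card I/(rh ^ card I*(2*rd) ^ (CARD('n) - card I)))*(\<integral>\<^sup>+ u\<in>F.DD. ennreal \<bar>f (F.FF u)\<bar> \<partial>lborel)"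
  using F.average_bound[OF B1 B2 B3, of "%y. \<bar>f y\<bar>"] rh(1,2) f unfolding rad by (auto intro: continuous_intros)
 define cc where "cc i = (th/\<xi>1) powr d (ph i)" for i
 have cc: "0 < cc i & cc i <= 1" if "i : I" for i
  using th \<xi>1 dpos[OF F.phq[OF that]] powr_mono2[of "d (ph i)" "th/\<xi>1" 1] by (auto simp: cc_def)
 have step: "flow Om (lc q (sX X d th) (F.iot {i} u)) z = T.psi (ph i) (cc i*u $ i) z" if i: "i : I" for i u z
 proof -
  have "lc q (sX X d th) (F.iot {i} u) y = lc q (sX X d \<xi>1) (ej (ph i) (cc i*u $ i)) y" for y
  proof -
   have "lc q (sX X d \<xi>1) (ej (ph i) (cc i*u $ i)) y = (\<Sum>k<q. if k = ph i then (cc i*u $ i) *\<^sub>R sX X d \<xi>1 k y else 0)"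
    unfolding lc_def ej_def by (intro sum.cong) auto
   also have "... = (cc i*u $ i) *\<^sub>R sX X d \<xi>1 (ph i) y" using F.phq[OF i] by simp
   also have "... = u $ i *\<^sub>R sX X d th (ph i) y"
   proof -
    have "cc i * \<xi>1 powr d (ph i) = th powr d (ph i)" using th(1) \<xi>1(1) by (simp add: cc_def powr_divide)
    then show ?thesis unfolding sX_def by (simp add: mult.assoc mult.commute[of "cc i"] mult.left_commute)
   qed
   finally show ?thesis using F.iot_lc[of "{i}" u y] i by simp
  qed
  then have "lc q (sX X d th) (F.iot {i} u) = lc q (sX X d \<xi>1) (ej (ph i) (cc i*u $ i))" by blast
  then show ?thesis unfolding T.psi_def by simp
 qed
 \<comment> \<open>The partial compositions stay in \<open>KK\<close>, where \<open>psit\<close>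
   agrees with \<open>psi\<close>.\<close>
 have fold: "foldl (%z i. flow Om (lc q (sX X d th) (F.iot {i} u)) z) x l = foldl (%z i. T.psit (ph i) (cc i*u $ i) z) x l
   & foldl (%z i. flow Om (lc q (sX X d th) (F.iot {i} u)) z) x l : T.KK (length l)"
  if u: "!!i. \<bar>u $ i\<bar> <= rd" and l: "set l \<subseteq> I" "length l <= CARD('n)" for u l
  using l
 proof (induction l rule: rev_induct)
  case Nil
  then show ?case using x by simp
 next
  case (snoc i l)
  let ?z = "foldl (%z i. flow Om (lc q (sX X d th) (F.iot {i} u)) z) x l"
  have IH: "?z = foldl (%z i. T.psit (ph i) (cc i*u $ i) z) x l" "?z : T.KK (length l)" using snoc by auto
  have i: "i : I" and ll: "length l <= 3*CARD('n) + 1" using snoc.prems by auto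
  have "\<bar>cc i*u $ i\<bar> <= 1*rd" unfolding abs_mult using cc[OF i] u[of i] by (intro mult_mono) auto
  then have b: "\<bar>cc i*u $ i\<bar> <= 3*rd" "\<bar>cc i*u $ i\<bar> <= 2*(3*rd)" using rd_pos by auto
  have s: "flow Om (lc q (sX X d th) (F.iot {i} u)) ?z = T.psi (ph i) (cc i*u $ i) ?z" by (rule step[OF i])
  have e: "T.psit (ph i) (cc i*u $ i) ?z = T.psi (ph i) (cc i*u $ i) ?z" by (rule T.psit_eq[OF b(2) IH(2) ll])
  have k: "T.psi (ph i) (cc i*u $ i) ?z : T.KK (Suc (length l))" by (rule T.KK_step[OF IH(2) b(1) F.phq[OF i]])
  show ?case using s e k IH(1) by simp
 qed
 have lenil: "length il <= CARD('n)" by (rule F.length_il)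
 have J: "(\<integral>\<^sup>+ u\<in>F.DD. ennreal \<bar>f (F.FF u)\<bar> \<partial>lborel) <= (\<integral>\<^sup>+u\<in>T.bx rd {}. ?gt (foldl (%z i. T.psit (ph i) (cc i*u $ i) z) x il) \<partial>lborel)"
 proof (rule nn_integral_mono)
  fix u :: "real^'n"
  show "ennreal \<bar>f (F.FF u)\<bar>*indicator F.DD u <= ?gt (foldl (%z i. T.psit (ph i) (cc i*u $ i) z) x il)*indicator (T.bx rd {}) u"
  proof (cases "u : F.DD")
   case True
   then have ub: "!!i. \<bar>u $ i\<bar> <= rd" and un: "norm (F.pI u) <= rd/2" unfolding F.DD_def rad by auto
   have e: "F.FF u = foldl (%z i. T.psit (ph i) (cc i*u $ i) z) x il" unfolding F.FF_def using fold[OF ub, of il] F.il lenil by simp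
   have "F.pI u : cball 0 F.rad" using un rd_pos unfolding rad by simp
   then have "F.FF u : Om" using F.FF_Om[of "F.pI u"] F.FF_pI by simp
   then show ?thesis using True ub unfolding e[symmetric] by (simp add: T.bx_def)
  qed simp
 qed
 also have "... <= ennreal (6 ^ length il*(4*rd) ^ CARD('n))*T.TT (map ph il) ?gt x"
  by (rule T.iterated_average_bound[where S=I]) (use rd_pos F.il cc gtm in auto)
 also have "... <= ennreal (6 ^ CARD('n)*(4*rd) ^ CARD('n))*T.TT (map ph il) ?gt x"
  using lenil rd_pos by (intro mult_right_mono ennreal_leI power_increasing) auto
 finally have J2: "(\<integral>\<^sup>+ u\<in>F.DD. ennreal \<bar>f (F.FF u)\<bar> \<partial>lborel) <= ennreal (6 ^ CARD('n)*(4*rd) ^ CARD('n))*T.TT (map ph il) ?gt x" .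
 have k: "card I <= CARD('n)" by (rule card_mono) auto
 have const: "(512*?N\<^sup>2) ^ card I/(rh ^ card I*(2*rd) ^ (CARD('n) - card I)) <= (512*?N\<^sup>2) ^ CARD('n)/(rh ^ CARD('n)*(2*rd) ^ CARD('n))"
 proof (rule frac_le)
  have "1*1 <= 512*?N\<^sup>2" by (intro mult_mono one_le_power N1) auto
  then show "(512*?N\<^sup>2) ^ card I <= (512*?N\<^sup>2) ^ CARD('n)" using k by (intro power_increasing) auto
  have "1*rh <= ?N*rh" using rh(1) by (intro mult_right_mono N1) auto
  then have "rh <= 1" using rh(2) rd_le by linarith
  moreover have "2*rd <= 1" using rd_le by simp
  ultimately show "rh ^ CARD('n)*(2*rd) ^ CARD('n) <= rh ^ card I*(2*rd) ^ (CARD('n) - card I)"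
   using k rh(1) rd_pos by (intro mult_mono power_decreasing) auto
 qed (use rh(1) rd_pos in auto)
 have "(\<integral>\<^sup>+ y\<in>?B. ennreal \<bar>f y\<bar> \<partial>hausdorff_measure (card I))/emeasure (hausdorff_measure (card I)) ?B
  <= ennreal ((512*?N\<^sup>2) ^ CARD('n)/(rh ^ CARD('n)*(2*rd) ^ CARD('n)))*(ennreal (6 ^ CARD('n)*(4*rd) ^ CARD('n))*T.TT (map ph il) ?gt x)"
  by (rule order_trans[OF av mult_mono[OF ennreal_leI[OF const] J2]]) auto
 also have "... = ennreal Cst*T.TT (map ph il) ?gt x" unfolding Cst_def using rh(1) rd_pos
  by (subst ennreal_mult) (auto simp: mult.assoc)
 finally have fin: "(\<integral>\<^sup>+ y\<in>?B. ennreal \<bar>f y\<bar> \<partial>hausdorff_measure (card I))/emeasure (hausdorff_measure (card I)) ?B <= ennreal Cst*T.TT (map ph il) ?gt x" .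
 show "EX js. set js \<subseteq> {..<q} & length js <= CARD('n) &
   (\<integral>\<^sup>+ y\<in>?B. ennreal \<bar>f y\<bar> \<partial>leaf_measure X q x)/emeasure (leaf_measure X q x) ?B <= ennreal Cst*T.TT js ?gt x"
 proof (intro exI[of _ "map ph il"] conjI)
  show "set (map ph il) \<subseteq> {..<q}" using F.il F.phq by auto
  show "length (map ph il) <= CARD('n)" using lenil by simp
  show "(\<integral>\<^sup>+ y\<in>?B. ennreal \<bar>f y\<bar> \<partial>leaf_measure X q x)/emeasure (leaf_measure X q x) ?B <= ennreal Cst*T.TT (map ph il) ?gt x"
   using fin unfolding leaf_measure_def cI .
 qed
qed

end

section \<open>The estimate of the maximal function in L^p\<close>

lemma upper_nn_integral_le: "h : borel_measurable M ==> (!!x. x : space M ==> g x <= h x) ==> upper_nn_integral M g <= nn_integral M h"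
 unfolding upper_nn_integral_def by (rule INF_lower) auto

lemma nn_integral_le_upper: "nn_integral M g <= upper_nn_integral M g"
 unfolding upper_nn_integral_def by (rule INF_greatest) (auto intro: nn_integral_mono)

context setting
begin

text \<open>Formed with \<open>Q\<close> instead of \<open>q\<close>, so that its cardinality is an
  admissible constant.\<close>

definition JS :: "nat list set" where "JS = {js. set js \<subseteq> {..<Q} & length js <= CARD('n)}"

lemma finite_JS: "finite JS" unfolding JS_def by (rule finite_lists_length_le) simp

definition Cfin :: "real => real" where
 "Cfin p = (1 + real (card JS))*Cst powr p * (max 1 (T.TC p)) ^ CARD('n)"

lemma Cst_pos: "0 < Cst" using rh(1) rd_pos by (simp add: Cst_def)

text \<open>Which list dominates an average varies with the point and the radius, so all lists are
  summed: \<open>h\<close> is a Borel majorant of the p-th power of the maximal function and bounds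
  its upper integral. Each summand is controlled by \<open>TT_bound\<close>, whose last set still
  lies in \<open>Om\<close>.\<close>

lemma maximal_integral_bound:
 fixes f :: "real^'n => real"
 assumes p: "1 < p" and f: "continuous_on Om f"
 shows "upper_nn_integral (restrict_space lborel K) (%x. enn_powr (maximal_fn Om X d q (\<eta> * \<xi>1) f x) p)
  <= ennreal (Cfin p)*upper_nn_integral (restrict_space lborel Om) (%y. enn_powr (ennreal \<bar>f y\<bar>) p)"
proof -
 let ?gt = "%y. ennreal \<bar>f y\<bar>*indicator Om y"
 let ?J = "{js : JS. set js \<subseteq> {..<q}}"
 have finJ: "finite ?J" using finite_JS by simp
 have gtm: "?gt : borel_measurable borel" by (rule measurable_abs_indicator[OF f])
 have Kb: "K : sets borel" using K(1) by (rule borel_compact)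
 define h where "h x = (\<Sum>js\<in>?J. ennreal (Cst powr p)*enn_powr (T.TT js ?gt x) p)" for x
 have Tm: "(%x. enn_powr (T.TT js ?gt x) p) : borel_measurable borel" for js
  by (rule enn_powr_measurable[OF T.TT_measurable[OF gtm]])
 have hm: "h : borel_measurable borel" unfolding h_def[abs_def]
  by (intro borel_measurable_sum borel_measurable_times_ennreal borel_measurable_const Tm)
 have le: "enn_powr (maximal_fn Om X d q (\<eta> * \<xi>1) f x) p <= h x" if x: "x : K" for x
 proof -
  \<comment> \<open>The p-th root of the majorant: the supremum over the radii is taken before
    raising to the power \<open>p\<close>.\<close>
  define S where "S = enn_powr (h x) (1/p)"
  have hS: "enn_powr S p = h x" using enn_powr_inverse[of "1/p" "h x"] p by (simp add: S_def)
  have "maximal_fn Om X d q (\<eta> * \<xi>1) f x <= S" unfolding maximal_fn_def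
  proof (rule SUP_least)
   fix dl assume "dl : {0<..\<eta> * \<xi>1}"
   then have dl: "0 < dl" "dl <= \<eta> * \<xi>1" by auto
   from average_le(2)[OF x dl f] obtain js where js: "set js \<subseteq> {..<q}" "length js <= CARD('n)" and
    r: "(\<integral>\<^sup>+ y\<in>CC_ball Om X d q x dl. ennreal \<bar>f y\<bar> \<partial>leaf_measure X q x)/emeasure (leaf_measure X q x) (CC_ball Om X d q x dl)
     <= ennreal Cst*T.TT js ?gt x" by (elim exE conjE)
   have jJ: "js : ?J" using js qQ by (auto simp: JS_def)
   have "enn_powr (ennreal Cst*T.TT js ?gt x) p = ennreal (Cst powr p)*enn_powr (T.TT js ?gt x) p" by (rule enn_powr_cmult[OF Cst_pos])
   also have "... <= h x" unfolding h_def by (rule member_le_sum[OF jJ _ finJ]) simp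
   finally have "enn_powr (enn_powr (ennreal Cst*T.TT js ?gt x) p) (1/p) <= S" unfolding S_def by (intro enn_powr_mono) (use p in auto)
   then have "ennreal Cst*T.TT js ?gt x <= S" using enn_powr_inverse[of p "ennreal Cst*T.TT js ?gt x"] p by simp
   then show "(\<integral>\<^sup>+ y\<in>CC_ball Om X d q x dl. ennreal \<bar>f y\<bar> \<partial>leaf_measure X q x)/emeasure (leaf_measure X q x) (CC_ball Om X d q x dl) <= S"
    by (rule order_trans[OF r])
  qed
  then have "enn_powr (maximal_fn Om X d q (\<eta> * \<xi>1) f x) p <= enn_powr S p" by (intro enn_powr_mono) (use p in auto)
  then show ?thesis unfolding hS .
 qed
 let ?R = "\<integral>\<^sup>+y\<in>Om. enn_powr (ennreal \<bar>f y\<bar>) p \<partial>lborel"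
 define M where "M = max 1 (T.TC p) ^ CARD('n)"
 have M0: "0 <= M" by (simp add: M_def)
 have each: "(\<integral>\<^sup>+x\<in>K. enn_powr (T.TT js ?gt x) p \<partial>lborel) <= ennreal M*?R" if js: "js : ?J" for js
 proof -
  have l: "length js <= CARD('n)" "set js \<subseteq> {..<q}" using js by (auto simp: JS_def)
  have "(\<integral>\<^sup>+x\<in>T.KK 0. enn_powr (T.TT js ?gt x) p \<partial>lborel) <= ennreal (T.TC p ^ length js)*(\<integral>\<^sup>+y\<in>T.KK (0 + 3*length js). enn_powr (?gt y) p \<partial>lborel)"
   by (rule T.TT_bound[OF p gtm l(2)]) (use l(1) in simp)
  also have "... <= ennreal M*?R"
  proof (rule mult_mono)
   have TC0: "0 <= T.TC p" using p by (simp add: T.TC_def)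
   have "T.TC p ^ length js <= max 1 (T.TC p) ^ length js" using TC0 by (intro power_mono) auto
   also have "... <= M" unfolding M_def using l(1) by (intro power_increasing) auto
   finally show "ennreal (T.TC p ^ length js) <= ennreal M" by (rule ennreal_leI)
   have "real (0 + 3*length js)*(3*rd) < 1" by (rule T.Lm_lt) (use l(1) in simp)
   then have sub: "T.KK (0 + 3*length js) \<subseteq> Om" by (rule T.KK_Om)
   show "(\<integral>\<^sup>+y\<in>T.KK (0 + 3*length js). enn_powr (?gt y) p \<partial>lborel) <= ?R"
    by (rule nn_integral_mono) (use sub in \<open>auto simp: indicator_def\<close>)
  qed auto
  finally show ?thesis by simp
 qed
 have "upper_nn_integral (restrict_space lborel K) (%x. enn_powr (maximal_fn Om X d q (\<eta> * \<xi>1) f x) p) <= nn_integral (restrict_space lborel K) h"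
  by (rule upper_nn_integral_le) (use hm le in \<open>auto intro: measurable_restrict_space1 simp: space_restrict_space\<close>)
 also have "... = (\<integral>\<^sup>+x\<in>K. h x \<partial>lborel)" by (rule nn_integral_restrict_space) (use Kb in simp)
 also have "... = (\<integral>\<^sup>+x. (\<Sum>js\<in>?J. ennreal (Cst powr p)*(enn_powr (T.TT js ?gt x) p * indicator K x)) \<partial>lborel)"
  unfolding h_def by (simp add: sum_distrib_right mult.assoc)
 also have "... = (\<Sum>js\<in>?J. \<integral>\<^sup>+x. ennreal (Cst powr p)*(enn_powr (T.TT js ?gt x) p * indicator K x) \<partial>lborel)"
  by (rule nn_integral_sum) (use Tm Kb in \<open>auto intro!: borel_measurable_times_ennreal borel_measurable_indicator\<close>)
 also have "... = (\<Sum>js\<in>?J. ennreal (Cst powr p)*(\<integral>\<^sup>+x\<in>K. enn_powr (T.TT js ?gt x) p \<partial>lborel))"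
  by (intro sum.cong refl nn_integral_cmult) (use Tm Kb in \<open>auto intro!: borel_measurable_times_ennreal borel_measurable_indicator\<close>)
 also have "... <= (\<Sum>js\<in>?J. ennreal (Cst powr p)*(ennreal M*?R))" by (intro sum_mono mult_left_mono each) auto
 also have "... = of_nat (card ?J)*(ennreal (Cst powr p)*(ennreal M*?R))" by simp
 also have "... <= ennreal (1 + real (card JS))*(ennreal (Cst powr p)*(ennreal M*?R))"
 proof (rule mult_right_mono)
  have "card ?J <= card JS" by (rule card_mono[OF finite_JS]) auto
  then show "of_nat (card ?J) <= ennreal (1 + real (card JS))" unfolding ennreal_of_nat_eq_real_of_nat by (intro ennreal_leI) simp
 qed simp
 also have "... = ennreal (Cfin p)*?R"
 proof -
  have "ennreal (Cfin p) = ennreal (1 + real (card JS))*(ennreal (Cst powr p)*ennreal M)"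
   unfolding Cfin_def M_def[symmetric] using M0 by (simp only: ennreal_mult mult.assoc powr_ge_zero mult_nonneg_nonneg add_nonneg_nonneg zero_le_one of_nat_0_le_iff)
  then show ?thesis by (simp only: mult.assoc)
 qed
 also have "?R = nn_integral (restrict_space lborel Om) (%y. enn_powr (ennreal \<bar>f y\<bar>) p)"
  by (rule nn_integral_restrict_space[symmetric]) (use open_Om in simp)
 also have "ennreal (Cfin p) * ... <= ennreal (Cfin p)*upper_nn_integral (restrict_space lborel Om) (%y. enn_powr (ennreal \<bar>f y\<bar>) p)"
  by (rule mult_left_mono[OF nn_integral_le_upper]) simp
 finally show ?thesis .
qed

lemma Cfin_pos: "0 < Cfin p" using Cst_pos by (simp add: Cfin_def add_pos_nonneg)

text \<open>Finite p is the integral bound with roots taken. For p = \<infinity> the balls lie in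
  leaves, which may be Lebesgue null sets; an essential bound of \<open>f\<close> still reaches them
  because, by continuity, it holds at every point of \<open>Om\<close>.\<close>

lemma maximal_Lp:
 assumes p: "1 < p" and f: "continuous_on Om f"
 shows "Lp_norm (restrict_space lborel K) p (maximal_fn Om X d q (\<eta> * \<xi>1) f)
  <= ennreal (if p = \<infinity> then 1 else Cfin (enn2real p) powr (1/enn2real p))*Lp_norm (restrict_space lborel Om) p (%y. ennreal \<bar>f y\<bar>)"
proof (cases "p = \<infinity>")
 case False
 define r where "r = enn2real p"
 have pr: "p = ennreal r" using False by (simp add: r_def ennreal_enn2real less_top[symmetric])
 have r: "1 < r" using p unfolding pr by (metis ennreal_1 ennreal_less_iff zero_le_one)
 have "Lp_norm (restrict_space lborel K) p (maximal_fn Om X d q (\<eta> * \<xi>1) f)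
   <= enn_powr (ennreal (Cfin r)*upper_nn_integral (restrict_space lborel Om) (%y. enn_powr (ennreal \<bar>f y\<bar>) r)) (1/r)"
  unfolding Lp_norm_def r_def[symmetric] using False maximal_integral_bound[OF r f] r by (simp add: enn_powr_mono)
 also have "... = ennreal (Cfin r powr (1/r))*enn_powr (upper_nn_integral (restrict_space lborel Om) (%y. enn_powr (ennreal \<bar>f y\<bar>) r)) (1/r)"
  by (rule enn_powr_cmult[OF Cfin_pos])
 finally show ?thesis using False unfolding Lp_norm_def r_def[symmetric] by simp
next
 case True
 have main: "maximal_fn Om X d q (\<eta> * \<xi>1) f x <= c" if c: "AE y in restrict_space lborel Om. ennreal \<bar>f y\<bar> <= c" and x: "x : K" for c x
 proof -
  \<comment> \<open>The set where |f| exceeds the bound is open, and a nonempty open set is not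
    negligible.\<close>
  have bd: "ennreal \<bar>f y\<bar> <= c" if y: "y : Om" for y
  proof (cases c)
   case (real r)
   let ?U = "{y : Om. r < \<bar>f y\<bar>}"
   have oU: "open ?U"
   proof -
    have "open (Om \<inter> (%y. \<bar>f y\<bar>) -` {r<..})"
     using f open_Om by (intro continuous_open_preimage continuous_on_rabs) auto
    moreover have "Om \<inter> (%y. \<bar>f y\<bar>) -` {r<..} = ?U" by auto
    ultimately show ?thesis by simp
   qed
   have "AE y in lborel. y : Om --> ennreal \<bar>f y\<bar> <= c" using c open_Om by (subst (asm) AE_restrict_space_iff) auto
   then have "AE y in lborel. y \<notin> ?U" unfolding real by eventually_elim (use real in \<open>auto simp: ennreal_le_iff\<close>)
   then have "?U : null_sets lborel" using oU by (subst (asm) AE_iff_null_sets[symmetric]) auto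
   then have "negligible ?U" by (simp add: negligible_iff_null_sets null_sets_completionI)
   then have "?U = {}" using open_not_negligible[OF oU] by blast
   then have "\<bar>f y\<bar> <= r" using y by (auto simp: not_less)
   then show ?thesis unfolding real by (rule ennreal_leI)
  qed simp
  show ?thesis unfolding maximal_fn_def
  proof (rule SUP_least)
   fix dl assume "dl : {0<..\<eta> * \<xi>1}"
   then have dl: "0 < dl" "dl <= \<eta> * \<xi>1" by auto
   let ?B = "CC_ball Om X d q x dl" and ?M = "leaf_measure X q x"
   have B: "?B : sets ?M" using average_le(1)[OF x dl f] by (simp add: leaf_measure_def)
   have Bo: "?B \<subseteq> Om" unfolding CC_ball_def ctrl_path_def by auto
   have "(\<integral>\<^sup>+ y\<in>?B. ennreal \<bar>f y\<bar> \<partial>?M) <= (\<integral>\<^sup>+ y. c*indicator ?B y \<partial>?M)"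
    by (rule nn_integral_mono) (use bd Bo in \<open>auto simp: indicator_def\<close>)
   also have "... = c*emeasure ?M ?B" by (rule nn_integral_cmult_indicator[OF B])
   finally have le: "(\<integral>\<^sup>+ y\<in>?B. ennreal \<bar>f y\<bar> \<partial>?M) <= c*emeasure ?M ?B" .
   show "(\<integral>\<^sup>+ y\<in>?B. ennreal \<bar>f y\<bar> \<partial>?M)/emeasure ?M ?B <= c"
   proof (cases "emeasure ?M ?B = 0 \<or> emeasure ?M ?B = top")
    case True
    then show ?thesis
    proof
     assume z: "emeasure ?M ?B = 0"
     then have "(\<integral>\<^sup>+ y\<in>?B. ennreal \<bar>f y\<bar> \<partial>?M) = 0" using le by simp
     then show ?thesis by (simp add: z)
    qed simp
   next
    case False
    have "(\<integral>\<^sup>+ y\<in>?B. ennreal \<bar>f y\<bar> \<partial>?M)/emeasure ?M ?B <= c*emeasure ?M ?B/emeasure ?M ?B" by (rule divide_right_mono_ennreal[OF le])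
    also have "... = c" by (rule ennreal_mult_divide_eq) (use False in auto)
    finally show ?thesis .
   qed
  qed
 qed
 have "Inf {c. AE x in restrict_space lborel K. maximal_fn Om X d q (\<eta> * \<xi>1) f x <= c} <= Inf {c. AE y in restrict_space lborel Om. ennreal \<bar>f y\<bar> <= c}"
 proof (rule Inf_superset_mono, safe)
  fix c assume c: "AE y in restrict_space lborel Om. ennreal \<bar>f y\<bar> <= c"
  show "AE x in restrict_space lborel K. maximal_fn Om X d q (\<eta> * \<xi>1) f x <= c"
   by (rule AE_I2) (use main[OF c] in \<open>simp add: space_restrict_space\<close>)
 qed
 then show ?thesis using True by (simp add: Lp_norm_def)
qed

end

section \<open>Fixing the admissible constants\<close>

text \<open>The witnesses are \<eta>*min 1 t for the radius and, for finite p, the p-th root of the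
  constant in the integral estimate. They are built from \<open>dlo\<close>, \<open>dhi\<close>,
  \<open>A1\<close>, \<open>A2\<close>, \<open>Q\<close> and the dimension before any fields are
  given, which expresses admissibility.\<close>

theorem theorem6p15:
  fixes dlo dhi A1 A2 :: real and Q :: nat
  assumes "0 < dlo"
  shows "\<exists>lb :: real \<Rightarrow> real. \<exists>Cp :: ennreal \<Rightarrow> real. (\<forall>t>0. lb t > 0) \<and>
    (\<forall>(\<Omega> :: (real^'n) set) X d q K \<xi>.
       open \<Omega> \<and> q \<le> Q \<and> (\<forall>j<q. dlo \<le> d j \<and> d j \<le> dhi) \<and> (\<forall>j<q. C1_on (X j) \<Omega>)
       \<and> compact K \<and> K \<subseteq> \<Omega> \<and> 0 < \<xi> \<and> (\<forall>x\<in>K. cond_C \<Omega> X d q x \<xi>)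
       \<and> (\<forall>x\<in>K. \<forall>j<q. C2_ok (CC_ball \<Omega> X d q x \<xi>) (X j)
                        \<and> C2_norm (CC_ball \<Omega> X d q x \<xi>) (X j) \<le> ennreal A1)
       \<and> (\<forall>\<delta>\<in>{0<..\<xi>}. \<forall>x\<in>K. \<exists>c :: nat \<Rightarrow> nat \<Rightarrow> nat \<Rightarrow> real^'n \<Rightarrow> real.
            (\<forall>i<q. \<forall>j<q. \<forall>y\<in>CC_ball \<Omega> X d q x \<delta>.
               lie_bracket (sX X d \<delta> i) (sX X d \<delta> j) y = (\<Sum>k<q. c i j k y *\<^sub>R sX X d \<delta> k y))
          \<and> (\<forall>i<q. \<forall>j<q. \<forall>k<q.
               vf_deriv_bound q (sX X d \<delta>) (CC_ball \<Omega> X d q x \<delta>) (c i j k) (ennreal A2)))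
     \<longrightarrow> (\<exists>\<xi>'. lb \<xi> \<le> \<xi>' \<and> \<xi>' \<le> \<xi> \<and>
           (\<forall>p. 1 < p \<longrightarrow> (\<forall>f. continuous_on \<Omega> f
               \<and> Lp_norm (restrict_space lborel \<Omega>) p (\<lambda>y. ennreal \<bar>f y\<bar>) < \<infinity> \<longrightarrow>
               Lp_norm (restrict_space lborel K) p (maximal_fn \<Omega> X d q \<xi>' f)
                 \<le> ennreal (Cp p) * Lp_norm (restrict_space lborel \<Omega>) p (\<lambda>y. ennreal \<bar>f y\<bar>)))))"
proof -
 let ?N = "real CARD('n)"
 \<comment> \<open>At least 1, so that it may stand in denominators even if \<open>Q\<close> is
   0.\<close>
 define Q' where "Q' = max 1 Q"
 define A where "A = max 1 (max A1 A2)"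
 define rd where "rd = 1/(200*?N ^ 4*real Q' ^ 5*A)"
 define \<mu> where "\<mu> = rd/(16*(?N*real Q'))"
 \<comment> \<open>The solution of \<eta>^dlo = \<mu>, where \<mu> is the control bound under which
   reachable points lie in the chart.\<close>
 define \<eta> where "\<eta> = \<mu> powr (1/dlo)"
 \<comment> \<open>The two entries answer the two demands on the cube: room in the chart and
   inclusion in the ball.\<close>
 define rh where "rh = min (rd/(8*?N)) (\<eta> powr dhi/(4*?N))"
 define Cs where "Cs = ((512*?N\<^sup>2) ^ CARD('n)/(rh ^ CARD('n)*(2*rd) ^ CARD('n)))*(6 ^ CARD('n)*(4*rd) ^ CARD('n))"
 define TC where "TC p = 2*((2*exp (A + 1)*?N) ^ CARD('n))\<^sup>2*(10 * p * 4 powr (p - 1)/(p - 1))" for p :: real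
 define Cf where "Cf p = (1 + real (card {js. set js \<subseteq> {..<Q'} & length js <= CARD('n)}))*Cs powr p * (max 1 (TC p)) ^ CARD('n)" for p
 have N: "1 <= ?N" by simp
 have Q1: "1 <= Q'" "1 <= real Q'" by (auto simp: Q'_def)
 have A: "1 <= A" "A1 <= A" "A2 <= A" by (auto simp: A_def)
 have prod1: "1 <= ?N ^ 4*real Q' ^ 5*A"
 proof -
  have "1*1*1 <= ?N ^ 4*real Q' ^ 5*A" using N Q1 A by (intro mult_mono one_le_power) auto
  then show ?thesis by simp
 qed
 have rd0: "0 < rd" using prod1 A Q1 by (simp add: rd_def)
 have rd1: "rd <= 1"
 proof -
  have "1 <= 200*?N ^ 4*real Q' ^ 5*A" using prod1 by simp
  then show ?thesis unfolding rd_def by (subst divide_le_eq_1_pos) linarith+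
 qed
 have \<mu>0: "0 < \<mu>" using rd0 Q1 by (simp add: \<mu>_def)
 have \<mu>1: "\<mu> <= 1"
 proof -
  have "1*1 <= ?N*real Q'" using N Q1 by (intro mult_mono) auto
  then have "rd <= 1*(16*(?N*real Q'))" using rd1 by simp
  then show ?thesis unfolding \<mu>_def using Q1 by (simp add: pos_divide_le_eq)
 qed
 have \<eta>0: "0 < \<eta>" using \<mu>0 by (simp add: \<eta>_def)
 have \<eta>1: "\<eta> <= 1" unfolding \<eta>_def using \<mu>0 \<mu>1 assms powr_mono2[of "1/dlo" \<mu> 1] by simp
 have \<eta>\<mu>: "\<eta> powr dlo <= rd/(16*(?N*real Q'))" unfolding \<eta>_def powr_powr using assms \<mu>0 by (simp add: \<mu>_def[symmetric])
 have rh0: "0 < rh" using rd0 \<eta>0 by (simp add: rh_def)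
 have rh1: "?N*rh <= rd/8"
 proof -
  have "?N*rh <= ?N*(rd/(8*?N))" by (rule mult_left_mono) (auto simp: rh_def)
  then show ?thesis by simp
 qed
 have rh2: "4*?N*rh <= \<eta> powr dhi"
 proof -
  have "4*?N*rh <= 4*?N*(\<eta> powr dhi/(4*?N))" by (rule mult_left_mono) (auto simp: rh_def)
  then show ?thesis by simp
 qed
 show ?thesis
 proof (intro exI[of _ "%t. \<eta>*min 1 t"] exI[of _ "%p. if p = \<infinity> then 1 else Cf (enn2real p) powr (1/enn2real p)"] conjI allI impI, goal_cases)
  case (1 t)
  then show ?case using \<eta>0 by simp
 next
  case H: (2 Om X d q K \<xi>)
  interpret S: setting Om X d q K \<xi> dlo dhi A1 A2 A rd \<eta> rh Q'
  proof
   have "q <= Q" using H by (elim conjE)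
   then show "q <= Q'" by (simp add: Q'_def)
   show "open Om" using H by (elim conjE)
   show "compact K" using H by (elim conjE)
   show "K \<subseteq> Om" using H by (elim conjE)
   show "0 < \<xi>" using H by (elim conjE)
   have "ALL j<q. dlo <= d j & d j <= dhi" using H by (elim conjE)
   then show "!!j. j < q ==> dlo <= d j & d j <= dhi" by blast
   have "ALL j<q. C1_on (X j) Om" using H by (elim conjE)
   then show "!!j. j < q ==> C1_on (X j) Om" by blast
   have "ALL x:K. cond_C Om X d q x \<xi>" using H by (elim conjE)
   then show "!!x. x : K ==> cond_C Om X d q x \<xi>" by blast
   have "ALL x:K. ALL j<q. C2_ok (CC_ball Om X d q x \<xi>) (X j) & C2_norm (CC_ball Om X d q x \<xi>) (X j) <= ennreal A1" using H by (elim conjE)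
   then show "!!x j. x : K ==> j < q ==> C2_ok (CC_ball Om X d q x \<xi>) (X j) & C2_norm (CC_ball Om X d q x \<xi>) (X j) <= ennreal A1" by blast
   fix dl x assume dx: "dl : {0<..\<xi>}" "x : K"
   have "ALL dl:{0<..\<xi>}. ALL x:K. EX c :: nat => nat => nat => real^'n => real.
      (ALL i<q. ALL j<q. ALL y:CC_ball Om X d q x dl.
        lie_bracket (sX X d dl i) (sX X d dl j) y = (\<Sum>k<q. c i j k y *\<^sub>R sX X d dl k y))
     & (ALL i<q. ALL j<q. ALL k<q.
        vf_deriv_bound q (sX X d dl) (CC_ball Om X d q x dl) (c i j k) (ennreal A2))" using H by (elim conjE)
   from this[rule_format, OF dx] show "EX c :: nat => nat => nat => real^'n => real.
      (ALL i<q. ALL j<q. ALL y:CC_ball Om X d q x dl.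
        lie_bracket (sX X d dl i) (sX X d dl j) y = (\<Sum>k<q. c i j k y *\<^sub>R sX X d dl k y))
     & (ALL i<q. ALL j<q. ALL k<q.
        vf_deriv_bound q (sX X d dl) (CC_ball Om X d q x dl) (c i j k) (ennreal A2))" .
  qed (rule assms Q1 A rd_def \<eta>0 \<eta>1 \<eta>\<mu> rh0 rh1 rh2)+
  have CfE: "S.Cfin p = Cf p" for p
   unfolding S.Cfin_def S.JS_def S.Cst_def S.T.TC_def Cf_def Cs_def TC_def ..
  have \<xi>E: "S.\<xi>1 = min 1 \<xi>" by (rule S.\<xi>1_def)
  show ?case
  proof (intro exI[of _ "\<eta>*min 1 \<xi>"] conjI allI impI order_refl)
   have "\<eta>*min 1 \<xi> <= 1*min 1 \<xi>" using \<eta>1 S.\<xi> by (intro mult_right_mono) auto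
   then show "\<eta>*min 1 \<xi> <= \<xi>" by simp
   fix p f assume p: "1 < p" and f: "continuous_on Om f & Lp_norm (restrict_space lborel Om) p (%y. ennreal \<bar>f y\<bar>) < \<infinity>"
   show "Lp_norm (restrict_space lborel K) p (maximal_fn Om X d q (\<eta>*min 1 \<xi>) f)
    <= ennreal (if p = \<infinity> then 1 else Cf (enn2real p) powr (1/enn2real p))*Lp_norm (restrict_space lborel Om) p (%y. ennreal \<bar>f y\<bar>)"
    using S.maximal_Lp[OF p conjunct1[OF f]] unfolding CfE \<xi>E .
  qed
 qed
qed

end
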